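(* Let $q,\tilde q\in\mathcal Q^{(pt)}$ (Lipschitz continuous and piecewise analytic on $I$) and let $u_0\in C^{1,2}([-\tau,0]\times[-1,1])$. Let $u$ be the solution of $$\begin{cases} u_t-(\rho(x)u_x)_x=r(t)q(x)\beta(u)-\varepsilon(u)|u|^3u+f(H(t,x,u)), & t>0,\ x\in I,\\ \rho(x)u_x=0, & t>0,\ x\in\partial I,\\ u(s,x)=u_0(s,x), & s\in[-\tau,0],\ x\in I,\end{cases}$$ and let $\tilde u$ be the solution of the same problem with the same initial condition $u_0$ but with $q$ replaced by $\tilde q$. Assume that - there exists $\delta\in(0,\tau)$ such that $k(s,\cdot)\equiv0$ for all $s\in[-\delta,0]$; - $r$ and $\beta$ are positive; - there exist $x_0\in I$ and $T>0$ such that for all $t\in(0,T)$: $u(t,x_0)=\tilde u(t,x_0)$ and $u_x(t,x_0)=\tilde u_x(t,x_0)$. Then $q\equiv\tilde q$ on $I$.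
   Context: Setting and standing assumptions. $I=(-1,1)$, $\tau>0$, $\rho(x)=\rho_0(1-x^2)$ with a constant $\rho_0>0$. $H(t,x,u)=\int_{-\tau}^0k(s,x)u(t+s,x)\,ds$. $r\in C^1(\mathbb R_+)$ with $r,r'\in L^\infty(\mathbb R_+)$; $\beta\in C^2(\mathbb R)$ with $\beta,\beta',\beta''\in L^\infty(\mathbb R)$; $\varepsilon\in C^1(\mathbb R)$ with $\varepsilon,\varepsilon'\in L^\infty(\mathbb R)$ and there is $\varepsilon_1>0$ with $\varepsilon(u)\ge\varepsilon_1$ for all $u$; $k\in C^1([-\tau,0]\times[-1,1];\mathbb R)$; $f:\mathbb R\to\mathbb R$ is $C^1$ with $f,f'\in L^\infty(\mathbb R)$ and $f,f'$ Lipschitz. $\mathcal Q^{(pt)}$ is the set of functions $q$ that are Lipschitz continuous and piecewise analytic on $I$. A continuous function $\psi$ is called piecewise analytic if there exist $n\ge1$ and an increasing sequence $(p_j)_{1\le j\le n}$ with $p_1=-1$, $p_n=1$, such that $\psi(x)=\sum_{j=1}^{n-1}\chi_{[p_j,p_{j+1})}(x)\varphi_j(x)$ for all $x\in I$, where $\varphi_j$ is an analytic function defined on $[p_j,p_{j+1}]$ and $\chi_{[p_j,p_{j+1})}$ is the characteristic function of $[p_j,p_{j+1})$. Solutions. $V=\{w\in L^2(I): w\in AC_{loc}(I),\ \sqrt\rho\,w_x\in L^2(I)\}$ with inner product $(u,v)_V=(u,v)_{L^2(I)}+(\sqrt\rho u_x,\sqrt\rho v_x)_{L^2(I)}$. The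 operator $A$ on $L^2(I)$ is $D(A)=\{u\in V:\rho u_x\in H^1(I)\}$, $Au=(\rho u_x)_x$; it is self-adjoint and generates an analytic contraction semigroup $(e^{tA})_{t\ge0}$. The solution is the (unique, global) mild solution: for every $T>0$, $u\in H^1(0,T;L^2(I))\cap L^2(0,T;D(A))\cap C([-\tau,T];V)$, $u(s)=u_0(s)$ for $s\in[-\tau,0]$, and for $t\in[0,T]$, $u(t)=e^{tA}u_0(0)+\int_0^te^{(t-s)A}g(s)\,ds$ with $g(s)(x)=r(s)q(x)\beta(u(s,x))-\varepsilon(u(s,x))|u(s,x)|^3u(s,x)+f(H(s,x,u))$. *)

theory Defs
  imports "HOL-Analysis.Analysis"
begin

text \<open>
  \<open>L2_on a b\<close> consists of representatives (no quotient is taken) of \<open>L\<^sup>2(a,b;X)\<close>. For a separable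
  Banach space \<open>X\<close> Borel measurability coincides with strong (Bochner) measurability.
\<close>

definition L2_on :: "real \<Rightarrow> real \<Rightarrow> (real \<Rightarrow> 'a::real_normed_vector) set" where
  "L2_on a b = {f. f \<in> borel_measurable (lebesgue_on {a<..<b}) \<and>
                   integrable (lebesgue_on {a<..<b}) (\<lambda>t. (norm (f t))\<^sup>2)}"

abbreviation Imeas :: "real measure" where
  "Imeas \<equiv> lebesgue_on {-1<..<1}"

lemma finite_measure_Imeas: "finite_measure Imeas"
  by (rule finite_measure_lebesgue_on) simp

lemma L2I_iff: "(f::real \<Rightarrow> real) \<in> L2_on (-1) 1 \<longleftrightarrow>
    f \<in> borel_measurable Imeas \<and> integrable Imeas (\<lambda>x. (f x)\<^sup>2)"
  by (simp add: L2_on_def)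

lemma L2I_zero: "(\<lambda>x. 0::real) \<in> L2_on (-1) 1"
  by (simp add: L2I_iff)

lemma L2I_mult:
  fixes f g :: "real \<Rightarrow> real"
  assumes "f \<in> L2_on (-1) 1" "g \<in> L2_on (-1) 1"
  shows "integrable Imeas (\<lambda>x. f x * g x)"
proof (rule Bochner_Integration.integrable_bound)
  show "integrable Imeas (\<lambda>x. (f x)\<^sup>2 + (g x)\<^sup>2)"
    using assms by (simp add: L2I_iff)
  show "(\<lambda>x. f x * g x) \<in> borel_measurable Imeas"
    using assms by (auto simp: L2I_iff)
  have "\<bar>a * b\<bar> \<le> a\<^sup>2 + b\<^sup>2" for a b :: real
    using sum_squares_bound[of "\<bar>a\<bar>" "\<bar>b\<bar>"] mult_nonneg_nonneg[of "\<bar>a\<bar>" "\<bar>b\<bar>"]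
    unfolding abs_mult power2_abs by linarith
  then show "AE x in Imeas. norm (f x * g x) \<le> norm ((f x)\<^sup>2 + (g x)\<^sup>2)"
    by simp
qed

lemma L2I_add:
  fixes f g :: "real \<Rightarrow> real"
  assumes "f \<in> L2_on (-1) 1" "g \<in> L2_on (-1) 1"
  shows "(\<lambda>x. f x + g x) \<in> L2_on (-1) 1"
  using assms L2I_mult[OF assms] by (auto simp: L2I_iff power2_sum mult.assoc)

lemma L2I_scale:
  fixes f :: "real \<Rightarrow> real"
  assumes "f \<in> L2_on (-1) 1"
  shows "(\<lambda>x. c * f x) \<in> L2_on (-1) 1"
  using assms by (auto simp: L2I_iff power_mult_distrib)

lemma L2I_diff:
  fixes f g :: "real \<Rightarrow> real"
  assumes "f \<in> L2_on (-1) 1" "g \<in> L2_on (-1) 1"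
  shows "(\<lambda>x. f x - g x) \<in> L2_on (-1) 1"
  using L2I_add[OF assms(1) L2I_scale[OF assms(2), of "-1"]] by simp

lemma L2I_bounded:
  fixes f :: "real \<Rightarrow> real"
  assumes "f \<in> borel_measurable Imeas" "\<And>x. \<bar>f x\<bar> \<le> B"
  shows "f \<in> L2_on (-1) 1"
proof -
  interpret finite_measure Imeas by (rule finite_measure_Imeas)
  have "integrable Imeas (\<lambda>x. (f x)\<^sup>2)"
    by (rule integrable_const_bound[of _ "B\<^sup>2"])
       (use assms in \<open>auto intro!: power_mono simp flip: abs_le_square_iff simp: order_trans[OF assms(2) abs_ge_self]\<close>)
  then show ?thesis using assms by (simp add: L2I_iff)
qed

text \<open>
  The Hilbert space \<open>L\<^sup>2(I)\<close>, \<open>I = (-1,1)\<close>, as a type of almost-everywhere classes. It is made an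
  instance of \<^class>\<open>real_inner\<close>, \<^class>\<open>banach\<close> and \<^class>\<open>second_countable_topology\<close> (completeness and
  separability are proved below) so that the library's Bochner integral applies to it.
\<close>

quotient_type L2I = "real \<Rightarrow> real" / partial:
  "\<lambda>f g. f \<in> L2_on (-1) 1 \<and> g \<in> L2_on (-1) 1 \<and> (AE x in Imeas. f x = g x)"
proof (rule part_equivpI)
  show "\<exists>f::real \<Rightarrow> real. f \<in> L2_on (-1) 1 \<and> f \<in> L2_on (-1) 1 \<and> (AE x in Imeas. f x = f x)"
    using L2I_zero by auto
qed (auto intro!: sympI transpI)

text \<open>
  The class of a function. Functions that are not square integrable are sent to \<open>0\<close>; below the map
  is only relevant for square integrable arguments.
\<close>

lift_definition to_L2I :: "(real \<Rightarrow> real) \<Rightarrow> L2I" is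
  "\<lambda>f. if f \<in> L2_on (-1) 1 then f else (\<lambda>x. 0)"
  using L2I_zero by auto

instantiation L2I :: real_inner
begin

lift_definition zero_L2I :: L2I is "\<lambda>x. 0"
  using L2I_zero by auto

lift_definition plus_L2I :: "L2I \<Rightarrow> L2I \<Rightarrow> L2I" is "\<lambda>f g x. f x + g x"
  by (auto intro!: L2I_add)

lift_definition minus_L2I :: "L2I \<Rightarrow> L2I \<Rightarrow> L2I" is "\<lambda>f g x. f x - g x"
  by (auto intro!: L2I_diff)

lift_definition uminus_L2I :: "L2I \<Rightarrow> L2I" is "\<lambda>f x. - f x"
  using L2I_scale[of _ "-1"] by auto

lift_definition scaleR_L2I :: "real \<Rightarrow> L2I \<Rightarrow> L2I" is "\<lambda>c f x. c * f x"
  by (auto intro!: L2I_scale)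

lift_definition inner_L2I :: "L2I \<Rightarrow> L2I \<Rightarrow> real" is "\<lambda>f g. LINT x|Imeas. f x * g x"
  by (rule integral_cong_AE) (auto simp: L2I_iff)

definition norm_L2I :: "L2I \<Rightarrow> real" where
  "norm_L2I f = sqrt (inner f f)"

definition sgn_L2I :: "L2I \<Rightarrow> L2I" where
  "sgn_L2I f = scaleR (inverse (norm f)) f"

definition dist_L2I :: "L2I \<Rightarrow> L2I \<Rightarrow> real" where
  "dist_L2I f g = norm (f - g)"

definition uniformity_L2I :: "(L2I \<times> L2I) filter" where
  "uniformity_L2I = (INF e\<in>{0<..}. principal {(f, g). dist f g < e})"

definition open_L2I :: "L2I set \<Rightarrow> bool" where
  "open_L2I U \<longleftrightarrow> (\<forall>f\<in>U. eventually (\<lambda>(f', g). f' = f \<longrightarrow> g \<in> U) uniformity)"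

instance
proof
  fix f g h :: L2I and c d :: real
  show "f + g + h = f + (g + h)"
    by transfer (auto intro!: L2I_add simp: add.assoc)
  show "f + g = g + f"
    by transfer (auto intro!: L2I_add simp: add.commute)
  show "0 + f = f"
    by transfer auto
  show "- f + f = 0"
    by transfer (auto intro!: L2I_zero)
  show "f - g = f + - g"
    by transfer (auto intro!: L2I_diff)
  show "c *\<^sub>R (f + g) = c *\<^sub>R f + c *\<^sub>R g"
    by transfer (auto intro!: L2I_add L2I_scale simp: distrib_left)
  show "(c + d) *\<^sub>R f = c *\<^sub>R f + d *\<^sub>R f"
    by transfer (auto intro!: L2I_add L2I_scale simp: distrib_right)
  show "c *\<^sub>R d *\<^sub>R f = (c * d) *\<^sub>R f"
    by transfer (auto intro!: L2I_scale simp: mult.assoc)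
  show "1 *\<^sub>R f = f"
    by transfer auto
  show "inner f g = inner g f"
    by transfer (simp add: mult.commute)
  show "inner (f + g) h = inner f h + inner g h"
    by transfer (simp add: distrib_right L2I_mult)
  show "inner (c *\<^sub>R f) g = c * inner f g"
    by transfer (simp add: mult.assoc)
  show "0 \<le> inner f f"
    by transfer simp
  show "inner f f = 0 \<longleftrightarrow> f = 0"
  proof transfer
    fix f :: "real \<Rightarrow> real"
    assume *: "f \<in> L2_on (-1) 1 \<and> f \<in> L2_on (-1) 1 \<and> (AE x in Imeas. f x = f x)"
    have "(LINT x|Imeas. f x * f x) = 0 \<longleftrightarrow> (AE x in Imeas. f x * f x = 0)"
      by (rule integral_nonneg_eq_0_iff_AE) (use * L2I_mult in auto)
    with * show "((LINT x|Imeas. f x * f x) = 0) =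
        (f \<in> L2_on (-1) 1 \<and> (\<lambda>x. 0::real) \<in> L2_on (-1) 1 \<and> (AE x in Imeas. f x = 0))"
      by (simp add: L2I_zero)
  qed
  show "norm f = sqrt (inner f f)"
    by (simp add: norm_L2I_def)
  show "sgn f = scaleR (inverse (norm f)) f"
    by (simp add: sgn_L2I_def)
  show "dist f g = norm (f - g)"
    by (simp add: dist_L2I_def)
qed (simp_all add: uniformity_L2I_def open_L2I_def)

end

lemma L2I_ex_rep:
  fixes X :: L2I
  obtains f where "f \<in> L2_on (-1) 1" "X = to_L2I f"
proof -
  have "\<exists>f. f \<in> L2_on (-1) 1 \<and> X = to_L2I f"
  proof transfer
    fix X :: "real \<Rightarrow> real"
    assume "X \<in> L2_on (-1) 1 \<and> X \<in> L2_on (-1) 1 \<and> (AE x in Imeas. X x = X x)"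
    then show "\<exists>f. f \<in> L2_on (-1) 1 \<and> X \<in> L2_on (-1) 1 \<and>
        (if f \<in> L2_on (-1) 1 then f else (\<lambda>x. 0)) \<in> L2_on (-1) 1 \<and>
        (AE x in Imeas. X x = (if f \<in> L2_on (-1) 1 then f else (\<lambda>x. 0)) x)"
      by (intro exI[of _ X]) simp
  qed
  with that show ?thesis by blast
qed

lemma to_L2I_diff:
  assumes "f \<in> L2_on (-1) 1" "g \<in> L2_on (-1) 1"
  shows "to_L2I f - to_L2I g = to_L2I (\<lambda>x. f x - g x)"
  using assms L2I_diff[OF assms] by transfer simp

lemma norm_to_L2I:
  assumes "f \<in> L2_on (-1) 1"
  shows "(norm (to_L2I f))\<^sup>2 = (LINT x|Imeas. (f x)\<^sup>2)"
proof -
  have "inner (to_L2I f) (to_L2I f) = (LINT x|Imeas. f x * f x)"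
    using assms by transfer simp
  then show ?thesis unfolding power2_norm_eq_inner by (simp add: power2_eq_square)
qed

lemma L2I_fast_convergent:
  fixes X :: "nat \<Rightarrow> L2I"
  assumes fast: "\<And>k. norm (X (Suc k) - X k) \<le> (1/2)^k"
  shows "convergent X"
proof -
  interpret finite_measure Imeas by (rule finite_measure_Imeas)
  have "\<forall>k. \<exists>f. f \<in> L2_on (-1) 1 \<and> X k = to_L2I f"
    using L2I_ex_rep by metis
  then obtain F where F: "\<And>k. F k \<in> L2_on (-1) 1" and X: "\<And>k. X k = to_L2I (F k)"
    by metis
  have Fm [measurable]: "F k \<in> borel_measurable Imeas" for k
    using F[of k] by (simp add: L2I_iff)
  have one: "(\<lambda>x. 1::real) \<in> L2_on (-1) 1"
    by (rule L2I_bounded[of _ 1]) auto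
  define d where "d k x = \<bar>F (Suc k) x - F k x\<bar>" for k x
  have dL2: "d k \<in> L2_on (-1) 1" for k
    unfolding d_def using L2I_diff[OF F F, of "Suc k" k] by (simp add: L2I_iff)
  have dint: "integrable Imeas (d k)" for k
    using L2I_mult[OF dL2 one] by simp
  define C where "C = norm (to_L2I (\<lambda>x. 1))"
  have dle: "(LINT x|Imeas. d k x) \<le> (1/2)^k * C" for k
  proof -
    have "(norm (to_L2I (d k)))\<^sup>2 = (norm (X (Suc k) - X k))\<^sup>2"
      unfolding X to_L2I_diff[OF F F] norm_to_L2I[OF dL2] norm_to_L2I[OF L2I_diff[OF F F]]
      by (simp add: d_def)
    then have n: "norm (to_L2I (d k)) \<le> (1/2)^k"
      using fast[of k] by simp
    have "(LINT x|Imeas. d k x) = inner (to_L2I (d k)) (to_L2I (\<lambda>x. 1))"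
      using dL2[of k] one by transfer simp
    also have "\<dots> \<le> norm (to_L2I (d k)) * C"
      unfolding C_def by (rule norm_cauchy_schwarz)
    also have "\<dots> \<le> (1/2)^k * C"
      using n by (intro mult_right_mono) (auto simp: C_def)
    finally show ?thesis .
  qed
  have "AE x in Imeas. summable (\<lambda>k. d k x)"
  proof -
    have [measurable]: "d k \<in> borel_measurable Imeas" for k
      using dL2[of k] by (simp add: L2I_iff)
    have "(\<integral>\<^sup>+x. (\<Sum>k. ennreal (d k x)) \<partial>Imeas) = (\<Sum>k. \<integral>\<^sup>+x. ennreal (d k x) \<partial>Imeas)"
      by (rule nn_integral_suminf) auto
    also have "\<dots> = (\<Sum>k. ennreal (LINT x|Imeas. d k x))"
      by (intro suminf_cong nn_integral_eq_integral dint) (auto simp: d_def)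
    also have "\<dots> \<le> (\<Sum>k. ennreal ((1/2)^k * C))"
      by (intro suminf_le ennreal_leI dle) auto
    also have "\<dots> = ennreal (\<Sum>k. (1/2)^k * C)"
      by (intro suminf_ennreal_eq summable_sums summable_mult2 summable_geometric) (auto simp: C_def)
    also have "\<dots> < \<infinity>" by simp
    finally have "AE x in Imeas. (\<Sum>k. ennreal (d k x)) \<noteq> \<infinity>"
      by (intro nn_integral_noteq_infinite) auto
    then show ?thesis
      by eventually_elim (rule summable_suminf_not_top, auto simp: d_def)
  qed
  then have conv: "AE x in Imeas. convergent (\<lambda>n. F n x)"
  proof eventually_elim
    case (elim x)
    then have "summable (\<lambda>k. F (Suc k) x - F k x)"
      unfolding d_def by (rule summable_rabs_cancel)
    then have "convergent (\<lambda>n. F n x - F 0 x)"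
      unfolding summable_iff_convergent sum_lessThan_telescope[of "\<lambda>n. F n x"] .
    from convergent_add[OF this convergent_const[of "F 0 x"]] show ?case
      by simp
  qed
  define G where "G x = lim (\<lambda>n. F n x)" for x
  have Gm [measurable]: "G \<in> borel_measurable Imeas"
    unfolding G_def by measurable
  have lim: "AE x in Imeas. (\<lambda>n. F n x) \<longlonglongrightarrow> G x"
    using conv by eventually_elim (simp add: G_def convergent_LIMSEQ_iff)
  have tail: "norm (X (n + m) - X n) \<le> 2 * (1/2)^n - 2 * (1/2)^(n+m)" for n m
  proof (induction m)
    case (Suc m)
    have "norm (X (n + Suc m) - X n) \<le> norm (X (Suc (n + m)) - X (n + m)) + norm (X (n + m) - X n)"
      using norm_triangle_ineq[of "X (Suc (n + m)) - X (n + m)" "X (n + m) - X n"] by simp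
    also have "\<dots> \<le> (1/2)^(n+m) + (2 * (1/2)^n - 2 * (1/2)^(n+m))"
      by (intro add_mono fast Suc)
    finally show ?case by simp
  qed simp
  have main: "(\<integral>\<^sup>+x. ennreal ((G x - F n x)\<^sup>2) \<partial>Imeas) \<le> ennreal ((2 * (1/2)^n)\<^sup>2)" for n
  proof -
    have "(\<integral>\<^sup>+x. ennreal ((G x - F n x)\<^sup>2) \<partial>Imeas)
        = (\<integral>\<^sup>+x. liminf (\<lambda>m. ennreal ((F (n + m) x - F n x)\<^sup>2)) \<partial>Imeas)"
    proof (rule nn_integral_cong_AE, use lim in eventually_elim)
      fix x assume "(\<lambda>n. F n x) \<longlonglongrightarrow> G x"
      then have "(\<lambda>m. F (n + m) x) \<longlonglongrightarrow> G x"
        using LIMSEQ_ignore_initial_segment[of "\<lambda>n. F n x" _ n] by (simp add: add.commute)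
      then have "(\<lambda>m. ennreal ((F (n + m) x - F n x)\<^sup>2)) \<longlonglongrightarrow> ennreal ((G x - F n x)\<^sup>2)"
        by (intro tendsto_intros)
      then show "ennreal ((G x - F n x)\<^sup>2) = liminf (\<lambda>m. ennreal ((F (n + m) x - F n x)\<^sup>2))"
        using lim_imp_Liminf[OF sequentially_bot] by metis
    qed
    also have "\<dots> \<le> liminf (\<lambda>m. \<integral>\<^sup>+x. ennreal ((F (n + m) x - F n x)\<^sup>2) \<partial>Imeas)"
      by (rule nn_integral_liminf) auto
    also have "\<dots> \<le> liminf (\<lambda>m. ennreal ((2 * (1/2)^n)\<^sup>2))"
    proof (intro Liminf_mono always_eventually allI)
      fix m
      have "(\<integral>\<^sup>+x. ennreal ((F (n + m) x - F n x)\<^sup>2) \<partial>Imeas)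
          = ennreal (LINT x|Imeas. (F (n + m) x - F n x)\<^sup>2)"
        using L2I_diff[OF F F] by (intro nn_integral_eq_integral) (auto simp: L2I_iff)
      also have "\<dots> = ennreal ((norm (X (n + m) - X n))\<^sup>2)"
        unfolding X to_L2I_diff[OF F F] norm_to_L2I[OF L2I_diff[OF F F]] ..
      also have "\<dots> \<le> ennreal ((2 * (1/2)^n)\<^sup>2)"
      proof (intro ennreal_leI power_mono)
        have "(0::real) \<le> (1/2)^(n+m)" by simp
        with tail[of n m] show "norm (X (n + m) - X n) \<le> 2 * (1/2)^n" by linarith
      qed simp
      finally show "(\<integral>\<^sup>+x. ennreal ((F (n + m) x - F n x)\<^sup>2) \<partial>Imeas) \<le> ennreal ((2 * (1/2)^n)\<^sup>2)" .
    qed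
    finally show ?thesis by (simp add: Liminf_const)
  qed
  have GF: "(\<lambda>x. G x - F n x) \<in> L2_on (-1) 1" for n
  proof -
    have "integrable Imeas (\<lambda>x. (G x - F n x)\<^sup>2)"
      using le_less_trans[OF main[of n]] by (intro integrableI_nonneg) auto
    then show ?thesis by (simp add: L2I_iff)
  qed
  have G: "G \<in> L2_on (-1) 1"
    using L2I_add[OF GF[of 0] F[of 0]] by simp
  have bound: "norm (X n - to_L2I G) \<le> 2 * (1/2)^n" for n
  proof -
    have "ennreal ((norm (to_L2I G - X n))\<^sup>2) = ennreal (LINT x|Imeas. (G x - F n x)\<^sup>2)"
      unfolding X to_L2I_diff[OF G F] norm_to_L2I[OF GF] ..
    also have "\<dots> = (\<integral>\<^sup>+x. ennreal ((G x - F n x)\<^sup>2) \<partial>Imeas)"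
      using GF[of n] by (intro nn_integral_eq_integral[symmetric]) (auto simp: L2I_iff)
    also have "\<dots> \<le> ennreal ((2 * (1/2)^n)\<^sup>2)" by (rule main)
    finally have "(norm (to_L2I G - X n))\<^sup>2 \<le> (2 * (1/2)^n)\<^sup>2" by simp
    then show ?thesis
      by (subst norm_minus_commute) (rule power2_le_imp_le, auto)
  qed
  have "(\<lambda>n. X n - to_L2I G) \<longlonglongrightarrow> 0"
  proof (rule Lim_null_comparison[OF always_eventually])
    show "\<forall>n. norm (X n - to_L2I G) \<le> 2 * (1/2)^n" using bound by blast
    show "(\<lambda>n. 2 * (1/2::real)^n) \<longlonglongrightarrow> 0"
      by (intro tendsto_mult_right_zero LIMSEQ_power_zero) simp
  qed
  then show ?thesis
    by (auto simp: LIM_zero_iff convergent_def)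
qed

instance L2I :: banach
proof
  fix X :: "nat \<Rightarrow> L2I"
  assume "Cauchy X"
  have "\<exists>r. \<forall>k. (\<forall>m\<ge>r k. \<forall>n\<ge>r k. norm (X m - X n) < (1/2)^k) \<and> r k < r (Suc k)"
  proof (rule dependent_nat_choice)
    show "\<exists>N. \<forall>m\<ge>N. \<forall>n\<ge>N. norm (X m - X n) < (1/2)^0"
      using CauchyD[OF \<open>Cauchy X\<close>, of 1] by simp
    fix N0 k
    obtain N where N: "\<forall>m\<ge>N. \<forall>n\<ge>N. norm (X m - X n) < (1/2)^Suc k"
      using CauchyD[OF \<open>Cauchy X\<close>, of "(1/2)^Suc k"] by auto
    show "\<exists>N'. (\<forall>m\<ge>N'. \<forall>n\<ge>N'. norm (X m - X n) < (1/2)^Suc k) \<and> N0 < N'"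
      by (rule exI[of _ "max N (Suc N0)"]) (use N in auto)
  qed
  then obtain r where r: "\<And>k m n. m \<ge> r k \<Longrightarrow> n \<ge> r k \<Longrightarrow> norm (X m - X n) < (1/2)^k"
    and mono: "\<And>k. r k < r (Suc k)"
    by blast
  have "convergent (X \<circ> r)"
  proof (rule L2I_fast_convergent)
    show "norm ((X \<circ> r) (Suc k) - (X \<circ> r) k) \<le> (1/2)^k" for k
      using r[where k = k and m = "r (Suc k)" and n = "r k"] mono[of k] by simp
  qed
  then obtain L where "(X \<circ> r) \<longlonglongrightarrow> L"
    by (auto simp: convergent_def)
  with \<open>Cauchy X\<close> mono have "X \<longlonglongrightarrow> L"
    by (intro Cauchy_converges_subseq[of X r]) (auto simp: strict_mono_Suc_iff)
  then show "convergent X"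
    by (auto simp: convergent_def)
qed

lemma dist_to_L2I:
  assumes "f \<in> L2_on (-1) 1" "g \<in> L2_on (-1) 1"
  shows "dist (to_L2I f) (to_L2I g) = sqrt (LINT x|Imeas. (f x - g x)\<^sup>2)"
  unfolding dist_norm to_L2I_diff[OF assms] norm_to_L2I[OF L2I_diff[OF assms], symmetric]
  by simp

lemma dist_to_L2I_le:
  assumes fg: "f \<in> L2_on (-1) 1" "g \<in> L2_on (-1) 1"
    and le: "\<And>x. x \<in> {-1<..<1} \<Longrightarrow> \<bar>f x - g x\<bar> \<le> e" and "e \<ge> 0"
  shows "dist (to_L2I f) (to_L2I g) \<le> 2 * e"
proof -
  interpret finite_measure Imeas by (rule finite_measure_Imeas)
  have "(LINT x|Imeas. (f x - g x)\<^sup>2) \<le> (LINT x|Imeas. e\<^sup>2)"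
  proof (rule integral_mono)
    show "integrable Imeas (\<lambda>x. (f x - g x)\<^sup>2)"
      using L2I_diff[OF fg] by (simp add: L2I_iff)
    show "(f x - g x)\<^sup>2 \<le> e\<^sup>2" if "x \<in> space Imeas" for x
      using le[of x] that \<open>e \<ge> 0\<close> by (simp flip: abs_le_square_iff)
  qed simp
  also have "\<dots> = 2 * e\<^sup>2"
    by (simp add: measure_restrict_space)
  also have "\<dots> \<le> (2 * e)\<^sup>2"
    by (simp add: power_mult_distrib)
  finally show ?thesis
    unfolding dist_to_L2I[OF fg] using \<open>e \<ge> 0\<close> by (intro real_le_lsqrt) auto
qed

lemma dist_to_L2I_tendsto:
  assumes f: "f \<in> L2_on (-1) 1" and g: "\<And>n. g n \<in> L2_on (-1) 1"
    and lim: "AE x in Imeas. (\<lambda>n. g n x) \<longlonglongrightarrow> f x"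
    and w: "integrable Imeas w" "\<And>n x. (g n x - f x)\<^sup>2 \<le> w x"
  shows "(\<lambda>n. dist (to_L2I (g n)) (to_L2I f)) \<longlonglongrightarrow> 0"
proof -
  have "(\<lambda>n. LINT x|Imeas. (g n x - f x)\<^sup>2) \<longlonglongrightarrow> (LINT x|Imeas. 0)"
  proof (rule integral_dominated_convergence[where w = w])
    show "(\<lambda>x. (g n x - f x)\<^sup>2) \<in> borel_measurable Imeas" for n
      using L2I_diff[OF g f, of n] by (simp add: L2I_iff borel_measurable_integrable)
    show "AE x in Imeas. (\<lambda>n. (g n x - f x)\<^sup>2) \<longlonglongrightarrow> 0"
      using lim by eventually_elim (auto intro!: tendsto_eq_intros)
  qed (use w f g in \<open>auto simp: L2I_iff\<close>)
  then have "(\<lambda>n. sqrt (LINT x|Imeas. (g n x - f x)\<^sup>2)) \<longlonglongrightarrow> sqrt 0"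
    by (intro tendsto_intros) simp
  then show ?thesis
    by (simp add: dist_to_L2I[OF g f])
qed

lemma L2I_dense_rational_polys:
  fixes X :: L2I
  assumes "e > 0"
  shows "\<exists>cs :: rat list. dist (to_L2I (\<lambda>x. if \<bar>x\<bar> < 1 then \<Sum>i<length cs. of_rat (cs ! i) * x ^ i else 0)) X < e"
proof -
  define clip :: "real \<Rightarrow> real \<Rightarrow> real" where "clip B t = max (- B) (min B t)" for B t
  have clip_le: "\<bar>clip B t\<bar> \<le> B" if "B \<ge> 0" for B t
    using that by (auto simp: clip_def)
  have clip_id: "clip B t = t" if "\<bar>t\<bar> \<le> B" for B t
    using that by (auto simp: clip_def)
  have clip_meas: "(\<lambda>x. clip B (f x)) \<in> borel_measurable Imeas"
    if "f \<in> borel_measurable Imeas" for B f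
    unfolding clip_def using that by measurable
  have clip_L2: "(\<lambda>x. clip B (f x)) \<in> L2_on (-1) 1"
    if "f \<in> borel_measurable Imeas" "B \<ge> 0" for B f
    by (rule L2I_bounded[of _ B]) (use clip_meas that clip_le in auto)
  obtain f where f: "f \<in> L2_on (-1) 1" and X: "X = to_L2I f"
    by (rule L2I_ex_rep)
  have fm: "f \<in> borel_measurable Imeas"
    using f by (simp add: L2I_iff)
  have "(\<lambda>n. dist (to_L2I (\<lambda>x. clip (real n) (f x))) (to_L2I f)) \<longlonglongrightarrow> 0"
  proof (rule dist_to_L2I_tendsto[where w = "\<lambda>x. (f x)\<^sup>2"])
    show "AE x in Imeas. (\<lambda>n. clip (real n) (f x)) \<longlonglongrightarrow> f x"
    proof (rule AE_I2)
      fix x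
      have "eventually (\<lambda>n. \<bar>f x\<bar> \<le> real n) sequentially"
        using real_arch_simple[of "\<bar>f x\<bar>"] unfolding eventually_sequentially
        by (meson of_nat_le_iff order_trans)
      then show "(\<lambda>n. clip (real n) (f x)) \<longlonglongrightarrow> f x"
        by (rule tendsto_eventually[OF eventually_mono]) (rule clip_id)
    qed
    show "(clip (real n) (f x) - f x)\<^sup>2 \<le> (f x)\<^sup>2" for n x
      unfolding abs_le_square_iff[symmetric] by (auto simp: clip_def)
  qed (use f fm in \<open>auto simp: L2I_iff intro: clip_L2[unfolded L2I_iff, THEN conjunct2] clip_meas\<close>)
  then obtain n where n: "dist (to_L2I (\<lambda>x. clip (real n) (f x))) (to_L2I f) < e / 4"
    using order_tendstoD(2)[of _ 0 sequentially "e/4"] \<open>e > 0\<close>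
    by (auto simp: eventually_sequentially)
  define B where "B = real n"
  have B: "B \<ge> 0" by (simp add: B_def)
  define g where "g x = clip B (f x)" for x
  have gm: "g \<in> borel_measurable Imeas" and gL2: "g \<in> L2_on (-1) 1"
    unfolding g_def using clip_meas clip_L2 fm B by blast+
  have gB: "\<bar>g x\<bar> \<le> B" for x
    unfolding g_def by (rule clip_le[OF B])
  have "g measurable_on {-1<..<1}"
    using gm by (simp add: measurable_on_iff_borel_measurable)
  then obtain N h where N: "negligible N" and h: "\<And>k::nat. continuous_on UNIV (h k)"
    and lim: "\<And>x. x \<notin> N \<Longrightarrow> (\<lambda>k. h k x) \<longlonglongrightarrow> (if x \<in> {-1<..<1} then g x else 0)"
    unfolding measurable_on_def by blast
  have clip_cont: "continuous_on UNIV (\<lambda>x. clip B (h k x))" for k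
    unfolding clip_def by (intro continuous_intros h)
  have hL2: "(\<lambda>x. clip B (h k x)) \<in> L2_on (-1) 1" for k
    by (rule clip_L2[OF _ B])
       (use h[of k] in \<open>auto intro!: continuous_imp_measurable_on_sets_lebesgue elim: continuous_on_subset\<close>)
  have "(\<lambda>k. dist (to_L2I (\<lambda>x. clip B (h k x))) (to_L2I g)) \<longlonglongrightarrow> 0"
  proof (rule dist_to_L2I_tendsto[where w = "\<lambda>x. (2 * B)\<^sup>2", OF gL2 hL2])
    have "AE x in lebesgue. x \<notin> N"
      using N by (simp add: negligible_iff_null_sets AE_not_in)
    then have "AE x in Imeas. x \<notin> N"
      by (subst AE_restrict_space_iff) auto
    then show "AE x in Imeas. (\<lambda>k. clip B (h k x)) \<longlonglongrightarrow> g x"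
    proof (rule AE_mp, intro AE_I2 impI)
      fix x assume "x \<in> space Imeas" "x \<notin> N"
      with lim[of x] have "(\<lambda>k. h k x) \<longlonglongrightarrow> g x" by simp
      then have "(\<lambda>k. clip B (h k x)) \<longlonglongrightarrow> clip B (g x)"
        unfolding clip_def by (intro tendsto_intros)
      then show "(\<lambda>k. clip B (h k x)) \<longlonglongrightarrow> g x"
        by (simp add: clip_id[OF gB])
    qed
    interpret finite_measure Imeas by (rule finite_measure_Imeas)
    show "integrable Imeas (\<lambda>x. (2 * B)\<^sup>2)" by simp
    show "(clip B (h k x) - g x)\<^sup>2 \<le> (2 * B)\<^sup>2" for k x
      unfolding abs_le_square_iff[symmetric] using clip_le[OF B, of "h k x"] gB[of x] by auto
  qed
  then obtain k where k: "dist (to_L2I (\<lambda>x. clip B (h k x))) (to_L2I g) < e / 4"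
    using order_tendstoD(2)[of _ 0 sequentially "e/4"] \<open>e > 0\<close>
    by (auto simp: eventually_sequentially)
  obtain P where P: "real_polynomial_function P"
    and Pe: "\<And>x. x \<in> {-1..1} \<Longrightarrow> \<bar>clip B (h k x) - P x\<bar> < e / 16"
    using Stone_Weierstrass_real_polynomial_function[of "{-1..1}" "\<lambda>x. clip B (h k x)" "e/16"]
      continuous_on_subset[OF clip_cont] \<open>e > 0\<close> by auto
  obtain a m where Pa: "P = (\<lambda>x. \<Sum>i\<le>m. a i * x ^ i)"
    using real_polynomial_function_imp_sum[OF P] by blast
  have "\<exists>q::rat. \<bar>a i - of_rat q\<bar> < e / 16 / real (Suc m)" for i
  proof -
    obtain q where "a i - e / 16 / real (Suc m) < of_rat q" "of_rat q < a i"
      using of_rat_dense[of "a i - e / 16 / real (Suc m)" "a i"] \<open>e > 0\<close> by auto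
    then show ?thesis by (intro exI[of _ q]) auto
  qed
  then obtain q :: "nat \<Rightarrow> rat" where q: "\<And>i. \<bar>a i - of_rat (q i)\<bar> < e / 16 / real (Suc m)"
    by metis
  define cs where "cs = map q [0..<Suc m]"
  define R where "R x = (if \<bar>x\<bar> < 1 then \<Sum>i<length cs. of_rat (cs ! i) * x ^ i else 0)" for x :: real
  have R: "R x = (\<Sum>i\<le>m. of_rat (q i) * x ^ i)" if "\<bar>x\<bar> < 1" for x
    using that by (simp add: R_def cs_def lessThan_Suc_atMost del: upt_Suc)
  have RL2: "R \<in> L2_on (-1) 1"
  proof (rule L2I_bounded[of _ "\<Sum>i<length cs. \<bar>of_rat (cs ! i)\<bar>"])
    have "R \<in> borel_measurable borel"
      unfolding R_def by measurable
    then show "R \<in> borel_measurable Imeas"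
      by (intro measurable_restrict_space1 measurable_completion) simp
    fix x
    show "\<bar>R x\<bar> \<le> (\<Sum>i<length cs. \<bar>of_rat (cs ! i)\<bar>)"
    proof (cases "\<bar>x\<bar> < 1")
      case True
      then have "\<bar>R x\<bar> \<le> (\<Sum>i<length cs. \<bar>of_rat (cs ! i) * x ^ i\<bar>)"
        by (simp add: R_def sum_abs)
      also have "\<dots> \<le> (\<Sum>i<length cs. \<bar>of_rat (cs ! i)\<bar>)"
        using True by (intro sum_mono) (auto simp: abs_mult power_abs intro!: mult_left_le power_le_one)
      finally show ?thesis .
    qed (auto simp: R_def intro!: sum_nonneg)
  qed
  have "\<bar>R x - clip B (h k x)\<bar> \<le> e / 8" if x: "x \<in> {-1<..<1}" for x
  proof -
    have "R x - P x = (\<Sum>i\<le>m. (of_rat (q i) - a i) * x ^ i)"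
      using x R[of x] by (simp add: Pa sum_subtractf left_diff_distrib abs_less_iff)
    also have "\<bar>\<dots>\<bar> \<le> (\<Sum>i\<le>m. \<bar>(of_rat (q i) - a i) * x ^ i\<bar>)"
      by (rule sum_abs)
    also have "\<dots> \<le> (\<Sum>i\<le>m. e / 16 / real (Suc m))"
    proof (rule sum_mono)
      fix i
      have "\<bar>(of_rat (q i) - a i) * x ^ i\<bar> \<le> \<bar>of_rat (q i) - a i\<bar>"
        using x by (auto simp: abs_mult power_abs intro!: mult_left_le power_le_one)
      also have "\<dots> \<le> e / 16 / real (Suc m)"
        using q[of i] by (simp add: abs_minus_commute)
      finally show "\<bar>(of_rat (q i) - a i) * x ^ i\<bar> \<le> e / 16 / real (Suc m)" .
    qed
    also have "\<dots> = real (Suc m) * (e / 16 / real (Suc m))" by simp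
    also have "\<dots> = e / 16" by (simp del: of_nat_Suc)
    finally have "\<bar>R x - P x\<bar> \<le> e / 16" .
    moreover have "\<bar>clip B (h k x) - P x\<bar> < e / 16"
      using Pe[of x] x by simp
    ultimately show ?thesis by linarith
  qed
  then have "dist (to_L2I R) (to_L2I (\<lambda>x. clip B (h k x))) \<le> 2 * (e / 8)"
    using \<open>e > 0\<close> by (intro dist_to_L2I_le RL2 hL2) auto
  moreover have "dist (to_L2I g) X < e / 4"
    using n unfolding X g_def B_def .
  ultimately have "dist (to_L2I R) X < e"
    using k \<open>e > 0\<close> dist_triangle[of "to_L2I R" X "to_L2I g"]
      dist_triangle[of "to_L2I R" "to_L2I g" "to_L2I (\<lambda>x. clip B (h k x))"]
    by linarith
  then show ?thesis
    unfolding R_def by blast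
qed

instance L2I :: second_countable_topology
proof
  define p :: "rat list \<Rightarrow> L2I" where
    "p cs = to_L2I (\<lambda>x. if \<bar>x\<bar> < 1 then \<Sum>i<length cs. of_rat (cs ! i) * x ^ i else 0)" for cs
  define B where "B = (\<lambda>(cs, n). ball (p cs) (1 / real (Suc n))) ` UNIV"
  have "topological_basis B"
  proof (rule topological_basisI)
    show "open U" if "U \<in> B" for U
      using that by (auto simp: B_def)
    fix U and X :: L2I assume "open U" "X \<in> U"
    then obtain e where e: "e > 0" "ball X e \<subseteq> U"
      by (auto simp: open_contains_ball)
    obtain n where n: "1 / real (Suc n) < e / 2"
      using nat_approx_posE[of "e/2"] e by auto
    obtain cs where cs: "dist (p cs) X < 1 / real (Suc n)"
      using L2I_dense_rational_polys[of "1 / real (Suc n)" X] by (auto simp: p_def)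
    have "ball (p cs) (1 / real (Suc n)) \<subseteq> ball X e"
    proof
      fix Y assume "Y \<in> ball (p cs) (1 / real (Suc n))"
      with cs n dist_triangle[of X Y "p cs"] show "Y \<in> ball X e"
        by (simp add: dist_commute)
    qed
    then show "\<exists>B'\<in>B. X \<in> B' \<and> B' \<subseteq> U"
      using cs e by (intro bexI[of _ "ball (p cs) (1 / real (Suc n))"]) (auto simp: B_def)
  qed
  moreover have "countable B"
    by (simp add: B_def)
  ultimately show "\<exists>B::L2I set set. countable B \<and> open = generate_topology B"
    using topological_basis_imp_subbasis by auto
qed


section \<open>Function spaces\<close>

definition test_function :: "real \<Rightarrow> real \<Rightarrow> (real \<Rightarrow> real) \<Rightarrow> bool" where
  "test_function a b \<phi> \<longleftrightarrow>
     (\<forall>n x. (deriv ^^ n) \<phi> field_differentiable at x) \<and>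
     compact (closure {x. \<phi> x \<noteq> 0}) \<and> closure {x. \<phi> x \<noteq> 0} \<subseteq> {a<..<b}"

definition weak_deriv ::
  "real \<Rightarrow> real \<Rightarrow> (real \<Rightarrow> 'a::{banach, second_countable_topology}) \<Rightarrow> (real \<Rightarrow> 'a) \<Rightarrow> bool" where
  "weak_deriv a b v v' \<longleftrightarrow> (\<forall>\<phi>. test_function a b \<phi> \<longrightarrow>
     (LINT t|lebesgue_on {a<..<b}. deriv \<phi> t *\<^sub>R v t) = - (LINT t|lebesgue_on {a<..<b}. \<phi> t *\<^sub>R v' t))"

definition H1_on :: "real \<Rightarrow> real \<Rightarrow> (real \<Rightarrow> 'a::{banach, second_countable_topology}) set" where
  "H1_on a b = {v \<in> L2_on a b. \<exists>v'\<in>L2_on a b. weak_deriv a b v v'}"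

definition abs_cont_on :: "real \<Rightarrow> real \<Rightarrow> (real \<Rightarrow> real) \<Rightarrow> bool" where
  "abs_cont_on c d w \<longleftrightarrow> (\<forall>e>0. \<exists>\<delta>>0. \<forall>(n::nat) a b.
     (\<forall>i<n. c \<le> a i \<and> a i \<le> b i \<and> b i \<le> d) \<and>
     (\<forall>i<n. \<forall>j<n. i \<noteq> j \<longrightarrow> {a i<..<b i} \<inter> {a j<..<b j} = {}) \<and>
     (\<Sum>i<n. b i - a i) < \<delta> \<longrightarrow> (\<Sum>i<n. \<bar>w (b i) - w (a i)\<bar>) < e)"

definition AC_loc :: "(real \<Rightarrow> real) \<Rightarrow> bool" where
  "AC_loc w \<longleftrightarrow> (\<forall>c d. -1 < c \<and> c \<le> d \<and> d < 1 \<longrightarrow> abs_cont_on c d w)"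

text \<open>
  An element of \<open>V\<close> is represented by its locally absolutely continuous representative on \<open>I\<close>; it is
  differentiable almost everywhere and \<open>w\<^sub>x\<close> is \<^term>\<open>deriv w\<close>.
\<close>

definition V_space :: "(real \<Rightarrow> real) \<Rightarrow> (real \<Rightarrow> real) set" where
  "V_space \<rho> = {w \<in> L2_on (-1) 1. AC_loc w \<and> (\<lambda>x. sqrt (\<rho> x) * deriv w x) \<in> L2_on (-1) 1}"

definition V_inner :: "(real \<Rightarrow> real) \<Rightarrow> (real \<Rightarrow> real) \<Rightarrow> (real \<Rightarrow> real) \<Rightarrow> real" where
  "V_inner \<rho> v w = (LINT x|Imeas. v x * w x) +
     (LINT x|Imeas. (sqrt (\<rho> x) * deriv v x) * (sqrt (\<rho> x) * deriv w x))"

definition V_norm :: "(real \<Rightarrow> real) \<Rightarrow> (real \<Rightarrow> real) \<Rightarrow> real" where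
  "V_norm \<rho> w = sqrt (V_inner \<rho> w w)"

definition cont_V :: "(real \<Rightarrow> real) \<Rightarrow> real set \<Rightarrow> (real \<Rightarrow> real \<Rightarrow> real) \<Rightarrow> bool" where
  "cont_V \<rho> J u \<longleftrightarrow> (\<forall>t\<in>J. u t \<in> V_space \<rho>) \<and>
     (\<forall>t\<in>J. ((\<lambda>s. V_norm \<rho> (\<lambda>x. u s x - u t x)) \<longlongrightarrow> 0) (at t within J))"

section \<open>The degenerate operator and its semigroup\<close>

definition rho :: "real \<Rightarrow> real \<Rightarrow> real" where
  "rho \<rho>0 x = \<rho>0 * (1 - x\<^sup>2)"

definition dom_A :: "(real \<Rightarrow> real) \<Rightarrow> (real \<Rightarrow> real) set" where
  "dom_A \<rho> = {w \<in> V_space \<rho>. (\<lambda>x. \<rho> x * deriv w x) \<in> H1_on (-1) 1}"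

text \<open>
  The graph of \<open>A w = (\<rho> w\<^sub>x)\<^sub>x\<close> in \<open>L\<^sup>2(I) \<times> L\<^sup>2(I)\<close>. As usual for degenerate operators, the boundary
  condition \<open>\<rho> w\<^sub>x = 0\<close> on \<open>\<partial>I\<close> is contained in the domain: the limit of \<open>\<rho> w\<^sub>x\<close> at an end point
  exists, and it vanishes because \<open>\<surd>\<rho> w\<^sub>x\<close> is square integrable.
\<close>

definition graph_A :: "(real \<Rightarrow> real) \<Rightarrow> (L2I \<times> L2I) set" where
  "graph_A \<rho> = {(to_L2I w, to_L2I v) | w v.
     w \<in> dom_A \<rho> \<and> v \<in> L2_on (-1) 1 \<and> weak_deriv (-1) 1 (\<lambda>x. \<rho> x * deriv w x) v}"

definition C0_semigroup :: "(real \<Rightarrow> 'a::real_normed_vector \<Rightarrow> 'a) \<Rightarrow> bool" where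
  "C0_semigroup S \<longleftrightarrow>
     (\<forall>t\<ge>0. bounded_linear (S t)) \<and> (\<forall>v. S 0 v = v) \<and>
     (\<forall>s\<ge>0. \<forall>t\<ge>0. \<forall>v. S (s + t) v = S s (S t v)) \<and>
     (\<forall>v. ((\<lambda>t. S t v) \<longlongrightarrow> v) (at_right 0))"

definition infinitesimal_generator :: "(real \<Rightarrow> 'a::real_normed_vector \<Rightarrow> 'a) \<Rightarrow> ('a \<times> 'a) set" where
  "infinitesimal_generator S = {(v, z). ((\<lambda>h. (S h v - v) /\<^sub>R h) \<longlongrightarrow> z) (at_right 0)}"

text \<open>
  \<open>L\<^sup>2(0,T;D(A))\<close>, where \<open>D(A)\<close> carries the graph norm, i.e. the norm induced from the product
  \<open>L\<^sup>2(I) \<times> L\<^sup>2(I)\<close> by \<open>w \<mapsto> (w, A w)\<close>.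
\<close>

definition L2_dom_A :: "(real \<Rightarrow> real) \<Rightarrow> real \<Rightarrow> (real \<Rightarrow> L2I) \<Rightarrow> bool" where
  "L2_dom_A \<rho> T U \<longleftrightarrow> (\<exists>AU. (AE t in lebesgue_on {0<..<T}. (U t, AU t) \<in> graph_A \<rho>) \<and>
     (\<lambda>t. (U t, AU t)) \<in> L2_on 0 T)"

section \<open>Mild solutions\<close>

definition memory :: "real \<Rightarrow> (real \<Rightarrow> real \<Rightarrow> real) \<Rightarrow> (real \<Rightarrow> real \<Rightarrow> real) \<Rightarrow> real \<Rightarrow> real \<Rightarrow> real" where
  "memory \<tau> k u t x = integral {-\<tau>..0} (\<lambda>s. k s x * u (t + s) x)"

definition source ::
  "real \<Rightarrow> (real \<Rightarrow> real) \<Rightarrow> (real \<Rightarrow> real) \<Rightarrow> (real \<Rightarrow> real) \<Rightarrow> (real \<Rightarrow> real \<Rightarrow> real) \<Rightarrow> (real \<Rightarrow> real) \<Rightarrow>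
   (real \<Rightarrow> real) \<Rightarrow> (real \<Rightarrow> real \<Rightarrow> real) \<Rightarrow> real \<Rightarrow> real \<Rightarrow> real" where
  "source \<tau> r \<beta> \<epsilon> k f q u t x =
     r t * q x * \<beta> (u t x) - \<epsilon> (u t x) * \<bar>u t x\<bar> ^ 3 * u t x + f (memory \<tau> k u t x)"

text \<open>
  \<open>u t x\<close> is the value of the solution at time \<open>t \<ge> -\<tau>\<close> and \<open>x \<in> I\<close>; \<open>S\<close> stands for \<open>(e\<^sup>t\<^sup>A)\<close>, \<open>t \<ge> 0\<close>.
  Pointwise values make sense because \<open>u t \<in> V\<close> is continuous on \<open>I\<close>. The integral is the Bochner
  integral in \<open>L\<^sup>2(I)\<close>.
\<close>

definition mild_solution ::
  "real \<Rightarrow> real \<Rightarrow> (real \<Rightarrow> L2I \<Rightarrow> L2I) \<Rightarrow> (real \<Rightarrow> real) \<Rightarrow> (real \<Rightarrow> real) \<Rightarrow> (real \<Rightarrow> real) \<Rightarrow>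
   (real \<Rightarrow> real \<Rightarrow> real) \<Rightarrow> (real \<Rightarrow> real) \<Rightarrow> (real \<Rightarrow> real) \<Rightarrow> (real \<Rightarrow> real \<Rightarrow> real) \<Rightarrow>
   (real \<Rightarrow> real \<Rightarrow> real) \<Rightarrow> bool" where
  "mild_solution \<tau> \<rho>0 S r \<beta> \<epsilon> k f q u0 u \<longleftrightarrow> (\<forall>T>0.
     (\<lambda>t. to_L2I (u t)) \<in> H1_on 0 T \<and>
     L2_dom_A (rho \<rho>0) T (\<lambda>t. to_L2I (u t)) \<and>
     cont_V (rho \<rho>0) {-\<tau>..T} u \<and>
     (\<forall>s\<in>{-\<tau>..0}. \<forall>x\<in>{-1<..<1}. u s x = u0 s x) \<and>
     (\<forall>t\<in>{0..T}.
        source \<tau> r \<beta> \<epsilon> k f q u t \<in> L2_on (-1) 1 \<and>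
        integrable (lebesgue_on {0..t}) (\<lambda>s. S (t - s) (to_L2I (source \<tau> r \<beta> \<epsilon> k f q u s))) \<and>
        to_L2I (u t) = S t (to_L2I (u0 0)) +
          (LINT s|lebesgue_on {0..t}. S (t - s) (to_L2I (source \<tau> r \<beta> \<epsilon> k f q u s)))))"

section \<open>Regularity classes of the data\<close>

definition C1_bounded_on :: "real set \<Rightarrow> (real \<Rightarrow> real) \<Rightarrow> bool" where
  "C1_bounded_on D g \<longleftrightarrow> bounded (g ` D) \<and>
     (\<exists>g'. (\<forall>x\<in>D. (g has_real_derivative g' x) (at x within D)) \<and>
           continuous_on D g' \<and> bounded (g' ` D))"

definition C2_bounded_on :: "real set \<Rightarrow> (real \<Rightarrow> real) \<Rightarrow> bool" where
  "C2_bounded_on D g \<longleftrightarrow> bounded (g ` D) \<and>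
     (\<exists>g'. (\<forall>x\<in>D. (g has_real_derivative g' x) (at x within D)) \<and> C1_bounded_on D g')"

text \<open>\<open>C\<^sup>1\<close> and \<open>C\<^sup>1\<^sup>,\<^sup>2\<close> on a closed rectangle \<open>D \<times> E\<close>, with one-sided derivatives on its boundary.\<close>

definition C1_rect :: "real set \<Rightarrow> real set \<Rightarrow> (real \<Rightarrow> real \<Rightarrow> real) \<Rightarrow> bool" where
  "C1_rect D E g \<longleftrightarrow> (\<exists>gs gx.
     (\<forall>s\<in>D. \<forall>x\<in>E. ((\<lambda>s'. g s' x) has_real_derivative gs s x) (at s within D) \<and>
        (g s has_real_derivative gx s x) (at x within E)) \<and>
     continuous_on (D \<times> E) (\<lambda>(s, x). g s x) \<and>
     continuous_on (D \<times> E) (\<lambda>(s, x). gs s x) \<and>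
     continuous_on (D \<times> E) (\<lambda>(s, x). gx s x))"

definition C12_rect :: "real set \<Rightarrow> real set \<Rightarrow> (real \<Rightarrow> real \<Rightarrow> real) \<Rightarrow> bool" where
  "C12_rect D E g \<longleftrightarrow> (\<exists>gs gx gxx.
     (\<forall>s\<in>D. \<forall>x\<in>E. ((\<lambda>s'. g s' x) has_real_derivative gs s x) (at s within D) \<and>
        (g s has_real_derivative gx s x) (at x within E) \<and>
        (gx s has_real_derivative gxx s x) (at x within E)) \<and>
     continuous_on (D \<times> E) (\<lambda>(s, x). g s x) \<and>
     continuous_on (D \<times> E) (\<lambda>(s, x). gs s x) \<and>
     continuous_on (D \<times> E) (\<lambda>(s, x). gx s x) \<and>
     continuous_on (D \<times> E) (\<lambda>(s, x). gxx s x))"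

text \<open>As for the library's \<open>analytic_on\<close>, analyticity on a closed interval means analyticity at each
  of its points, in a full neighbourhood of the point.\<close>

definition real_analytic_on :: "(real \<Rightarrow> real) \<Rightarrow> real set \<Rightarrow> bool" where
  "real_analytic_on g D \<longleftrightarrow>
     (\<forall>x\<in>D. \<exists>e>0. \<exists>c. \<forall>y. \<bar>y - x\<bar> < e \<longrightarrow> (\<lambda>n. c n * (y - x) ^ n) sums g y)"

definition piecewise_analytic :: "(real \<Rightarrow> real) \<Rightarrow> bool" where
  "piecewise_analytic \<psi> \<longleftrightarrow> continuous_on {-1<..<1} \<psi> \<and>
     (\<exists>n\<ge>1. \<exists>(p :: nat \<Rightarrow> real) (\<phi> :: nat \<Rightarrow> real \<Rightarrow> real).
        strict_mono_on {1..n} p \<and> p 1 = -1 \<and> p n = 1 \<and>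
        (\<forall>j\<in>{1..n-1}. real_analytic_on (\<phi> j) {p j..p (j+1)}) \<and>
        (\<forall>x\<in>{-1<..<1}. \<psi> x = (\<Sum>j=1..n-1. indicator {p j..<p (j+1)} x * \<phi> j x)))"

definition Q_pt :: "(real \<Rightarrow> real) set" where
  "Q_pt = {q. (\<exists>L. L-lipschitz_on {-1<..<1} q) \<and> piecewise_analytic q}"

end

(*
  Suppose q and q~ differ. By piecewise analyticity, between x0 and some b the difference q - q~ has one sign
  and is bounded away from 0 on a subinterval. Before time delta the memory terms of u and u~ coincide, so
  U = u - u~ solves a parabolic equation with forcing r beta(u) (q - q~), up to an error bounded by C |U|, with
  zero initial data and zero Cauchy data at x0. It is integrated against a nonnegative weight psi with (rho psi')' = (l^2 + V) psi + l^2 / quart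
  that vanishes to second order at b: Kato's inequality bounds the mass of |U| psi from above, and with that the
  first moment of U psi is at least of order exp(l^2 t), up to constants, for a small fixed time t. But the
  moment is at most of order exp(C l), which is absurd as l tends to infinity.

  The weak form of the equation that this requires is derived from the mild formulation: tested with a smooth
  function, the semigroup is differentiable because A is symmetric, and the test functions are dense in L^2(I).
*)
theory Submission
  imports Defs "HOL-Complex_Analysis.Complex_Analysis" "HOL-Real_Asymp.Real_Asymp"
begin

section \<open>Lebesgue's theorem for absolutely continuous functions: derivative almost everywhere,
  and its integral\<close>

section \<open>Absolutely continuous functions\<close>

text \<open>The engine is a clash of two rates. Against a weight growing like
  \<open>exp (l * arc)\<close>, diffusion acts as multiplication by \<open>l^2\<close>, so a forcing
  of one sign drives the moment at the rate \<open>l^2\<close>, while boundedness of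
  \<open>U\<close> caps the moment at the size of the weight. Zero Cauchy data removes the boundary
  terms at x0, where the weight is large; nothing is known of \<open>U\<close> at b, hence the
  double zero there. The obstacle is the error \<open>C |U|\<close>, which has no sign: the
  inequality for the moment does not close by itself. The one for the mass does, at the rate
  \<open>l^2 + C\<close>, and the loss it causes in the moment is the forcing times
  \<open>C t exp (C t)\<close>, which the forcing itself beats once t is small; only then is l sent
  to infinity. A second obstacle is regularity. The time derivative lives only in
  \<open>L^2(0,T; L^2(I))\<close>, so inequalities in time are derived for increments and summed; in
  space, the almost everywhere derivative of an absolutely continuous representative has to become a
  continuous flux before Cauchy data at a point can be used.\<close>

lemma abs_cont_onD:
  assumes "abs_cont_on c d w" "e > 0"
  shows "\<exists>\<eta>>0. \<forall>S (a :: 'i \<Rightarrow> real) b. finite S \<longrightarrow> (\<forall>i\<in>S. c \<le> a i \<and> a i \<le> b i \<and> b i \<le> d) \<longrightarrow>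
     (\<forall>i\<in>S. \<forall>j\<in>S. i \<noteq> j \<longrightarrow> {a i<..<b i} \<inter> {a j<..<b j} = {}) \<longrightarrow>
     (\<Sum>i\<in>S. b i - a i) < \<eta> \<longrightarrow> (\<Sum>i\<in>S. \<bar>w (b i) - w (a i)\<bar>) < e"
proof -
  obtain \<eta> where "\<eta> > 0" and *: "\<And>(n::nat) a b.
     (\<forall>i<n. c \<le> a i \<and> a i \<le> b i \<and> b i \<le> d) \<and>
     (\<forall>i<n. \<forall>j<n. i \<noteq> j \<longrightarrow> {a i<..<b i} \<inter> {a j<..<b j} = {}) \<and>
     (\<Sum>i<n. b i - a i) < \<eta> \<Longrightarrow> (\<Sum>i<n. \<bar>w (b i) - w (a i)\<bar>) < e"
    using assms(1)[unfolded abs_cont_on_def, rule_format, OF assms(2)] by blast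
  show ?thesis
  proof (intro exI[of _ \<eta>] conjI allI impI)
    fix S :: "'i set" and a b
    assume S: "finite S" "\<forall>i\<in>S. c \<le> a i \<and> a i \<le> b i \<and> b i \<le> d"
       "\<forall>i\<in>S. \<forall>j\<in>S. i \<noteq> j \<longrightarrow> {a i<..<b i} \<inter> {a j<..<b j} = {}"
       "(\<Sum>i\<in>S. b i - a i) < \<eta>"
    \<comment> \<open>The index type stays arbitrary because later the intervals are indexed by
      themselves or by tagged pairs; an enumeration of the index set reduces this to the
      definition.\<close>
    obtain f where f: "bij_betw f {..<card S} S"
      using ex_bij_betw_nat_finite[OF S(1)] by (auto simp: lessThan_atLeast0)
    have r: "(\<Sum>i<card S. g (f i)) = sum g S" for g :: "'i \<Rightarrow> real"
      using sum.reindex_bij_betw[OF f] .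
    have fS: "f i \<in> S" if "i < card S" for i
      using f that by (auto simp: bij_betw_def)
    have fi: "f i \<noteq> f j" if "i < card S" "j < card S" "i \<noteq> j" for i j
      using f that by (auto simp: bij_betw_def inj_on_def)
    have "(\<Sum>i<card S. \<bar>w (b (f i)) - w (a (f i))\<bar>) < e"
      by (rule *) (use S fS fi r[of "\<lambda>i. b i - a i"] in auto)
    then show "(\<Sum>i\<in>S. \<bar>w (b i) - w (a i)\<bar>) < e"
      using r[of "\<lambda>i. \<bar>w (b i) - w (a i)\<bar>"] by simp
  qed fact
qed

lemma abs_cont_on_imp_continuous:
  assumes "abs_cont_on c d w"
  shows "continuous_on {c..d} w"
  unfolding continuous_on_iff
proof (intro ballI allI impI)
  fix x e :: real assume x: "x \<in> {c..d}" and "e > 0"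
  obtain \<eta> where "\<eta> > 0" and *: "\<forall>S (a :: unit \<Rightarrow> real) b. finite S \<longrightarrow> (\<forall>i\<in>S. c \<le> a i \<and> a i \<le> b i \<and> b i \<le> d) \<longrightarrow>
       (\<forall>i\<in>S. \<forall>j\<in>S. i \<noteq> j \<longrightarrow> {a i<..<b i} \<inter> {a j<..<b j} = {}) \<longrightarrow>
       (\<Sum>i\<in>S. b i - a i) < \<eta> \<longrightarrow> (\<Sum>i\<in>S. \<bar>w (b i) - w (a i)\<bar>) < e"
    by (rule exE[OF abs_cont_onD[OF assms \<open>e > 0\<close>, where 'i = "unit"]], elim conjE, rule that)
  show "\<exists>\<eta>>0. \<forall>y\<in>{c..d}. dist y x < \<eta> \<longrightarrow> dist (w y) (w x) < e"
  proof (intro exI conjI ballI impI)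
    fix y assume y: "y \<in> {c..d}" "dist y x < \<eta>"
    show "dist (w y) (w x) < e"
      using *[rule_format, of "{()}" "\<lambda>_. min x y" "\<lambda>_. max x y"] x y
      by (auto simp: dist_real_def min_def max_def abs_if split: if_splits)
  qed fact
qed

lemma lipschitz_imp_abs_cont_on:
  assumes "\<And>x y. \<lbrakk>x \<in> {c..d}; y \<in> {c..d}\<rbrakk> \<Longrightarrow> \<bar>w x - w y\<bar> \<le> L * \<bar>x - y\<bar>"
  shows "abs_cont_on c d w"
  unfolding abs_cont_on_def
proof (intro allI impI)
  fix e :: real assume "e > 0"
  define M where "M = max L 1"
  have M: "M > 0" "L \<le> M" by (auto simp: M_def)
  show "\<exists>\<eta>>0. \<forall>(n::nat) a b. (\<forall>i<n. c \<le> a i \<and> a i \<le> b i \<and> b i \<le> d) \<and>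
          (\<forall>i<n. \<forall>j<n. i \<noteq> j \<longrightarrow> {a i<..<b i} \<inter> {a j<..<b j} = {}) \<and>
          (\<Sum>i<n. b i - a i) < \<eta> \<longrightarrow> (\<Sum>i<n. \<bar>w (b i) - w (a i)\<bar>) < e"
  proof (intro exI conjI allI impI)
    show "e / M > 0" using M \<open>e > 0\<close> by simp
    fix n :: nat and a b :: "nat \<Rightarrow> real"
    assume *: "(\<forall>i<n. c \<le> a i \<and> a i \<le> b i \<and> b i \<le> d) \<and>
          (\<forall>i<n. \<forall>j<n. i \<noteq> j \<longrightarrow> {a i<..<b i} \<inter> {a j<..<b j} = {}) \<and>
          (\<Sum>i<n. b i - a i) < e / M"
    have "(\<Sum>i<n. \<bar>w (b i) - w (a i)\<bar>) \<le> (\<Sum>i<n. M * (b i - a i))"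
    proof (rule sum_mono)
      fix i assume i: "i \<in> {..<n}"
      with * have ab: "c \<le> a i" "a i \<le> b i" "b i \<le> d" by auto
      have "\<bar>w (b i) - w (a i)\<bar> \<le> L * \<bar>b i - a i\<bar>"
        by (rule assms) (use ab in auto)
      also have "\<dots> \<le> M * (b i - a i)"
        using ab M by (auto intro!: mult_right_mono)
      finally show "\<bar>w (b i) - w (a i)\<bar> \<le> M * (b i - a i)" .
    qed
    also have "\<dots> = M * (\<Sum>i<n. b i - a i)" by (simp add: sum_distrib_left)
    also have "\<dots> < e" using * M by (simp add: field_simps)
    finally show "(\<Sum>i<n. \<bar>w (b i) - w (a i)\<bar>) < e" .
  qed
qed

lemma abs_cont_on_mult:
  assumes v: "abs_cont_on c d v" and w: "abs_cont_on c d w"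
  shows "abs_cont_on c d (\<lambda>x. v x * w x)"
proof -
  have "bounded (v ` {c..d})" "bounded (w ` {c..d})"
    using v w by (auto intro!: compact_imp_bounded compact_continuous_image abs_cont_on_imp_continuous)
  then obtain B1 B2 where B12: "\<forall>x\<in>{c..d}. \<bar>v x\<bar> \<le> B1" "\<forall>x\<in>{c..d}. \<bar>w x\<bar> \<le> B2"
    by (auto simp: bounded_real)
  define B where "B = max 1 (max B1 B2)"
  have B: "B > 0" "\<And>x. x \<in> {c..d} \<Longrightarrow> \<bar>v x\<bar> \<le> B" "\<And>x. x \<in> {c..d} \<Longrightarrow> \<bar>w x\<bar> \<le> B"
    using B12 by (force simp: B_def)+
  show ?thesis unfolding abs_cont_on_def
  proof (intro allI impI)
    fix e :: real assume "e > 0"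
    then have e': "e / (2*B) > 0" using B by simp
    obtain \<eta>1 where \<eta>1: "\<eta>1 > 0" "\<And>(n::nat) a b.
     (\<forall>i<n. c \<le> a i \<and> a i \<le> b i \<and> b i \<le> d) \<and>
     (\<forall>i<n. \<forall>j<n. i \<noteq> j \<longrightarrow> {a i<..<b i} \<inter> {a j<..<b j} = {}) \<and>
     (\<Sum>i<n. b i - a i) < \<eta>1 \<Longrightarrow> (\<Sum>i<n. \<bar>v (b i) - v (a i)\<bar>) < e / (2*B)"
      using v[unfolded abs_cont_on_def, rule_format, OF e'] by blast
    obtain \<eta>2 where \<eta>2: "\<eta>2 > 0" "\<And>(n::nat) a b.
     (\<forall>i<n. c \<le> a i \<and> a i \<le> b i \<and> b i \<le> d) \<and>
     (\<forall>i<n. \<forall>j<n. i \<noteq> j \<longrightarrow> {a i<..<b i} \<inter> {a j<..<b j} = {}) \<and>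
     (\<Sum>i<n. b i - a i) < \<eta>2 \<Longrightarrow> (\<Sum>i<n. \<bar>w (b i) - w (a i)\<bar>) < e / (2*B)"
      using w[unfolded abs_cont_on_def, rule_format, OF e'] by blast
    show "\<exists>\<eta>>0. \<forall>(n::nat) a b. (\<forall>i<n. c \<le> a i \<and> a i \<le> b i \<and> b i \<le> d) \<and>
          (\<forall>i<n. \<forall>j<n. i \<noteq> j \<longrightarrow> {a i<..<b i} \<inter> {a j<..<b j} = {}) \<and>
          (\<Sum>i<n. b i - a i) < \<eta> \<longrightarrow> (\<Sum>i<n. \<bar>v (b i) * w (b i) - v (a i) * w (a i)\<bar>) < e"
    proof (intro exI conjI allI impI)
      show "min \<eta>1 \<eta>2 > 0" using \<eta>1 \<eta>2 by simp
      fix n :: nat and a b :: "nat \<Rightarrow> real"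
      assume *: "(\<forall>i<n. c \<le> a i \<and> a i \<le> b i \<and> b i \<le> d) \<and>
            (\<forall>i<n. \<forall>j<n. i \<noteq> j \<longrightarrow> {a i<..<b i} \<inter> {a j<..<b j} = {}) \<and>
            (\<Sum>i<n. b i - a i) < min \<eta>1 \<eta>2"
      have "(\<Sum>i<n. \<bar>v (b i) * w (b i) - v (a i) * w (a i)\<bar>)
         \<le> (\<Sum>i<n. B * \<bar>v (b i) - v (a i)\<bar> + B * \<bar>w (b i) - w (a i)\<bar>)"
      proof (rule sum_mono)
        fix i assume i: "i \<in> {..<n}"
        with * have ab: "a i \<in> {c..d}" "b i \<in> {c..d}" by force+
        have "v (b i) * w (b i) - v (a i) * w (a i) = w (b i) * (v (b i) - v (a i)) + v (a i) * (w (b i) - w (a i))"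
          by (simp add: algebra_simps)
        also have "\<bar>\<dots>\<bar> \<le> \<bar>w (b i)\<bar> * \<bar>v (b i) - v (a i)\<bar> + \<bar>v (a i)\<bar> * \<bar>w (b i) - w (a i)\<bar>"
          by (metis abs_mult abs_triangle_ineq)
        also have "\<dots> \<le> B * \<bar>v (b i) - v (a i)\<bar> + B * \<bar>w (b i) - w (a i)\<bar>"
          using B ab by (intro add_mono mult_right_mono) auto
        finally show "\<bar>v (b i) * w (b i) - v (a i) * w (a i)\<bar> \<le> B * \<bar>v (b i) - v (a i)\<bar> + B * \<bar>w (b i) - w (a i)\<bar>" .
      qed
      also have "\<dots> = B * (\<Sum>i<n. \<bar>v (b i) - v (a i)\<bar>) + B * (\<Sum>i<n. \<bar>w (b i) - w (a i)\<bar>)"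
        by (simp add: sum.distrib sum_distrib_left)
      also have "\<dots> < B * (e / (2*B)) + B * (e / (2*B))"
        using * B by (intro add_strict_mono mult_strict_left_mono \<eta>1 \<eta>2) auto
      also have "\<dots> = e" using B by simp
      finally show "(\<Sum>i<n. \<bar>v (b i) * w (b i) - v (a i) * w (a i)\<bar>) < e" .
    qed
  qed
qed

text \<open>Intervals are treated as balls around their midpoints, so the Vitali theorem for balls
  yields a countable disjoint family covering almost all of \<open>E\<close>. Measurability of
  \<open>E\<close> enters through continuity of the measure from above, which cuts the family down
  to finitely many members.\<close>

lemma Vitali_finite_intervals:
  fixes E :: "real set" and P :: "real \<Rightarrow> real \<Rightarrow> bool"
  assumes E: "E \<in> lmeasurable" and "e > 0"
    and fine: "\<And>x \<eta>. \<lbrakk>x \<in> E; \<eta> > 0\<rbrakk> \<Longrightarrow> \<exists>a b. a < b \<and> a \<le> x \<and> x \<le> b \<and> b - a < \<eta> \<and> P a b"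
  obtains \<I> where "finite \<I>" "\<And>I. I \<in> \<I> \<Longrightarrow> \<exists>a b. a < b \<and> I = {a..b} \<and> P a b"
    "disjoint \<I>" "measure lebesgue (E - \<Union>\<I>) < e"
proof (cases "E = {}")
  case True
  with that[of "{}"] \<open>e > 0\<close> show ?thesis by (auto simp: disjoint_def)
next
  case False
  define K where "K = {(a, b). a < b \<and> P a b}"
  define m r where "m = (\<lambda>(a, b). (a + b) / 2 :: real)" and "r = (\<lambda>(a, b). (b - a) / 2 :: real)"
  define I where "I = (\<lambda>(a, b). {a..b} :: real set)"
  have I: "cball (m i) (r i) = I i" for i
    by (auto simp: I_def m_def r_def cball_eq_atLeastAtMost split: prod.split) (auto simp: field_simps)
  obtain C where C: "countable C" "C \<subseteq> K"
    "pairwise (\<lambda>i j. disjnt (cball (m i) (r i)) (cball (m j) (r j))) C"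
    "negligible (E - (\<Union>i\<in>C. cball (m i) (r i)))"
  proof (rule Vitali_covering_theorem_cballs[of K r E m])
    show "0 < r i" if "i \<in> K" for i using that by (auto simp: K_def r_def)
    show "\<exists>i. i \<in> K \<and> x \<in> cball (m i) (r i) \<and> r i < \<eta>" if x: "x \<in> E" "\<eta> > 0" for x \<eta>
    proof -
      obtain a b where "a < b" "a \<le> x" "x \<le> b" "b - a < \<eta>" "P a b" using fine[OF x] by blast
      then show ?thesis unfolding I by (intro exI[of _ "(a, b)"]) (auto simp: K_def r_def I_def)
    qed
  qed
  have neg: "negligible (E - (\<Union>i\<in>C. I i))" using C(4) unfolding I .
  show ?thesis
  proof (cases "C = {}")
    case True
    then have "measure lebesgue E = 0" using neg negligible_imp_measure0 by simp
    then show ?thesis using that[of "{}"] \<open>e > 0\<close> by (auto simp: disjoint_def)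
  next
    case False
    define g where "g = from_nat_into C"
    have g: "range g = C" unfolding g_def using False C(1) by (rule range_from_nat_into)
    define A where "A n = E - (\<Union>k\<le>n. I (g k))" for n
    have Im: "I i \<in> lmeasurable" for i by (auto simp: I_def split: prod.split)
    have Am: "A n \<in> lmeasurable" for n
      unfolding A_def using E Im by (intro fmeasurable.Diff fmeasurable.finite_UN) auto
    have INT: "(\<Inter>n. A n) = E - (\<Union>i\<in>C. I i)" unfolding A_def g[symmetric] by auto
    have "(\<lambda>n. measure lebesgue (A n)) \<longlonglongrightarrow> measure lebesgue (\<Inter>n. A n)"
    proof (rule Lim_measure_decseq)
      show "range A \<subseteq> sets lebesgue" using Am by auto
      show "decseq A" unfolding A_def decseq_def by fastforce
      show "emeasure lebesgue (A i) \<noteq> \<infinity>" for i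
        using Am[of i] by (metis fmeasurableD2 infinity_ennreal_def)
    qed
    moreover have "measure lebesgue (\<Inter>n. A n) = 0"
      unfolding INT using neg negligible_imp_measure0 by blast
    ultimately have "eventually (\<lambda>n. measure lebesgue (A n) < e) sequentially"
      using \<open>e > 0\<close> order_tendstoD(2) by fastforce
    then obtain n where n: "measure lebesgue (A n) < e" by (auto simp: eventually_sequentially)
    show ?thesis
    proof (rule that[of "I ` g ` {..n}"])
      show "finite (I ` g ` {..n})" by simp
      show "\<exists>a b. a < b \<and> J = {a..b} \<and> P a b" if J: "J \<in> I ` g ` {..n}" for J
      proof -
        obtain k where k: "J = I (g k)" using J by blast
        have "g k \<in> K" using C(2) g by auto
        then show ?thesis using k by (auto simp: I_def K_def)
      qed
      show "disjoint (I ` g ` {..n})"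
        unfolding disjoint_def
      proof (intro ballI impI)
        fix J J' assume J: "J \<in> I ` g ` {..n}" "J' \<in> I ` g ` {..n}" "J \<noteq> J'"
        then obtain i j where ij: "i \<in> C" "j \<in> C" "J = I i" "J' = I j" using g by blast
        with J have "i \<noteq> j" by auto
        with C(3) ij show "J \<inter> J' = {}" unfolding pairwise_def I disjnt_def by blast
      qed
      show "measure lebesgue (E - \<Union> (I ` g ` {..n})) < e" using n by (simp add: A_def)
    qed
  qed
qed

text \<open>Left end points serve as tags, which makes the telescoping sum for tagged divisions
  applicable.\<close>

lemma sum_diff_division:
  fixes w :: "real \<Rightarrow> real"
  assumes "a \<le> b" "q division_of {a..b}"
  shows "(\<Sum>K\<in>q. w (Sup K) - w (Inf K)) = w b - w a"
proof -
  have ne: "K \<noteq> {}" if "K \<in> q" for K using assms(2) that by (simp add: division_of_def)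
  have *: "(\<lambda>K. (Inf K, K)) ` q tagged_division_of {a..b}"
    unfolding tagged_division_of
  proof (intro conjI allI impI)
    show "finite ((\<lambda>K. (Inf K, K)) ` q)" using assms(2) by auto
    fix x K assume xK: "(x, K) \<in> (\<lambda>K. (Inf K, K)) ` q"
    then have K: "K \<in> q" "x = Inf K" by auto
    then obtain u v where uv: "K = cbox u v" using assms(2) by blast
    then show "\<exists>u v. K = cbox u v" by blast
    show "x \<in> K" using K ne[OF K(1)] uv by auto
    show "K \<subseteq> {a..b}" using K assms(2) by blast
  next
    fix x1 K1 x2 K2
    assume "(x1, K1) \<in> (\<lambda>K. (Inf K, K)) ` q \<and> (x2, K2) \<in> (\<lambda>K. (Inf K, K)) ` q \<and> (x1, K1) \<noteq> (x2, K2)"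
    then have "K1 \<in> q" "K2 \<in> q" "K1 \<noteq> K2" by auto
    then show "interior K1 \<inter> interior K2 = {}" using assms(2) unfolding division_of_def by blast
  next
    have "{K. \<exists>x. (x, K) \<in> (\<lambda>K. (Inf K, K)) ` q} = q" by auto
    then show "\<Union> {K. \<exists>x. (x, K) \<in> (\<lambda>K. (Inf K, K)) ` q} = {a..b}" using assms(2) by (simp add: division_of_def)
  qed
  show ?thesis
    using additive_tagged_division_1[OF assms(1) *, of w]
    by (subst (asm) sum.reindex) (auto simp: inj_on_def)
qed

text \<open>The classical Vitali argument. Disjoint intervals of slope below \<open>p\<close> cover
  almost all of the set \<open>E\<close>; inside them, disjoint intervals of slope above
  \<open>q\<close> cover almost all of it again. What the second family leaves of the first has
  small total length, so by absolute continuity the increments of \<open>w\<close> over both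
  families nearly agree, while they are at most \<open>p\<close> and at least \<open>q\<close> times
  a length close to the measure of \<open>E\<close>. Hence \<open>q - p\<close> times that measure
  is arbitrarily small.\<close>

lemma slopes_negligible:
  fixes w :: "real \<Rightarrow> real"
  assumes w: "abs_cont_on c d w" and "p < q"
  shows "negligible {x \<in> {c<..<d}.
     (\<forall>\<eta>>0. \<exists>a b. a < x \<and> x < b \<and> b - a < \<eta> \<and> c \<le> a \<and> b \<le> d \<and> w b - w a < p * (b - a)) \<and>
     (\<forall>\<eta>>0. \<exists>a b. a < x \<and> x < b \<and> b - a < \<eta> \<and> c \<le> a \<and> b \<le> d \<and> w b - w a > q * (b - a))}"
proof -
  \<comment> \<open>The intervals strictly surround \<open>x\<close>, so \<open>D R\<close> is a
    countable intersection of open sets; this is the source of measurability.\<close>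
  define D where "D R = (\<Inter>n. \<Union>{{a<..<b} | a b. b - a < 1 / Suc n \<and> c \<le> a \<and> b \<le> d \<and> R a b})" for R :: "real \<Rightarrow> real \<Rightarrow> bool"
  have D: "x \<in> D R \<longleftrightarrow> (\<forall>\<eta>>0. \<exists>a b. a < x \<and> x < b \<and> b - a < \<eta> \<and> c \<le> a \<and> b \<le> d \<and> R a b)" for x R
  proof
    assume x: "x \<in> D R"
    show "\<forall>\<eta>>0. \<exists>a b. a < x \<and> x < b \<and> b - a < \<eta> \<and> c \<le> a \<and> b \<le> d \<and> R a b"
    proof (intro allI impI)
      fix \<eta> :: real assume "\<eta> > 0"
      then obtain n where "1 / Suc n < \<eta>" using nat_approx_posE by metis
      moreover have "x \<in> \<Union>{{a<..<b} | a b. b - a < 1 / Suc n \<and> c \<le> a \<and> b \<le> d \<and> R a b}" using x by (auto simp: D_def)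
      ultimately show "\<exists>a b. a < x \<and> x < b \<and> b - a < \<eta> \<and> c \<le> a \<and> b \<le> d \<and> R a b" by fastforce
    qed
  next
    assume *: "\<forall>\<eta>>0. \<exists>a b. a < x \<and> x < b \<and> b - a < \<eta> \<and> c \<le> a \<and> b \<le> d \<and> R a b"
    show "x \<in> D R" unfolding D_def
    proof (rule INT_I)
      fix n :: nat
      obtain a b where "a < x" "x < b" "b - a < 1 / Suc n" "c \<le> a" "b \<le> d" "R a b"
        using *[rule_format, of "1 / Suc n"] by auto
      then show "x \<in> \<Union>{{a<..<b} | a b. b - a < 1 / Suc n \<and> c \<le> a \<and> b \<le> d \<and> R a b}"
        by (intro UnionI[of "{a<..<b}"]) auto
    qed
  qed
  have "D R \<in> sets borel" for R
    unfolding D_def by (intro sets.countable_INT'' borel_open open_Union) auto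
  then have Dm: "D R \<in> sets lebesgue" for R by (simp add: sets_completionI_sets)
  define P where "P a b \<longleftrightarrow> w b - w a < p * (b - a)" for a b
  define Q where "Q a b \<longleftrightarrow> w b - w a > q * (b - a)" for a b
  define E where "E = {c<..<d} \<inter> D P \<inter> D Q"
  have E: "E \<in> lmeasurable"
    unfolding E_def by (intro fmeasurable_Int_fmeasurable Dm lmeasurable_interval)
  have Esub: "E \<subseteq> {c<..<d}" by (auto simp: E_def)
  have main: "(q - p) * measure lebesgue E \<le> e" if "e > 0" for e
  proof -
    define e1 where "e1 = e / 3"
    have "e1 > 0" using that by (simp add: e1_def)
    obtain \<eta> where \<eta>: "\<eta> > 0" and ac: "\<forall>S (a :: real set \<Rightarrow> real) b. finite S \<longrightarrow> (\<forall>i\<in>S. c \<le> a i \<and> a i \<le> b i \<and> b i \<le> d) \<longrightarrow>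
       (\<forall>i\<in>S. \<forall>j\<in>S. i \<noteq> j \<longrightarrow> {a i<..<b i} \<inter> {a j<..<b j} = {}) \<longrightarrow>
       (\<Sum>i\<in>S. b i - a i) < \<eta> \<longrightarrow> (\<Sum>i\<in>S. \<bar>w (b i) - w (a i)\<bar>) < e1"
    by (rule exE[OF abs_cont_onD[OF w \<open>e1 > 0\<close>, where 'i = "real set"]], elim conjE, rule that)
    define C where "C = 2 * \<bar>q\<bar> + \<bar>p\<bar> + 1"
    have C: "C > 0" by (simp add: C_def)
    \<comment> \<open>The bound \<open>\<eta> / 4\<close> keeps the uncovered length, at most
      \<open>3 * \<epsilon>\<close>, below \<open>\<eta>\<close>; with the other bound, replacing
      both total lengths by the measure of \<open>E\<close> costs at most
      \<open>2 * e1\<close>.\<close>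
    define \<epsilon> where "\<epsilon> = min (\<eta> / 4) (e1 / (2 * C))"
    have \<epsilon>: "\<epsilon> > 0" "3 * \<epsilon> < \<eta>" "C * \<epsilon> \<le> e1"
      using \<eta> \<open>e1 > 0\<close> C by (auto simp: \<epsilon>_def min_def field_simps)
    obtain O0 where O0: "open O0" "E \<subseteq> O0" "O0 - E \<in> lmeasurable" "measure lebesgue (O0 - E) < \<epsilon>"
      using sets_lebesgue_outer_open[of E \<epsilon>] E \<epsilon> by (metis fmeasurableD emeasure_eq_measure2 fmeasurable_def ennreal_less_iff measure_nonneg)
    define W where "W = O0 \<inter> {c<..<d}"
    have W: "open W" "E \<subseteq> W" using O0 Esub by (auto simp: W_def)
    have "W - E \<in> lmeasurable"
      by (rule fmeasurableI2[OF O0(3)]) (use W E in \<open>auto simp: W_def\<close>)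
    moreover have "measure lebesgue (W - E) < \<epsilon>"
      by (rule order_le_less_trans[OF measure_mono_fmeasurable[of "W - E" "O0 - E" lebesgue] O0(4)])
        (use O0 calculation in \<open>auto simp: W_def\<close>)
    moreover have "W = E \<union> (W - E)" using W by auto
    ultimately have Wm: "W \<in> lmeasurable" "measure lebesgue W \<le> measure lebesgue E + \<epsilon>"
      using E measure_Un_le[of E lebesgue "W - E"] fmeasurable.Un[of E lebesgue "W - E"] by auto
    obtain \<I> where \<I>: "finite \<I>" "\<And>I. I \<in> \<I> \<Longrightarrow> \<exists>a b. a < b \<and> I = {a..b} \<and> (P a b \<and> {a..b} \<subseteq> W)"
      "disjoint \<I>" "measure lebesgue (E - \<Union>\<I>) < \<epsilon>"
    proof (rule Vitali_finite_intervals[OF E \<epsilon>(1), of "\<lambda>a b. P a b \<and> {a..b} \<subseteq> W"])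
      fix x \<eta> :: real assume x: "x \<in> E" "\<eta> > 0"
      obtain r where r: "r > 0" "ball x r \<subseteq> W" using W x by (meson openE subsetD)
      have "x \<in> D P" using x by (auto simp: E_def)
      then obtain a b where ab: "a < x" "x < b" "b - a < min \<eta> r" "P a b"
        unfolding D using \<open>\<eta> > 0\<close> r by (metis min_less_iff_conj)
      have "{a..b} \<subseteq> ball x r" using ab by (auto simp: dist_real_def)
      with ab r show "\<exists>a b. a < b \<and> a \<le> x \<and> x \<le> b \<and> b - a < \<eta> \<and> P a b \<and> {a..b} \<subseteq> W"
        by (intro exI[of _ a] exI[of _ b]) auto
    qed auto
    have \<I>div: "\<I> division_of \<Union>\<I>"
      unfolding division_of_def
    proof (intro conjI ballI impI)
      fix I J assume "I \<in> \<I>" "J \<in> \<I>" "I \<noteq> J"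
      then show "interior I \<inter> interior J = {}" using \<I>(3) interior_subset unfolding disjoint_def by blast
    qed (use \<I>(1,2) in \<open>force simp flip: box_real(2)\<close>)+
    \<comment> \<open>Restricting to interiors lets the second family be chosen inside members of
      the first; the end points excluded in this way form the finite set \<open>Z\<close>.\<close>
    define E' where "E' = E \<inter> \<Union>(interior ` \<I>)"
    have "open (\<Union>(interior ` \<I>))" by auto
    then have "\<Union>(interior ` \<I>) \<in> sets lebesgue" by (simp add: borel_open sets_completionI_sets)
    then have E': "E' \<in> lmeasurable"
      unfolding E'_def using E by (simp add: fmeasurable_Int_fmeasurable)
    obtain \<J> where \<J>: "finite \<J>" "\<And>I. I \<in> \<J> \<Longrightarrow> \<exists>a b. a < b \<and> I = {a..b} \<and> (Q a b \<and> (\<exists>I\<in>\<I>. {a..b} \<subseteq> I))"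
      "disjoint \<J>" "measure lebesgue (E' - \<Union>\<J>) < \<epsilon>"
    proof (rule Vitali_finite_intervals[OF E' \<epsilon>(1), of "\<lambda>a b. Q a b \<and> (\<exists>I\<in>\<I>. {a..b} \<subseteq> I)"])
      fix x \<eta> :: real assume x: "x \<in> E'" "\<eta> > 0"
      obtain I where I: "I \<in> \<I>" "x \<in> interior I" using x by (auto simp: E'_def)
      then obtain r where r: "r > 0" "ball x r \<subseteq> I" by (meson mem_interior)
      have "x \<in> D Q" using x by (auto simp: E_def E'_def)
      then obtain a b where ab: "a < x" "x < b" "b - a < min \<eta> r" "Q a b"
        unfolding D using \<open>\<eta> > 0\<close> r by (metis min_less_iff_conj)
      have "{a..b} \<subseteq> ball x r" using ab by (auto simp: dist_real_def)
      with ab r I(1) show "\<exists>a b. a < b \<and> a \<le> x \<and> x \<le> b \<and> b - a < \<eta> \<and> Q a b \<and> (\<exists>I\<in>\<I>. {a..b} \<subseteq> I)"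
        by (intro exI[of _ a] exI[of _ b]) auto
    qed auto
    have \<J>div: "\<J> division_of \<Union>\<J>"
      unfolding division_of_def
    proof (intro conjI ballI impI)
      fix I J assume "I \<in> \<J>" "J \<in> \<J>" "I \<noteq> J"
      then show "interior I \<inter> interior J = {}" using \<J>(3) interior_subset unfolding disjoint_def by blast
    qed (use \<J>(1,2) in \<open>force simp flip: box_real(2)\<close>)+
    have len: "measure lebesgue K = Sup K - Inf K" if "\<exists>a b. a \<le> b \<and> K = {a..b}" for K :: "real set"
      using that by auto
    define \<Delta> where "\<Delta> K = w (Sup K) - w (Inf K)" for K
    define l where "l K = Sup K - Inf K" for K :: "real set"
    have A: "measure lebesgue (\<Union>\<I>) = sum l \<I>"
      using content_division[OF \<I>div] len \<I>(2) unfolding l_def by (metis (no_types, lifting) less_imp_le sum.cong)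
    have B: "measure lebesgue (\<Union>\<J>) = sum l \<J>"
      using content_division[OF \<J>div] len \<J>(2) unfolding l_def by (metis (no_types, lifting) less_imp_le sum.cong)
    have Im: "\<Union>\<I> \<in> lmeasurable" "\<Union>\<J> \<in> lmeasurable"
      using \<I>div \<J>div content_division by auto
    have AW: "sum l \<I> \<le> measure lebesgue W"
      unfolding A[symmetric] by (rule measure_mono_fmeasurable) (use \<I>(2) Wm Im in auto)
    define Z where "Z = (Inf ` \<I>) \<union> (Sup ` \<I>)"
    have Z: "finite Z" using \<I>(1) by (auto simp: Z_def)
    have "E \<subseteq> (E - \<Union>\<I>) \<union> (E' - \<Union>\<J>) \<union> \<Union>\<J> \<union> Z"
    proof
      fix x assume x: "x \<in> E"
      show "x \<in> (E - \<Union>\<I>) \<union> (E' - \<Union>\<J>) \<union> \<Union>\<J> \<union> Z"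
      proof (cases "x \<in> \<Union>\<I> \<and> x \<notin> Z")
        case True
        then obtain I where I: "I \<in> \<I>" "x \<in> I" by auto
        obtain a b where ab: "a < b" "I = {a..b}" using \<I>(2)[OF I(1)] by auto
        have "a \<in> Z" "b \<in> Z" using I(1) ab by (force simp: Z_def)+
        then have "x \<in> interior I" using True I(2) ab by (auto simp: less_le)
        then have "x \<in> E'" using x I(1) by (auto simp: E'_def)
        then show ?thesis by auto
      qed (use x in auto)
    qed
    moreover have "(E - \<Union>\<I>) \<union> (E' - \<Union>\<J>) \<union> \<Union>\<J> \<union> Z \<in> lmeasurable"
      using E E' Im Z by (intro fmeasurable.Un fmeasurable.Diff) (auto simp: finite_imp_compact lmeasurable_compact)
    ultimately have "measure lebesgue E \<le> measure lebesgue ((E - \<Union>\<I>) \<union> (E' - \<Union>\<J>) \<union> \<Union>\<J> \<union> Z)"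
      using E by (intro measure_mono_fmeasurable) auto
    also have "\<dots> \<le> measure lebesgue (E - \<Union>\<I>) + measure lebesgue (E' - \<Union>\<J>) + measure lebesgue (\<Union>\<J>) + measure lebesgue Z"
      using E E' Im Z by (intro order_trans[OF measure_Un_le] add_mono order_refl sets.Un)
        (auto simp: finite_imp_compact fmeasurableD lmeasurable_compact)
    also have "measure lebesgue Z = 0" using Z by (simp add: negligible_imp_measure0 negligible_finite)
    finally have BE: "measure lebesgue E \<le> 2 * \<epsilon> + sum l \<J>" using \<I>(4) \<J>(4) B by linarith
    \<comment> \<open>Each member of the first family is divided into the members of the second
      inside it and a rest \<open>R I\<close>; absolute continuity is applied to all these rests at
      once.\<close>
    have sub: "\<exists>qq. {J \<in> \<J>. J \<subseteq> I} \<subseteq> qq \<and> qq division_of I" if I: "I \<in> \<I>" for I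
    proof -
      obtain a b where ab: "I = cbox a b" using \<I>(2)[OF I] by auto
      have "{J \<in> \<J>. J \<subseteq> I} division_of \<Union>{J \<in> \<J>. J \<subseteq> I}"
        by (rule division_of_subset[OF \<J>div]) auto
      then obtain qq where "{J \<in> \<J>. J \<subseteq> I} \<subseteq> qq" "qq division_of cbox a b"
        using partial_division_extend_interval[of "{J \<in> \<J>. J \<subseteq> I}" a b] ab by blast
      then show ?thesis using ab by blast
    qed
    then obtain qq where qq: "\<And>I. I \<in> \<I> \<Longrightarrow> {J \<in> \<J>. J \<subseteq> I} \<subseteq> qq I" "\<And>I. I \<in> \<I> \<Longrightarrow> qq I division_of I"
      by metis
    define R where "R I = qq I - {J \<in> \<J>. J \<subseteq> I}" for I
    have Rfin: "finite (R I)" if "I \<in> \<I>" for I using qq(2)[OF that] by (auto simp: R_def)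
    have Rsub: "K \<noteq> {} \<and> K \<subseteq> I \<and> (\<exists>a b. a \<le> b \<and> K = {a..b})" if "I \<in> \<I>" "K \<in> qq I" for I K
    proof -
      have K: "K \<noteq> {}" "K \<subseteq> I" "\<exists>a b. K = cbox a b" using qq(2)[OF that(1)] that(2) by (auto simp: division_of_def)
      then obtain a b where "K = {a..b}" by auto
      with K show ?thesis by (intro conjI exI[of _ a] exI[of _ b]) auto
    qed
    \<comment> \<open>Telescoping is stated for any \<open>w'\<close>, as it is used with
      \<open>w\<close> for the increments and with the identity for the lengths.\<close>
    have split: "(\<Sum>K\<in>\<Union>(R ` \<I>). w' (Sup K) - w' (Inf K)) = (\<Sum>I\<in>\<I>. w' (Sup I) - w' (Inf I)) - (\<Sum>J\<in>\<J>. w' (Sup J) - w' (Inf J))"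
      for w' :: "real \<Rightarrow> real"
    proof -
      let ?g = "\<lambda>K. w' (Sup K) - w' (Inf K)"
      have disjI: "K \<noteq> K'" if "I \<in> \<I>" "I' \<in> \<I>" "I \<noteq> I'" "K \<in> qq I" "K' \<in> qq I'" for I I' K K'
        using Rsub[OF that(1,4)] Rsub[OF that(2,5)] \<I>(3) that unfolding disjoint_def by blast
      have "sum ?g (\<Union>(R ` \<I>)) = (\<Sum>I\<in>\<I>. sum ?g (R I))"
      proof (rule sum.UNION_disjoint)
        show "\<forall>i\<in>\<I>. \<forall>j\<in>\<I>. i \<noteq> j \<longrightarrow> R i \<inter> R j = {}" unfolding R_def using disjI by blast
      qed (use \<I>(1) Rfin in auto)
      also have "\<dots> = (\<Sum>I\<in>\<I>. ?g I - sum ?g {J \<in> \<J>. J \<subseteq> I})"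
      proof (rule sum.cong[OF refl])
        fix I assume I: "I \<in> \<I>"
        obtain a b where ab: "a < b" "I = {a..b}" using \<I>(2)[OF I] by auto
        have "sum ?g (R I) = sum ?g (qq I) - sum ?g {J \<in> \<J>. J \<subseteq> I}"
          unfolding R_def using qq[OF I] by (intro sum_diff) auto
        also have "sum ?g (qq I) = ?g I"
          using sum_diff_division[of a b "qq I" w'] ab qq(2)[OF I] by auto
        finally show "sum ?g (R I) = ?g I - sum ?g {J \<in> \<J>. J \<subseteq> I}" .
      qed
      also have "\<dots> = sum ?g \<I> - (\<Sum>I\<in>\<I>. sum ?g {J \<in> \<J>. J \<subseteq> I})" by (simp add: sum_subtractf)
      also have "(\<Sum>I\<in>\<I>. sum ?g {J \<in> \<J>. J \<subseteq> I}) = sum ?g (\<Union>I\<in>\<I>. {J \<in> \<J>. J \<subseteq> I})"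
      proof (rule sum.UNION_disjoint[symmetric])
        show "\<forall>i\<in>\<I>. \<forall>j\<in>\<I>. i \<noteq> j \<longrightarrow> {J \<in> \<J>. J \<subseteq> i} \<inter> {J \<in> \<J>. J \<subseteq> j} = {}"
          using disjI qq(1) by blast
      qed (use \<I>(1) \<J>(1) in auto)
      also have "(\<Union>I\<in>\<I>. {J \<in> \<J>. J \<subseteq> I}) = \<J>" using \<J>(2) by blast
      finally show ?thesis .
    qed
    have "(\<Sum>K\<in>\<Union>(R ` \<I>). \<bar>w (Sup K) - w (Inf K)\<bar>) < e1"
    proof (rule ac[THEN spec, THEN spec, THEN spec, THEN mp, THEN mp, THEN mp, THEN mp]; (intro ballI impI)?)
      show "finite (\<Union>(R ` \<I>))" using \<I>(1) Rfin by auto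
    next
      fix K assume "K \<in> \<Union>(R ` \<I>)"
      then obtain I where I: "I \<in> \<I>" "K \<in> qq I" by (auto simp: R_def)
      obtain a b where ab: "a \<le> b" "K = {a..b}" "K \<subseteq> I" using Rsub[OF I] by auto
      have "I \<subseteq> W" using \<I>(2)[OF I(1)] by auto
      then have "K \<subseteq> {c<..<d}" using ab by (auto simp: W_def)
      then have "a \<in> {c<..<d}" "b \<in> {c<..<d}" using ab by auto
      then show "c \<le> Inf K \<and> Inf K \<le> Sup K \<and> Sup K \<le> d" using ab by auto
    next
      fix K K' assume K: "K \<in> \<Union>(R ` \<I>)" "K' \<in> \<Union>(R ` \<I>)" "K \<noteq> K'"
      then obtain I I' where I: "I \<in> \<I>" "K \<in> qq I" "I' \<in> \<I>" "K' \<in> qq I'" by (auto simp: R_def)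
      have "interior K \<inter> interior K' = {}"
      proof (cases "I = I'")
        case True
        then show ?thesis using qq(2)[OF I(1)] I K(3) by (auto simp: division_of_def)
      next
        case False
        then have "I \<inter> I' = {}" using \<I>(3) I unfolding disjoint_def by auto
        then show ?thesis using Rsub[OF I(1,2)] Rsub[OF I(3,4)] interior_subset by blast
      qed
      moreover have "interior K = {Inf K<..<Sup K}" "interior K' = {Inf K'<..<Sup K'}"
        using Rsub[OF I(1,2)] Rsub[OF I(3,4)] by auto
      ultimately show "{Inf K<..<Sup K} \<inter> {Inf K'<..<Sup K'} = {}" by simp
    next
      have "(\<Sum>K\<in>\<Union>(R ` \<I>). Sup K - Inf K) = sum l \<I> - sum l \<J>"
        using split[of "\<lambda>x. x"] by (simp add: l_def)
      then show "(\<Sum>K\<in>\<Union>(R ` \<I>). Sup K - Inf K) < \<eta>"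
        using AW BE Wm(2) \<epsilon>(2) by linarith
    qed
    then have "\<bar>\<Sum>K\<in>\<Union>(R ` \<I>). w (Sup K) - w (Inf K)\<bar> < e1"
      by (rule order_le_less_trans[OF sum_abs])
    then have "\<bar>sum \<Delta> \<I> - sum \<Delta> \<J>\<bar> < e1"
      using split[of w] by (simp add: \<Delta>_def)
    moreover have "sum \<Delta> \<I> \<le> p * sum l \<I>"
      unfolding sum_distrib_left by (rule sum_mono) (use \<I>(2) in \<open>force simp: \<Delta>_def l_def P_def\<close>)
    moreover have "sum \<Delta> \<J> \<ge> q * sum l \<J>"
      unfolding sum_distrib_left by (rule sum_mono) (use \<J>(2) in \<open>force simp: \<Delta>_def l_def Q_def\<close>)
    ultimately have 1: "q * sum l \<J> - p * sum l \<I> \<le> e1" by linarith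
    define m where "m = measure lebesgue E"
    have lb: "\<bar>sum l \<J> - m\<bar> \<le> 2 * \<epsilon>" "\<bar>sum l \<I> - m\<bar> \<le> 2 * \<epsilon>"
    proof -
      have "sum l \<J> \<le> sum l \<I>"
        unfolding A[symmetric] B[symmetric] by (rule measure_mono_fmeasurable) (use \<J>(2) Im in \<open>(blast intro: fmeasurableD)+\<close>)
      note b = this AW BE Wm(2) \<epsilon>(1)
      show "\<bar>sum l \<J> - m\<bar> \<le> 2 * \<epsilon>" using b unfolding m_def by linarith
      show "\<bar>sum l \<I> - m\<bar> \<le> 2 * \<epsilon>" using b unfolding m_def by linarith
    qed
    have "(q - p) * m = q * sum l \<J> - p * sum l \<I> - q * (sum l \<J> - m) + p * (sum l \<I> - m)"
      by (simp add: algebra_simps)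
    moreover have "\<bar>q * (sum l \<J> - m)\<bar> \<le> \<bar>q\<bar> * (2 * \<epsilon>)" "\<bar>p * (sum l \<I> - m)\<bar> \<le> \<bar>p\<bar> * (2 * \<epsilon>)"
      unfolding abs_mult using lb by (intro mult_left_mono; simp)+
    moreover have "\<bar>q\<bar> * (2 * \<epsilon>) + \<bar>p\<bar> * (2 * \<epsilon>) \<le> 2 * (C * \<epsilon>)"
      using \<epsilon> by (simp add: C_def algebra_simps)
    ultimately have "(q - p) * m \<le> e1 + 2 * e1" using 1 \<epsilon>(3) by linarith
    then show ?thesis unfolding m_def e1_def using that by linarith
  qed
  have "(q - p) * measure lebesgue E \<le> 0" using main field_le_epsilon[of "(q - p) * measure lebesgue E" 0] by auto
  then have "measure lebesgue E = 0"
    using \<open>p < q\<close> measure_nonneg[of lebesgue E] by (simp add: mult_le_0_iff)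
  then have "negligible E" using E negligible_iff_measure by blast
  moreover have "E = {x \<in> {c<..<d}.
     (\<forall>\<eta>>0. \<exists>a b. a < x \<and> x < b \<and> b - a < \<eta> \<and> c \<le> a \<and> b \<le> d \<and> w b - w a < p * (b - a)) \<and>
     (\<forall>\<eta>>0. \<exists>a b. a < x \<and> x < b \<and> b - a < \<eta> \<and> c \<le> a \<and> b \<le> d \<and> w b - w a > q * (b - a))}"
    by (auto simp: E_def D P_def Q_def)
  ultimately show ?thesis by simp
qed

text \<open>If a part of this set had measure \<open>m > 0\<close>, disjoint intervals of slope
  above \<open>2 / m\<close> and total length above \<open>m / 2\<close> would carry a total
  increment above 1. Absolute continuity for \<open>e = 1\<close> forbids this when the total length
  is below \<open>\<eta>\<close>.\<close>

lemma infinite_slope_negligible: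
  fixes w :: "real \<Rightarrow> real"
  assumes w: "abs_cont_on c d w"
  shows "negligible {x \<in> {c<..<d}.
     \<forall>q::nat. \<forall>\<eta>>0. \<exists>a b. a < x \<and> x < b \<and> b - a < \<eta> \<and> c \<le> a \<and> b \<le> d \<and> w b - w a > real q * (b - a)}" (is "negligible ?E")
proof -
  obtain \<eta> where \<eta>: "\<eta> > 0" and ac: "\<forall>S (a :: real set \<Rightarrow> real) b. finite S \<longrightarrow> (\<forall>i\<in>S. c \<le> a i \<and> a i \<le> b i \<and> b i \<le> d) \<longrightarrow>
       (\<forall>i\<in>S. \<forall>j\<in>S. i \<noteq> j \<longrightarrow> {a i<..<b i} \<inter> {a j<..<b j} = {}) \<longrightarrow>
       (\<Sum>i\<in>S. b i - a i) < \<eta> \<longrightarrow> (\<Sum>i\<in>S. \<bar>w (b i) - w (a i)\<bar>) < 1"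
    by (rule exE[OF abs_cont_onD[OF w zero_less_one, where 'i = "real set"]], elim conjE, rule that)
  define D where "D q = (\<Inter>n. \<Union>{{a<..<b} | a b. b - a < 1 / Suc n \<and> c \<le> a \<and> b \<le> d \<and> w b - w a > real q * (b - a)})" for q :: nat
  have D: "x \<in> D q \<longleftrightarrow> (\<forall>\<eta>>0. \<exists>a b. a < x \<and> x < b \<and> b - a < \<eta> \<and> c \<le> a \<and> b \<le> d \<and> w b - w a > real q * (b - a))" for x q
  proof
    assume x: "x \<in> D q"
    show "\<forall>\<eta>>0. \<exists>a b. a < x \<and> x < b \<and> b - a < \<eta> \<and> c \<le> a \<and> b \<le> d \<and> w b - w a > real q * (b - a)"
    proof (intro allI impI)
      fix \<eta> :: real assume "\<eta> > 0"
      then obtain n where "1 / Suc n < \<eta>" using nat_approx_posE by metis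
      moreover have "x \<in> \<Union>{{a<..<b} | a b. b - a < 1 / Suc n \<and> c \<le> a \<and> b \<le> d \<and> w b - w a > real q * (b - a)}" using x by (auto simp: D_def)
      ultimately show "\<exists>a b. a < x \<and> x < b \<and> b - a < \<eta> \<and> c \<le> a \<and> b \<le> d \<and> w b - w a > real q * (b - a)" by fastforce
    qed
  next
    assume *: "\<forall>\<eta>>0. \<exists>a b. a < x \<and> x < b \<and> b - a < \<eta> \<and> c \<le> a \<and> b \<le> d \<and> w b - w a > real q * (b - a)"
    show "x \<in> D q" unfolding D_def
    proof (rule INT_I)
      fix n :: nat
      obtain a b where "a < x" "x < b" "b - a < 1 / Suc n" "c \<le> a" "b \<le> d" "w b - w a > real q * (b - a)"
        using *[rule_format, of "1 / Suc n"] by auto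
      then show "x \<in> \<Union>{{a<..<b} | a b. b - a < 1 / Suc n \<and> c \<le> a \<and> b \<le> d \<and> w b - w a > real q * (b - a)}"
        by (intro UnionI[of "{a<..<b}"]) auto
    qed
  qed
  have "D q \<in> sets borel" for q
    unfolding D_def by (intro sets.countable_INT'' borel_open open_Union) auto
  then have "(\<Inter>q. D q) \<in> sets borel" by (intro sets.countable_INT'') auto
  then have Dm: "(\<Inter>q. D q) \<in> sets lebesgue" by (simp add: sets_completionI_sets)
  \<comment> \<open>Windows of length \<open>\<eta> / 2\<close> keep the total length of disjoint
    intervals below \<open>\<eta>\<close>.\<close>
  have loc: "negligible ({s<..<s + \<eta>/2} \<inter> (\<Inter>q. D q) \<inter> {c<..<d})" for s
  proof -
    define E where "E = {s<..<s + \<eta>/2} \<inter> {c<..<d} \<inter> (\<Inter>q. D q)"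
    have E: "E \<in> lmeasurable"
      unfolding E_def by (intro fmeasurable_Int_fmeasurable Dm) auto
    have "measure lebesgue E = 0"
    proof (rule ccontr)
      assume "measure lebesgue E \<noteq> 0"
      then have m: "measure lebesgue E > 0" using measure_nonneg[of lebesgue E] by linarith
      define m where "m = measure lebesgue E"
      have "m > 0" using m by (simp add: m_def)
      obtain q :: nat where q: "real q > 2 / m" using reals_Archimedean2 by blast
      obtain \<J> where \<J>: "finite \<J>" "\<And>I. I \<in> \<J> \<Longrightarrow> \<exists>a b. a < b \<and> I = {a..b} \<and> (w b - w a > real q * (b - a) \<and> {a..b} \<subseteq> {s<..<s + \<eta>/2} \<inter> {c<..<d})"
        "disjoint \<J>" "measure lebesgue (E - \<Union>\<J>) < m/2"
      proof (rule Vitali_finite_intervals[OF E, of "m/2" "\<lambda>a b. w b - w a > real q * (b - a) \<and> {a..b} \<subseteq> {s<..<s + \<eta>/2} \<inter> {c<..<d}"])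
        show "m/2 > 0" using \<open>m > 0\<close> by simp
        fix x \<eta>' :: real assume x: "x \<in> E" "\<eta>' > 0"
        have "open ({s<..<s + \<eta>/2} \<inter> {c<..<d})" by auto
        then obtain r where r: "r > 0" "ball x r \<subseteq> {s<..<s + \<eta>/2} \<inter> {c<..<d}"
          using x unfolding E_def by (meson IntD1 openE)
        have "x \<in> D q" using x by (auto simp: E_def)
        then obtain a b where ab: "a < x" "x < b" "b - a < min \<eta>' r" "w b - w a > real q * (b - a)"
          unfolding D using \<open>\<eta>' > 0\<close> r by (metis min_less_iff_conj)
        have "{a..b} \<subseteq> ball x r" using ab by (auto simp: dist_real_def)
        with ab r show "\<exists>a b. a < b \<and> a \<le> x \<and> x \<le> b \<and> b - a < \<eta>' \<and> w b - w a > real q * (b - a) \<and> {a..b} \<subseteq> {s<..<s + \<eta>/2} \<inter> {c<..<d}"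
          by (intro exI[of _ a] exI[of _ b]) auto
      qed auto
      have \<J>div: "\<J> division_of \<Union>\<J>"
        unfolding division_of_def
      proof (intro conjI ballI impI)
        fix I J assume "I \<in> \<J>" "J \<in> \<J>" "I \<noteq> J"
        then show "interior I \<inter> interior J = {}" using \<J>(3) interior_subset unfolding disjoint_def by blast
      qed (use \<J>(1,2) in \<open>force simp flip: box_real(2)\<close>)+
      have len: "measure lebesgue K = Sup K - Inf K" if "\<exists>a b. a \<le> b \<and> K = {a..b}" for K :: "real set"
        using that by auto
      have B: "measure lebesgue (\<Union>\<J>) = (\<Sum>K\<in>\<J>. Sup K - Inf K)"
        using content_division[OF \<J>div] len \<J>(2) by (metis (no_types, lifting) less_imp_le sum.cong)
      have Jm: "\<Union>\<J> \<in> lmeasurable" using \<J>div content_division by auto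
      have "measure lebesgue (\<Union>\<J>) \<le> measure lebesgue {s<..<s + \<eta>/2}"
        by (rule measure_mono_fmeasurable) (use \<J>(2) Jm in \<open>blast intro: fmeasurableD\<close>, use Jm in auto)
      then have small: "(\<Sum>K\<in>\<J>. Sup K - Inf K) < \<eta>" using B \<eta> by simp
      have "(\<Sum>K\<in>\<J>. \<bar>w (Sup K) - w (Inf K)\<bar>) < 1"
      proof (rule ac[THEN spec, THEN spec, THEN spec, THEN mp, THEN mp, THEN mp, THEN mp]; (intro ballI impI)?)
        fix K assume "K \<in> \<J>"
        then obtain a b where ab: "a < b" "K = {a..b}" "{a..b} \<subseteq> {s<..<s + \<eta>/2} \<inter> {c<..<d}" using \<J>(2)[of K] by blast
        then have "a \<in> {a..b}" "b \<in> {a..b}" by auto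
        moreover have "{a..b} \<subseteq> {c<..<d}" using ab(3) by blast
        ultimately have "a \<in> {c<..<d}" "b \<in> {c<..<d}" by (simp_all only: subset_iff)
        then show "c \<le> Inf K \<and> Inf K \<le> Sup K \<and> Sup K \<le> d" using ab by auto
      next
        fix K K' assume K: "K \<in> \<J>" "K' \<in> \<J>" "K \<noteq> K'"
        then have "K \<inter> K' = {}" using \<J>(3) unfolding disjoint_def by auto
        moreover have "{Inf K<..<Sup K} \<subseteq> K" "{Inf K'<..<Sup K'} \<subseteq> K'"
          using \<J>(2)[OF K(1)] \<J>(2)[OF K(2)] by auto
        ultimately show "{Inf K<..<Sup K} \<inter> {Inf K'<..<Sup K'} = {}" by blast
      qed (use small \<J>(1) in auto)
      moreover have "(\<Sum>K\<in>\<J>. \<bar>w (Sup K) - w (Inf K)\<bar>) \<ge> q * (\<Sum>K\<in>\<J>. Sup K - Inf K)"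
        unfolding sum_distrib_left by (rule sum_mono) (use \<J>(2) in force)
      moreover have "m \<le> measure lebesgue ((E - \<Union>\<J>) \<union> \<Union>\<J>)"
        unfolding m_def by (rule measure_mono_fmeasurable) (use E Jm in auto)
      moreover have "\<dots> \<le> measure lebesgue (E - \<Union>\<J>) + measure lebesgue (\<Union>\<J>)"
        using E Jm by (intro measure_Un_le) auto
      ultimately have "q * (\<Sum>K\<in>\<J>. Sup K - Inf K) < 1 \<and> (\<Sum>K\<in>\<J>. Sup K - Inf K) > m/2"
        using \<J>(4) B by linarith
      then have 1: "q * (\<Sum>K\<in>\<J>. Sup K - Inf K) < 1" "(\<Sum>K\<in>\<J>. Sup K - Inf K) > m/2" by auto
      have "1 = (2/m) * (m/2)" using \<open>m > 0\<close> by simp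
      also have "\<dots> \<le> q * (\<Sum>K\<in>\<J>. Sup K - Inf K)"
        using q 1 \<open>m > 0\<close> by (intro mult_mono) auto
      finally show False using 1 by simp
    qed
    then have "negligible E" using E negligible_iff_measure by blast
    then show ?thesis by (simp only: E_def Int_assoc Int_commute[of "\<Inter>(range D)"])
  qed
  \<comment> \<open>Consecutive windows overlap by half their length, so together they cover
    \<open>{c<..<d}\<close> although they are open.\<close>
  have "negligible (\<Union>k::nat. {c - \<eta>/4 + k * (\<eta>/4)<..<c - \<eta>/4 + k * (\<eta>/4) + \<eta>/2} \<inter> (\<Inter>q. D q) \<inter> {c<..<d})"
    by (rule negligible_countable_Union) (simp, elim imageE, simp only: loc)
  moreover have "?E \<subseteq> (\<Union>k::nat. {c - \<eta>/4 + k * (\<eta>/4)<..<c - \<eta>/4 + k * (\<eta>/4) + \<eta>/2} \<inter> (\<Inter>q. D q) \<inter> {c<..<d})"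
  proof
    fix x assume x: "x \<in> ?E"
    then have "x \<in> (\<Inter>q. D q)" "x \<in> {c<..<d}" by (auto simp: D)
    define k where "k = nat \<lfloor>(x - c) / (\<eta>/4)\<rfloor>"
    have "(x - c) / (\<eta>/4) \<ge> 0" using \<open>x \<in> {c<..<d}\<close> \<eta> by simp
    then have "real k = of_int \<lfloor>(x - c) / (\<eta>/4)\<rfloor>" by (simp add: k_def)
    then have "real k \<le> (x - c) / (\<eta>/4)" "(x - c) / (\<eta>/4) < real k + 1"
      using floor_correct[of "(x - c) / (\<eta>/4)"] by simp_all
    then have "real k * (\<eta>/4) \<le> x - c" "x - c < (real k + 1) * (\<eta>/4)" using \<eta> by (simp_all add: field_simps)
    then have "x \<in> {c - \<eta>/4 + k * (\<eta>/4)<..<c - \<eta>/4 + k * (\<eta>/4) + \<eta>/2}" using \<eta> by (auto simp: algebra_simps)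
    with \<open>x \<in> (\<Inter>q. D q)\<close> \<open>x \<in> {c<..<d}\<close> show "x \<in> (\<Union>k::nat. {c - \<eta>/4 + k * (\<eta>/4)<..<c - \<eta>/4 + k * (\<eta>/4) + \<eta>/2} \<inter> (\<Inter>q. D q) \<inter> {c<..<d})"
      by blast
  qed
  ultimately show ?thesis by (rule negligible_subset)
qed

lemma abs_cont_on_minus: "abs_cont_on c d w \<Longrightarrow> abs_cont_on c d (\<lambda>x. - w x)"
  using abs_cont_on_mult[OF lipschitz_imp_abs_cont_on[of c d "\<lambda>_. -1" 0]] by simp

text \<open>The second hypothesis concerns only intervals with \<open>x\<close> in their interior.
  Continuity at \<open>x\<close> allows one end point to move to \<open>x\<close>, which turns their
  slopes into one-sided difference quotients.\<close>

lemma straddle_imp_has_real_derivative: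
  fixes w :: "real \<Rightarrow> real"
  assumes cont: "isCont w x"
    and strad: "\<And>e. e > 0 \<Longrightarrow> \<exists>\<eta>>0. \<forall>a b. a < x \<and> x < b \<and> b - a < \<eta> \<longrightarrow>
       (D - e) * (b - a) \<le> w b - w a \<and> w b - w a \<le> (D + e) * (b - a)"
  shows "(w has_real_derivative D) (at x)"
  unfolding has_field_derivative_def has_derivative_at_alt
proof (intro conjI allI impI)
  show "bounded_linear ((*) D)" by (rule bounded_linear_mult_right)
  fix e :: real assume "e > 0"
  then obtain \<eta> where \<eta>: "\<eta> > 0" and *: "\<And>a b. \<lbrakk>a < x; x < b; b - a < \<eta>\<rbrakk> \<Longrightarrow>
       (D - e) * (b - a) \<le> w b - w a \<and> w b - w a \<le> (D + e) * (b - a)"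
    using strad[OF \<open>e > 0\<close>] by auto
  have cl: "((\<lambda>a. (D - e) * (y - a)) \<longlongrightarrow> (D - e) * (y - x)) (at_left x)"
           "((\<lambda>a. (D + e) * (y - a)) \<longlongrightarrow> (D + e) * (y - x)) (at_left x)"
           "((\<lambda>a. w y - w a) \<longlongrightarrow> w y - w x) (at_left x)"
           "((\<lambda>b. (D - e) * (b - y)) \<longlongrightarrow> (D - e) * (x - y)) (at_right x)"
           "((\<lambda>b. (D + e) * (b - y)) \<longlongrightarrow> (D + e) * (x - y)) (at_right x)"
           "((\<lambda>b. w b - w y) \<longlongrightarrow> w x - w y) (at_right x)" for y
    using cont by (auto intro!: tendsto_intros simp: isCont_def intro: filterlim_at_within_not_equal tendsto_within_subset[where S=UNIV])
  have right: "(D - e) * (y - x) \<le> w y - w x \<and> w y - w x \<le> (D + e) * (y - x)" if y: "x < y" "y - x < \<eta>" for y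
  proof -
    have ev: "eventually (\<lambda>a. a < x \<and> y - a < \<eta>) (at_left x)"
      unfolding eventually_at_left_field using y by (intro exI[of _ "y - \<eta>"]) auto
    have "(D - e) * (y - x) \<le> w y - w x"
      by (rule tendsto_le[OF _ cl(3) cl(1)]) (use ev * y in \<open>auto elim!: eventually_mono\<close>)
    moreover have "w y - w x \<le> (D + e) * (y - x)"
      by (rule tendsto_le[OF _ cl(2) cl(3)]) (use ev * y in \<open>auto elim!: eventually_mono\<close>)
    ultimately show ?thesis by simp
  qed
  have left: "(D - e) * (x - y) \<le> w x - w y \<and> w x - w y \<le> (D + e) * (x - y)" if y: "y < x" "x - y < \<eta>" for y
  proof -
    have ev: "eventually (\<lambda>b. x < b \<and> b - y < \<eta>) (at_right x)"
      unfolding eventually_at_right_field using y by (intro exI[of _ "y + \<eta>"]) auto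
    have "(D - e) * (x - y) \<le> w x - w y"
      by (rule tendsto_le[OF _ cl(6) cl(4)]) (use ev * y in \<open>auto elim!: eventually_mono\<close>)
    moreover have "w x - w y \<le> (D + e) * (x - y)"
      by (rule tendsto_le[OF _ cl(5) cl(6)]) (use ev * y in \<open>auto elim!: eventually_mono\<close>)
    ultimately show ?thesis by simp
  qed
  show "\<exists>\<eta>>0. \<forall>y. norm (y - x) < \<eta> \<longrightarrow> norm (w y - w x - D * (y - x)) \<le> e * norm (y - x)"
  proof (intro exI conjI allI impI)
    fix y assume y: "norm (y - x) < \<eta>"
    consider "y = x" | "x < y" | "y < x" by linarith
    then show "norm (w y - w x - D * (y - x)) \<le> e * norm (y - x)"
    proof cases
      case 2
      with right[of y] y show ?thesis by (auto simp: algebra_simps abs_le_iff)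
    next
      case 3
      with left[of y] y show ?thesis by (auto simp: algebra_simps abs_le_iff)
    qed simp
  qed fact
qed

text \<open>Outside the exceptional set, the slopes of small intervals around \<open>x\<close> stay
  bounded, and no rational pair \<open>p < q\<close> separates their lower from their upper limit;
  there are only countably many such pairs. The common limit is the derivative.\<close>

lemma abs_cont_on_differentiable_ae:
  fixes w :: "real \<Rightarrow> real"
  assumes w: "abs_cont_on c d w"
  shows "negligible {x \<in> {c..d}. \<not> w field_differentiable (at x)}"
proof -
  define Hi where "Hi q x \<longleftrightarrow> (\<forall>\<eta>>0. \<exists>a b. a < x \<and> x < b \<and> b - a < \<eta> \<and> c \<le> a \<and> b \<le> d \<and> w b - w a > q * (b - a))" for q x
  define Lo where "Lo p x \<longleftrightarrow> (\<forall>\<eta>>0. \<exists>a b. a < x \<and> x < b \<and> b - a < \<eta> \<and> c \<le> a \<and> b \<le> d \<and> w b - w a < p * (b - a))" for p x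
  define N where "N = {c, d} \<union> {x \<in> {c<..<d}. \<forall>q::nat. Hi q x} \<union> {x \<in> {c<..<d}. \<forall>q::nat. Lo (- real q) x}
     \<union> (\<Union>(p, q) \<in> {(p, q). p \<in> \<rat> \<and> q \<in> \<rat> \<and> p < q}. {x \<in> {c<..<d}. Lo p x \<and> Hi q x})"
  have 1: "negligible {x \<in> {c<..<d}. \<forall>q::nat. Hi q x}"
    using infinite_slope_negligible[OF w] unfolding Hi_def .
  have "{x \<in> {c<..<d}. \<forall>q::nat. \<forall>\<eta>>0. \<exists>a b. a < x \<and> x < b \<and> b - a < \<eta> \<and> c \<le> a \<and> b \<le> d \<and> - w b - - w a > q * (b - a)}
      = {x \<in> {c<..<d}. \<forall>q::nat. Lo (- real q) x}"
  proof -
    have "(- w b - - w a > real q * (b - a)) = (w b - w a < - real q * (b - a))" for a b q by auto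
    then show ?thesis unfolding Lo_def by simp
  qed
  then have 2: "negligible {x \<in> {c<..<d}. \<forall>q::nat. Lo (- real q) x}"
    using infinite_slope_negligible[OF abs_cont_on_minus[OF w]] by simp
  have 3: "negligible {x \<in> {c<..<d}. Lo p x \<and> Hi q x}" if "p < q" for p q
    using slopes_negligible[OF w that] unfolding Lo_def Hi_def .
  have "countable {(p::real, q). p \<in> \<rat> \<and> q \<in> \<rat> \<and> p < q}"
    by (rule countable_subset[of _ "\<rat> \<times> \<rat>"]) (auto simp: countable_rat)
  then have "negligible (\<Union>(p, q) \<in> {(p, q). p \<in> \<rat> \<and> q \<in> \<rat> \<and> p < q}. {x \<in> {c<..<d}. Lo p x \<and> Hi q x})"
    by (intro negligible_countable_Union) (use 3 in auto)
  then have N: "negligible N"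
    unfolding N_def using 1 2 by (intro negligible_Un) auto
  have "w field_differentiable (at x)" if x: "x \<in> {c..d}" "x \<notin> N" for x
  proof -
    have xcd: "c < x" "x < d" using x unfolding N_def by (auto simp: less_le)
    obtain q0 :: nat where q0: "\<not> Hi q0 x" using x xcd by (auto simp: N_def)
    obtain p0 :: nat where p0: "\<not> Lo (- real p0) x" using x xcd by (auto simp: N_def)
    have pq: "\<not> Lo p x \<or> \<not> Hi q x" if "p < q" "p \<in> \<rat>" "q \<in> \<rat>" for p q
    proof -
      have "x \<notin> {x \<in> {c<..<d}. Lo p x \<and> Hi q x}" using x(2) that unfolding N_def by blast
      then show ?thesis using xcd by simp
    qed
    define \<eta>0 where "\<eta>0 = min (x - c) (d - x)"
    have \<eta>0: "\<eta>0 > 0" using xcd by (simp add: \<eta>0_def)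
    have Hi: "\<exists>\<eta>>0. \<forall>a b. a < x \<and> x < b \<and> b - a < \<eta> \<longrightarrow> w b - w a \<le> q * (b - a)" if nHi: "\<not> Hi q x" for q
    proof -
      obtain \<eta> where \<eta>: "\<eta> > 0" "\<forall>a b. a < x \<and> x < b \<and> b - a < \<eta> \<and> c \<le> a \<and> b \<le> d \<longrightarrow> \<not> w b - w a > q * (b - a)"
        using nHi unfolding Hi_def by auto
      show ?thesis
        by (intro exI[of _ "min \<eta> \<eta>0"]) (use \<eta> \<eta>0 in \<open>auto simp: not_less \<eta>0_def\<close>)
    qed
    have Lo: "\<exists>\<eta>>0. \<forall>a b. a < x \<and> x < b \<and> b - a < \<eta> \<longrightarrow> p * (b - a) \<le> w b - w a" if nLo: "\<not> Lo p x" for p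
    proof -
      obtain \<eta> where \<eta>: "\<eta> > 0" "\<forall>a b. a < x \<and> x < b \<and> b - a < \<eta> \<and> c \<le> a \<and> b \<le> d \<longrightarrow> \<not> w b - w a < p * (b - a)"
        using nLo unfolding Lo_def by auto
      show ?thesis
        by (intro exI[of _ "min \<eta> \<eta>0"]) (use \<eta> \<eta>0 in \<open>auto simp: not_less \<eta>0_def\<close>)
    qed
    \<comment> \<open>\<open>L\<close> consists of the eventual lower bounds for the slopes at
      \<open>x\<close>. It contains \<open>- real p0\<close> and is bounded above by
      \<open>q0\<close>, so its supremum \<open>D\<close> is the candidate for the
      derivative.\<close>
    define L where "L = {p. \<not> Lo p x}"
    have LU: "p \<le> q" if pL: "p \<in> L" and nq: "\<not> Hi q x" for p q
    proof -
      obtain \<eta>1 where \<eta>1: "\<eta>1 > 0" "\<And>a b. a < x \<and> x < b \<and> b - a < \<eta>1 \<Longrightarrow> p * (b - a) \<le> w b - w a"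
        using Lo[of p] pL unfolding L_def by blast
      obtain \<eta>2 where \<eta>2: "\<eta>2 > 0" "\<And>a b. a < x \<and> x < b \<and> b - a < \<eta>2 \<Longrightarrow> w b - w a \<le> q * (b - a)"
        using Hi[OF nq] by blast
      define h where "h = min \<eta>1 \<eta>2 / 4"
      have h: "h > 0" "2 * h < \<eta>1" "2 * h < \<eta>2" using \<eta>1 \<eta>2 by (auto simp: h_def min_def)
      have "p * (2 * h) \<le> w (x + h) - w (x - h)" using \<eta>1(2)[of "x - h" "x + h"] h by simp
      also have "\<dots> \<le> q * (2 * h)" using \<eta>2(2)[of "x - h" "x + h"] h by simp
      finally show ?thesis using h by simp
    qed
    have bdd: "bdd_above L" using LU q0 by (auto intro!: bdd_aboveI)
    have ne: "L \<noteq> {}" using p0 by (auto simp: L_def)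
    define D where "D = Sup L"
    have "(w has_real_derivative D) (at x)"
    proof (rule straddle_imp_has_real_derivative)
      have "continuous_on {c..d} w" using w by (rule abs_cont_on_imp_continuous)
      then show "isCont w x" using xcd by (intro continuous_on_interior[of "{c..d}"]) auto
      fix e :: real assume e: "e > 0"
      \<comment> \<open>Since \<open>p\<close> exceeds the supremum of \<open>L\<close>, slopes
        below \<open>p\<close> recur; the rational pair \<open>p < q\<close> then excludes recurring
        slopes above \<open>q\<close>, which is less than \<open>D + e\<close>.\<close>
      obtain p where p: "p \<in> \<rat>" "D < p" "p < D + e/2" using Rats_dense_in_real[of D "D + e/2"] e by auto
      obtain q where q: "q \<in> \<rat>" "D + e/2 < q" "q < D + e" using Rats_dense_in_real[of "D + e/2" "D + e"] e by auto
      have "p \<notin> L" using p cSup_upper[OF _ bdd, of p] by (auto simp: D_def)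
      then have "\<not> Hi q x" using pq[of p q] p q by (auto simp: L_def)
      then obtain \<eta>1 where \<eta>1: "\<eta>1 > 0" "\<And>a b. a < x \<and> x < b \<and> b - a < \<eta>1 \<Longrightarrow> w b - w a \<le> q * (b - a)"
        using Hi[of q] by blast
      obtain l where l: "l \<in> L" "D - e < l" using less_cSupD[OF ne, of "D - e"] e by (auto simp: D_def)
      then obtain \<eta>2 where \<eta>2: "\<eta>2 > 0" "\<And>a b. a < x \<and> x < b \<and> b - a < \<eta>2 \<Longrightarrow> l * (b - a) \<le> w b - w a"
        using Lo[of l] unfolding L_def by blast
      show "\<exists>\<eta>>0. \<forall>a b. a < x \<and> x < b \<and> b - a < \<eta> \<longrightarrow>
         (D - e) * (b - a) \<le> w b - w a \<and> w b - w a \<le> (D + e) * (b - a)"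
      proof (intro exI conjI allI impI)
        show "min \<eta>1 \<eta>2 > 0" using \<eta>1 \<eta>2 by simp
        fix a b assume ab: "a < x \<and> x < b \<and> b - a < min \<eta>1 \<eta>2"
        have "(D - e) * (b - a) \<le> l * (b - a)" using ab l by (intro mult_right_mono) auto
        also have "\<dots> \<le> w b - w a" using \<eta>2 ab by auto
        finally show "(D - e) * (b - a) \<le> w b - w a" .
        have "w b - w a \<le> q * (b - a)" using \<eta>1 ab by auto
        also have "\<dots> \<le> (D + e) * (b - a)" using ab q by (intro mult_right_mono) auto
        finally show "w b - w a \<le> (D + e) * (b - a)" .
      qed
    qed
    then show ?thesis by (auto simp: field_differentiable_def)
  qed
  then show ?thesis by (intro negligible_subset[OF N]) auto
qed

text \<open>In the gauge proof below, tags outside \<open>N\<close> are treated by the straddle lemma, and the intervals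
  with tags in \<open>N\<close> are made to lie in an open set of small measure.\<close>

lemma abs_cont_on_has_integral:
  fixes w w' :: "real \<Rightarrow> real"
  assumes "c \<le> d" and w: "abs_cont_on c d w" and N: "negligible N"
    and w': "\<And>x. x \<in> {c..d} - N \<Longrightarrow> (w has_real_derivative w' x) (at x within {c..d})"
  shows "(w' has_integral (w d - w c)) {c..d}"
proof -
  \<comment> \<open>With value 0 on \<open>N\<close>, tags in \<open>N\<close> contribute nothing to
    the Riemann sum, and only the increments of \<open>w\<close> over their intervals remain to be
    estimated.\<close>
  define g where "g x = (if x \<in> N then 0 else w' x)" for x
  have "(g has_integral (w d - w c)) {c..d}"
    unfolding has_integral[of g "w d - w c" c d, unfolded box_real]
  proof (intro allI impI)
    fix e :: real assume "e > 0"
    define e1 where "e1 = e / 2"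
    have e1: "e1 > 0" using \<open>e > 0\<close> by (simp add: e1_def)
    \<comment> \<open>The summand 1 covers the case \<open>c = d\<close>.\<close>
    define e2 where "e2 = e1 / (d - c + 1)"
    have e2: "e2 > 0" using e1 assms(1) by (simp add: e2_def)
    obtain \<eta> where \<eta>: "\<eta> > 0" and ac: "\<forall>S (a :: real \<times> real set \<Rightarrow> real) b. finite S \<longrightarrow> (\<forall>i\<in>S. c \<le> a i \<and> a i \<le> b i \<and> b i \<le> d) \<longrightarrow>
       (\<forall>i\<in>S. \<forall>j\<in>S. i \<noteq> j \<longrightarrow> {a i<..<b i} \<inter> {a j<..<b j} = {}) \<longrightarrow>
       (\<Sum>i\<in>S. b i - a i) < \<eta> \<longrightarrow> (\<Sum>i\<in>S. \<bar>w (b i) - w (a i)\<bar>) < e1"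
      by (rule exE[OF abs_cont_onD[OF w e1, where 'i = "real \<times> real set"]], elim conjE, rule that)
    obtain W where W: "open W" "N \<subseteq> W" "W - N \<in> lmeasurable" "emeasure lebesgue (W - N) < ennreal \<eta>"
      using sets_lebesgue_outer_open[of N \<eta>] negligible_imp_sets[OF N] \<eta> by blast
    have NW: "W \<in> lmeasurable" "measure lebesgue W < \<eta>"
    proof -
      have Nm: "N \<in> lmeasurable" "measure lebesgue N = 0" using N negligible_iff_measure by auto
      have W2: "W = (W - N) \<union> N" using W by auto
      show Wm: "W \<in> lmeasurable" by (subst W2) (intro fmeasurable.Un W Nm)
      have "measure lebesgue W \<le> measure lebesgue (W - N) + measure lebesgue N"
        by (subst W2, rule measure_Un_le) (use W(3) Nm in auto)
      moreover have "measure lebesgue (W - N) < \<eta>"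
        using W(3,4) \<eta> by (simp add: emeasure_eq_measure2 ennreal_less_iff)
      ultimately show "measure lebesgue W < \<eta>" using Nm by simp
    qed
    have "\<exists>r>0. (x \<in> N \<longrightarrow> ball x r \<subseteq> W) \<and> (x \<in> {c..d} - N \<longrightarrow> (\<forall>y\<in>{c..d}. \<bar>y - x\<bar> < r \<longrightarrow>
        \<bar>w y - w x - w' x * (y - x)\<bar> \<le> e2 * \<bar>y - x\<bar>))" for x
    proof (cases "x \<in> N")
      case True
      then show ?thesis using W by (meson DiffD2 openE subsetD)
    next
      case False
      show ?thesis
      proof (cases "x \<in> {c..d}")
        case True
        then have "(w has_derivative (*) (w' x)) (at x within {c..d})"
          using w'[of x] False by (simp add: has_field_derivative_def)
        then obtain r where "r > 0" "\<And>y. \<lbrakk>y\<in>{c..d}; norm (y - x) < r\<rbrakk> \<Longrightarrow> norm (w y - w x - w' x * (y - x)) \<le> e2 * norm (y - x)"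
          using e2 unfolding has_derivative_within_alt by blast
        then show ?thesis using False by (intro exI[of _ r]) auto
      qed (use False in \<open>auto intro!: exI[of _ 1]\<close>)
    qed
    then obtain r where r: "\<And>x. r x > 0" "\<And>x. x \<in> N \<Longrightarrow> ball x (r x) \<subseteq> W"
      "\<And>x y. \<lbrakk>x \<in> {c..d} - N; y \<in> {c..d}; \<bar>y - x\<bar> < r x\<rbrakk> \<Longrightarrow> \<bar>w y - w x - w' x * (y - x)\<bar> \<le> e2 * \<bar>y - x\<bar>"
      by metis
    show "\<exists>\<gamma>. gauge \<gamma> \<and> (\<forall>\<D>. \<D> tagged_division_of {c..d} \<and> \<gamma> fine \<D> \<longrightarrow>
       norm ((\<Sum>(x, k)\<in>\<D>. measure lborel k *\<^sub>R g x) - (w d - w c)) < e)"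
    proof (intro exI conjI allI impI)
      show "gauge (\<lambda>x. ball x (r x))" using r(1) by (rule gauge_ball_dependent[rule_format])
      fix p assume p: "p tagged_division_of {c..d} \<and> (\<lambda>x. ball x (r x)) fine p"
      have fin: "finite p" using p by auto
      have K: "\<exists>u v. K = {u..v} \<and> u \<le> v \<and> x \<in> {u..v} \<and> c \<le> u \<and> v \<le> d \<and> {u..v} \<subseteq> ball x (r x) \<and> x \<in> {c..d}" if xK: "(x, K) \<in> p" for x K
      proof -
        obtain u v where uv: "K = cbox u v" using p xK by blast
        have x: "x \<in> K" "K \<subseteq> {c..d}" using p[THEN conjunct1] xK by (simp_all add: tagged_division_of)
        have "K \<subseteq> ball x (r x)" using p xK by (auto simp: fine_def)
        then show ?thesis using x uv by (intro exI[of _ u] exI[of _ v]) (auto simp: subset_iff)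
      qed
      have K2: "c \<le> Inf (snd i) \<and> Inf (snd i) \<le> Sup (snd i) \<and> Sup (snd i) \<le> d
          \<and> measure lborel (snd i) = Sup (snd i) - Inf (snd i) \<and> measure lborel (snd i) = measure lebesgue (snd i) \<and> snd i \<in> sets lebesgue" if i: "i \<in> p" for i
      proof -
        have "(fst i, snd i) \<in> p" using i by simp
        then obtain u v where "snd i = {u..v}" "u \<le> v" "c \<le> u" "v \<le> d" using K by blast
        then show ?thesis by (simp add: measure_completion)
      qed
      define A where "A = {i \<in> p. fst i \<in> N}"
      have finA: "finite A" "A \<subseteq> p" using fin by (auto simp: A_def)
      have disj: "{Inf (snd i)<..<Sup (snd i)} \<inter> {Inf (snd j)<..<Sup (snd j)} = {}" if "i \<in> p" "j \<in> p" "i \<noteq> j" for i j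
      proof -
        obtain x K y K' where ij: "i = (x, K)" "j = (y, K')" by (metis surj_pair)
        have "interior K \<inter> interior K' = {}" using p that ij by (auto simp: tagged_division_of)
        moreover have "interior K = {Inf K<..<Sup K}" "interior K' = {Inf K'<..<Sup K'}"
          using K[of x K] K[of y K'] that ij by auto
        ultimately show ?thesis using ij by simp
      qed
      have Wsum: "(\<Sum>i\<in>A. Sup (snd i) - Inf (snd i)) < \<eta>"
      proof -
        have tp: "A tagged_partial_division_of {c..d}"
          using p finA(2) by (meson tagged_division_of_def tagged_partial_division_subset)
        have len: "measure lborel (snd i) = Sup (snd i) - Inf (snd i)" if i: "i \<in> p" for i
          using K2[OF i] by simp
        have "(\<Sum>i\<in>A. Sup (snd i) - Inf (snd i)) = (\<Sum>i\<in>A. measure lborel (snd i))"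
          using len finA(2) by (intro sum.cong) auto
        \<comment> \<open>Different tags can share an interval only if it is degenerate, and then
          its length is 0.\<close>
        also have "\<dots> = (\<Sum>K\<in>snd ` A. measure lborel K)"
        proof (rule sum.reindex_nontrivial[symmetric, unfolded o_def])
          fix i j assume ij: "i \<in> A" "j \<in> A" "i \<noteq> j" "snd i = snd j"
          then have "i \<in> p" "j \<in> p" using finA by auto
          then show "measure lborel (snd i) = 0"
            using disj[of i j] ij K2[of i] by auto
        qed (rule finA)
        also have "\<dots> = (\<Sum>K\<in>snd ` A. measure lebesgue K)"
          using K2 finA(2) by (intro sum.cong) auto
        also have "\<dots> = measure lebesgue (\<Union>(snd ` A))"
          using content_division[OF partial_division_of_tagged_division[OF tp]] by simp
        also have "\<dots> \<le> measure lebesgue W"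
        proof (rule measure_mono_fmeasurable)
          show "\<Union>(snd ` A) \<subseteq> W"
          proof
            fix z assume "z \<in> \<Union>(snd ` A)"
            then obtain x K' where xK: "(x, K') \<in> A" "z \<in> K'" by auto
            then have "K' \<subseteq> ball x (r x)" "x \<in> N" using K[of x K'] finA(2) by (auto simp: A_def)
            then show "z \<in> W" using r(2)[of x] xK by blast
          qed
          show "\<Union>(snd ` A) \<in> sets lebesgue"
            using K2 finA by (intro sets.finite_Union) auto
        qed (use NW in auto)
        finally show ?thesis using NW by simp
      qed
      have SA: "(\<Sum>i\<in>A. \<bar>w (Sup (snd i)) - w (Inf (snd i))\<bar>) < e1"
      proof (rule ac[THEN spec, THEN spec, THEN spec, THEN mp, THEN mp, THEN mp, THEN mp]; (intro ballI impI)?)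
        fix i assume "i \<in> A"
        then show "c \<le> Inf (snd i) \<and> Inf (snd i) \<le> Sup (snd i) \<and> Sup (snd i) \<le> d"
          using K2 finA(2) by blast
      next
        fix i j assume "i \<in> A" "j \<in> A" "i \<noteq> j"
        then show "{Inf (snd i)<..<Sup (snd i)} \<inter> {Inf (snd j)<..<Sup (snd j)} = {}"
          using disj finA(2) by blast
      qed (use Wsum finA in auto)
      have tel: "w d - w c = (\<Sum>i\<in>p. w (Sup (snd i)) - w (Inf (snd i)))" "d - c = (\<Sum>i\<in>p. Sup (snd i) - Inf (snd i))"
        using additive_tagged_division_1[OF assms(1), of p w] additive_tagged_division_1[OF assms(1), of p "\<lambda>x. x"] p
        by (simp_all add: split_def)
      have "norm ((\<Sum>(x, k)\<in>p. measure lborel k *\<^sub>R g x) - (w d - w c))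
          = \<bar>\<Sum>i\<in>p. measure lborel (snd i) * g (fst i) - (w (Sup (snd i)) - w (Inf (snd i)))\<bar>"
        by (simp add: tel(1) sum_subtractf split_def)
      also have "\<dots> \<le> (\<Sum>i\<in>p. \<bar>measure lborel (snd i) * g (fst i) - (w (Sup (snd i)) - w (Inf (snd i)))\<bar>)" by (rule sum_abs)
      also have "\<dots> \<le> (\<Sum>i\<in>p. e2 * (Sup (snd i) - Inf (snd i)) + (if i \<in> A then \<bar>w (Sup (snd i)) - w (Inf (snd i))\<bar> else 0))"
      proof (rule sum_mono)
        fix i assume i: "i \<in> p"
        obtain x K' where ix: "i = (x, K')" by (metis surj_pair)
        obtain u v where uv: "K' = {u..v}" "u \<le> v" "x \<in> {u..v}" "c \<le> u" "v \<le> d" "{u..v} \<subseteq> ball x (r x)" "x \<in> {c..d}"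
          using K[of x K'] i ix by blast
        show "\<bar>measure lborel (snd i) * g (fst i) - (w (Sup (snd i)) - w (Inf (snd i)))\<bar>
           \<le> e2 * (Sup (snd i) - Inf (snd i)) + (if i \<in> A then \<bar>w (Sup (snd i)) - w (Inf (snd i))\<bar> else 0)"
        proof (cases "x \<in> N")
          case True
          have "0 \<le> e2 * (v - u)" using e2 uv by simp
          then show ?thesis using True ix uv i by (simp add: g_def A_def abs_minus_commute)
        next
          case False
          have "u \<in> ball x (r x)" "v \<in> ball x (r x)" using uv(2,6) by (simp_all add: subset_iff)
          then have "\<bar>w u - w x - w' x * (u - x)\<bar> \<le> e2 * \<bar>u - x\<bar>" "\<bar>w v - w x - w' x * (v - x)\<bar> \<le> e2 * \<bar>v - x\<bar>"
            using r(3)[of x u] r(3)[of x v] False uv by (auto simp: dist_real_def abs_minus_commute)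
          moreover have "(v - u) * w' x - (w v - w u) = (w u - w x - w' x * (u - x)) - (w v - w x - w' x * (v - x))"
            by (simp add: algebra_simps)
          ultimately have "\<bar>(v - u) * w' x - (w v - w u)\<bar> \<le> e2 * \<bar>u - x\<bar> + e2 * \<bar>v - x\<bar>" by linarith
          also have "\<dots> = e2 * (v - u)" using uv by (simp add: algebra_simps)
          finally show ?thesis using False ix uv by (simp add: g_def A_def)
        qed
      qed
      also have "\<dots> = e2 * (d - c) + (\<Sum>i\<in>A. \<bar>w (Sup (snd i)) - w (Inf (snd i))\<bar>)"
        using fin by (simp add: sum.distrib sum_distrib_left tel(2) A_def sum.inter_filter)
      also have "\<dots> < e2 * (d - c) + e1" using SA by simp
      also have "\<dots> \<le> e"
      proof -
        have "e2 * (d - c) \<le> e2 * (d - c + 1)" using e2 by simp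
        also have "\<dots> = e1" using assms(1) by (simp add: e2_def)
        finally show ?thesis by (simp add: e1_def)
      qed
      finally show "norm ((\<Sum>(x, k)\<in>p. measure lborel k *\<^sub>R g x) - (w d - w c)) < e" .
    qed
  qed
  then show ?thesis
    by (rule has_integral_spike[OF N, rotated]) (auto simp: g_def)
qed

text \<open>Where \<open>w\<close> is not differentiable, \<open>deriv w\<close> has an unspecified
  value; these points form a null set and leave the integral unchanged.\<close>

lemma abs_cont_on_has_integral_deriv:
  assumes "c \<le> d" "abs_cont_on c d w"
  shows "(deriv w has_integral (w d - w c)) {c..d}"
  by (rule abs_cont_on_has_integral[OF assms abs_cont_on_differentiable_ae[OF assms(2)]])
     (auto intro: has_field_derivative_at_within simp: field_differentiable_derivI)

section \<open>Test functions\<close>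

definition smooth :: "(real \<Rightarrow> real) \<Rightarrow> bool" where
  "smooth f \<longleftrightarrow> (\<forall>n x. (deriv ^^ n) f field_differentiable at x)"

text \<open>Smoothness is proved by exhibiting a family of differentiable functions closed under
  \<open>deriv\<close>; formulas for higher derivatives never appear.\<close>

lemma smooth_coinduct:
  assumes "f \<in> F" and F: "\<And>g. g \<in> F \<Longrightarrow> (\<forall>x. g field_differentiable at x) \<and> deriv g \<in> F"
  shows "smooth f"
proof -
  have "(deriv ^^ n) f \<in> F" for n by (induction n) (use assms in auto)
  then show ?thesis using F by (auto simp: smooth_def)
qed

lemma smooth_differentiable: "smooth f \<Longrightarrow> f field_differentiable at x"
  unfolding smooth_def by (metis funpow_0)

lemma smooth_deriv: "smooth f \<Longrightarrow> smooth (deriv f)"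
  unfolding smooth_def by (metis comp_apply funpow_Suc_right)

lemma smooth_has_derivative: "smooth f \<Longrightarrow> (f has_real_derivative deriv f x) (at x)"
  by (simp add: field_differentiable_derivI smooth_differentiable)

lemma smooth_continuous: "smooth f \<Longrightarrow> continuous_on A f"
  by (meson DERIV_continuous_on has_field_derivative_at_within smooth_has_derivative)

lemma deriv_eqI: "(\<And>x. (f has_real_derivative f' x) (at x)) \<Longrightarrow> deriv f = f'"
  by (simp add: fun_eq_iff DERIV_imp_deriv)

lemma smoothI_deriv:
  assumes "\<And>x. (f has_real_derivative f' x) (at x)" "smooth f'"
  shows "smooth f"
  unfolding smooth_def
proof (intro allI)
  fix n x
  have d: "deriv f = f'" using assms(1) by (rule deriv_eqI)
  show "(deriv ^^ n) f field_differentiable at x"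
  proof (cases n)
    case 0
    then show ?thesis using assms(1) by (auto simp: field_differentiable_def)
  next
    case (Suc m)
    then show ?thesis using assms(2) d unfolding smooth_def by (simp add: funpow_Suc_right del: funpow.simps)
  qed
qed

text \<open>The product rule turns a product into a sum of products, so closure under both
  operations is what makes the family stable under \<open>deriv\<close> and
  \<open>smooth_coinduct\<close> applicable.\<close>

inductive_set smooth_algebra :: "(real \<Rightarrow> real) set" where
  base: "smooth f \<Longrightarrow> f \<in> smooth_algebra"
| add: "f \<in> smooth_algebra \<Longrightarrow> g \<in> smooth_algebra \<Longrightarrow> (\<lambda>x. f x + g x) \<in> smooth_algebra"
| mult: "f \<in> smooth_algebra \<Longrightarrow> g \<in> smooth_algebra \<Longrightarrow> (\<lambda>x. f x * g x) \<in> smooth_algebra"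

lemma smooth_algebra_smooth:
  assumes "f \<in> smooth_algebra"
  shows "smooth f"
proof (rule smooth_coinduct[OF assms])
  fix g assume "g \<in> smooth_algebra"
  then have "(\<forall>x. (g has_real_derivative deriv g x) (at x)) \<and> deriv g \<in> smooth_algebra"
  proof induction
    case (base f)
    then show ?case by (auto intro: smooth_algebra.base smooth_deriv smooth_has_derivative)
  next
    case (add f g)
    have *: "((\<lambda>x. f x + g x) has_real_derivative deriv f x + deriv g x) (at x)" for x
      using add by (auto intro!: derivative_eq_intros)
    show ?case using deriv_eqI[OF *] * add by (auto intro: smooth_algebra.add)
  next
    case (mult f g)
    have *: "((\<lambda>x. f x * g x) has_real_derivative f x * deriv g x + deriv f x * g x) (at x)" for x
      using mult by (auto intro!: derivative_eq_intros)
    show ?case using deriv_eqI[OF *] * mult by (auto intro!: smooth_algebra.add smooth_algebra.mult)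
  qed
  then show "(\<forall>x. g field_differentiable at x) \<and> deriv g \<in> smooth_algebra"
    by (auto simp: field_differentiable_def)
qed

lemma smooth_const [simp]: "smooth (\<lambda>_. c)"
  by (rule smooth_coinduct[of _ "range (\<lambda>c _. c)"]) (auto intro!: field_differentiable_const deriv_eqI derivative_eq_intros simp: deriv_const image_def)

lemma smooth_add: "smooth f \<Longrightarrow> smooth g \<Longrightarrow> smooth (\<lambda>x. f x + g x)"
  by (rule smooth_algebra_smooth[OF smooth_algebra.add[OF smooth_algebra.base smooth_algebra.base]])

lemma smooth_mult: "smooth f \<Longrightarrow> smooth g \<Longrightarrow> smooth (\<lambda>x. f x * g x)"
  by (rule smooth_algebra_smooth[OF smooth_algebra.mult[OF smooth_algebra.base smooth_algebra.base]])

lemma smooth_id [simp]: "smooth (\<lambda>x. x)"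
  by (rule smoothI_deriv[of _ "\<lambda>_. 1"]) (auto intro!: derivative_eq_intros)

lemma smooth_diff: "smooth f \<Longrightarrow> smooth g \<Longrightarrow> smooth (\<lambda>x. f x - g x)"
  using smooth_add[OF _ smooth_mult[OF smooth_const[of "-1"]], of f g] by simp

lemma smooth_power: "smooth f \<Longrightarrow> smooth (\<lambda>x. f x ^ n)"
  by (induction n) (auto intro: smooth_mult)

lemma smooth_sum: "(\<And>i. i \<in> A \<Longrightarrow> smooth (f i)) \<Longrightarrow> smooth (\<lambda>x. \<Sum>i\<in>A. f i x)"
  by (induction A rule: infinite_finite_induct) (auto intro: smooth_add)

lemma smooth_affine: "smooth f \<Longrightarrow> smooth (\<lambda>x. f (a * x + b))"
proof (rule smooth_coinduct[of _ "{\<lambda>x. c * g (a * x + b) | c g. smooth g}"])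
  assume "smooth f"
  then show "(\<lambda>x. f (a * x + b)) \<in> {\<lambda>x. c * g (a * x + b) | c g. smooth g}"
    by (intro CollectI exI[of _ 1] exI[of _ f]) auto
next
  fix h assume "h \<in> {\<lambda>x. c * g (a * x + b) | c g. smooth g}"
  then obtain c g where h: "h = (\<lambda>x. c * g (a * x + b))" "smooth g" by auto
  have *: "(h has_real_derivative (c * a) * deriv g (a * x + b)) (at x)" for x
    unfolding h(1) by (auto intro!: derivative_eq_intros DERIV_chain2[OF smooth_has_derivative[OF h(2)]])
  have "deriv h = (\<lambda>x. (c * a) * deriv g (a * x + b))" using * by (rule deriv_eqI)
  then have "deriv h \<in> {\<lambda>x. c * g (a * x + b) | c g. smooth g}"
    using smooth_deriv[OF h(2)] by blast
  then show "(\<forall>x. h field_differentiable at x) \<and> deriv h \<in> {\<lambda>x. c * g (a * x + b) | c g. smooth g}"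
    using * by (auto simp: field_differentiable_def)
qed

section \<open>Bump functions and smooth cut-offs\<close>

definition half_bump :: "real \<Rightarrow> real" where
  "half_bump x = (if x > 0 then exp (- inverse x) else 0)"

lemma poly_exp_tendsto_0: "((\<lambda>y. poly p y * exp (- y)) \<longlongrightarrow> (0::real)) at_top"
proof -
  have "((\<lambda>y. \<Sum>i\<le>degree p. coeff p i * (y ^ i / exp y)) \<longlongrightarrow> (\<Sum>i\<le>degree p. coeff p i * 0)) at_top"
    by (intro tendsto_intros tendsto_power_div_exp_0)
  moreover have "(\<lambda>y. poly p y * exp (- y)) = (\<lambda>y. \<Sum>i\<le>degree p. coeff p i * (y ^ i / exp y))"
    by (simp add: poly_altdef exp_minus sum_distrib_right divide_inverse mult.assoc)
  ultimately show ?thesis by simp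
qed

text \<open>The invariant family consists of the functions \<open>p(1/x) exp(-1/x)\<close> with a
  polynomial \<open>p\<close>; differentiation maps \<open>p\<close> to \<open>X^2 (p - p')\<close>.
  At 0 the difference quotient from the right is \<open>y p(y) exp(-y)\<close> with
  \<open>y = 1/x\<close>, which tends to 0.\<close>

lemma smooth_half_bump: "smooth half_bump"
proof (rule smooth_coinduct[of _ "range (\<lambda>p x. if x > 0 then poly p (inverse x) * exp (- inverse x) else 0)"])
  show "half_bump \<in> range (\<lambda>p x. if x > 0 then poly p (inverse x) * exp (- inverse x) else 0)"
    by (intro image_eqI[of _ _ 1]) (auto simp: half_bump_def fun_eq_iff)
next
  fix g assume "g \<in> range (\<lambda>(p::real poly) x. if x > 0 then poly p (inverse x) * exp (- inverse x) else 0)"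
  then obtain p :: "real poly" where g: "g = (\<lambda>x. if x > 0 then poly p (inverse x) * exp (- inverse x) else 0)" by auto
  define q where "q = monom 1 2 * (p - pderiv p)"
  have *: "(g has_real_derivative (if x > 0 then poly q (inverse x) * exp (- inverse x) else 0)) (at x)" for x
  proof -
    consider "x > 0" | "x < 0" | "x = 0" by linarith
    then show ?thesis
    proof cases
      case 1
      have "((\<lambda>x. poly p (inverse x) * exp (- inverse x)) has_real_derivative poly q (inverse x) * exp (- inverse x)) (at x)"
        using 1 by (auto intro!: derivative_eq_intros simp: q_def poly_monom field_simps power2_eq_square)
      then have "(g has_real_derivative poly q (inverse x) * exp (- inverse x)) (at x)"
        by (rule has_field_derivative_transform_within_open[of _ _ _ "{0<..}"]) (use 1 in \<open>auto simp: g\<close>)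
      then show ?thesis using 1 by simp
    next
      case 2
      have "((\<lambda>_. 0) has_real_derivative 0) (at x)" by simp
      then have "(g has_real_derivative 0) (at x)"
        by (rule has_field_derivative_transform_within_open[of _ _ _ "{..<0}"]) (use 2 in \<open>auto simp: g\<close>)
      then show ?thesis using 2 by simp
    next
      case 3
      have "((\<lambda>y. poly (monom 1 1 * p) y * exp (- y)) \<longlongrightarrow> (0::real)) at_top" by (rule poly_exp_tendsto_0)
      then have "((\<lambda>h. poly (monom 1 1 * p) (inverse h) * exp (- inverse h)) \<longlongrightarrow> 0) (at_right 0)"
        by (rule filterlim_compose[OF _ filterlim_inverse_at_top_right])
      moreover have "eventually (\<lambda>h. poly (monom 1 1 * p) (inverse h) * exp (- inverse h) = (g (0 + h) - g 0) / h) (at_right 0)"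
        unfolding eventually_at_right_field by (intro exI[of _ 1]) (auto simp: g poly_monom field_simps)
      ultimately have r: "((\<lambda>h. (g (0 + h) - g 0) / h) \<longlongrightarrow> 0) (at_right 0)"
        by (rule Lim_transform_eventually)
      have "eventually (\<lambda>h. 0 = (g (0 + h) - g 0) / h) (at_left 0)"
        unfolding eventually_at_left_field by (intro exI[of _ "-1"]) (auto simp: g)
      then have l: "((\<lambda>h. (g (0 + h) - g 0) / h) \<longlongrightarrow> 0) (at_left 0)"
        by (rule Lim_transform_eventually[OF tendsto_const])
      show ?thesis using 3 filterlim_split_at[OF l r] by (simp add: DERIV_def)
    qed
  qed
  then have "deriv g = (\<lambda>x. if x > 0 then poly q (inverse x) * exp (- inverse x) else 0)" by (rule deriv_eqI)
  then show "(\<forall>x. g field_differentiable at x) \<and> deriv g \<in> range (\<lambda>p x. if x > 0 then poly p (inverse x) * exp (- inverse x) else 0)"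
    using * by (auto simp: field_differentiable_def)
qed

text \<open>Powers of one minus a bump tend to 0 exactly where the bump is positive, so these smooth
  functions increase with \<open>n\<close> to the indicator of \<open>{c<..<d}\<close>. They serve
  as cut-offs in place of mollified indicators.\<close>

definition plateau :: "real \<Rightarrow> real \<Rightarrow> nat \<Rightarrow> real \<Rightarrow> real" where
  "plateau c d n x = 1 - (1 - half_bump (x - c) * half_bump (d - x)) ^ n"

lemma half_bump_bounds: "0 \<le> half_bump x" "half_bump x \<le> 1" "half_bump x > 0 \<longleftrightarrow> x > 0"
  by (auto simp: half_bump_def)

lemma plateau_bounds: "0 \<le> plateau c d n x" "plateau c d n x \<le> 1"
proof -
  have "0 \<le> half_bump (x - c) * half_bump (d - x)" "half_bump (x - c) * half_bump (d - x) \<le> 1"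
    using half_bump_bounds by (auto intro: mult_le_one)
  then show "0 \<le> plateau c d n x" "plateau c d n x \<le> 1"
    by (auto simp: plateau_def power_le_one)
qed

lemma plateau_eq_0: "x \<notin> {c<..<d} \<Longrightarrow> plateau c d n x = 0"
  by (auto simp: plateau_def half_bump_def)

lemma smooth_plateau: "smooth (plateau c d n)"
proof -
  have "smooth (\<lambda>x. half_bump (x - c))" "smooth (\<lambda>x. half_bump (d - x))"
    using smooth_affine[OF smooth_half_bump, of 1 "-c"] smooth_affine[OF smooth_half_bump, of "-1" d] by simp_all
  then show ?thesis unfolding plateau_def by (intro smooth_diff smooth_power smooth_mult smooth_const)
qed

lemma plateau_tendsto: "(\<lambda>n. plateau c d n x) \<longlonglongrightarrow> indicator {c<..<d} x"
proof (cases "x \<in> {c<..<d}")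
  case True
  define y where "y = half_bump (x - c) * half_bump (d - x)"
  have "0 < y" "y \<le> 1" unfolding y_def using True half_bump_bounds by (auto intro: mult_le_one)
  then have "(\<lambda>n. (1 - y) ^ n) \<longlonglongrightarrow> 0" by (intro LIMSEQ_realpow_zero) auto
  then have "(\<lambda>n. 1 - (1 - y) ^ n) \<longlonglongrightarrow> 1 - 0" by (rule tendsto_diff[OF tendsto_const])
  then show ?thesis using True by (simp add: plateau_def y_def)
qed (simp add: plateau_eq_0)

lemma test_functionI:
  assumes "smooth f" "a < c" "d < b" "\<And>x. x \<notin> {c..d} \<Longrightarrow> f x = 0"
  shows "test_function a b f"
proof -
  have "closure {x. f x \<noteq> 0} \<subseteq> {c..d}" by (rule closure_minimal) (use assms(4) in blast, simp)
  moreover from this have "compact (closure {x. f x \<noteq> 0})"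
    by (meson bounded_closed_interval bounded_subset closed_closure compact_eq_bounded_closed)
  ultimately show ?thesis using assms by (auto simp: test_function_def smooth_def)
qed

lemma test_function_plateau: "a < c \<Longrightarrow> d < b \<Longrightarrow> test_function a b (plateau c d n)"
  by (rule test_functionI[OF smooth_plateau, of a c d b]) (auto simp: plateau_eq_0)

lemma test_functionE:
  assumes "test_function a b f" "a < b"
  obtains c d where "a < c" "c < d" "d < b" "\<And>x. x \<notin> {c<..<d} \<Longrightarrow> f x = 0" "smooth f"
proof -
  \<comment> \<open>The midpoint is inserted so that \<open>K\<close> is nonempty even for the zero
    function.\<close>
  define K where "K = insert ((a+b)/2) (closure {x. f x \<noteq> 0})"
  have K: "compact K" "K \<noteq> {}" "K \<subseteq> {a<..<b}" using assms unfolding test_function_def K_def by auto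
  obtain s where s: "s \<in> K" "\<And>x. x \<in> K \<Longrightarrow> s \<le> x" using compact_attains_inf[OF K(1,2)] by blast
  obtain t where t: "t \<in> K" "\<And>x. x \<in> K \<Longrightarrow> x \<le> t" using compact_attains_sup[OF K(1,2)] by blast
  have st: "a < s" "s \<le> t" "t < b" using s t K by auto
  show ?thesis
  proof (rule that[of "(a+s)/2" "(t+b)/2"])
    fix x assume x: "x \<notin> {(a+s)/2<..<(t+b)/2}"
    show "f x = 0"
    proof (rule ccontr)
      assume "f x \<noteq> 0"
      then have "x \<in> closure {x. f x \<noteq> 0}" using closure_subset[of "{x. f x \<noteq> 0}"] by (simp add: subset_iff)
      then have "x \<in> K" by (simp add: K_def)
      then have "s \<le> x" "x \<le> t" using s t by auto
      then show False using x st by auto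
    qed
  qed (use assms st in \<open>auto simp: test_function_def smooth_def\<close>)
qed

section \<open>Test functions in L^2: density and the du Bois-Reymond lemma\<close>

lemma inner_to_L2I:
  assumes "f \<in> L2_on (-1) 1" "g \<in> L2_on (-1) 1"
  shows "inner (to_L2I f) (to_L2I g) = (LINT x|Imeas. f x * g x)"
  using assms by transfer simp

lemma to_L2I_eq_iff:
  assumes "f \<in> L2_on (-1) 1" "g \<in> L2_on (-1) 1"
  shows "to_L2I f = to_L2I g \<longleftrightarrow> (AE x in Imeas. f x = g x)"
  using assms by transfer simp

lemma lebesgue_on_measurable_borel:
  fixes f :: "real \<Rightarrow> real"
  assumes "f \<in> borel_measurable borel"
  shows "f \<in> borel_measurable (lebesgue_on S)"
proof -
  have "f \<in> borel_measurable lborel" using assms by simp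
  then show ?thesis using measurable_completion measurable_restrict_space1 by blast
qed

lemma L2_indicator_continuous:
  fixes f :: "real \<Rightarrow> real"
  assumes "continuous_on {c..d} f"
  shows "(\<lambda>x. indicator {c..d} x * f x) \<in> L2_on (-1) 1"
proof -
  have "bounded (f ` {c..d})" using assms by (intro compact_imp_bounded compact_continuous_image) auto
  then obtain B where B: "\<forall>x\<in>{c..d}. \<bar>f x\<bar> \<le> B" by (auto simp: bounded_real)
  show ?thesis
  proof (rule L2I_bounded[of _ "\<bar>B\<bar>"])
    show "(\<lambda>x. indicator {c..d} x * f x) \<in> borel_measurable Imeas"
      using borel_measurable_continuous_on_indicator[OF _ assms] by (intro lebesgue_on_measurable_borel) simp
    show "\<bar>indicator {c..d} x * f x\<bar> \<le> \<bar>B\<bar>" for x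
      using B by (auto simp: indicator_def intro: order_trans[OF _ abs_ge_self])
  qed
qed

lemma L2_continuous:
  fixes f :: "real \<Rightarrow> real"
  assumes "continuous_on {-1..1} f"
  shows "f \<in> L2_on (-1) 1"
proof -
  have 1: "(\<lambda>x. indicator {-1..1} x * f x) \<in> L2_on (-1) 1" by (rule L2_indicator_continuous[OF assms])
  have 2: "(\<lambda>x. indicator {-1..1} x * f x) \<in> borel_measurable Imeas \<longleftrightarrow> f \<in> borel_measurable Imeas"
    by (rule measurable_cong) (auto simp: space_restrict_space)
  have 3: "integrable Imeas (\<lambda>x. (indicator {-1..1} x * f x)\<^sup>2) \<longleftrightarrow> integrable Imeas (\<lambda>x. (f x)\<^sup>2)"
    by (rule Bochner_Integration.integrable_cong) (auto simp: space_restrict_space)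
  from 1 2 3 show ?thesis by (simp add: L2I_iff)
qed

lemma test_function_smooth: "test_function a b f \<Longrightarrow> smooth f"
  by (simp add: test_function_def smooth_def)

lemma test_function_L2: "test_function a b f \<Longrightarrow> f \<in> L2_on (-1) 1"
  by (intro L2_continuous smooth_continuous test_function_smooth)

text \<open>Polynomials are dense already, and a plateau cuts them off near the end points. Two
  dominated limits follow each other: in \<open>n\<close> the plateau sharpens to an indicator, in
  \<open>m\<close> its interval exhausts \<open>{-1<..<1}\<close>.\<close>

lemma test_function_dense:
  fixes X :: L2I
  assumes "e > 0"
  shows "\<exists>\<phi>. test_function (-1) 1 \<phi> \<and> dist (to_L2I \<phi>) X < e"
proof -
  interpret finite_measure Imeas by (rule finite_measure_Imeas)
  obtain cs :: "rat list" where cs: "dist (to_L2I (\<lambda>x. if \<bar>x\<bar> < 1 then \<Sum>i<length cs. of_rat (cs ! i) * x ^ i else 0)) X < e/2"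
    using L2I_dense_rational_polys[of "e/2" X] assms by auto
  define p where "p x = (\<Sum>i<length cs. real_of_rat (cs ! i) * x ^ i)" for x
  have sp: "smooth p" unfolding p_def by (intro smooth_sum smooth_mult smooth_const smooth_power smooth_id)
  have pL2: "p \<in> L2_on (-1) 1" by (intro L2_continuous smooth_continuous sp)
  have "(\<lambda>x. if \<bar>x\<bar> < 1 then p x else 0) \<in> L2_on (-1) 1"
  proof -
    have 2: "(\<lambda>x. if \<bar>x\<bar> < 1 then p x else 0) \<in> borel_measurable Imeas \<longleftrightarrow> p \<in> borel_measurable Imeas"
      by (rule measurable_cong) (auto simp: space_restrict_space)
    have 3: "integrable Imeas (\<lambda>x. (if \<bar>x\<bar> < 1 then p x else 0)\<^sup>2) \<longleftrightarrow> integrable Imeas (\<lambda>x. (p x)\<^sup>2)"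
      by (rule Bochner_Integration.integrable_cong) (auto simp: space_restrict_space)
    from pL2 2 3 show ?thesis by (simp add: L2I_iff)
  qed
  then have "to_L2I (\<lambda>x. if \<bar>x\<bar> < 1 then p x else 0) = to_L2I p"
    using pL2 by (subst to_L2I_eq_iff) (auto simp: space_restrict_space intro!: AE_I2)
  then have 1: "dist (to_L2I p) X < e/2" using cs unfolding p_def by simp
  define cc dd where "cc m = -1 + 1 / real (m + 2)" and "dd m = 1 - 1 / real (m + 2)" for m :: nat
  define g where "g m n x = p x * plateau (cc m) (dd m) n x" for m n x
  have cd: "-1 < cc m" "dd m < 1" for m by (auto simp: cc_def dd_def)
  have tg: "test_function (-1) 1 (g m n)" for m n
  proof (rule test_functionI[of _ _ "cc m" "dd m"])
    show "smooth (g m n)" unfolding g_def by (rule smooth_mult[OF sp smooth_plateau])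
  qed (auto simp: g_def plateau_eq_0 cd)
  have pint: "integrable Imeas (\<lambda>x. (p x)\<^sup>2)" using pL2 by (simp add: L2I_iff)
  have pm [measurable]: "p \<in> borel_measurable Imeas" using pL2 by (simp add: L2I_iff)
  have ym [measurable]: "plateau c d n \<in> borel_measurable Imeas" for c d n
    using L2_continuous[OF smooth_continuous[OF smooth_plateau]] by (simp add: L2I_iff)
  define h where "h m x = (p x * (1 - indicator {cc m<..<dd m} x))\<^sup>2" for m x
  have im [measurable]: "indicat_real {a<..<b} \<in> borel_measurable Imeas" for a b :: real
    by (intro lebesgue_on_measurable_borel) simp
  have lim1: "(\<lambda>n. LINT x|Imeas. (p x * (1 - plateau (cc m) (dd m) n x))\<^sup>2) \<longlonglongrightarrow> (LINT x|Imeas. h m x)" for m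
    unfolding h_def
  proof (rule integral_dominated_convergence[OF _ _ pint])
    show "AE x in Imeas. (\<lambda>n. (p x * (1 - plateau (cc m) (dd m) n x))\<^sup>2) \<longlonglongrightarrow> (p x * (1 - indicator {cc m<..<dd m} x))\<^sup>2"
      by (intro AE_I2 tendsto_intros plateau_tendsto)
    have "(p x * (1 - y))\<^sup>2 \<le> (p x)\<^sup>2" if "0 \<le> y" "y \<le> 1" for x y :: real
      using that mult_left_mono[OF power_le_one[of "1 - y" 2], of "(p x)\<^sup>2"] by (simp add: power_mult_distrib)
    then show "AE x in Imeas. norm ((p x * (1 - plateau (cc m) (dd m) n x))\<^sup>2) \<le> (p x)\<^sup>2" for n
      using plateau_bounds by auto
  qed measurable
  have lim2: "(\<lambda>m. LINT x|Imeas. h m x) \<longlonglongrightarrow> (LINT x|Imeas. 0)"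
  proof (rule integral_dominated_convergence[OF _ _ pint])
    show "h m \<in> borel_measurable Imeas" for m unfolding h_def by measurable
    show "AE x in Imeas. (\<lambda>m. h m x) \<longlonglongrightarrow> 0"
    proof (rule AE_I2)
      fix x assume "x \<in> space Imeas"
      then have x: "-1 < x" "x < 1" by (auto simp: space_restrict_space)
      have l: "(\<lambda>m. 1 / real (m + 2)) \<longlonglongrightarrow> 0" by (rule LIMSEQ_ignore_initial_segment[OF lim_1_over_n])
      have "cc \<longlonglongrightarrow> -1 + 0" unfolding cc_def by (rule tendsto_add[OF tendsto_const l])
      moreover have "dd \<longlonglongrightarrow> 1 - 0" unfolding dd_def by (rule tendsto_diff[OF tendsto_const l])
      ultimately have "eventually (\<lambda>m. cc m < x) sequentially" "eventually (\<lambda>m. x < dd m) sequentially"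
        using x by (auto intro: order_tendstoD)
      then have "eventually (\<lambda>m. h m x = 0) sequentially" by eventually_elim (auto simp: h_def)
      then show "(\<lambda>m. h m x) \<longlonglongrightarrow> 0" by (rule tendsto_eventually)
    qed
    show "AE x in Imeas. norm (h m x) \<le> (p x)\<^sup>2" for m by (auto simp: h_def indicator_def)
  qed simp
  have "eventually (\<lambda>m. (LINT x|Imeas. h m x) < (e/2)\<^sup>2) sequentially"
    using order_tendstoD(2)[OF lim2, of "(e/2)\<^sup>2"] assms by simp
  then obtain m where m: "(LINT x|Imeas. h m x) < (e/2)\<^sup>2" by (auto simp: eventually_sequentially)
  then have "eventually (\<lambda>n. (LINT x|Imeas. (p x * (1 - plateau (cc m) (dd m) n x))\<^sup>2) < (e/2)\<^sup>2) sequentially"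
    by (rule order_tendstoD(2)[OF lim1])
  then obtain n where n: "(LINT x|Imeas. (p x * (1 - plateau (cc m) (dd m) n x))\<^sup>2) < (e/2)\<^sup>2"
    by (auto simp: eventually_sequentially)
  have gL2: "g m n \<in> L2_on (-1) 1" using tg by (rule test_function_L2)
  have "(norm (to_L2I p - to_L2I (g m n)))\<^sup>2 = (LINT x|Imeas. (p x * (1 - plateau (cc m) (dd m) n x))\<^sup>2)"
    unfolding to_L2I_diff[OF pL2 gL2] norm_to_L2I[OF L2I_diff[OF pL2 gL2]] by (simp add: g_def algebra_simps)
  then have "(norm (to_L2I p - to_L2I (g m n)))\<^sup>2 < (e/2)\<^sup>2" using n by simp
  then have "norm (to_L2I p - to_L2I (g m n)) < e/2" by (rule power2_less_imp_less) (use assms in simp)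
  then have "dist (to_L2I (g m n)) X < e"
    using 1 dist_triangle_half_l[of "to_L2I (g m n)" "to_L2I p" e X] by (simp add: dist_norm norm_minus_commute)
  then show ?thesis using tg by blast
qed

lemma inner_test_functions_eq_0:
  fixes X :: L2I
  assumes "\<And>\<phi>. test_function (-1) 1 \<phi> \<Longrightarrow> inner X (to_L2I \<phi>) = 0"
  shows "X = 0"
proof (rule ccontr)
  assume "X \<noteq> 0"
  then obtain \<phi> where \<phi>: "test_function (-1) 1 \<phi>" "dist (to_L2I \<phi>) X < norm X"
    using test_function_dense[of "norm X" X] by auto
  have "(norm X)\<^sup>2 = inner X (X - to_L2I \<phi>)"
    using assms[OF \<phi>(1)] by (simp add: inner_diff_right power2_norm_eq_inner)
  also have "\<dots> \<le> norm X * norm (X - to_L2I \<phi>)" by (rule norm_cauchy_schwarz)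
  also have "\<dots> < norm X * norm X"
    using \<phi>(2) \<open>X \<noteq> 0\<close> by (intro mult_strict_left_mono) (auto simp: dist_norm norm_minus_commute)
  finally show False by (simp add: power2_eq_square)
qed

lemma LINT_Imeas_eq_integral:
  fixes f :: "real \<Rightarrow> real"
  assumes "integrable Imeas f"
  shows "(LINT x|Imeas. f x) = integral {-1..1} f"
  using lebesgue_integral_eq_integral[OF assms] integral_open_interval_real[of "-1" 1 f] by simp

lemma L2_integrable:
  fixes f :: "real \<Rightarrow> real"
  assumes "f \<in> L2_on (-1) 1"
  shows "integrable Imeas f"
  using L2I_mult[OF assms L2_continuous[of "\<lambda>_. 1"]] by simp

text \<open>Mean zero makes the primitive that vanishes to the left of the support vanish to its
  right as well.\<close>

lemma test_function_antiderivative: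
  assumes g: "test_function (-1) 1 g" and 0: "(LINT x|Imeas. g x) = 0"
  shows "\<exists>\<phi>. test_function (-1) 1 \<phi> \<and> deriv \<phi> = g"
proof -
  obtain c d where cd: "-1 < c" "c < d" "d < 1" "\<And>x. x \<notin> {c<..<d} \<Longrightarrow> g x = 0" "smooth g"
    using test_functionE[OF g] by auto
  define \<phi> where "\<phi> x = integral {c..x} g" for x
  have cont: "continuous_on A g" for A using cd(5) by (rule smooth_continuous)
  have int: "g integrable_on {a..b}" for a b by (intro integrable_continuous_interval cont)
  have left: "\<phi> x = 0" if "x \<le> c" for x
    using that by (cases "x = c") (auto simp: \<phi>_def)
  have tot: "integral {-1..1} g = 0"
    using 0 LINT_Imeas_eq_integral[OF L2_integrable[OF test_function_L2[OF g]]] by simp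
  have z: "integral {a..b} g = 0" if "b \<le> c \<or> d \<le> a" for a b
  proof -
    have "integral {a..b} g = integral {a..b} (\<lambda>_. 0)"
      by (rule integral_cong) (use that cd(4) in auto)
    then show ?thesis by simp
  qed
  have right: "\<phi> x = 0" if "x \<ge> d" for x
  proof -
    have "integral {-1..x} g = integral {-1..c} g + integral {c..x} g"
      using Henstock_Kurzweil_Integration.integral_combine[of "-1" c x g] int that cd by simp
    moreover have "integral {-1..1} g = integral {-1..d} g + integral {d..1} g"
      using Henstock_Kurzweil_Integration.integral_combine[of "-1" d 1 g] int cd by simp
    moreover have "integral {-1..x} g = integral {-1..d} g + integral {d..x} g"
      using Henstock_Kurzweil_Integration.integral_combine[of "-1" d x g] int that cd by simp
    ultimately show ?thesis using tot z by (simp add: \<phi>_def)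
  qed
  have der: "(\<phi> has_real_derivative g x) (at x)" for x
  proof (cases "x < c")
    case True
    have "((\<lambda>_. 0) has_real_derivative 0) (at x)" by simp
    then have "(\<phi> has_real_derivative 0) (at x)"
      by (rule has_field_derivative_transform_within_open[of _ _ _ "{..<c}"]) (use True left in auto)
    then show ?thesis using True cd(4) by simp
  next
    case False
    \<comment> \<open>A base point left of \<open>c\<close> keeps \<open>x\<close> in the interior
      of the interval, so the derivative is two-sided also at \<open>c\<close>.\<close>
    define \<psi> where "\<psi> x = integral {c - 1..x} g" for x
    have "(\<psi> has_real_derivative g x) (at x within {c - 1..x + 1})"
      unfolding \<psi>_def by (rule integral_has_real_derivative) (use False cont in auto)
    then have "(\<psi> has_real_derivative g x) (at x)"
      using False by (simp add: at_within_Icc_at)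
    moreover have eq: "\<psi> y = \<phi> y" if "y > c - 1" for y
    proof (cases "y \<ge> c")
      case True
      then show ?thesis using Henstock_Kurzweil_Integration.integral_combine[of "c - 1" c y g] int z[of c "c - 1"] by (simp add: \<psi>_def \<phi>_def)
    next
      case False
      then show ?thesis using z[of y "c - 1"] left[of y] by (simp add: \<psi>_def)
    qed
    ultimately show ?thesis
      by (elim has_field_derivative_transform_within_open[where S = "{c - 1<..}"]) (use False in auto)
  qed
  have "test_function (-1) 1 \<phi>"
    by (rule test_functionI[of _ _ c d]) (use cd der smoothI_deriv left right in auto)
  moreover have "deriv \<phi> = g" using der by (rule deriv_eqI)
  ultimately show ?thesis by blast
qed

text \<open>With \<open>\<theta>\<close> a fixed test function of integral 1, subtracting from a
  test function \<open>g\<close> its integral times \<open>\<theta>\<close> leaves integral 0, hence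
  the derivative of a test function. For \<open>C\<close> the integral of
  \<open>\<theta> * r\<close>, the difference \<open>r - C\<close> is therefore orthogonal to all
  test functions.\<close>

lemma du_Bois_Reymond:
  assumes r: "r \<in> L2_on (-1) 1"
    and orth: "\<And>\<phi>. test_function (-1) 1 \<phi> \<Longrightarrow> (LINT x|Imeas. deriv \<phi> x * r x) = 0"
  shows "\<exists>C. AE x in Imeas. r x = C"
proof -
  define \<theta>0 where "\<theta>0 = plateau (-1/2) (1/2) 1"
  have t0: "test_function (-1) 1 \<theta>0" unfolding \<theta>0_def by (rule test_function_plateau) auto
  have s0: "(LINT x|Imeas. \<theta>0 x) > 0"
  proof -
    have i0: "integrable Imeas \<theta>0" by (intro L2_integrable test_function_L2[OF t0])
    have "(LINT x|Imeas. \<theta>0 x) \<noteq> 0"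
    proof
      assume "(LINT x|Imeas. \<theta>0 x) = 0"
      then have "AE x in Imeas. \<theta>0 x = 0"
        by (subst (asm) integral_nonneg_eq_0_iff_AE) (use i0 plateau_bounds in \<open>auto simp: \<theta>0_def\<close>)
      then have "to_L2I \<theta>0 = to_L2I (\<lambda>_. 0)"
        by (subst to_L2I_eq_iff) (auto intro: test_function_L2[OF t0] L2I_zero)
      then have "integral {-1..1} (\<lambda>x. (\<theta>0 x)\<^sup>2) = 0"
        using norm_to_L2I[OF test_function_L2[OF t0]] norm_to_L2I[OF L2I_zero] LINT_Imeas_eq_integral[of "\<lambda>x. (\<theta>0 x)\<^sup>2"] test_function_L2[OF t0]
        by (simp add: L2I_iff)
      moreover have "continuous_on {-1..1} (\<lambda>x. (\<theta>0 x)\<^sup>2)"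
        by (intro continuous_intros smooth_continuous test_function_smooth[OF t0])
      ultimately have "\<forall>x\<in>{-1..1}. (\<theta>0 x)\<^sup>2 = 0"
        using integral_eq_0_iff[of "-1" 1 "\<lambda>x. (\<theta>0 x)\<^sup>2"] by auto
      then have "\<theta>0 0 = 0" by auto
      moreover have "half_bump (1/2) > 0" by (simp add: half_bump_bounds)
      ultimately show False by (simp add: \<theta>0_def plateau_def)
    qed
    moreover have "(LINT x|Imeas. \<theta>0 x) \<ge> 0" by (rule Bochner_Integration.integral_nonneg) (simp add: \<theta>0_def plateau_bounds)
    ultimately show ?thesis by linarith
  qed
  define \<theta> where "\<theta> x = inverse (LINT x|Imeas. \<theta>0 x) * \<theta>0 x" for x
  have \<theta>: "test_function (-1) 1 \<theta>"
  proof (rule test_functionI[of _ _ "-1/2" "1/2"])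
    show "smooth \<theta>" unfolding \<theta>_def \<theta>0_def by (rule smooth_mult[OF smooth_const smooth_plateau])
  qed (auto simp: \<theta>_def \<theta>0_def plateau_eq_0)
  have \<theta>1: "(LINT x|Imeas. \<theta> x) = 1" using s0 by (simp add: \<theta>_def)
  define C where "C = (LINT x|Imeas. \<theta> x * r x)"
  have cL2: "(\<lambda>x. C) \<in> L2_on (-1) 1" by (rule L2_continuous) auto
  have "to_L2I (\<lambda>x. r x - C) = 0"
  proof (rule inner_test_functions_eq_0)
    fix g assume g: "test_function (-1) 1 g"
    define s where "s = (LINT x|Imeas. g x)"
    note gL2 = test_function_L2[OF g] and \<theta>L2 = test_function_L2[OF \<theta>]
    obtain c d where cd: "-1 < c" "c < d" "d < 1" "\<And>x. x \<notin> {c<..<d} \<Longrightarrow> g x = 0" "smooth g"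
      using test_functionE[OF g] by auto
    obtain c' d' where cd': "-1 < c'" "c' < d'" "d' < 1" "\<And>x. x \<notin> {c'<..<d'} \<Longrightarrow> \<theta> x = 0" "smooth \<theta>"
      using test_functionE[OF \<theta>] by auto
    have "test_function (-1) 1 (\<lambda>x. g x - s * \<theta> x)"
    proof (rule test_functionI[of _ _ "min c c'" "max d d'"])
      show "smooth (\<lambda>x. g x - s * \<theta> x)" using cd(5) cd'(5) by (intro smooth_diff smooth_mult smooth_const)
      show "g x - s * \<theta> x = 0" if "x \<notin> {min c c'..max d d'}" for x
      proof -
        have "x \<notin> {c<..<d}" "x \<notin> {c'<..<d'}" using that by auto
        then show ?thesis using cd(4) cd'(4) by simp
      qed
    qed (use cd cd' in auto)
    moreover have "(LINT x|Imeas. g x - s * \<theta> x) = 0"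
      using L2_integrable[OF gL2] L2_integrable[OF \<theta>L2] \<theta>1 by (simp add: s_def)
    ultimately obtain \<phi> where \<phi>: "test_function (-1) 1 \<phi>" "deriv \<phi> = (\<lambda>x. g x - s * \<theta> x)"
      using test_function_antiderivative by blast
    have "0 = (LINT x|Imeas. (g x - s * \<theta> x) * r x)" using orth[OF \<phi>(1)] \<phi>(2) by simp
    also have "\<dots> = (LINT x|Imeas. g x * r x - s * (\<theta> x * r x))" by (simp add: algebra_simps)
    also have "\<dots> = (LINT x|Imeas. g x * r x) - s * C"
      using L2I_mult[OF gL2 r] L2I_mult[OF \<theta>L2 r] by (simp add: C_def)
    also have "\<dots> = (LINT x|Imeas. (r x - C) * g x)"
      using L2I_mult[OF gL2 r] L2_integrable[OF gL2] by (simp add: s_def algebra_simps)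
    also have "\<dots> = inner (to_L2I (\<lambda>x. r x - C)) (to_L2I g)"
      by (rule inner_to_L2I[symmetric]) (intro L2I_diff r cL2 gL2)+
    finally show "inner (to_L2I (\<lambda>x. r x - C)) (to_L2I g) = 0" by simp
  qed
  then have "to_L2I r = to_L2I (\<lambda>x. C)" using to_L2I_diff[OF r cL2] by simp
  then show ?thesis using to_L2I_eq_iff[OF r cL2] by blast
qed

section \<open>Domain of A: symmetry against test functions and existence of a continuous
  flux\<close>

section \<open>The domain of the operator\<close>

text \<open>The bridge from Lebesgue integrals over the open interval to gauge integrals over closed
  subintervals, where the fundamental theorem of calculus is applied; the two end points form a null
  set.\<close>

lemma integrable_interval_HK:
  fixes f :: "real \<Rightarrow> real"
  assumes "integrable (lebesgue_on {a<..<b}) f" "a \<le> c" "d \<le> b"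
  shows "f absolutely_integrable_on {c..d}"
proof -
  have "f absolutely_integrable_on {a<..<b}"
    using assms(1) by (simp add: set_integrable_def integrable_restrict_space)
  then have "f absolutely_integrable_on {a..b}"
    by (rule absolutely_integrable_spike_set) (auto intro: negligible_subset[of "{a, b}"])
  then show ?thesis by (rule set_integrable_subset) (use assms in auto)
qed

lemma LINT_indicator_eq_integral:
  fixes h :: "real \<Rightarrow> real"
  assumes "integrable Imeas (\<lambda>x. indicator {c..d} x * h x)" "-1 \<le> c" "d \<le> 1"
  shows "(LINT x|Imeas. indicator {c..d} x * h x) = integral {c..d} h"
proof -
  have eq: "(\<lambda>x. indicator {c..d} x * h x) = (\<lambda>x. if x \<in> {c..d} then h x else 0)"
    by (auto simp: indicator_def)
  have "(LINT x|Imeas. indicator {c..d} x * h x) = integral {-1..1} (\<lambda>x. if x \<in> {c..d} then h x else 0)"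
    using LINT_Imeas_eq_integral[OF assms(1)] by (simp only: eq)
  also have "\<dots> = integral ({c..d} \<inter> {-1..1}) h"
    by (rule integral_restrict_Int)
  also have "{c..d} \<inter> {-1..1} = {c..d}" using assms by auto
  finally show ?thesis .
qed

lemma L2_mult_continuous:
  fixes f g :: "real \<Rightarrow> real"
  assumes "f \<in> L2_on (-1) 1" "continuous_on {c..d} g"
  shows "(\<lambda>x. indicator {c..d} x * (f x * g x)) \<in> L2_on (-1) 1"
proof -
  have gL: "(\<lambda>x. indicator {c..d} x * g x) \<in> L2_on (-1) 1" using assms(2) by (rule L2_indicator_continuous)
  have [measurable]: "f \<in> borel_measurable Imeas" "(\<lambda>x. indicator {c..d} x * g x) \<in> borel_measurable Imeas"
    using assms gL by (auto simp: L2I_iff)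
  have "bounded (g ` {c..d})" using assms by (intro compact_imp_bounded compact_continuous_image) auto
  then obtain B where B: "\<forall>x\<in>{c..d}. \<bar>g x\<bar> \<le> B" by (auto simp: bounded_real)
  have eq: "(\<lambda>x. indicator {c..d} x * (f x * g x)) = (\<lambda>x. f x * (indicator {c..d} x * g x))" by (auto simp: fun_eq_iff)
  have "integrable Imeas (\<lambda>x. (f x * (indicator {c..d} x * g x))\<^sup>2)"
  proof (rule Bochner_Integration.integrable_bound[of _ "\<lambda>x. B\<^sup>2 * (f x)\<^sup>2"])
    show "AE x in Imeas. norm ((f x * (indicator {c..d} x * g x))\<^sup>2) \<le> norm (B\<^sup>2 * (f x)\<^sup>2)"
    proof (rule AE_I2)
      fix x
      have "(indicator {c..d} x * g x)\<^sup>2 \<le> B\<^sup>2"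
        using B by (auto simp: indicator_def power2_le_iff_abs_le order_trans[OF abs_ge_zero] abs_le_square_iff[symmetric] intro: order_trans[OF _ abs_ge_self])
      then have "(f x)\<^sup>2 * (indicator {c..d} x * g x)\<^sup>2 \<le> (f x)\<^sup>2 * B\<^sup>2" by (rule mult_left_mono) auto
      then show "norm ((f x * (indicator {c..d} x * g x))\<^sup>2) \<le> norm (B\<^sup>2 * (f x)\<^sup>2)"
        by (simp add: power_mult_distrib mult.commute)
    qed
  qed (use assms in \<open>auto simp: L2I_iff\<close>)
  then show ?thesis unfolding eq by (simp add: L2I_iff)
qed

lemma rho_pos: "\<rho>0 > 0 \<Longrightarrow> x \<in> {-1<..<1} \<Longrightarrow> rho \<rho>0 x > 0"
  by (auto simp: rho_def abs_square_less_1 abs_less_iff)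

lemma continuous_rho: "continuous_on A (rho \<rho>0)"
  unfolding rho_def by (intro continuous_intros)

lemma V_space_AC: "w \<in> V_space \<rho> \<Longrightarrow> -1 < c \<Longrightarrow> c \<le> d \<Longrightarrow> d < 1 \<Longrightarrow> abs_cont_on c d w"
  by (simp add: V_space_def AC_loc_def)

lemma V_space_continuous:
  assumes "w \<in> V_space \<rho>" shows "continuous_on {-1<..<1} w"
proof (rule continuous_at_imp_continuous_on, rule ballI)
  fix x :: real assume x: "x \<in> {-1<..<1}"
  have "continuous_on {(x-1)/2..(x+1)/2} w"
    using x by (intro abs_cont_on_imp_continuous V_space_AC[OF assms]) auto
  then show "isCont w x" using x by (intro continuous_on_interior[of "{(x-1)/2..(x+1)/2}"]) auto
qed

text \<open>Cauchy-Schwarz applied to \<open>sqrt rho * w'\<close> and \<open>1 / sqrt rho\<close>: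
  the energy controls increments of \<open>w\<close> through the integral of \<open>1 / rho\<close>,
  which diverges only logarithmically at the end points.\<close>

lemma V_space_FTC:
  assumes "\<rho>0 > 0" "w \<in> V_space (rho \<rho>0)" "-1 < c" "c \<le> d" "d < 1"
  shows "integrable Imeas (\<lambda>x. indicator {c..d} x * deriv w x)"
    and "integral {c..d} (deriv w) = w d - w c"
    and "(w d - w c)\<^sup>2 \<le> integral {c..d} (\<lambda>x. 1 / rho \<rho>0 x) * (LINT x|Imeas. (sqrt (rho \<rho>0 x) * deriv w x)\<^sup>2)"
proof -
  let ?f = "\<lambda>x. sqrt (rho \<rho>0 x) * deriv w x" and ?g = "\<lambda>x. indicator {c..d} x * (1 / sqrt (rho \<rho>0 x))"
  have sub: "{c..d} \<subseteq> {-1<..<1}" using assms by auto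
  have pos: "rho \<rho>0 x > 0" if "x \<in> {c..d}" for x using rho_pos[OF assms(1)] that sub by blast
  have f: "?f \<in> L2_on (-1) 1" using assms(2) by (simp add: V_space_def)
  have g: "?g \<in> L2_on (-1) 1"
    by (rule L2_indicator_continuous) (use pos in \<open>intro continuous_intros continuous_rho, force\<close>)
  have fg: "?f x * ?g x = indicator {c..d} x * deriv w x" for x
    using pos[of x] by (auto simp: indicator_def)
  show int: "integrable Imeas (\<lambda>x. indicator {c..d} x * deriv w x)"
    using L2I_mult[OF f g] unfolding fg .
  show w: "integral {c..d} (deriv w) = w d - w c"
    using abs_cont_on_has_integral_deriv[OF assms(4) V_space_AC[OF assms(2-5)]] by (rule integral_unique)
  have "w d - w c = inner (to_L2I ?f) (to_L2I ?g)"
    unfolding inner_to_L2I[OF f g] fg w[symmetric] using LINT_indicator_eq_integral[OF int] assms by simp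
  then have "(w d - w c)\<^sup>2 \<le> (norm (to_L2I ?f) * norm (to_L2I ?g))\<^sup>2"
    using Cauchy_Schwarz_ineq2[of "to_L2I ?f" "to_L2I ?g"] by (intro abs_le_square_iff[THEN iffD1]) simp
  also have "\<dots> = (norm (to_L2I ?g))\<^sup>2 * (norm (to_L2I ?f))\<^sup>2" by (simp add: power_mult_distrib)
  also have "(norm (to_L2I ?g))\<^sup>2 = (LINT x|Imeas. indicator {c..d} x * (1 / rho \<rho>0 x))"
    unfolding norm_to_L2I[OF g]
    by (rule Bochner_Integration.integral_cong) (use pos in \<open>auto simp: indicator_def power_divide order_less_imp_le\<close>)
  also have "\<dots> = integral {c..d} (\<lambda>x. 1 / rho \<rho>0 x)"
  proof (rule LINT_indicator_eq_integral)
    show "integrable Imeas (\<lambda>x. indicator {c..d} x * (1 / rho \<rho>0 x))"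
      by (rule L2_integrable[OF L2_indicator_continuous]) (use pos in \<open>intro continuous_intros continuous_rho, force\<close>)
  qed (use assms in auto)
  finally show "(w d - w c)\<^sup>2 \<le> integral {c..d} (\<lambda>x. 1 / rho \<rho>0 x) * (LINT x|Imeas. (sqrt (rho \<rho>0 x) * deriv w x)\<^sup>2)"
    by (simp add: norm_to_L2I[OF f])
qed

lemma smooth_rho: "smooth (rho \<rho>0)"
  unfolding rho_def by (intro smooth_mult smooth_diff smooth_power smooth_const smooth_id)

lemma test_function_rho_deriv:
  assumes "test_function (-1) 1 z"
  shows "test_function (-1) 1 (\<lambda>x. rho \<rho>0 x * deriv z x)" "test_function (-1) 1 (deriv z)"
proof -
  obtain c d where cd: "-1 < c" "c < d" "d < 1" "\<And>x. x \<notin> {c<..<d} \<Longrightarrow> z x = 0" "smooth z"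
    using test_functionE[OF assms] by auto
  have z0: "deriv z x = 0" if "x \<notin> {c..d}" for x
  proof -
    have "((\<lambda>_. 0) has_real_derivative 0) (at x)" by simp
    then have "(z has_real_derivative 0) (at x)"
      by (rule has_field_derivative_transform_within_open[of _ _ _ "- {c..d}"]) (use that cd in auto)
    then show ?thesis by (rule DERIV_imp_deriv)
  qed
  show "test_function (-1) 1 (\<lambda>x. rho \<rho>0 x * deriv z x)"
    by (rule test_functionI[of _ _ c d]) (use cd z0 in \<open>auto intro!: smooth_mult smooth_rho smooth_deriv\<close>)
  show "test_function (-1) 1 (deriv z)"
    by (rule test_functionI[of _ _ c d]) (use cd z0 in \<open>auto intro!: smooth_deriv\<close>)
qed

lemma test_function_deriv: "test_function (-1) 1 z \<Longrightarrow> test_function (-1) 1 (deriv z)"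
  by (rule test_function_rho_deriv)

text \<open>\<open>w\<close> is absolutely continuous on compact subintervals only. The supports of
  \<open>rho * z'\<close> and of its derivative lie in some \<open>{a..b}\<close> inside the open
  interval; there the product with \<open>w\<close> is absolutely continuous and has zero boundary
  values.\<close>

lemma V_space_by_parts:
  assumes "\<rho>0 > 0" and w: "w \<in> V_space (rho \<rho>0)" and z: "test_function (-1) 1 z"
  shows "(LINT x|Imeas. deriv z x * (rho \<rho>0 x * deriv w x)) =
     - (LINT x|Imeas. w x * deriv (\<lambda>x. rho \<rho>0 x * deriv z x) x)"
proof -
  define \<phi> where "\<phi> = (\<lambda>x. rho \<rho>0 x * deriv z x)"
  have t: "test_function (-1) 1 \<phi>" unfolding \<phi>_def by (rule test_function_rho_deriv[OF z])
  obtain c d where cd: "-1 < c" "c < d" "d < 1" "\<And>x. x \<notin> {c<..<d} \<Longrightarrow> \<phi> x = 0" "smooth \<phi>"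
    using test_functionE[OF t] by auto
  obtain c' d' where cd': "-1 < c'" "c' < d'" "d' < 1" "\<And>x. x \<notin> {c'<..<d'} \<Longrightarrow> deriv \<phi> x = 0" "smooth (deriv \<phi>)"
    using test_functionE[OF test_function_deriv[OF t]] by auto
  define a b where "a = min c c'" and "b = max d d'"
  have ab: "-1 < a" "a \<le> b" "b < 1" using cd cd' by (auto simp: a_def b_def)
  have out: "\<phi> x = 0" "deriv \<phi> x = 0" if "x \<notin> {a<..<b}" for x
  proof -
    have "x \<notin> {c<..<d}" "x \<notin> {c'<..<d'}" using that by (auto simp: a_def b_def)
    then show "\<phi> x = 0" "deriv \<phi> x = 0" using cd(4) cd'(4) by simp_all
  qed
  have ac: "abs_cont_on a b w" using ab by (intro V_space_AC[OF w])
  have "abs_cont_on a b \<phi>"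
  proof -
    have "bounded (deriv \<phi> ` {a..b})" by (intro compact_imp_bounded compact_continuous_image smooth_continuous cd') auto
    then obtain B where B: "\<forall>x\<in>{a..b}. \<bar>deriv \<phi> x\<bar> \<le> B" by (auto simp: bounded_real)
    show ?thesis
    proof (rule lipschitz_imp_abs_cont_on[of _ _ _ B])
      fix x y assume xy: "x \<in> {a..b}" "y \<in> {a..b}"
      have "norm (\<phi> x - \<phi> y) \<le> B * norm (x - y)"
        by (rule field_differentiable_bound[of "{a..b}" \<phi> "deriv \<phi>"])
           (use B xy in \<open>auto intro: has_field_derivative_at_within smooth_has_derivative[OF cd(5)]\<close>)
      then show "\<bar>\<phi> x - \<phi> y\<bar> \<le> B * \<bar>x - y\<bar>" by simp
    qed
  qed
  then have "((\<lambda>x. deriv w x * \<phi> x + w x * deriv \<phi> x) has_integral w b * \<phi> b - w a * \<phi> a) {a..b}"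
  proof (rule abs_cont_on_has_integral[OF ab(2) abs_cont_on_mult[OF ac] abs_cont_on_differentiable_ae[OF ac]])
    fix x assume "x \<in> {a..b} - {x \<in> {a..b}. \<not> w field_differentiable at x}"
    then have "(w has_real_derivative deriv w x) (at x)" by (simp add: field_differentiable_derivI)
    from DERIV_mult[OF this smooth_has_derivative[OF cd(5), of x]]
    have "((\<lambda>x. w x * \<phi> x) has_real_derivative deriv w x * \<phi> x + w x * deriv \<phi> x) (at x)"
      by (rule DERIV_cong) simp
    then show "((\<lambda>x. w x * \<phi> x) has_real_derivative deriv w x * \<phi> x + w x * deriv \<phi> x) (at x within {a..b})"
      by (rule has_field_derivative_at_within)
  qed
  then have 0: "integral {a..b} (\<lambda>x. deriv w x * \<phi> x + w x * deriv \<phi> x) = 0"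
    using out[of a] out[of b] by (simp add: integral_unique)
  have "(\<lambda>x. sqrt (rho \<rho>0 x) * deriv z x) \<in> L2_on (-1) 1"
    by (intro L2_continuous continuous_intros continuous_rho smooth_continuous smooth_deriv test_function_smooth[OF z])
  moreover have "(\<lambda>x. sqrt (rho \<rho>0 x) * deriv w x) \<in> L2_on (-1) 1" using w by (simp add: V_space_def)
  ultimately have "integrable Imeas (\<lambda>x. (sqrt (rho \<rho>0 x) * deriv z x) * (sqrt (rho \<rho>0 x) * deriv w x))" by (rule L2I_mult)
  moreover have "(sqrt (rho \<rho>0 x) * deriv z x) * (sqrt (rho \<rho>0 x) * deriv w x) = deriv w x * \<phi> x" if "x \<in> {-1<..<1}" for x
    using rho_pos[OF assms(1) that] by (simp add: \<phi>_def)
  ultimately have i1: "integrable Imeas (\<lambda>x. deriv w x * \<phi> x)"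
    by (subst Bochner_Integration.integrable_cong[OF refl, symmetric]) (auto simp: space_restrict_space)
  have i2: "integrable Imeas (\<lambda>x. w x * deriv \<phi> x)"
    using w by (intro L2I_mult test_function_L2[OF test_function_deriv[OF t]]) (simp add: V_space_def)
  have ind: "deriv w x * \<phi> x + w x * deriv \<phi> x = indicator {a..b} x * (deriv w x * \<phi> x + w x * deriv \<phi> x)" for x
    using out[of x] by (cases "x \<in> {a<..<b}") (auto simp: indicator_def)
  have "(LINT x|Imeas. deriv w x * \<phi> x) + (LINT x|Imeas. w x * deriv \<phi> x) = (LINT x|Imeas. deriv w x * \<phi> x + w x * deriv \<phi> x)"
    using i1 i2 by simp
  also have "\<dots> = (LINT x|Imeas. indicator {a..b} x * (deriv w x * \<phi> x + w x * deriv \<phi> x))" by (simp only: ind[symmetric])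
  also have "\<dots> = 0"
  proof (subst LINT_indicator_eq_integral)
    show "integrable Imeas (\<lambda>x. indicator {a..b} x * (deriv w x * \<phi> x + w x * deriv \<phi> x))"
      unfolding ind[symmetric] by (rule Bochner_Integration.integrable_add[OF i1 i2])
  qed (use ab 0 in auto)
  finally show ?thesis by (simp add: \<phi>_def mult_ac)
qed

text \<open>One integration by parts is the definition of the weak derivative, the other is
  \<open>V_space_by_parts\<close>. Testing with compactly supported functions keeps the degenerate
  end points out of the identity.\<close>

lemma graph_A_symmetric:
  assumes "\<rho>0 > 0" and XY: "(X, Y) \<in> graph_A (rho \<rho>0)" and z: "test_function (-1) 1 z"
  shows "inner Y (to_L2I z) = inner X (to_L2I (deriv (\<lambda>x. rho \<rho>0 x * deriv z x)))"
proof -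
  obtain w v where wv: "X = to_L2I w" "Y = to_L2I v" "w \<in> dom_A (rho \<rho>0)" "v \<in> L2_on (-1) 1"
     "weak_deriv (-1) 1 (\<lambda>x. rho \<rho>0 x * deriv w x) v"
    using XY by (auto simp: graph_A_def)
  have wV: "w \<in> V_space (rho \<rho>0)" using wv by (simp add: dom_A_def)
  then have wL: "w \<in> L2_on (-1) 1" by (simp add: V_space_def)
  note zL = test_function_L2[OF z] and bL = test_function_L2[OF test_function_deriv[OF test_function_rho_deriv(1)[OF z]]]
  have "inner Y (to_L2I z) = (LINT x|Imeas. z x * v x)"
    using inner_to_L2I[OF wv(4) zL] wv by (simp add: mult.commute)
  also have "\<dots> = - (LINT x|Imeas. deriv z x * (rho \<rho>0 x * deriv w x))"
    using wv(5) z by (simp add: weak_deriv_def)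
  also have "\<dots> = (LINT x|Imeas. w x * deriv (\<lambda>x. rho \<rho>0 x * deriv z x) x)"
    using V_space_by_parts[OF assms(1) wV z] by simp
  also have "\<dots> = inner X (to_L2I (deriv (\<lambda>x. rho \<rho>0 x * deriv z x)))"
    using inner_to_L2I[OF wL bL] wv by simp
  finally show ?thesis .
qed

lemma L2_integral_bound:
  fixes v :: "real \<Rightarrow> real"
  assumes "v \<in> L2_on (-1) 1" "-1 \<le> c" "d \<le> 1"
  shows "v absolutely_integrable_on {c..d}" "\<bar>integral {c..d} v\<bar> \<le> 2 * norm (to_L2I v)"
proof -
  show "v absolutely_integrable_on {c..d}" by (rule integrable_interval_HK[OF L2_integrable[OF assms(1)] assms(2,3)])
  have g: "(\<lambda>x. indicator {c..d} x * (1::real)) \<in> L2_on (-1) 1" by (rule L2_indicator_continuous) simp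
  have 1: "(\<lambda>x. 1::real) \<in> L2_on (-1) 1" by (rule L2_continuous) simp
  have "integral {c..d} v = inner (to_L2I v) (to_L2I (\<lambda>x. indicator {c..d} x * (1::real)))"
    unfolding inner_to_L2I[OF assms(1) g]
    using LINT_indicator_eq_integral[of c d v] L2I_mult[OF assms(1) g] assms by (simp add: mult.commute)
  then have "\<bar>integral {c..d} v\<bar> \<le> norm (to_L2I v) * norm (to_L2I (\<lambda>x. indicator {c..d} x * (1::real)))"
    using Cauchy_Schwarz_ineq2 by metis
  also have "\<dots> \<le> norm (to_L2I v) * 2"
  proof (rule mult_left_mono)
    have "(norm (to_L2I (\<lambda>x. indicator {c..d} x * (1::real))))\<^sup>2 \<le> (LINT x|Imeas. 1)"
      unfolding norm_to_L2I[OF g] using g L2_integrable[OF 1]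
      by (intro integral_mono) (auto simp: L2I_iff indicator_def)
    also have "\<dots> = 2" using LINT_Imeas_eq_integral[OF L2_integrable[OF 1]] by simp
    also have "\<dots> \<le> 2\<^sup>2" by simp
    finally show "norm (to_L2I (\<lambda>x. indicator {c..d} x * (1::real))) \<le> 2" by (rule power2_le_imp_le) simp
  qed simp
  finally show "\<bar>integral {c..d} v\<bar> \<le> 2 * norm (to_L2I v)" by simp
qed

text \<open>Since \<open>v\<close> is merely square integrable, the defect \<open>E v\<close> of the
  identity is studied as a functional of \<open>v\<close>. It respects differences, is bounded by
  the norm of \<open>v\<close>, and is zero on test functions by the fundamental theorem of
  calculus; density does the rest.\<close>

lemma L2_primitive_by_parts:
  fixes v y y' :: "real \<Rightarrow> real"
  assumes v: "v \<in> L2_on (-1) 1" and cd: "-1 \<le> c" "c \<le> d" "d \<le> 1"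
    and y: "\<And>x. x \<in> {c..d} \<Longrightarrow> (y has_real_derivative y' x) (at x within {c..d})"
    and y': "continuous_on {c..d} y'"
  shows "(\<lambda>x. v x * y x) absolutely_integrable_on {c..d}"
    "integral {c..d} (\<lambda>x. v x * y x) = integral {-1..d} v * y d - integral {-1..c} v * y c
       - integral {c..d} (\<lambda>x. integral {-1..x} v * y' x)"
proof -
  have yc: "continuous_on {c..d} y" using y by (rule DERIV_continuous_on)
  have "bounded (y ` {c..d})" "bounded (y' ` {c..d})" using yc y' by (auto intro!: compact_imp_bounded compact_continuous_image)
  then obtain B1 B2 where B12: "\<forall>x\<in>{c..d}. \<bar>y x\<bar> \<le> B1" "\<forall>x\<in>{c..d}. \<bar>y' x\<bar> \<le> B2" by (auto simp: bounded_real)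
  define B where "B = max 1 (max B1 B2)"
  have B: "B \<ge> 1" "\<And>x. x \<in> {c..d} \<Longrightarrow> \<bar>y x\<bar> \<le> B" "\<And>x. x \<in> {c..d} \<Longrightarrow> \<bar>y' x\<bar> \<le> B"
    using B12 by (force simp: B_def)+
  have ai: "(\<lambda>x. v x * y x) absolutely_integrable_on {c..d}" if v: "v \<in> L2_on (-1) 1" for v
  proof -
    have "(\<lambda>x. indicator {c..d} x * (v x * y x)) \<in> L2_on (-1) 1" by (rule L2_mult_continuous[OF v yc])
    then have "(\<lambda>x. indicator {c..d} x * (v x * y x)) absolutely_integrable_on {c..d}"
      by (rule integrable_interval_HK[OF L2_integrable]) (use cd in auto)
    then show ?thesis
      by (rule set_integrable_cong[THEN iffD1, rotated -1]) auto
  qed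
  show "(\<lambda>x. v x * y x) absolutely_integrable_on {c..d}" by (rule ai[OF v])
  define P where "P v x = integral {-1..x} v" for v :: "real \<Rightarrow> real" and x
  have Pc: "continuous_on {c..d} (P v)" if v: "v \<in> L2_on (-1) 1" for v
  proof -
    have "v integrable_on {-1..1}"
      using L2_integral_bound(1)[OF v, of "-1" 1] by (simp add: absolutely_integrable_on_def)
    then have "continuous_on {-1..1} (P v)" unfolding P_def by (rule indefinite_integral_continuous_1)
    then show ?thesis by (rule continuous_on_subset) (use cd in auto)
  qed
  define E where "E v = integral {c..d} (\<lambda>x. v x * y x) - P v d * y d + P v c * y c + integral {c..d} (\<lambda>x. P v x * y' x)" for v
  have int1: "(\<lambda>x. v x * y x) integrable_on {c..d}" if "v \<in> L2_on (-1) 1" for v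
    using ai[OF that] by (simp add: absolutely_integrable_on_def)
  have int2: "(\<lambda>x. P v x * y' x) integrable_on {c..d}" if "v \<in> L2_on (-1) 1" for v
    by (intro integrable_continuous_interval continuous_intros Pc[OF that] y')
  \<comment> \<open>The constant 10 adds 2 for each boundary term, 2 for the left side, and 4 for
    the last integral, which runs over a length of at most 2.\<close>
  have Ebound: "\<bar>E v\<bar> \<le> 10 * B * norm (to_L2I v)" if v: "v \<in> L2_on (-1) 1" for v
  proof -
    define N where "N = norm (to_L2I v)"
    have N: "N \<ge> 0" by (simp add: N_def)
    have Pb: "\<bar>P v x\<bar> \<le> 2 * N" if "x \<in> {c..d}" for x
      unfolding P_def N_def by (rule L2_integral_bound(2)[OF v]) (use that cd in auto)
    have vL: "(\<lambda>x. \<bar>v x\<bar>) \<in> L2_on (-1) 1" using v by (auto simp: L2I_iff)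
    have "norm (to_L2I (\<lambda>x. \<bar>v x\<bar>)) = N"
      unfolding N_def by (rule power2_eq_imp_eq[OF _ norm_ge_zero norm_ge_zero]) (simp add: norm_to_L2I[OF v] norm_to_L2I[OF vL])
    then have av: "\<bar>integral {c..d} (\<lambda>x. \<bar>v x\<bar>)\<bar> \<le> 2 * N" using L2_integral_bound(2)[OF vL, of c d] cd by simp
    have "norm (integral {c..d} (\<lambda>x. v x * y x)) \<le> integral {c..d} (\<lambda>x. B * \<bar>v x\<bar>)"
    proof (rule integral_norm_bound_integral[OF int1[OF v]])
      have "(\<lambda>x. \<bar>v x\<bar>) integrable_on {c..d}"
        using L2_integral_bound(1)[OF vL, of c d] cd by (simp add: absolutely_integrable_on_def)
      then show "(\<lambda>x. B * \<bar>v x\<bar>) integrable_on {c..d}" by (intro integrable_on_mult_right)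
      show "norm (v x * y x) \<le> B * \<bar>v x\<bar>" if "x \<in> {c..d}" for x
        using mult_right_mono[OF B(2)[OF that], of "\<bar>v x\<bar>"] by (simp add: abs_mult mult.commute)
    qed
    also have "\<dots> = B * integral {c..d} (\<lambda>x. \<bar>v x\<bar>)" by (rule Henstock_Kurzweil_Integration.integral_mult_right)
    also have "\<dots> \<le> B * (2 * N)" using av B(1) by (intro mult_left_mono) auto
    finally have 1: "\<bar>integral {c..d} (\<lambda>x. v x * y x)\<bar> \<le> B * (2 * N)" by simp
    have Pyb: "\<bar>P v x * g x\<bar> \<le> 2 * N * B" if "x \<in> {c..d}" "\<bar>g x\<bar> \<le> B" for x g
      unfolding abs_mult using Pb[OF that(1)] that(2) N by (intro mult_mono) auto
    have "norm (integral {c..d} (\<lambda>x. P v x * y' x)) \<le> integral {c..d} (\<lambda>x. 2 * N * B)"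
      by (rule integral_norm_bound_integral[OF int2[OF v]]) (use Pyb B in auto)
    also have "\<dots> = (d - c) * (2 * N * B)" using cd by simp
    also have "\<dots> \<le> 2 * (2 * N * B)" using cd N B(1) by (intro mult_right_mono) auto
    finally have 2: "\<bar>integral {c..d} (\<lambda>x. P v x * y' x)\<bar> \<le> 2 * (2 * N * B)" by simp
    have 3: "\<bar>P v c * y c\<bar> \<le> 2 * N * B" "\<bar>P v d * y d\<bar> \<le> 2 * N * B"
      using Pyb[of c y] Pyb[of d y] B cd by auto
    have "\<bar>E v\<bar> \<le> B * (2 * N) + 2 * N * B + 2 * N * B + 2 * (2 * N * B)" using 1 2 3 unfolding E_def by linarith
    then show ?thesis by (simp add: N_def algebra_simps)
  qed
  have E0: "E \<phi> = 0" if \<phi>: "test_function (-1) 1 \<phi>" for \<phi>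
  proof -
    have \<phi>c: "continuous_on A \<phi>" for A by (intro smooth_continuous test_function_smooth[OF \<phi>])
    have Pd: "(P \<phi> has_real_derivative \<phi> x) (at x within {c..d})" if "x \<in> {c..d}" for x
    proof -
      have "(P \<phi> has_real_derivative \<phi> x) (at x within {-1..1})"
        unfolding P_def by (rule integral_has_real_derivative[OF \<phi>c]) (use that cd in auto)
      then show ?thesis by (rule DERIV_subset) (use cd in auto)
    qed
    have "((\<lambda>x. \<phi> x * y x + P \<phi> x * y' x) has_integral (P \<phi> d * y d - P \<phi> c * y c)) {c..d}"
    proof (rule fundamental_theorem_of_calculus[OF cd(2)])
      fix x assume x: "x \<in> {c..d}"
      show "((\<lambda>x. P \<phi> x * y x) has_vector_derivative \<phi> x * y x + P \<phi> x * y' x) (at x within {c..d})"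
        using DERIV_mult[OF Pd[OF x] y[OF x]] unfolding has_real_derivative_iff_has_vector_derivative
        by (simp add: add.commute mult.commute)
    qed
    then have "integral {c..d} (\<lambda>x. \<phi> x * y x + P \<phi> x * y' x) = P \<phi> d * y d - P \<phi> c * y c" by (rule integral_unique)
    then show ?thesis
      using Henstock_Kurzweil_Integration.integral_add[OF int1[OF test_function_L2[OF \<phi>]] int2[OF test_function_L2[OF \<phi>]]]
      by (simp add: E_def)
  qed
  have Ediff: "E (\<lambda>x. v x - \<phi> x) = E v - E \<phi>" if L: "v \<in> L2_on (-1) 1" "\<phi> \<in> L2_on (-1) 1" for v \<phi>
  proof -
    have Pdiff: "P (\<lambda>x. v x - \<phi> x) x = P v x - P \<phi> x" if "x \<in> {c..d}" for x
      unfolding P_def using L2_integral_bound(1)[OF L(1), of "-1" x] L2_integral_bound(1)[OF L(2), of "-1" x] that cd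
      by (intro Henstock_Kurzweil_Integration.integral_diff) (auto simp: absolutely_integrable_on_def)
    have "integral {c..d} (\<lambda>x. P (\<lambda>x. v x - \<phi> x) x * y' x) = integral {c..d} (\<lambda>x. P v x * y' x - P \<phi> x * y' x)"
      by (rule Henstock_Kurzweil_Integration.integral_cong) (simp add: Pdiff left_diff_distrib)
    then show ?thesis
      using Henstock_Kurzweil_Integration.integral_diff[OF int1[OF L(1)] int1[OF L(2)]]
        Henstock_Kurzweil_Integration.integral_diff[OF int2[OF L(1)] int2[OF L(2)]] Pdiff[of c] Pdiff[of d] cd
      by (simp add: E_def left_diff_distrib)
  qed
  have "\<bar>E v\<bar> \<le> e" if "e > 0" for e
  proof -
    obtain \<phi> where \<phi>: "test_function (-1) 1 \<phi>" "dist (to_L2I \<phi>) (to_L2I v) < e / (10 * B)"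
      using test_function_dense[of "e / (10 * B)" "to_L2I v"] \<open>e > 0\<close> B(1) by auto
    note \<phi>L = test_function_L2[OF \<phi>(1)]
    have "\<bar>E v\<bar> = \<bar>E (\<lambda>x. v x - \<phi> x)\<bar>" using Ediff[OF v \<phi>L] E0[OF \<phi>(1)] by simp
    also have "\<dots> \<le> 10 * B * norm (to_L2I (\<lambda>x. v x - \<phi> x))" by (rule Ebound[OF L2I_diff[OF v \<phi>L]])
    also have "\<dots> \<le> 10 * B * (e / (10 * B))"
      using \<phi>(2) B(1) unfolding to_L2I_diff[OF v \<phi>L, symmetric]
      by (intro mult_left_mono) (auto simp: dist_norm norm_minus_commute)
    also have "\<dots> = e" using B(1) by simp
    finally show ?thesis .
  qed
  then have "\<bar>E v\<bar> \<le> 0" using field_le_epsilon[of "\<bar>E v\<bar>" 0] by simp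
  then show "integral {c..d} (\<lambda>x. v x * y x) = integral {-1..d} v * y d - integral {-1..c} v * y c
       - integral {c..d} (\<lambda>x. integral {-1..x} v * y' x)"
    by (simp add: E_def P_def)
qed

text \<open>It identifies the continuous representative of a class, so that pointwise values survive
  the passage through \<open>L2I\<close>.\<close>

lemma AE_eq_continuous:
  fixes f g :: "real \<Rightarrow> real"
  assumes "AE x in Imeas. f x = g x" "continuous_on {-1<..<1} f" "continuous_on {-1<..<1} g" "x \<in> {-1<..<1}"
  shows "f x = g x"
proof (rule ccontr)
  assume ne: "f x \<noteq> g x"
  have "open ({-1<..<1} \<inter> (\<lambda>x. f x - g x) -` (- {0}))"
    by (rule continuous_open_preimage[of "{-1<..<1}"]) (auto intro!: continuous_intros assms)
  moreover have "x \<in> {-1<..<1} \<inter> (\<lambda>x. f x - g x) -` (- {0})" using assms ne by auto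
  ultimately obtain e where e: "e > 0" "ball x e \<subseteq> {-1<..<1} \<inter> (\<lambda>x. f x - g x) -` (- {0})"
    using openE by blast
  have "AE x in lebesgue. x \<in> {-1<..<1} \<longrightarrow> f x = g x"
    using assms(1) by (simp add: AE_restrict_space_iff)
  then have "AE y in lebesgue. y \<notin> ball x e" by eventually_elim (use e in auto)
  then have "negligible (ball x e)"
    by (simp add: negligible_iff_null_sets AE_iff_null_sets)
  then show False using e(1) by (simp add: negligible_iff_measure content_ball_pos less_imp_neq)
qed

text \<open>Graph membership gives a weak derivative \<open>v\<close> of \<open>rho * w0'\<close>.
  By \<open>du_Bois_Reymond\<close> that product agrees almost everywhere with a continuous
  primitive \<open>P\<close> of \<open>v\<close>, so by absolute continuity \<open>w\<close> is
  locally an integral of \<open>P / rho\<close> and differentiable at every point. This gives a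
  meaning to derivative data at a single point. The last clause is \<open>P' = v\<close> in weak
  form, boundary terms included.\<close>

lemma graph_A_slice:
  assumes "\<rho>0 > 0" and w: "w \<in> V_space (rho \<rho>0)" and "(to_L2I w, Y) \<in> graph_A (rho \<rho>0)"
  obtains v P where "v \<in> L2_on (-1) 1" "Y = to_L2I v" "continuous_on {-1..1} P"
    "\<And>x. x \<in> {-1<..<1} \<Longrightarrow> (w has_real_derivative P x / rho \<rho>0 x) (at x)"
    "\<And>c d y y'. \<lbrakk>-1 < c; c \<le> d; d < 1; \<And>x. x \<in> {c..d} \<Longrightarrow> (y has_real_derivative y' x) (at x within {c..d});
        continuous_on {c..d} y'\<rbrakk> \<Longrightarrow>
        integral {c..d} (\<lambda>x. v x * y x) = P d * y d - P c * y c - integral {c..d} (\<lambda>x. P x * y' x)"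
proof -
  obtain w0 v where wv: "to_L2I w = to_L2I w0" "Y = to_L2I v" "w0 \<in> dom_A (rho \<rho>0)" and v: "v \<in> L2_on (-1) 1"
     and wd: "weak_deriv (-1) 1 (\<lambda>x. rho \<rho>0 x * deriv w0 x) v"
    using assms(3) by (auto simp: graph_A_def)
  have w0: "w0 \<in> V_space (rho \<rho>0)" and pL: "(\<lambda>x. rho \<rho>0 x * deriv w0 x) \<in> L2_on (-1) 1"
    using wv(3) by (auto simp: dom_A_def H1_on_def)
  have wL: "w \<in> L2_on (-1) 1" "w0 \<in> L2_on (-1) 1" using w w0 by (auto simp: V_space_def)
  have eq: "w x = w0 x" if "x \<in> {-1<..<1}" for x
    using wv(1) to_L2I_eq_iff[OF wL] AE_eq_continuous[OF _ V_space_continuous[OF w] V_space_continuous[OF w0] that] by blast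
  define Q where "Q x = integral {-1..x} v" for x
  have "v integrable_on {-1..1}" using L2_integral_bound(1)[OF v, of "-1" 1] by (simp add: absolutely_integrable_on_def)
  then have Qc: "continuous_on {-1..1} Q" unfolding Q_def by (rule indefinite_integral_continuous_1)
  have QL: "Q \<in> L2_on (-1) 1" by (rule L2_continuous[OF Qc])
  have "\<exists>C. AE x in Imeas. rho \<rho>0 x * deriv w0 x - Q x = C"
  proof (rule du_Bois_Reymond[OF L2I_diff[OF pL QL]])
    fix \<phi> assume \<phi>: "test_function (-1) 1 \<phi>"
    obtain c d where cd: "-1 < c" "c < d" "d < 1" "\<And>x. x \<notin> {c<..<d} \<Longrightarrow> \<phi> x = 0" "smooth \<phi>"
      using test_functionE[OF \<phi>] by auto
    note dL = test_function_L2[OF test_function_deriv[OF \<phi>]] and \<phi>L = test_function_L2[OF \<phi>]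
    have bdry: "\<phi> 1 = 0" "\<phi> (-1) = 0" using cd(4)[of 1] cd(4)[of "-1"] cd by auto
    have "(LINT x|Imeas. \<phi> x * v x) = integral {-1..1} (\<lambda>x. v x * \<phi> x)"
      using LINT_Imeas_eq_integral[OF L2I_mult[OF \<phi>L v]] by (simp add: mult.commute)
    also have "\<dots> = - integral {-1..1} (\<lambda>x. Q x * deriv \<phi> x)"
      using L2_primitive_by_parts(2)[OF v, of "-1" 1 \<phi> "deriv \<phi>"] bdry
        smooth_continuous[OF smooth_deriv[OF cd(5)]] has_field_derivative_at_within[OF smooth_has_derivative[OF cd(5)]]
      by (simp add: Q_def)
    also have "\<dots> = - (LINT x|Imeas. deriv \<phi> x * Q x)"
      using LINT_Imeas_eq_integral[OF L2I_mult[OF dL QL]] by (simp add: mult.commute)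
    finally have 1: "(LINT x|Imeas. \<phi> x * v x) = - (LINT x|Imeas. deriv \<phi> x * Q x)" .
    have "(LINT x|Imeas. deriv \<phi> x * (rho \<rho>0 x * deriv w0 x)) = - (LINT x|Imeas. \<phi> x * v x)"
      using wd \<phi> by (simp add: weak_deriv_def)
    then show "(LINT x|Imeas. deriv \<phi> x * (rho \<rho>0 x * deriv w0 x - Q x)) = 0"
      using 1 L2I_mult[OF dL pL] L2I_mult[OF dL QL] by (simp add: right_diff_distrib)
  qed
  then obtain C where C: "AE x in Imeas. rho \<rho>0 x * deriv w0 x - Q x = C" by blast
  define P where "P x = Q x + C" for x
  have Pc: "continuous_on {-1..1} P" unfolding P_def by (intro continuous_intros Qc)
  have "AE x in lebesgue. x \<in> {-1<..<1} \<longrightarrow> rho \<rho>0 x * deriv w0 x - Q x = C"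
    using C by (simp add: AE_restrict_space_iff)
  then have "AE x in lebesgue. x \<in> {-1<..<1} \<longrightarrow> deriv w0 x = P x / rho \<rho>0 x"
    by eventually_elim (use rho_pos[OF assms(1)] in \<open>force simp: P_def field_simps\<close>)
  then obtain N where N: "negligible N" "\<And>x. x \<in> {-1<..<1} \<Longrightarrow> x \<notin> N \<Longrightarrow> deriv w0 x = P x / rho \<rho>0 x"
    by (auto elim!: AE_E3 simp: negligible_iff_null_sets)
  \<comment> \<open>On a compact neighbourhood of \<open>x\<close>, \<open>w0\<close> is a constant
    plus the integral of the continuous function \<open>P / rho\<close>; by \<open>eq\<close> the
    same holds for \<open>w\<close>.\<close>
  have der: "(w has_real_derivative P x / rho \<rho>0 x) (at x)" if x: "x \<in> {-1<..<1}" for x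
  proof -
    define a b where "a = (x - 1) / 2" and "b = (x + 1) / 2"
    have ab: "-1 < a" "a < x" "x < b" "b < 1" using x by (auto simp: a_def b_def)
    have pos: "rho \<rho>0 s > 0" if "s \<in> {a..b}" for s using rho_pos[OF assms(1)] that ab by auto
    have cont: "continuous_on {a..b} (\<lambda>s. P s / rho \<rho>0 s)"
      by (intro continuous_intros continuous_rho continuous_on_subset[OF Pc]) (use pos ab in force)+
    have w0i: "w0 s = w0 a + integral {a..s} (\<lambda>s. P s / rho \<rho>0 s)" if "s \<in> {a..b}" for s
    proof -
      have "integral {a..s} (deriv w0) = w0 s - w0 a"
        using V_space_FTC(2)[OF assms(1) w0, of a s] that ab by auto
      moreover have "integral {a..s} (deriv w0) = integral {a..s} (\<lambda>s. P s / rho \<rho>0 s)"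
        by (rule integral_spike[OF N(1)]) (use N(2) that ab in auto)
      ultimately show ?thesis by simp
    qed
    have "((\<lambda>s. w0 a + integral {a..s} (\<lambda>s. P s / rho \<rho>0 s)) has_real_derivative P x / rho \<rho>0 x) (at x within {a..b})"
      using integral_has_real_derivative[OF cont, of x] ab by (auto intro!: derivative_eq_intros)
    then have "((\<lambda>s. w0 a + integral {a..s} (\<lambda>s. P s / rho \<rho>0 s)) has_real_derivative P x / rho \<rho>0 x) (at x)"
      using ab by (simp add: at_within_Icc_at)
    then show ?thesis
    proof (rule has_field_derivative_transform_within_open)
      show "open {a<..<b}" "x \<in> {a<..<b}" using ab by auto
      show "w0 a + integral {a..s} (\<lambda>s. P s / rho \<rho>0 s) = w s" if "s \<in> {a<..<b}" for s
        using w0i[of s] eq[of s] that ab by simp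
    qed
  qed
  show ?thesis
  proof (rule that[OF v wv(2) Pc der])
    fix c d y y'
    assume cd: "-1 < c" "c \<le> d" "d < 1" and y: "\<And>x. x \<in> {c..d} \<Longrightarrow> (y has_real_derivative y' x) (at x within {c..d})"
      and y': "continuous_on {c..d} y'"
    have iy: "(y' has_integral (y d - y c)) {c..d}"
      by (rule fundamental_theorem_of_calculus[OF cd(2)]) (use y in \<open>simp add: has_real_derivative_iff_has_vector_derivative\<close>)
    have "continuous_on {c..d} Q" by (rule continuous_on_subset[OF Qc]) (use cd in auto)
    then have "integral {c..d} (\<lambda>x. P x * y' x) = integral {c..d} (\<lambda>x. Q x * y' x) + C * (y d - y c)"
      using Henstock_Kurzweil_Integration.integral_add[of "\<lambda>x. Q x * y' x" "{c..d}" "\<lambda>x. C * y' x"] integral_unique[OF iy] y'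
      by (simp add: P_def distrib_right integrable_continuous_interval continuous_intros)
    moreover have "integral {c..d} (\<lambda>x. v x * y x) = Q d * y d - Q c * y c - integral {c..d} (\<lambda>x. Q x * y' x)"
      unfolding Q_def by (rule L2_primitive_by_parts(2)[OF v _ cd(2) _ y y']) (use cd in auto)
    ultimately show "integral {c..d} (\<lambda>x. v x * y x) = P d * y d - P c * y c - integral {c..d} (\<lambda>x. P x * y' x)"
      by (simp add: P_def algebra_simps)
  qed
qed

section \<open>Strongly continuous semigroups and the passage from mild to weak solutions\<close>

section \<open>Semigroups\<close>

lemma C0_semigroupD:
  assumes "C0_semigroup S"
  shows "\<And>t. t \<ge> 0 \<Longrightarrow> bounded_linear (S t)" "\<And>v. S 0 v = v"
    "\<And>s t v. s \<ge> 0 \<Longrightarrow> t \<ge> 0 \<Longrightarrow> S (s + t) v = S s (S t v)"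
    "\<And>v. ((\<lambda>t. S t v) \<longlongrightarrow> v) (at_right 0)"
  using assms by (auto simp: C0_semigroup_def)

text \<open>Baire's theorem for closed covers: otherwise the complements would be dense open sets
  with empty intersection.\<close>

lemma closed_cover_interior:
  fixes F :: "nat \<Rightarrow> 'a::{real_normed_vector, complete_space} set"
  assumes "\<And>n. closed (F n)" "(\<Union>n. F n) = UNIV"
  shows "\<exists>n. interior (F n) \<noteq> {}"
proof (rule ccontr)
  assume "\<nexists>n. interior (F n) \<noteq> {}"
  then have int: "interior (F n) = {}" for n by blast
  have mc: "Met_TC.mcomplete TYPE('a)" by (simp add: complete_UNIV)
  have "Met_TC.mtopology closure_of \<Inter>(range (\<lambda>n. - F n)) = (UNIV :: 'a set)"
  proof (rule Met_TC.metric_Baire_category[OF mc])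
    fix T assume "T \<in> range (\<lambda>n. - F n)"
    then show "openin Met_TC.mtopology T \<and> Met_TC.mtopology closure_of T = UNIV"
      using assms(1) int by (auto simp: closure_complement[symmetric] closure_complement)
  qed auto
  moreover have "\<Inter>(range (\<lambda>n. - F n)) = {}" using assms(2) by blast
  ultimately show False by simp
qed

text \<open>\<open>C0_semigroup\<close> demands continuity of orbits only at time 0. Each orbit is
  thus bounded on some interval that depends on \<open>v\<close>; Baire's theorem provides a ball of
  vectors with a common interval and bound, and linearity extends this to all vectors.\<close>

lemma C0_semigroup_bounded_near_0:
  fixes S :: "real \<Rightarrow> 'a::banach \<Rightarrow> 'a"
  assumes S: "C0_semigroup S"
  shows "\<exists>\<eta>>0. \<exists>M\<ge>1. \<forall>t\<in>{0..\<eta>}. \<forall>v. norm (S t v) \<le> M * norm v"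
proof -
  note bl = C0_semigroupD(1)[OF S]
  \<comment> \<open>The time interval shrinks while the bound grows with \<open>n\<close>, so that
    every \<open>v\<close> lies in some \<open>F n\<close>.\<close>
  define F where "F n = {v. \<forall>t\<in>{0..1 / real (Suc n)}. norm (S t v) \<le> real (Suc n)}" for n
  have "closed (F n)" for n
  proof -
    have "F n = (\<Inter>t\<in>{0..1 / real (Suc n)}. {v. norm (S t v) \<le> real (Suc n)})" by (auto simp: F_def)
    moreover have "closed {v. norm (S t v) \<le> real (Suc n)}" if "t \<in> {0..1 / real (Suc n)}" for t
      by (intro closed_Collect_le continuous_intros bounded_linear.continuous_on[OF bl]) (use that in auto)
    ultimately show ?thesis by auto
  qed
  moreover have "(\<Union>n. F n) = UNIV"
  proof -
    have "\<exists>n. v \<in> F n" for v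
    proof -
      have "eventually (\<lambda>t. dist (S t v) v < 1) (at_right 0)"
        using C0_semigroupD(4)[OF S] by (rule tendstoD) simp
      then obtain b where b: "b > 0" "\<And>t. 0 < t \<Longrightarrow> t < b \<Longrightarrow> dist (S t v) v < 1"
        unfolding eventually_at_right_field by auto
      obtain n1 where n1: "1 / real (Suc n1) < b" using nat_approx_posE[OF b(1)] by auto
      obtain n2 :: nat where n2: "norm v + 1 \<le> real n2" using real_arch_simple by blast
      define n where "n = max n1 n2"
      have "1 / real (Suc n) \<le> 1 / real (Suc n1)" unfolding n_def by (intro divide_left_mono) auto
      then have nb: "1 / real (Suc n) < b" using n1 by simp
      have nn: "norm v + 1 \<le> real (Suc n)" using n2 by (simp add: n_def)
      have "norm (S t v) \<le> real (Suc n)" if t: "t \<in> {0..1 / real (Suc n)}" for t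
      proof (cases "t = 0")
        case True
        then show ?thesis using nn C0_semigroupD(2)[OF S] by simp
      next
        case False
        then have "dist (S t v) v < 1" using b(2)[of t] t nb by auto
        then have "norm (S t v) \<le> norm v + 1"
          using norm_triangle_ineq2[of "S t v" v] by (simp add: dist_norm)
        then show ?thesis using nn by simp
      qed
      then have "v \<in> F n" by (simp add: F_def)
      then show ?thesis by blast
    qed
    then show ?thesis by auto
  qed
  ultimately obtain n where "interior (F n) \<noteq> {}" using closed_cover_interior by blast
  then obtain x r where xr: "r > 0" "ball x r \<subseteq> F n" by (meson ex_in_conv mem_interior)
  define M where "M = max 1 (4 * real (Suc n) / r)"
  have "norm (S t v) \<le> M * norm v" if t: "t \<in> {0..1 / real (Suc n)}" for t v
  proof (cases "v = 0")
    case True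
    then show ?thesis using linear_0[OF bounded_linear.linear[OF bl[of t]]] t by simp
  next
    case False
    \<comment> \<open>This scaling puts \<open>x + c *\<^sub>R v\<close> at distance
      \<open>r / 2\<close> from \<open>x\<close>, inside the ball.\<close>
    define c where "c = r / (2 * norm v)"
    have c: "c > 0" using xr False by (simp add: c_def)
    have "x \<in> F n" "x + c *\<^sub>R v \<in> F n" using xr False by (auto simp: subset_iff dist_norm c_def)
    then have "norm (S t x) \<le> Suc n" "norm (S t (x + c *\<^sub>R v)) \<le> Suc n" using t by (auto simp: F_def)
    moreover have "c *\<^sub>R S t v = S t (x + c *\<^sub>R v) - S t x"
      using bl[of t] t by (simp add: bounded_linear.linear linear_add linear_scale)
    ultimately have "norm (c *\<^sub>R S t v) \<le> 2 * real (Suc n)"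
      using norm_triangle_ineq4[of "S t (x + c *\<^sub>R v)" "S t x"] by simp
    then have "norm (S t v) \<le> 2 * real (Suc n) / c" using c by (simp add: field_simps)
    also have "\<dots> = 4 * real (Suc n) / r * norm v" using xr False by (simp add: c_def)
    also have "\<dots> \<le> M * norm v" by (intro mult_right_mono) (auto simp: M_def)
    finally show ?thesis .
  qed
  then show ?thesis by (intro exI[of _ "1 / real (Suc n)"] exI[of _ M] conjI) (auto simp: M_def)
qed

lemma C0_semigroup_bounded:
  fixes S :: "real \<Rightarrow> 'a::banach \<Rightarrow> 'a"
  assumes S: "C0_semigroup S"
  shows "\<exists>M\<ge>1. \<forall>t\<in>{0..T}. \<forall>v. norm (S t v) \<le> M * norm v"
proof -
  obtain \<eta> M where \<eta>: "\<eta> > 0" and M: "M \<ge> 1" "\<And>t v. t \<in> {0..\<eta>} \<Longrightarrow> norm (S t v) \<le> M * norm v"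
    using C0_semigroup_bounded_near_0[OF S] by metis
  have pow: "norm (S t v) \<le> M ^ Suc k * norm v" if "0 \<le> t" "t \<le> real k * \<eta>" for k t v
    using that
  proof (induction k arbitrary: t v)
    case 0
    then show ?case using C0_semigroupD(2)[OF S] M(1) mult_right_mono[of 1 M "norm v"] by simp
  next
    case (Suc k)
    show ?case
    proof (cases "t \<le> \<eta>")
      case True
      have "norm (S t v) \<le> M * norm v" using M(2) True Suc.prems by simp
      also have "\<dots> \<le> M ^ Suc (Suc k) * norm v"
        using M(1) power_increasing[of 1 "Suc (Suc k)" M] by (intro mult_right_mono) auto
      finally show ?thesis .
    next
      case False
      have "S t v = S \<eta> (S (t - \<eta>) v)" using C0_semigroupD(3)[OF S, of \<eta> "t - \<eta>" v] False \<eta> by simp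
      also have "norm \<dots> \<le> M * norm (S (t - \<eta>) v)" using M(2) \<eta> by simp
      also have "\<dots> \<le> M * (M ^ Suc k * norm v)"
        using Suc.IH[of "t - \<eta>" v] Suc.prems False M(1) by (intro mult_left_mono) (auto simp: algebra_simps)
      finally show ?thesis by (simp add: mult.assoc)
    qed
  qed
  obtain k :: nat where "T / \<eta> \<le> real k" using real_arch_simple by blast
  then have "T \<le> real k * \<eta>" using \<eta> by (simp add: field_simps)
  then show ?thesis using pow M(1) by (intro exI[of _ "M ^ Suc k"]) (auto simp: one_le_power simp del: power_Suc)
qed

text \<open>For \<open>p < q\<close> the increment is \<open>S p\<close> applied to
  \<open>S (q - p) v - v\<close>, so boundedness of \<open>S\<close> on compact time intervals turns
  right continuity at 0 into continuity from both sides.\<close>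

lemma C0_semigroup_continuous:
  fixes S :: "real \<Rightarrow> 'a::banach \<Rightarrow> 'a"
  assumes S: "C0_semigroup S"
  shows "continuous_on {0..} (\<lambda>t. S t v)"
  unfolding continuous_on_iff
proof (intro ballI allI impI)
  fix t e :: real assume t: "t \<in> {0..}" and "e > 0"
  obtain M where M: "M \<ge> 1" "\<And>s v. s \<in> {0..t+1} \<Longrightarrow> norm (S s v) \<le> M * norm v"
    using C0_semigroup_bounded[OF S, of "t + 1"] by metis
  have "eventually (\<lambda>h. dist (S h v) v < e / M) (at_right 0)"
    using C0_semigroupD(4)[OF S] by (rule tendstoD) (use \<open>e > 0\<close> M in simp)
  then obtain b where b: "b > 0" "\<And>h. 0 < h \<Longrightarrow> h < b \<Longrightarrow> dist (S h v) v < e / M"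
    unfolding eventually_at_right_field by auto
  have *: "dist (S p v) (S q v) < e" if pq: "0 \<le> p" "p < q" "q - p < b" "p \<le> t + 1" for p q
  proof -
    have bl: "bounded_linear (S p)" using C0_semigroupD(1)[OF S] pq by simp
    have "S q v - S p v = S p (S (q - p) v - v)"
      using C0_semigroupD(3)[OF S, of p "q - p" v] pq by (simp add: linear_diff[OF bounded_linear.linear[OF bl]])
    then have "norm (S q v - S p v) \<le> M * norm (S (q - p) v - v)" using M(2)[of p] pq by simp
    also have "\<dots> < M * (e / M)" using b(2)[of "q - p"] pq M(1) by (intro mult_strict_left_mono) (auto simp: dist_norm)
    also have "\<dots> = e" using M(1) by simp
    finally show ?thesis by (simp add: dist_norm norm_minus_commute)
  qed
  show "\<exists>d>0. \<forall>s\<in>{0..}. dist s t < d \<longrightarrow> dist (S s v) (S t v) < e"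
  proof (intro exI[of _ "min 1 b"] conjI ballI impI)
    fix s :: real assume s: "s \<in> {0..}" "dist s t < min 1 b"
    consider "s = t" | "s < t" | "t < s" by linarith
    then show "dist (S s v) (S t v) < e"
    proof cases
      case 2
      then show ?thesis using *[of s t] s t by (auto simp: dist_real_def)
    next
      case 3
      then show ?thesis using *[of t s] s t by (auto simp: dist_real_def dist_commute)
    qed (use \<open>e > 0\<close> in simp)
  qed (use b in simp)
qed

text \<open>The integral of an orbit lies in the domain of the generator whether or not
  \<open>v\<close> does. Applying \<open>S \<epsilon>\<close> shifts the interval of integration, so
  the difference quotient is a difference of two short averages of the orbit, one at each
  end.\<close>

lemma integral_orbit_in_generator:
  fixes S :: "real \<Rightarrow> 'a::banach \<Rightarrow> 'a"
  assumes S: "C0_semigroup S" and h: "h \<ge> 0"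
  shows "(integral {0..h} (\<lambda>s. S s v), S h v - v) \<in> infinitesimal_generator S"
proof -
  define W where "W x = integral {0..x} (\<lambda>s. S s v)" for x
  have cont: "continuous_on {0..b} (\<lambda>s. S s v)" for b
    by (rule continuous_on_subset[OF C0_semigroup_continuous[OF S]]) auto
  have W': "(W has_vector_derivative S x v) (at x within {0..b})" if "x \<in> {0..b}" for x b
    unfolding W_def by (rule integral_has_vector_derivative[OF cont that])
  have W0: "W 0 = 0" by (simp add: W_def)
  have shift: "S \<epsilon> (W h) = W (h + \<epsilon>) - W \<epsilon>" if "\<epsilon> \<ge> 0" for \<epsilon>
  proof -
    have "((\<lambda>s. S (s + \<epsilon>) v) has_integral (W (h + \<epsilon>) - W (0 + \<epsilon>))) {0..h}"
    proof (rule fundamental_theorem_of_calculus[OF h])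
      fix s assume s: "s \<in> {0..h}"
      have "(W \<circ> (\<lambda>s. s + \<epsilon>) has_vector_derivative 1 *\<^sub>R S (s + \<epsilon>) v) (at s within {0..h})"
      proof (rule vector_diff_chain_within)
        show "((\<lambda>s. s + \<epsilon>) has_vector_derivative 1) (at s within {0..h})"
          by (auto intro!: derivative_eq_intros)
        show "(W has_vector_derivative S (s + \<epsilon>) v) (at (s + \<epsilon>) within (\<lambda>s. s + \<epsilon>) ` {0..h})"
          by (rule has_vector_derivative_within_subset[OF W'[of _ "h + \<epsilon>"]]) (use s that in auto)
      qed
      then show "((\<lambda>s. W (s + \<epsilon>)) has_vector_derivative S (s + \<epsilon>) v) (at s within {0..h})" by (simp add: o_def)
    qed
    moreover have "((\<lambda>s. S (s + \<epsilon>) v) has_integral S \<epsilon> (W h)) {0..h}"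
    proof -
      have "((\<lambda>s. S s v) has_integral W h) {0..h}"
        unfolding W_def by (intro integrable_integral integrable_continuous_interval cont)
      then have "(S \<epsilon> \<circ> (\<lambda>s. S s v) has_integral S \<epsilon> (W h)) {0..h}"
        by (rule has_integral_linear[OF _ C0_semigroupD(1)[OF S that]])
      then show ?thesis
        by (rule has_integral_eq[rotated]) (use C0_semigroupD(3)[OF S that] in \<open>simp add: add.commute\<close>)
    qed
    ultimately show ?thesis by (metis add_0 has_integral_unique)
  qed
  have quot: "((\<lambda>\<epsilon>. (W (x + \<epsilon>) - W x) /\<^sub>R \<epsilon>) \<longlongrightarrow> S x v) (at_right 0)" if "x \<ge> 0" for x
  proof -
    have "(W has_vector_derivative S x v) (at x within {0..x+1})" using W'[of x "x + 1"] that by simp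
    then have "(W has_vector_derivative S x v) (at x within {x..x+1})"
      by (rule has_vector_derivative_within_subset) (use that in auto)
    then have "((\<lambda>y. (1 / norm (y - x)) *\<^sub>R (W y - (W x + (y - x) *\<^sub>R S x v))) \<longlongrightarrow> 0) (at x within {x..x+1})"
      by (simp add: has_vector_derivative_def has_derivative_within)
    then have "((\<lambda>y. (1 / norm (y - x)) *\<^sub>R (W y - (W x + (y - x) *\<^sub>R S x v))) \<longlongrightarrow> 0) (at_right x)"
      by (simp add: at_within_Icc_at_right)
    then have "((\<lambda>\<epsilon>. (1 / norm (\<epsilon> + x - x)) *\<^sub>R (W (\<epsilon> + x) - (W x + (\<epsilon> + x - x) *\<^sub>R S x v))) \<longlongrightarrow> 0) (at_right 0)"
      by (simp only: filterlim_at_right_to_0[of _ _ x])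
    moreover have "eventually (\<lambda>\<epsilon>. (1 / norm (\<epsilon> + x - x)) *\<^sub>R (W (\<epsilon> + x) - (W x + (\<epsilon> + x - x) *\<^sub>R S x v))
        = (W (x + \<epsilon>) - W x) /\<^sub>R \<epsilon> - S x v) (at_right 0)"
      unfolding eventually_at_right_field
      by (intro exI[of _ 1]) (auto simp: algebra_simps divide_inverse)
    ultimately have "((\<lambda>\<epsilon>. (W (x + \<epsilon>) - W x) /\<^sub>R \<epsilon> - S x v) \<longlongrightarrow> 0) (at_right 0)"
      by (rule Lim_transform_eventually)
    then show ?thesis by (rule LIM_zero_cancel)
  qed
  have "((\<lambda>\<epsilon>. (W (h + \<epsilon>) - W h) /\<^sub>R \<epsilon> - (W (0 + \<epsilon>) - W 0) /\<^sub>R \<epsilon>) \<longlongrightarrow> S h v - S 0 v) (at_right 0)"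
    by (intro tendsto_diff quot h order_refl)
  moreover have "eventually (\<lambda>\<epsilon>. (W (h + \<epsilon>) - W h) /\<^sub>R \<epsilon> - (W (0 + \<epsilon>) - W 0) /\<^sub>R \<epsilon> = (S \<epsilon> (W h) - W h) /\<^sub>R \<epsilon>) (at_right 0)"
    unfolding eventually_at_right_field
    by (intro exI[of _ 1]) (auto simp: shift W0 simp flip: scaleR_diff_right)
  ultimately have "((\<lambda>\<epsilon>. (S \<epsilon> (W h) - W h) /\<^sub>R \<epsilon>) \<longlongrightarrow> S h v - S 0 v) (at_right 0)"
    by (rule Lim_transform_eventually)
  then show ?thesis
    using C0_semigroupD(2)[OF S] by (simp add: infinitesimal_generator_def W_def)
qed

text \<open>The operator is moved onto the smooth function by \<open>graph_A_symmetric\<close>; thus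
  every orbit, whatever its starting vector, is differentiable in time when tested with
  \<open>z\<close>.\<close>

lemma semigroup_test_function:
  assumes "\<rho>0 > 0" and S: "C0_semigroup S" and gen: "infinitesimal_generator S = graph_A (rho \<rho>0)"
    and z: "test_function (-1) 1 z" and h: "h \<ge> 0"
  defines "B \<equiv> to_L2I (deriv (\<lambda>x. rho \<rho>0 x * deriv z x))"
  shows "inner (S h v - v) (to_L2I z) = integral {0..h} (\<lambda>s. inner (S s v) B)"
proof -
  have cont: "continuous_on {0..h} (\<lambda>s. S s v)"
    by (rule continuous_on_subset[OF C0_semigroup_continuous[OF S]]) auto
  have "(integral {0..h} (\<lambda>s. S s v), S h v - v) \<in> graph_A (rho \<rho>0)"
    using integral_orbit_in_generator[OF S h, of v] gen by simp
  then have "inner (S h v - v) (to_L2I z) = inner (integral {0..h} (\<lambda>s. S s v)) B"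
    unfolding B_def by (rule graph_A_symmetric[OF assms(1) _ z])
  also have "\<dots> = integral {0..h} ((\<lambda>x. inner x B) \<circ> (\<lambda>s. S s v))"
    by (rule integral_linear[symmetric]) (auto intro: integrable_continuous_interval cont bounded_linear_inner_left)
  finally show ?thesis by (simp add: o_def)
qed

lemma continuous_quadratic_increment_const:
  fixes F :: "real \<Rightarrow> real"
  assumes "\<And>s t. \<lbrakk>a \<le> s; s \<le> t; t \<le> b\<rbrakk> \<Longrightarrow> \<bar>F t - F s\<bar> \<le> K * (t - s)\<^sup>2" and "a \<le> t" "t \<le> b"
  shows "F t = F a"
proof (rule has_derivative_zero_unique[of "{a..b}" F])
  fix s assume s: "s \<in> {a..b}"
  have K: "\<bar>F r - F s\<bar> \<le> \<bar>K\<bar> * (r - s)\<^sup>2" if "r \<in> {a..b}" for r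
  proof -
    have "\<bar>F r - F s\<bar> \<le> K * (r - s)\<^sup>2"
      using assms(1)[of r s] assms(1)[of s r] that s by (cases "r \<le> s") (auto simp: abs_minus_commute power2_commute)
    also have "\<dots> \<le> \<bar>K\<bar> * (r - s)\<^sup>2" by (rule mult_right_mono) auto
    finally show ?thesis .
  qed
  show "(F has_derivative (\<lambda>h. 0)) (at s within {a..b})"
    unfolding has_derivative_within_alt
  proof (intro conjI allI impI)
    fix e :: real assume "e > 0"
    show "\<exists>d>0. \<forall>r\<in>{a..b}. norm (r - s) < d \<longrightarrow> norm (F r - F s - 0) \<le> e * norm (r - s)"
    proof (intro exI[of _ "e / (\<bar>K\<bar> + 1)"] conjI ballI impI)
      show "e / (\<bar>K\<bar> + 1) > 0" using \<open>e > 0\<close> by simp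
      fix r assume r: "r \<in> {a..b}" "norm (r - s) < e / (\<bar>K\<bar> + 1)"
      have "\<bar>F r - F s\<bar> \<le> (\<bar>K\<bar> * \<bar>r - s\<bar>) * \<bar>r - s\<bar>" using K[OF r(1)] by (simp add: power2_eq_square)
      also have "\<dots> \<le> ((\<bar>K\<bar> + 1) * \<bar>r - s\<bar>) * \<bar>r - s\<bar>" by (intro mult_right_mono) auto
      also have "\<dots> \<le> e * \<bar>r - s\<bar>"
        using r(2) by (intro mult_right_mono) (auto simp: field_simps)
      finally show "norm (F r - F s - 0) \<le> e * norm (r - s)" by simp
    qed
  qed simp
qed (use assms in auto)

text \<open>The increment of \<open>F t = \<langle>U t, z\<rangle> - \<integral>\<^sub>0\<^sup>t (\<langle>U, B\<rangle> + \<langle>G, z\<rangle>)\<close> is quadratic in the length of the time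
  interval, because \<open>S\<close> acts weakly Lipschitz continuously on bounded sets against test functions.\<close>

lemma mild_imp_weak:
  fixes U G :: "real \<Rightarrow> L2I"
  assumes "\<rho>0 > 0" and S: "C0_semigroup S" and gen: "infinitesimal_generator S = graph_A (rho \<rho>0)"
    and z: "test_function (-1) 1 z" and T: "T \<ge> 0"
    and mild: "\<And>t. t \<in> {0..T} \<Longrightarrow> integrable (lebesgue_on {0..t}) (\<lambda>s. S (t - s) (G s)) \<and>
          U t = S t (U 0) + (LINT s|lebesgue_on {0..t}. S (t - s) (G s))"
    and G: "\<And>s. s \<in> {0..T} \<Longrightarrow> norm (G s) \<le> C"
    and meas: "(\<lambda>s. inner (G s) (to_L2I z)) integrable_on {0..T}"
    and Uc: "continuous_on {0..T} U"
    and t: "t \<in> {0..T}"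
  defines "B \<equiv> to_L2I (deriv (\<lambda>x. rho \<rho>0 x * deriv z x))"
  shows "inner (U t) (to_L2I z) = inner (U 0) (to_L2I z) +
     integral {0..t} (\<lambda>s. inner (U s) B + inner (G s) (to_L2I z))"
proof -
  define Z where "Z = to_L2I z"
  obtain M where M: "M \<ge> 1" "\<And>s v. s \<in> {0..T} \<Longrightarrow> norm (S s v) \<le> M * norm v"
    using C0_semigroup_bounded[OF S, of T] by metis
  have C: "C \<ge> 0" using order_trans[OF norm_ge_zero G[of 0]] T by simp
  note bl = C0_semigroupD(1)[OF S]
  define D where "D a b = (LINT s|lebesgue_on {a..b}. S (b - s) (G s))" for a b
  have intS: "integrable (lebesgue_on {a..b}) (\<lambda>s. S (b - s) (G s))" if "0 \<le> a" "b \<le> T" for a b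
  proof (cases "a \<le> b")
    case True
    have "set_integrable lebesgue {0..b} (\<lambda>s. S (b - s) (G s))"
      using mild[of b] True that by (simp add: set_integrable_def integrable_restrict_space)
    then have "set_integrable lebesgue {a..b} (\<lambda>s. S (b - s) (G s))"
      by (rule set_integrable_subset) (use that in auto)
    then show ?thesis by (simp add: set_integrable_def integrable_restrict_space)
  qed (simp add: integrable_restrict_space)
  \<comment> \<open>Restarting the mild formula at time \<open>a\<close>: the semigroup law pulls
    \<open>S (b - a)\<close> out of the integral up to \<open>a\<close>.\<close>
  have step: "U b = S (b - a) (U a) + D a b" if ab: "0 \<le> a" "a \<le> b" "b \<le> T" for a b
  proof -
    have Ua: "U a = S a (U 0) + (LINT s|lebesgue_on {0..a}. S (a - s) (G s))" using mild[of a] ab by simp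
    have Ub: "U b = S b (U 0) + (LINT s|lebesgue_on {0..b}. S (b - s) (G s))" using mild[of b] ab by simp
    have blb: "bounded_linear (S (b - a))" using bl ab by simp
    have "S (b - a) (U a) = S (b - a) (S a (U 0)) + S (b - a) (LINT s|lebesgue_on {0..a}. S (a - s) (G s))"
      unfolding Ua by (rule linear_add[OF bounded_linear.linear[OF blb]])
    also have "S (b - a) (S a (U 0)) = S b (U 0)" using C0_semigroupD(3)[OF S, of "b - a" a "U 0"] ab by simp
    also have "S (b - a) (LINT s|lebesgue_on {0..a}. S (a - s) (G s)) = (LINT s|lebesgue_on {0..a}. S (b - a) (S (a - s) (G s)))"
      by (rule integral_bounded_linear[OF blb, symmetric]) (use mild[of a] ab in auto)
    also have "\<dots> = (LINT s|lebesgue_on {0..a}. S (b - s) (G s))"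
      by (rule Bochner_Integration.integral_cong[OF refl])
         (use C0_semigroupD(3)[OF S, symmetric] ab in \<open>auto simp: space_restrict_space\<close>)
    finally have 1: "S (b - a) (U a) = S b (U 0) + (LINT s|lebesgue_on {0..a}. S (b - s) (G s))" .
    have si: "set_integrable lebesgue {c..d} (\<lambda>s. S (b - s) (G s))" if "0 \<le> c" "d \<le> b" for c d
      by (rule set_integrable_subset[of _ "{0..b}"])
         (use mild[of b] ab that in \<open>auto simp: set_integrable_def integrable_restrict_space\<close>)
    have "(LINT s:({0..a} \<union> {a<..b})|lebesgue. S (b - s) (G s)) = (LINT s:{0..a}|lebesgue. S (b - s) (G s)) + (LINT s:{a<..b}|lebesgue. S (b - s) (G s))"
      by (rule set_integral_Un) (use si[of 0 a] si[of 0 b] ab in \<open>auto intro: set_integrable_subset\<close>)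
    moreover have "{0..a} \<union> {a<..b} = {0..b}" using ab by auto
    \<comment> \<open>Additivity of the set integral was applied to disjoint sets; the point
      \<open>a\<close> has measure 0.\<close>
    moreover have "(LINT s:{a<..b}|lebesgue. S (b - s) (G s)) = (LINT s:{a..b}|lebesgue. S (b - s) (G s))"
    proof (rule set_integral_cong_set)
      show "set_borel_measurable lebesgue {a..b} (\<lambda>s. S (b - s) (G s))"
        using si[of a b] ab by (simp add: set_integrable_def set_borel_measurable_def borel_measurable_integrable)
      show "set_borel_measurable lebesgue {a<..b} (\<lambda>s. S (b - s) (G s))"
      proof -
        have "set_integrable lebesgue {a<..b} (\<lambda>s. S (b - s) (G s))"
          by (rule set_integrable_subset[OF si[of a b]]) (use ab in auto)
        then show ?thesis unfolding set_integrable_def set_borel_measurable_def by (rule borel_measurable_integrable)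
      qed
      have "AE x in lebesgue. x \<noteq> a"
        using AE_not_in[of "{a}" lebesgue] negligible_sing[of a] by (simp add: negligible_iff_null_sets)
      then show "AE x in lebesgue. (x \<in> {a..b}) = (x \<in> {a<..b})" by eventually_elim auto
    qed
    ultimately have "(LINT s|lebesgue_on {0..b}. S (b - s) (G s)) = (LINT s|lebesgue_on {0..a}. S (b - s) (G s)) + D a b"
      by (simp add: D_def set_lebesgue_integral_def integral_restrict_space)
    then show ?thesis using 1 Ub by (simp add: add.assoc)
  qed
  \<comment> \<open>By \<open>semigroup_test_function\<close> the increment is an integral over a
    length \<open>h\<close> against the fixed vector \<open>B\<close>; this is where smoothness of
    \<open>z\<close> is used.\<close>
  have near: "\<bar>inner (S h v - v) Z\<bar> \<le> M * norm v * norm B * h" if h: "0 \<le> h" "h \<le> T" for h v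
  proof -
    have cont: "continuous_on {0..h} (\<lambda>s. inner (S s v) B)"
      by (intro continuous_intros continuous_on_subset[OF C0_semigroup_continuous[OF S]]) auto
    have "norm (integral {0..h} (\<lambda>s. inner (S s v) B)) \<le> M * norm v * norm B * (h - 0)"
    proof (rule integral_bound[OF h(1) cont])
      fix s assume s: "s \<in> {0..h}"
      have "norm (inner (S s v) B) \<le> norm (S s v) * norm B" using Cauchy_Schwarz_ineq2[of "S s v" B] by simp
      also have "\<dots> \<le> M * norm v * norm B" using M(2)[of s v] s h by (intro mult_right_mono) auto
      finally show "norm (inner (S s v) B) \<le> M * norm v * norm B" .
    qed
    then show ?thesis
      using semigroup_test_function[OF assms(1) S gen z h(1), of v] by (simp add: B_def Z_def)
  qed
  have Dnorm: "norm (D a b) \<le> M * C * (b - a)" if ab: "0 \<le> a" "a \<le> b" "b \<le> T" for a b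
  proof -
    have "norm (D a b) \<le> (LINT s|lebesgue_on {a..b}. norm (S (b - s) (G s)))"
      unfolding D_def by (rule integral_norm_bound)
    also have "\<dots> \<le> (LINT s|lebesgue_on {a..b}. M * C)"
    proof (rule integral_mono)
      show "integrable (lebesgue_on {a..b}) (\<lambda>s. norm (S (b - s) (G s)))" using intS ab by simp
      show "integrable (lebesgue_on {a..b}) (\<lambda>s. M * C)"
        by (intro finite_measure.integrable_const finite_measure_lebesgue_on) simp
      fix s assume "s \<in> space (lebesgue_on {a..b})"
      then have s: "s \<in> {a..b}" by (simp add: space_restrict_space)
      have "norm (S (b - s) (G s)) \<le> M * norm (G s)" using M(2) s ab by simp
      also have "\<dots> \<le> M * C" using G[of s] s ab M(1) by (intro mult_left_mono) auto
      finally show "norm (S (b - s) (G s)) \<le> M * C" .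
    qed
    also have "\<dots> = M * C * (b - a)" using ab by (simp add: measure_restrict_space)
    finally show ?thesis .
  qed
  \<comment> \<open>Tested with \<open>z\<close>, \<open>S (b - s)\<close> differs from the identity
    by order \<open>b - s\<close>; integrating over the interval yields the square.\<close>
  have Dz: "\<bar>inner (D a b) Z - integral {a..b} (\<lambda>s. inner (G s) Z)\<bar> \<le> M * C * norm B * (b - a)\<^sup>2"
    if ab: "0 \<le> a" "a \<le> b" "b \<le> T" for a b
  proof -
    have i1: "integrable (lebesgue_on {a..b}) (\<lambda>s. inner (S (b - s) (G s)) Z)"
      using intS[of a b] ab by simp
    have "inner (D a b) Z = (LINT s|lebesgue_on {a..b}. inner (S (b - s) (G s)) Z)"
      unfolding D_def using intS[of a b] ab by simp
    also have "\<dots> = integral {a..b} (\<lambda>s. inner (S (b - s) (G s)) Z)"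
      by (rule lebesgue_integral_eq_integral[OF i1]) simp
    finally have 1: "inner (D a b) Z = integral {a..b} (\<lambda>s. inner (S (b - s) (G s)) Z)" .
    have i1': "(\<lambda>s. inner (S (b - s) (G s)) Z) integrable_on {a..b}"
      using integrable_on_lebesgue_on[OF i1] by simp
    have i2: "(\<lambda>s. inner (G s) Z) integrable_on {a..b}"
      using integrable_subinterval_real[OF meas, of a b] ab by (auto simp: Z_def)
    have "norm (integral {a..b} (\<lambda>s. inner (S (b - s) (G s)) Z - inner (G s) Z)) \<le> integral {a..b} (\<lambda>s. M * C * norm B * (b - a))"
    proof (rule integral_norm_bound_integral[OF integrable_diff[OF i1' i2]])
      fix s assume s: "s \<in> {a..b}"
      have "\<bar>inner (S (b - s) (G s) - G s) Z\<bar> \<le> M * norm (G s) * norm B * (b - s)" using near[of "b - s" "G s"] s ab by simp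
      also have "\<dots> \<le> M * C * norm B * (b - a)" using G[of s] M(1) C s ab by (intro mult_mono) auto
      finally show "norm (inner (S (b - s) (G s)) Z - inner (G s) Z) \<le> M * C * norm B * (b - a)" by (simp add: inner_diff_left)
    qed auto
    also have "\<dots> = M * C * norm B * (b - a)\<^sup>2" using ab by (simp add: power2_eq_square)
    finally show ?thesis using 1 Henstock_Kurzweil_Integration.integral_diff[OF i1' i2] by simp
  qed
  define y where "y s = inner (U s) B + inner (G s) Z" for s
  have yU: "(\<lambda>s. inner (U s) B) integrable_on {a..b}" if "0 \<le> a" "b \<le> T" for a b
    by (intro integrable_continuous_interval continuous_intros continuous_on_subset[OF Uc]) (use that in auto)
  have yG: "(\<lambda>s. inner (G s) Z) integrable_on {a..b}" if "0 \<le> a" "b \<le> T" for a b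
    using integrable_subinterval_real[OF meas, of a b] that by (auto simp: Z_def)
  have yi: "y integrable_on {a..b}" if "0 \<le> a" "b \<le> T" for a b
    unfolding y_def by (intro integrable_add yU yG that)
  define F where "F t = inner (U t) Z - integral {0..t} y" for t
  have "F t = F 0"
  \<comment> \<open>Two quadratic errors add up, hence the factor 2: one from the integral
    \<open>D a b\<close>, the other from following the orbit of \<open>U a\<close> instead of
    \<open>U\<close> itself.\<close>
  proof (rule continuous_quadratic_increment_const[of 0 T F "2 * M * C * norm B"])
    fix a b assume ab: "0 \<le> a" "a \<le> b" "b \<le> T"
    have bla: "bounded_linear (S (b - a))" using bl ab by simp
    have dF: "F b - F a = inner (S (b - a) (U a) - U a) Z + inner (D a b) Z - integral {a..b} y"
      using Henstock_Kurzweil_Integration.integral_combine[of 0 a b y] yi[of 0 b] ab step[OF ab]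
      by (simp add: F_def inner_diff_left inner_add_left)
    have "integral {a..b} y = integral {a..b} (\<lambda>s. inner (U s) B) + integral {a..b} (\<lambda>s. inner (G s) Z)"
      unfolding y_def using yU yG ab by (intro Henstock_Kurzweil_Integration.integral_add) auto
    moreover have "\<bar>inner (S (b - a) (U a) - U a) Z - integral {a..b} (\<lambda>s. inner (U s) B)\<bar> \<le> M * C * norm B * (b - a)\<^sup>2"
    proof -
      have "((\<lambda>s. inner (S s (U a)) B) has_integral integral {0..b - a} (\<lambda>s. inner (S s (U a)) B)) {0..b - a}"
        by (intro integrable_integral integrable_continuous_interval continuous_intros continuous_on_subset[OF C0_semigroup_continuous[OF S]]) auto
      then have "((\<lambda>s. inner (S (s - a) (U a)) B) has_integral integral {0..b - a} (\<lambda>s. inner (S s (U a)) B)) {a..b}"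
        using has_integral_affinity'[of "\<lambda>s. inner (S s (U a)) B" _ 0 "b - a" 1 "-a"] by simp
      then have 1: "((\<lambda>s. inner (S (s - a) (U a)) B) has_integral inner (S (b - a) (U a) - U a) Z) {a..b}"
        using semigroup_test_function[OF assms(1) S gen z, of "b - a" "U a"] ab by (simp add: B_def Z_def)
      have 2: "((\<lambda>s. inner (U s) B) has_integral integral {a..b} (\<lambda>s. inner (U s) B)) {a..b}"
        using yU[of a b] ab by (simp add: integrable_integral)
      have "norm (inner (S (b - a) (U a) - U a) Z - integral {a..b} (\<lambda>s. inner (U s) B)) \<le> integral {a..b} (\<lambda>s. M * C * norm B * (b - a))"
        unfolding integral_unique[OF has_integral_diff[OF 1 2], symmetric]
      proof (rule integral_norm_bound_integral)
        show "(\<lambda>s. inner (S (s - a) (U a)) B - inner (U s) B) integrable_on {a..b}"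
          using has_integral_diff[OF 1 2] by blast
        fix s assume s: "s \<in> {a..b}"
        have "U s = S (s - a) (U a) + D a s" using step[of a s] s ab by simp
        then have "inner (S (s - a) (U a)) B - inner (U s) B = - inner (D a s) B" by (simp add: inner_add_left)
        then have "norm (inner (S (s - a) (U a)) B - inner (U s) B) \<le> norm (D a s) * norm B"
          using Cauchy_Schwarz_ineq2[of "D a s" B] by simp
        also have "\<dots> \<le> (M * C * (s - a)) * norm B" using Dnorm[of a s] s ab by (intro mult_right_mono) auto
        also have "\<dots> \<le> (M * C * (b - a)) * norm B" using s ab M(1) C by (intro mult_right_mono mult_left_mono) auto
        finally show "norm (inner (S (s - a) (U a)) B - inner (U s) B) \<le> M * C * norm B * (b - a)" by (simp add: mult_ac)
      qed auto
      also have "\<dots> = M * C * norm B * (b - a)\<^sup>2" using ab by (simp add: power2_eq_square)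
      finally show ?thesis by simp
    qed
    moreover note Dz[OF ab]
    ultimately show "\<bar>F b - F a\<bar> \<le> 2 * M * C * norm B * (b - a)\<^sup>2"
      unfolding dF by linarith
  qed (use t in auto)
  then show ?thesis by (simp add: F_def y_def[abs_def] Z_def)
qed

section \<open>Growth near the degenerate end points, and joint continuity in time and space\<close>

section \<open>Pointwise bounds in the energy space\<close>

lemma V_norm_sq: "(V_norm \<rho> w)\<^sup>2 = V_inner \<rho> w w"
proof -
  have "V_inner \<rho> w w \<ge> 0" unfolding V_inner_def
    by (intro add_nonneg_nonneg Bochner_Integration.integral_nonneg) auto
  then show ?thesis by (simp add: V_norm_def)
qed

lemma V_norm_sq_ge:
  "(LINT x|Imeas. (w x)\<^sup>2) \<le> (V_norm \<rho> w)\<^sup>2"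
  "(LINT x|Imeas. (sqrt (\<rho> x) * deriv w x)\<^sup>2) \<le> (V_norm \<rho> w)\<^sup>2"
  unfolding V_norm_sq V_inner_def power2_eq_square[symmetric]
  by (simp_all add: Bochner_Integration.integral_nonneg)

lemma integral_inverse_rho:
  assumes "\<rho>0 > 0" "-1 < c" "c \<le> d" "d < 1"
  shows "integral {c..d} (\<lambda>x. 1 / rho \<rho>0 x) = (artanh d - artanh c) / \<rho>0"
proof -
  have "((\<lambda>x. 1 / rho \<rho>0 x) has_integral (artanh d / \<rho>0 - artanh c / \<rho>0)) {c..d}"
  proof (rule fundamental_theorem_of_calculus[OF assms(3)])
    fix x assume x: "x \<in> {c..d}"
    then have "\<bar>x\<bar> < 1" using assms by auto
    then have "((\<lambda>x. artanh x / \<rho>0) has_real_derivative 1 / (1 - x\<^sup>2) / \<rho>0) (at x within {c..d})"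
      by (intro DERIV_cdivide has_field_derivative_at_within[OF artanh_real_has_field_derivative])
    then show "((\<lambda>x. artanh x / \<rho>0) has_vector_derivative 1 / rho \<rho>0 x) (at x within {c..d})"
      by (simp add: has_real_derivative_iff_has_vector_derivative rho_def mult.commute)
  qed
  then show ?thesis by (simp add: integral_unique diff_divide_distrib)
qed

text \<open>Every negative power dominates the logarithm. The exponent 1/8 looks ahead to
  \<open>source_norm_bound\<close>: there \<open>u^2\<close> is bounded by a multiple of this power,
  the absorption has degree 4 in \<open>u\<close>, and its square is of order
  \<open>(1 - |x|) powr (-1/2)\<close>, which is integrable.\<close>

lemma artanh_bound:
  fixes x :: real
  assumes "\<bar>x\<bar> < 1"
  shows "\<bar>artanh x\<bar> \<le> 5 * (1 - \<bar>x\<bar>) powr (-1/8)"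
proof -
  define y where "y = (1 - \<bar>x\<bar>) powr (-1/8)"
  have y: "y \<ge> 1" unfolding y_def using assms powr_mono2'[of "-1/8" "1 - \<bar>x\<bar>" 1] by simp
  have "ln y = - ln (1 - \<bar>x\<bar>) / 8" unfolding y_def using assms by (simp add: ln_powr)
  moreover have "ln y \<le> y - 1" using y by (intro ln_le_minus_one) auto
  ultimately have l: "- ln (1 - \<bar>x\<bar>) \<le> 8 * y" by linarith
  have l2: "ln (1 + \<bar>x\<bar>) \<le> 1" "ln (1 + \<bar>x\<bar>) \<ge> 0" using ln_add_one_self_le_self[of "\<bar>x\<bar>"] assms by auto
  have "\<bar>artanh x\<bar> = artanh \<bar>x\<bar>"
  proof (cases "x \<ge> 0")
    case True
    then have "artanh x \<ge> 0" using assms by (simp add: artanh_def)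
    then show ?thesis using True by simp
  next
    case False
    then have "artanh (- x) \<ge> 0" using assms by (simp add: artanh_def)
    then show ?thesis using False assms by (simp add: artanh_minus_real)
  qed
  also have "\<dots> = (ln (1 + \<bar>x\<bar>) - ln (1 - \<bar>x\<bar>)) / 2"
    using assms by (simp add: artanh_def ln_div)
  also have "\<dots> \<le> 5 * y" using l l2 y by simp
  finally show ?thesis by (simp add: y_def)
qed

text \<open>\<open>w x\<close> is compared with \<open>w s\<close> for \<open>s\<close> in the
  middle half of the interval, which has length 1, and the result is averaged over \<open>s\<close>.
  The increment is paid for by the energy, the average by the L^2 norm.\<close>

lemma V_space_pointwise_bound:
  assumes "\<rho>0 > 0"
  shows "\<exists>C>0. \<forall>w\<in>V_space (rho \<rho>0). \<forall>x\<in>{-1<..<1}. (w x)\<^sup>2 \<le> C * (1 - \<bar>x\<bar>) powr (-1/8) * (V_norm (rho \<rho>0) w)\<^sup>2"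
proof (intro exI conjI ballI)
  \<comment> \<open>From \<open>(w x)^2 \<le> 2 (w s)^2 + 2 (w x - w s)^2\<close> the average
    receives the constant 2 and the increment the constant \<open>2 * 15 / \<rho>0\<close>.\<close>
  show "2 + 30 / \<rho>0 > 0" using assms by (simp add: add_pos_pos)
  fix w x assume w: "w \<in> V_space (rho \<rho>0)" and x: "x \<in> {-1<..<1::real}"
  define y where "y = (1 - \<bar>x\<bar>) powr (-1/8)"
  have y: "y \<ge> 1" unfolding y_def using x powr_mono2'[of "-1/8" "1 - \<bar>x\<bar>" 1] by auto
  define N where "N = (V_norm (rho \<rho>0) w)\<^sup>2"
  define E where "E = (LINT x|Imeas. (sqrt (rho \<rho>0 x) * deriv w x)\<^sup>2)"
  have E: "0 \<le> E" "E \<le> N" unfolding E_def N_def by (auto intro: V_norm_sq_ge Bochner_Integration.integral_nonneg)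
  have wL: "w \<in> L2_on (-1) 1" using w by (simp add: V_space_def)
  \<comment> \<open>The 15 adds 5 for \<open>artanh x\<close> and 10 for \<open>artanh s\<close>,
    where the power of \<open>1 - |s|\<close> is at most 2; the second share is absorbed using
    \<open>y \<ge> 1\<close>.\<close>
  have diff: "(w x - w s)\<^sup>2 \<le> 15 / \<rho>0 * y * N" if s: "s \<in> {-1/2..1/2::real}" for s
  proof -
    define c d where "c = min x s" and "d = max x s"
    have cd: "-1 < c" "c \<le> d" "d < 1" using x s by (auto simp: c_def d_def)
    have "(1 - \<bar>s\<bar>) powr (-1/8) \<le> (1/2) powr (-1/8)" using s by (intro powr_mono2') auto
    also have "\<dots> = 2 powr (1/8)" by (simp add: powr_divide powr_minus_divide)
    also have "\<dots> \<le> 2 powr 1" by (intro powr_mono) auto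
    finally have s2: "(1 - \<bar>s\<bar>) powr (-1/8) \<le> 2" by simp
    have "\<bar>s\<bar> < 1" using s by auto
    from artanh_bound[OF this] s2 have "\<bar>artanh s\<bar> \<le> 10" by linarith
    moreover have "\<bar>artanh x\<bar> \<le> 5 * y" unfolding y_def using artanh_bound[of x] x by auto
    ultimately have "\<bar>artanh x\<bar> + \<bar>artanh s\<bar> \<le> 15 * y" using y by linarith
    then have a: "artanh d - artanh c \<le> 15 * y" by (auto simp: c_def d_def min_def max_def)
    have "(w x - w s)\<^sup>2 = (w d - w c)\<^sup>2" by (auto simp: c_def d_def min_def max_def power2_commute)
    also have "\<dots> \<le> (artanh d - artanh c) / \<rho>0 * E"
      using V_space_FTC(3)[OF assms w cd] integral_inverse_rho[OF assms cd] by (simp add: E_def)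
    also have "\<dots> \<le> 15 * y / \<rho>0 * N"
      using a assms E y by (intro mult_mono divide_right_mono) auto
    finally show ?thesis by (simp add: mult_ac)
  qed
  have int: "(\<lambda>s. (w s)\<^sup>2) absolutely_integrable_on {-1/2..1/2::real}"
    by (rule integrable_interval_HK) (use wL in \<open>auto simp: L2I_iff\<close>)
  have "(w x)\<^sup>2 = integral {-1/2..1/2::real} (\<lambda>s. (w x)\<^sup>2)" by simp
  also have "\<dots> \<le> integral {-1/2..1/2::real} (\<lambda>s. 2 * (w s)\<^sup>2 + 2 * (15 / \<rho>0 * y * N))"
  proof (rule integral_le)
    show "(\<lambda>s. 2 * (w s)\<^sup>2 + 2 * (15 / \<rho>0 * y * N)) integrable_on {-1/2..1/2::real}"
      using int by (intro integrable_add integrable_on_mult_right) (auto simp: absolutely_integrable_on_def)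
    fix s assume s: "s \<in> {-1/2..1/2::real}"
    have "(w x)\<^sup>2 \<le> 2 * (w s)\<^sup>2 + 2 * (w x - w s)\<^sup>2"
      using sum_squares_ge_zero[of "w x - 2 * w s" 0] by (simp add: power2_eq_square algebra_simps)
    then show "(w x)\<^sup>2 \<le> 2 * (w s)\<^sup>2 + 2 * (15 / \<rho>0 * y * N)" using diff[OF s] by linarith
  qed (rule integrable_const_ivl)
  also have "\<dots> = 2 * integral {-1/2..1/2::real} (\<lambda>s. (w s)\<^sup>2) + 2 * (15 / \<rho>0 * y * N)"
    using int by (subst Henstock_Kurzweil_Integration.integral_add) (auto intro!: integrable_on_mult_right simp: absolutely_integrable_on_def)
  also have "integral {-1/2..1/2::real} (\<lambda>s. (w s)\<^sup>2) \<le> integral {-1..1} (\<lambda>s. (w s)\<^sup>2)"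
  proof (rule integral_subset_le)
    show "(\<lambda>s. (w s)\<^sup>2) integrable_on {-1..1}"
      using integrable_interval_HK[of "-1" 1 "\<lambda>s. (w s)\<^sup>2" "-1" 1] wL by (auto simp: L2I_iff absolutely_integrable_on_def)
  qed (use int in \<open>auto simp: absolutely_integrable_on_def\<close>)
  also have "\<dots> \<le> N"
    unfolding N_def using V_norm_sq_ge(1)[of w "rho \<rho>0"] LINT_Imeas_eq_integral[of "\<lambda>s. (w s)\<^sup>2"] wL by (simp add: L2I_iff)
  finally have "(w x)\<^sup>2 \<le> 2 * N + 2 * (15 / \<rho>0 * y * N)" by simp
  also have "2 * N \<le> 2 * y * N" using y E by (simp add: mult_right_mono)
  finally show "(w x)\<^sup>2 \<le> (2 + 30 / \<rho>0) * (1 - \<bar>x\<bar>) powr (-1/8) * (V_norm (rho \<rho>0) w)\<^sup>2"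
    by (simp add: y_def N_def algebra_simps)
qed

lemma abs_cont_on_diff:
  assumes "abs_cont_on c d v" "abs_cont_on c d w"
  shows "abs_cont_on c d (\<lambda>x. v x - w x)"
  unfolding abs_cont_on_def
proof (intro allI impI)
  fix e :: real assume "e > 0"
  then have e2: "e / 2 > 0" by simp
  obtain \<eta>1 where \<eta>1: "\<eta>1 > 0" "\<And>(n::nat) a b.
     (\<forall>i<n. c \<le> a i \<and> a i \<le> b i \<and> b i \<le> d) \<and>
     (\<forall>i<n. \<forall>j<n. i \<noteq> j \<longrightarrow> {a i<..<b i} \<inter> {a j<..<b j} = {}) \<and>
     (\<Sum>i<n. b i - a i) < \<eta>1 \<Longrightarrow> (\<Sum>i<n. \<bar>v (b i) - v (a i)\<bar>) < e / 2"
    using assms(1)[unfolded abs_cont_on_def, rule_format, OF e2] by blast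
  obtain \<eta>2 where \<eta>2: "\<eta>2 > 0" "\<And>(n::nat) a b.
     (\<forall>i<n. c \<le> a i \<and> a i \<le> b i \<and> b i \<le> d) \<and>
     (\<forall>i<n. \<forall>j<n. i \<noteq> j \<longrightarrow> {a i<..<b i} \<inter> {a j<..<b j} = {}) \<and>
     (\<Sum>i<n. b i - a i) < \<eta>2 \<Longrightarrow> (\<Sum>i<n. \<bar>w (b i) - w (a i)\<bar>) < e / 2"
    using assms(2)[unfolded abs_cont_on_def, rule_format, OF e2] by blast
  show "\<exists>\<eta>>0. \<forall>(n::nat) a b. (\<forall>i<n. c \<le> a i \<and> a i \<le> b i \<and> b i \<le> d) \<and>
          (\<forall>i<n. \<forall>j<n. i \<noteq> j \<longrightarrow> {a i<..<b i} \<inter> {a j<..<b j} = {}) \<and>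
          (\<Sum>i<n. b i - a i) < \<eta> \<longrightarrow> (\<Sum>i<n. \<bar>v (b i) - w (b i) - (v (a i) - w (a i))\<bar>) < e"
  proof (intro exI[of _ "min \<eta>1 \<eta>2"] conjI allI impI)
    fix n :: nat and a b :: "nat \<Rightarrow> real"
    assume *: "(\<forall>i<n. c \<le> a i \<and> a i \<le> b i \<and> b i \<le> d) \<and>
            (\<forall>i<n. \<forall>j<n. i \<noteq> j \<longrightarrow> {a i<..<b i} \<inter> {a j<..<b j} = {}) \<and>
            (\<Sum>i<n. b i - a i) < min \<eta>1 \<eta>2"
    have "(\<Sum>i<n. \<bar>v (b i) - w (b i) - (v (a i) - w (a i))\<bar>)
       \<le> (\<Sum>i<n. \<bar>v (b i) - v (a i)\<bar> + \<bar>w (b i) - w (a i)\<bar>)"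
    proof (rule sum_mono)
      fix i
      show "\<bar>v (b i) - w (b i) - (v (a i) - w (a i))\<bar> \<le> \<bar>v (b i) - v (a i)\<bar> + \<bar>w (b i) - w (a i)\<bar>"
        using abs_triangle_ineq4[of "v (b i) - v (a i)" "w (b i) - w (a i)"] by (simp add: algebra_simps)
    qed
    also have "\<dots> = (\<Sum>i<n. \<bar>v (b i) - v (a i)\<bar>) + (\<Sum>i<n. \<bar>w (b i) - w (a i)\<bar>)" by (simp add: sum.distrib)
    also have "\<dots> < e / 2 + e / 2" by (intro add_strict_mono \<eta>1 \<eta>2) (use * in auto)
    finally show "(\<Sum>i<n. \<bar>v (b i) - w (b i) - (v (a i) - w (a i))\<bar>) < e" by simp
  qed (use \<eta>1 \<eta>2 in simp)
qed

lemma V_space_differentiable_ae: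
  assumes "w \<in> V_space \<rho>"
  shows "AE x in Imeas. w field_differentiable at x"
proof -
  have "negligible (\<Union>n::nat. {x \<in> {-1 + 1 / real (n + 2)..1 - 1 / real (n + 2)}. \<not> w field_differentiable at x})"
  proof (rule negligible_countable_Union)
    fix S assume "S \<in> range (\<lambda>n::nat. {x \<in> {-1 + 1 / real (n + 2)..1 - 1 / real (n + 2)}. \<not> w field_differentiable at x})"
    then obtain n :: nat where S: "S = {x \<in> {-1 + 1 / real (n + 2)..1 - 1 / real (n + 2)}. \<not> w field_differentiable at x}" by auto
    have "1 / real (n + 2) \<le> 1 / 2" by (intro divide_left_mono) auto
    moreover have "1 / real (n + 2) > 0" by simp
    ultimately have "-1 < -1 + 1 / real (n + 2)" "-1 + 1 / real (n + 2) \<le> 1 - 1 / real (n + 2)" "1 - 1 / real (n + 2) < 1"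
      by linarith+
    then show "negligible S" unfolding S
      by (intro abs_cont_on_differentiable_ae V_space_AC[OF assms])
  qed simp
  moreover have "{x \<in> {-1<..<1}. \<not> w field_differentiable at x} \<subseteq> \<dots>"
  proof
    fix x assume x: "x \<in> {x \<in> {-1<..<1::real}. \<not> w field_differentiable at x}"
    then have "min (x + 1) (1 - x) > 0" by auto
    then obtain n where "1 / real (Suc n) < min (x + 1) (1 - x)" using nat_approx_posE by metis
    moreover have "1 / real (n + 2) \<le> 1 / real (Suc n)" by (simp add: field_simps)
    ultimately have "x \<in> {-1 + 1 / real (n + 2)..1 - 1 / real (n + 2)}" by auto
    then show "x \<in> (\<Union>n::nat. {x \<in> {-1 + 1 / real (n + 2)..1 - 1 / real (n + 2)}. \<not> w field_differentiable at x})"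
      using x by blast
  qed
  ultimately have "negligible {x \<in> {-1<..<1}. \<not> w field_differentiable at x}" by (rule negligible_subset)
  then have "AE x in lebesgue. x \<notin> {x \<in> {-1<..<1}. \<not> w field_differentiable at x}"
    by (intro AE_not_in) (simp add: negligible_iff_null_sets)
  then have "AE x in lebesgue. x \<in> {-1<..<1} \<longrightarrow> w field_differentiable at x" by eventually_elim auto
  then show ?thesis by (subst AE_restrict_space_iff) auto
qed

lemma borel_measurable_Imeas_AE:
  fixes f g :: "real \<Rightarrow> real"
  assumes "f \<in> borel_measurable Imeas" "AE x in Imeas. f x = g x"
  shows "g \<in> borel_measurable Imeas"
proof -
  have "(\<lambda>x. indicator {-1<..<1} x *\<^sub>R f x) \<in> borel_measurable lebesgue"
    using assms(1) by (simp add: borel_measurable_restrict_space_iff)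
  moreover have "AE x in lebesgue. x \<in> {-1<..<1} \<longrightarrow> f x = g x"
    using assms(2) by (subst (asm) AE_restrict_space_iff) auto
  then have "AE x in lebesgue. indicator {-1<..<1} x *\<^sub>R f x = indicator {-1<..<1} x *\<^sub>R g x"
    by eventually_elim (auto simp: indicator_def)
  ultimately have "(\<lambda>x. indicator {-1<..<1} x *\<^sub>R g x) \<in> borel_measurable lebesgue" by (rule borel_measurable_AE)
  then show ?thesis by (simp add: borel_measurable_restrict_space_iff)
qed

text \<open>\<open>deriv\<close> is a total function and respects differences only where both
  functions are differentiable, which is almost everywhere; measurability and integrability are
  transferred along that equality.\<close>

lemma V_space_diff:
  assumes v: "v \<in> V_space \<rho>" and w: "w \<in> V_space \<rho>"
  shows "(\<lambda>x. v x - w x) \<in> V_space \<rho>"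
proof -
  let ?s = "\<lambda>w x. sqrt (\<rho> x) * deriv w x"
  have L: "v \<in> L2_on (-1) 1" "w \<in> L2_on (-1) 1" "?s v \<in> L2_on (-1) 1" "?s w \<in> L2_on (-1) 1"
    using v w by (auto simp: V_space_def)
  have AC: "AC_loc (\<lambda>x. v x - w x)"
    using v w unfolding V_space_def AC_loc_def by (auto intro: abs_cont_on_diff)
  have L2: "(\<lambda>x. ?s v x - ?s w x) \<in> L2_on (-1) 1" by (rule L2I_diff[OF L(3,4)])
  have ae: "AE x in Imeas. ?s v x - ?s w x = ?s (\<lambda>x. v x - w x) x"
    using V_space_differentiable_ae[OF v] V_space_differentiable_ae[OF w]
    by eventually_elim (simp add: right_diff_distrib)
  have m: "?s (\<lambda>x. v x - w x) \<in> borel_measurable Imeas"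
    by (rule borel_measurable_Imeas_AE[OF _ ae]) (use L2 in \<open>simp add: L2I_iff\<close>)
  have "integrable Imeas (\<lambda>x. (?s (\<lambda>x. v x - w x) x)\<^sup>2)"
    by (rule integrable_cong_AE_imp[of _ "\<lambda>x. (?s v x - ?s w x)\<^sup>2"])
       (use L2 m ae in \<open>auto simp: L2I_iff elim: eventually_mono\<close>)
  then show ?thesis using L2I_diff[OF L(1,2)] AC m by (simp add: V_space_def L2I_iff)
qed

text \<open>Compactness in time: finitely many \<open>t\<close> have neighbourhoods that cover
  \<open>{a..b}\<close> and in which \<open>u\<close> moves by at most 1 in the norm of
  \<open>V\<close>. The pointwise bound is applied to the increment and to the value at such a
  \<open>t\<close> separately.\<close>

lemma cont_V_bound:
  assumes "\<rho>0 > 0" and u: "cont_V (rho \<rho>0) {a..b} u"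
  shows "\<exists>C>0. \<forall>s\<in>{a..b}. \<forall>x\<in>{-1<..<1}. (u s x)\<^sup>2 \<le> C * (1 - \<bar>x\<bar>) powr (-1/8)"
proof -
  obtain C0 where C0: "C0 > 0" "\<And>w x. w \<in> V_space (rho \<rho>0) \<Longrightarrow> x \<in> {-1<..<1} \<Longrightarrow>
      (w x)\<^sup>2 \<le> C0 * (1 - \<bar>x\<bar>) powr (-1/8) * (V_norm (rho \<rho>0) w)\<^sup>2"
    using V_space_pointwise_bound[OF assms(1)] by metis
  have V: "u t \<in> V_space (rho \<rho>0)" if "t \<in> {a..b}" for t using u that by (simp add: cont_V_def)
  have "\<exists>d>0. \<forall>s\<in>{a..b}. \<bar>s - t\<bar> < d \<longrightarrow> (V_norm (rho \<rho>0) (\<lambda>x. u s x - u t x))\<^sup>2 \<le> 1" if t: "t \<in> {a..b}" for t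
  proof -
    have "((\<lambda>s. V_norm (rho \<rho>0) (\<lambda>x. u s x - u t x)) \<longlongrightarrow> 0) (at t within {a..b})" using u t by (simp add: cont_V_def)
    then have "eventually (\<lambda>s. dist (V_norm (rho \<rho>0) (\<lambda>x. u s x - u t x)) 0 < 1) (at t within {a..b})" by (rule tendstoD) simp
    then obtain d where d: "d > 0" "\<And>s. s \<in> {a..b} \<Longrightarrow> s \<noteq> t \<Longrightarrow> dist s t < d \<Longrightarrow> dist (V_norm (rho \<rho>0) (\<lambda>x. u s x - u t x)) 0 < 1"
      unfolding eventually_at by auto
    have "(V_norm (rho \<rho>0) (\<lambda>x. u s x - u t x))\<^sup>2 \<le> 1" if s: "s \<in> {a..b}" "\<bar>s - t\<bar> < d" for s
    proof (cases "s = t")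
      case True
      then show ?thesis by (simp add: V_norm_sq V_inner_def)
    next
      case False
      then show ?thesis using d(2)[of s] s by (simp add: dist_real_def abs_square_le_1)
    qed
    then show ?thesis using d(1) by blast
  qed
  then obtain d where d: "\<And>t. t \<in> {a..b} \<Longrightarrow> d t > 0"
     "\<And>t s. t \<in> {a..b} \<Longrightarrow> s \<in> {a..b} \<Longrightarrow> \<bar>s - t\<bar> < d t \<Longrightarrow> (V_norm (rho \<rho>0) (\<lambda>x. u s x - u t x))\<^sup>2 \<le> 1"
    by metis
  have "compact {a..b}" by simp
  then obtain F where F: "F \<subseteq> {a..b}" "finite F" "{a..b} \<subseteq> (\<Union>t\<in>F. ball t (d t))"
  proof (rule compactE_image[of _ "{a..b}" "\<lambda>t. ball t (d t)"])
    show "{a..b} \<subseteq> (\<Union>t\<in>{a..b}. ball t (d t))" 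
    proof
      fix t assume "t \<in> {a..b}"
      moreover from this have "t \<in> ball t (d t)" using d(1) by simp
      ultimately show "t \<in> (\<Union>t\<in>{a..b}. ball t (d t))" by blast
    qed
  qed auto
  define C where "C = 1 + 2 * C0 * (1 + (\<Sum>t\<in>F. (V_norm (rho \<rho>0) (u t))\<^sup>2))"
  have Cp: "C > 0" using C0(1) by (simp add: C_def add_pos_nonneg sum_nonneg)
  have "(u s x)\<^sup>2 \<le> C * (1 - \<bar>x\<bar>) powr (-1/8)" if s: "s \<in> {a..b}" and x: "x \<in> {-1<..<1}" for s x
  proof -
    define y where "y = (1 - \<bar>x\<bar>) powr (-1/8)"
    have y: "y \<ge> 0" by (simp add: y_def)
    obtain t where t: "t \<in> F" "s \<in> ball t (d t)" using F(3) s by blast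
    then have tab: "t \<in> {a..b}" using F by auto
    have 1: "(V_norm (rho \<rho>0) (\<lambda>x. u s x - u t x))\<^sup>2 \<le> 1"
      using d(2)[OF tab s] t by (simp add: dist_real_def abs_minus_commute)
    have "(u s x - u t x)\<^sup>2 \<le> C0 * y * (V_norm (rho \<rho>0) (\<lambda>x. u s x - u t x))\<^sup>2"
      unfolding y_def by (rule C0(2)[OF V_space_diff[OF V[OF s] V[OF tab]] x])
    also have "\<dots> \<le> C0 * y * 1" using 1 C0(1) y by (intro mult_left_mono) auto
    finally have a: "(u s x - u t x)\<^sup>2 \<le> C0 * y" by simp
    have "(u t x)\<^sup>2 \<le> C0 * y * (V_norm (rho \<rho>0) (u t))\<^sup>2" unfolding y_def by (rule C0(2)[OF V[OF tab] x])
    also have "\<dots> \<le> C0 * y * (\<Sum>t\<in>F. (V_norm (rho \<rho>0) (u t))\<^sup>2)"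
      using C0(1) y t F by (intro mult_left_mono member_le_sum) auto
    finally have b: "(u t x)\<^sup>2 \<le> C0 * y * (\<Sum>t\<in>F. (V_norm (rho \<rho>0) (u t))\<^sup>2)" .
    have "(u s x)\<^sup>2 \<le> 2 * (u s x - u t x)\<^sup>2 + 2 * (u t x)\<^sup>2"
      using sum_squares_ge_zero[of "u s x - 2 * u t x" 0] by (simp add: power2_eq_square algebra_simps)
    also have "\<dots> \<le> 2 * (C0 * y) + 2 * (C0 * y * (\<Sum>t\<in>F. (V_norm (rho \<rho>0) (u t))\<^sup>2))" using a b by linarith
    also have "\<dots> \<le> C * y" using y by (simp add: C_def algebra_simps)
    finally show ?thesis by (simp add: y_def)
  qed
  then show ?thesis using Cp by blast
qed

lemma cont_V_L2_continuous:
  assumes u: "cont_V (rho \<rho>0) J u"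
  shows "continuous_on J (\<lambda>t. to_L2I (u t))"
  unfolding continuous_on_def
proof
  fix t assume t: "t \<in> J"
  have L: "u s \<in> L2_on (-1) 1" if "s \<in> J" for s using u that by (simp add: cont_V_def V_space_def)
  have le: "dist (to_L2I (u s)) (to_L2I (u t)) \<le> V_norm (rho \<rho>0) (\<lambda>x. u s x - u t x)" if s: "s \<in> J" for s
  proof -
    have "(dist (to_L2I (u s)) (to_L2I (u t)))\<^sup>2 \<le> (V_norm (rho \<rho>0) (\<lambda>x. u s x - u t x))\<^sup>2"
      unfolding dist_norm to_L2I_diff[OF L[OF s] L[OF t]] norm_to_L2I[OF L2I_diff[OF L[OF s] L[OF t]]]
      by (rule V_norm_sq_ge)
    then show ?thesis
      by (rule power2_le_imp_le) (simp add: V_norm_def V_inner_def Bochner_Integration.integral_nonneg)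
  qed
  have z: "((\<lambda>s. V_norm (rho \<rho>0) (\<lambda>x. u s x - u t x)) \<longlongrightarrow> 0) (at t within J)" using u t by (simp add: cont_V_def)
  have "((\<lambda>s. dist (to_L2I (u s)) (to_L2I (u t))) \<longlongrightarrow> 0) (at t within J)"
  proof (rule tendsto_sandwich[OF _ _ tendsto_const z])
    show "eventually (\<lambda>s. 0 \<le> dist (to_L2I (u s)) (to_L2I (u t))) (at t within J)" by simp
    show "eventually (\<lambda>s. dist (to_L2I (u s)) (to_L2I (u t)) \<le> V_norm (rho \<rho>0) (\<lambda>x. u s x - u t x)) (at t within J)"
      unfolding eventually_at using le by (intro exI[of _ 1]) auto
  qed
  then show "((\<lambda>t. to_L2I (u t)) \<longlongrightarrow> to_L2I (u t)) (at t within J)" by (rule tendsto_dist_iff[THEN iffD2])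
qed

text \<open>The increment is split into a change in time at the new point, which the pointwise bound
  controls by the norm of \<open>V\<close>, and a change in space at the fixed time
  \<open>t\<close>.\<close>

lemma cont_V_continuous:
  assumes "\<rho>0 > 0" and u: "cont_V (rho \<rho>0) J u"
  shows "continuous_on (J \<times> {-1<..<1}) (\<lambda>(s, x). u s x)"
  unfolding continuous_on_def
proof
  fix p :: "real \<times> real" assume p: "p \<in> J \<times> {-1<..<1}"
  then obtain t x where tx: "p = (t, x)" "t \<in> J" "x \<in> {-1<..<1}" by auto
  obtain C0 where C0: "C0 > 0" "\<And>w x. w \<in> V_space (rho \<rho>0) \<Longrightarrow> x \<in> {-1<..<1} \<Longrightarrow>
      (w x)\<^sup>2 \<le> C0 * (1 - \<bar>x\<bar>) powr (-1/8) * (V_norm (rho \<rho>0) w)\<^sup>2"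
    using V_space_pointwise_bound[OF assms(1)] by metis
  have V: "u t \<in> V_space (rho \<rho>0)" if "t \<in> J" for t using u that by (simp add: cont_V_def)
  define N where "N s = V_norm (rho \<rho>0) (\<lambda>x. u s x - u t x)" for s
  have N0: "N t = 0" by (simp add: N_def V_norm_def V_inner_def)
  have "(N \<longlongrightarrow> N t) (at t within J)" using u tx(2) unfolding N0 unfolding N_def cont_V_def by blast
  then have "continuous (at t within J) N" by (simp add: continuous_within)
  moreover have fst: "(fst \<longlongrightarrow> t) (at p within J \<times> {-1<..<1})" "(snd \<longlongrightarrow> x) (at p within J \<times> {-1<..<1})"
    using tx by (auto intro!: tendsto_eq_intros)
  ultimately have Nl: "((\<lambda>q. N (fst q)) \<longlongrightarrow> N t) (at p within J \<times> {-1<..<1})"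
    by (intro continuous_within_tendsto_compose[of t J N]) (auto simp: eventually_at intro!: exI[of _ 1])
  have "continuous (at x within {-1<..<1}) (u t)"
    using V_space_continuous[OF V[OF tx(2)]] tx by (simp add: continuous_on_eq_continuous_within)
  then have ul: "((\<lambda>q. u t (snd q)) \<longlongrightarrow> u t x) (at p within J \<times> {-1<..<1})"
    by (rule continuous_within_tendsto_compose[OF _ _ fst(2)]) (auto simp: eventually_at intro!: exI[of _ 1])
  have "((\<lambda>q. u (fst q) (snd q) - u t (snd q)) \<longlongrightarrow> 0) (at p within J \<times> {-1<..<1})"
  proof (rule Lim_null_comparison)
    have "((\<lambda>q. sqrt (C0 * (1 - \<bar>snd q\<bar>) powr (-1/8) * (N (fst q))\<^sup>2)) \<longlongrightarrow> sqrt (C0 * (1 - \<bar>x\<bar>) powr (-1/8) * (N t)\<^sup>2)) (at p within J \<times> {-1<..<1})"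
      by (intro tendsto_intros Nl fst) (use tx in auto)
    then show "((\<lambda>q. sqrt (C0 * (1 - \<bar>snd q\<bar>) powr (-1/8) * (N (fst q))\<^sup>2)) \<longlongrightarrow> 0) (at p within J \<times> {-1<..<1})"
      by (simp add: N0)
    have "norm (u s y - u t y) \<le> sqrt (C0 * (1 - \<bar>y\<bar>) powr (-1/8) * (N s)\<^sup>2)" if "s \<in> J" "y \<in> {-1<..<1}" for s y
      using C0(2)[OF V_space_diff[OF V[OF that(1)] V[OF tx(2)]] that(2)] unfolding N_def
      by (simp add: real_le_rsqrt)
    then show "eventually (\<lambda>q. norm (u (fst q) (snd q) - u t (snd q)) \<le> sqrt (C0 * (1 - \<bar>snd q\<bar>) powr (-1/8) * (N (fst q))\<^sup>2)) (at p within J \<times> {-1<..<1})"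
      unfolding eventually_at by (intro exI[of _ 1]) auto
  qed
  from tendsto_add[OF this ul]
  show "((\<lambda>(s, x). u s x) \<longlongrightarrow> (case p of (s, x) \<Rightarrow> u s x)) (at p within J \<times> {-1<..<1})"
    by (simp add: case_prod_unfold tx)
qed

section \<open>Continuity of the memory and source terms\<close>

lemma memory_continuous:
  assumes k: "C1_rect {-\<tau>..0} {-1..1} k" and u: "continuous_on ({-\<tau>..T} \<times> {-1<..<1}) (\<lambda>(s, x). u s x)"
    and "\<tau> > 0" "T \<ge> 0"
  shows "continuous_on ({0..T} \<times> {-1<..<1}) (\<lambda>(t, x). memory \<tau> k u t x)"
proof -
  have kc: "continuous_on ({-\<tau>..0} \<times> {-1..1}) (\<lambda>(s, x). k s x)" using k by (auto simp: C1_rect_def)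
  have "continuous_on (({0..T} \<times> {-1<..<1}) \<times> {-\<tau>..0}) (\<lambda>(p, s). k s (snd p) * u (fst p + s) (snd p))"
  proof -
    have "continuous_on (({0..T} \<times> {-1<..<1}) \<times> {-\<tau>..0}) (\<lambda>q. (\<lambda>(s, x). k s x) (snd q, snd (fst q)))"
      by (rule continuous_on_compose2[OF kc]) (auto intro!: continuous_intros)
    moreover have "continuous_on (({0..T} \<times> {-1<..<1}) \<times> {-\<tau>..0}) (\<lambda>q. (\<lambda>(s, x). u s x) (fst (fst q) + snd q, snd (fst q)))"
      by (rule continuous_on_compose2[OF u]) (auto intro!: continuous_intros)
    ultimately show ?thesis by (auto simp: case_prod_unfold intro!: continuous_on_mult)
  qed
  then have "continuous_on ({0..T} \<times> {-1<..<1}) (\<lambda>p. integral (cbox (-\<tau>) 0) (\<lambda>s. k s (snd p) * u (fst p + s) (snd p)))"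
    by (intro integral_continuous_on_param) simp
  then show ?thesis by (simp add: memory_def case_prod_unfold)
qed

lemma C1_bounded_on_continuous: "C1_bounded_on D g \<Longrightarrow> continuous_on D g"
  unfolding C1_bounded_on_def by (meson DERIV_continuous_on)

lemma C2_bounded_on_continuous: "C2_bounded_on D g \<Longrightarrow> continuous_on D g"
  unfolding C2_bounded_on_def by (meson DERIV_continuous_on)

lemma Q_pt_continuous: "q \<in> Q_pt \<Longrightarrow> continuous_on {-1<..<1} q"
  by (auto simp: Q_pt_def piecewise_analytic_def)

lemma Q_pt_bounded:
  assumes "q \<in> Q_pt"
  shows "\<exists>B. \<forall>x\<in>{-1<..<1}. \<bar>q x\<bar> \<le> B"
proof -
  obtain L where L: "L-lipschitz_on {-1<..<1} q" using assms by (auto simp: Q_pt_def)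
  have "\<bar>q x\<bar> \<le> \<bar>q 0\<bar> + L" if x: "x \<in> {-1<..<1}" for x
  proof -
    have "\<bar>q x - q 0\<bar> \<le> L * \<bar>x - 0\<bar>" using lipschitz_onD[OF L x, of 0] by (simp add: dist_real_def)
    also have "\<dots> \<le> L * 1" using x lipschitz_on_nonneg[OF L] by (intro mult_left_mono) auto
    finally show ?thesis by linarith
  qed
  then show ?thesis by blast
qed

lemma source_continuous:
  assumes "\<tau> > 0" "T \<ge> 0" and k: "C1_rect {-\<tau>..0} {-1..1} k" and u: "continuous_on ({-\<tau>..T} \<times> {-1<..<1}) (\<lambda>(s, x). u s x)"
    and r: "C1_bounded_on {0..} r" and \<beta>: "C2_bounded_on UNIV \<beta>" and \<epsilon>: "C1_bounded_on UNIV \<epsilon>" and f: "C1_bounded_on UNIV f"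
    and q: "q \<in> Q_pt"
  shows "continuous_on ({0..T} \<times> {-1<..<1}) (\<lambda>(t, x). source \<tau> r \<beta> \<epsilon> k f q u t x)"
proof -
  have c: "continuous_on UNIV \<beta>" "continuous_on UNIV \<epsilon>" "continuous_on UNIV f" "continuous_on {0..} r" "continuous_on {-1<..<1} q"
    using r \<beta> \<epsilon> f q by (auto intro: C1_bounded_on_continuous C2_bounded_on_continuous Q_pt_continuous)
  let ?D = "{0..T} \<times> {-1<..<1::real}"
  have u': "continuous_on ?D (\<lambda>p. u (fst p) (snd p))"
    by (rule continuous_on_subset[OF u[unfolded case_prod_unfold]]) (use assms(1) in auto)
  have m: "continuous_on ?D (\<lambda>p. memory \<tau> k u (fst p) (snd p))"
    using memory_continuous[OF k u assms(1,2)] by (simp add: case_prod_unfold)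
  have 1: "continuous_on ?D (\<lambda>p. r (fst p))" "continuous_on ?D (\<lambda>p. q (snd p))"
    by (rule continuous_on_compose2[OF c(4)], auto intro!: continuous_intros, rule continuous_on_compose2[OF c(5)], auto intro!: continuous_intros)
  have 2: "continuous_on ?D (\<lambda>p. \<beta> (u (fst p) (snd p)))" "continuous_on ?D (\<lambda>p. \<epsilon> (u (fst p) (snd p)))"
    "continuous_on ?D (\<lambda>p. f (memory \<tau> k u (fst p) (snd p)))"
    by (rule continuous_on_compose2[OF c(1) u'], simp, rule continuous_on_compose2[OF c(2) u'], simp, rule continuous_on_compose2[OF c(3) m], simp)
  show ?thesis unfolding source_def case_prod_unfold
    by (intro continuous_intros 1 2 u')
qed

lemma integrable_powr_boundary: "integrable Imeas (\<lambda>x. (1 - \<bar>x\<bar>) powr (-1/2))"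
proof -
  have 0: "((\<lambda>x::real. x powr (-1/2)) has_integral 2) {0..1}"
    using has_integral_powr_from_0[of "-1/2" 1] by simp
  have "((\<lambda>x::real. (1 * x + 1) powr (-1/2)) has_integral 2) {-1..0}"
    using has_integral_affinity'[OF 0[folded box_real(2)], of 1 1] by simp
  then have b: "((\<lambda>x::real. (1 - \<bar>x\<bar>) powr (-1/2)) has_integral 2) {-1..0}"
    by (rule has_integral_eq[rotated]) (simp add: add.commute)
  then have "((\<lambda>x::real. (1 - \<bar>- x\<bar>) powr (-1/2)) has_integral 2) {-0..- (-1)}"
    by (subst has_integral_reflect_real)
  then have a: "((\<lambda>x::real. (1 - \<bar>x\<bar>) powr (-1/2)) has_integral 2) {0..1}" by simp
  from has_integral_combine[OF _ _ b a]
  have "((\<lambda>x::real. (1 - \<bar>x\<bar>) powr (-1/2)) has_integral 4) {-1..1}" by simp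
  then have "(\<lambda>x::real. (1 - \<bar>x\<bar>) powr (-1/2)) absolutely_integrable_on {-1..1}"
    by (intro nonnegative_absolutely_integrable_1) auto
  then have "(\<lambda>x::real. (1 - \<bar>x\<bar>) powr (-1/2)) absolutely_integrable_on {-1<..<1}"
    by (rule set_integrable_subset) auto
  then show ?thesis by (simp add: set_integrable_def integrable_restrict_space)
qed

section \<open>Weak form of the equation\<close>

text \<open>Thanks to the common bound \<open>C\<close>, approximating \<open>Z\<close> by test
  functions gives convergence that is uniform over \<open>J\<close>.\<close>

lemma continuous_on_test_function_dense:
  fixes G :: "real \<Rightarrow> L2I"
  assumes bound: "\<And>s. s \<in> J \<Longrightarrow> norm (G s) \<le> C"
    and test: "\<And>z. test_function (-1) 1 z \<Longrightarrow> continuous_on J (\<lambda>s. inner (G s) (to_L2I z))"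
  shows "continuous_on J (\<lambda>s. inner (G s) Z)"
proof (cases "J = {}")
  case False
  then have C: "C \<ge> 0" using bound norm_ge_zero order_trans by blast
  have "\<exists>z. test_function (-1) 1 z \<and> dist (to_L2I z) Z < 1 / real (Suc n)" for n
    by (rule test_function_dense) simp
  then obtain z where z: "\<And>n. test_function (-1) 1 (z n)" "\<And>n. dist (to_L2I (z n)) Z < 1 / real (Suc n)" by metis
  show ?thesis
  proof (rule uniform_limit_theorem[where f = "\<lambda>n s. inner (G s) (to_L2I (z n))" and F = sequentially])
    show "\<forall>\<^sub>F n in sequentially. continuous_on J (\<lambda>s. inner (G s) (to_L2I (z n)))" using test z by simp
    show "uniform_limit J (\<lambda>n s. inner (G s) (to_L2I (z n))) (\<lambda>s. inner (G s) Z) sequentially"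
      unfolding uniform_limit_iff
    proof (intro allI impI)
      fix e :: real assume "e > 0"
      have "(\<lambda>n. C * (1 / real (Suc n))) \<longlonglongrightarrow> C * 0"
        by (intro tendsto_intros LIMSEQ_Suc[OF lim_1_over_n])
      then have "eventually (\<lambda>n. C * (1 / real (Suc n)) < e) sequentially"
        using \<open>e > 0\<close> by (intro order_tendstoD) auto
      then show "\<forall>\<^sub>F n in sequentially. \<forall>s\<in>J. dist (inner (G s) (to_L2I (z n))) (inner (G s) Z) < e"
      proof eventually_elim
        case (elim n)
        show ?case
        proof
          fix s assume s: "s \<in> J"
          have "dist (inner (G s) (to_L2I (z n))) (inner (G s) Z) = \<bar>inner (G s) (to_L2I (z n) - Z)\<bar>"
            by (simp add: dist_real_def inner_diff_right)
          also have "\<dots> \<le> norm (G s) * norm (to_L2I (z n) - Z)" by (rule Cauchy_Schwarz_ineq2)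
          also have "\<dots> \<le> C * (1 / real (Suc n))"
            using bound[OF s] z(2)[of n] C by (intro mult_mono) (auto simp: dist_norm)
          finally show "dist (inner (G s) (to_L2I (z n))) (inner (G s) Z) < e" using elim by simp
        qed
      qed
    qed
  qed simp
qed simp

locale problem_data =
  fixes \<tau> \<rho>0 :: real and r \<beta> \<epsilon> f :: "real \<Rightarrow> real" and k :: "real \<Rightarrow> real \<Rightarrow> real" and S :: "real \<Rightarrow> L2I \<Rightarrow> L2I"
  assumes tau: "\<tau> > 0" and rho0: "\<rho>0 > 0" and r: "C1_bounded_on {0..} r" and beta: "C2_bounded_on UNIV \<beta>"
    and eps: "C1_bounded_on UNIV \<epsilon>" and k: "C1_rect {-\<tau>..0} {-1..1} k" and f: "C1_bounded_on UNIV f"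
    and S: "C0_semigroup S" and gen: "infinitesimal_generator S = graph_A (rho \<rho>0)"
begin

lemma solution_continuous:
  assumes "mild_solution \<tau> \<rho>0 S r \<beta> \<epsilon> k f q u0 u" "T > 0"
  shows "cont_V (rho \<rho>0) {-\<tau>..T} u" "continuous_on ({-\<tau>..T} \<times> {-1<..<1}) (\<lambda>(s, x). u s x)"
proof -
  show 1: "cont_V (rho \<rho>0) {-\<tau>..T} u" using assms by (simp add: mild_solution_def)
  show "continuous_on ({-\<tau>..T} \<times> {-1<..<1}) (\<lambda>(s, x). u s x)" by (rule cont_V_continuous[OF rho0 1])
qed

text \<open>With \<open>y = (1 - |x|) powr (-1/8)\<close>, the absorption is of order
  \<open>(u^2)^2\<close>, hence of order \<open>y^2\<close>, and the other terms are bounded; the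
  square of the source is of order \<open>y^4\<close>, which is integrable.\<close>

lemma source_norm_bound:
  assumes q: "q \<in> Q_pt" and mild: "mild_solution \<tau> \<rho>0 S r \<beta> \<epsilon> k f q u0 u" and T: "T > 0"
  shows "\<exists>C. \<forall>s\<in>{0..T}. norm (to_L2I (source \<tau> r \<beta> \<epsilon> k f q u s)) \<le> C"
proof -
  obtain C where C: "C > 0" "\<And>s x. s \<in> {-\<tau>..T} \<Longrightarrow> x \<in> {-1<..<1} \<Longrightarrow> (u s x)\<^sup>2 \<le> C * (1 - \<bar>x\<bar>) powr (-1/8)"
    using cont_V_bound[OF rho0 solution_continuous(1)[OF mild T]] by metis
  obtain Br where Br: "\<And>t. t \<in> {0..} \<Longrightarrow> \<bar>r t\<bar> \<le> Br" using r by (auto simp: C1_bounded_on_def bounded_real)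
  obtain Bb where Bb: "\<And>z. \<bar>\<beta> z\<bar> \<le> Bb" using beta by (auto simp: C2_bounded_on_def bounded_real)
  obtain Be where Be: "\<And>z. \<bar>\<epsilon> z\<bar> \<le> Be" using eps by (auto simp: C1_bounded_on_def bounded_real)
  obtain Bf where Bf: "\<And>z. \<bar>f z\<bar> \<le> Bf" using f by (auto simp: C1_bounded_on_def bounded_real)
  obtain Bq where Bq: "\<And>x. x \<in> {-1<..<1} \<Longrightarrow> \<bar>q x\<bar> \<le> Bq" using Q_pt_bounded[OF q] by metis
  have nn: "Br \<ge> 0" "Bb \<ge> 0" "Be \<ge> 0" "Bf \<ge> 0" "Bq \<ge> 0"
    using Br[of 0] Bb[of 0] Be[of 0] Bf[of 0] Bq[of 0] by auto
  define K where "K = Br * Bq * Bb + Be * C\<^sup>2 + Bf"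
  have K: "K \<ge> 0" using nn C by (simp add: K_def)
  have bound: "(source \<tau> r \<beta> \<epsilon> k f q u s x)\<^sup>2 \<le> K\<^sup>2 * (1 - \<bar>x\<bar>) powr (-1/2)" if s: "s \<in> {0..T}" and x: "x \<in> {-1<..<1}" for s x
  proof -
    define y where "y = (1 - \<bar>x\<bar>) powr (-1/8)"
    have y: "y \<ge> 1" unfolding y_def using x powr_mono2'[of "-1/8" "1 - \<bar>x\<bar>" 1] by auto
    have y2: "y\<^sup>2 \<ge> 1" using y by (simp add: one_le_power)
    have y4: "(y\<^sup>2)\<^sup>2 = (1 - \<bar>x\<bar>) powr (-1/2)"
      using x unfolding y_def by (auto simp: powr_power)
    have u: "(u s x)\<^sup>2 \<le> C * y" unfolding y_def using C(2)[of s x] s x tau by auto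
    have "\<bar>r s * q x * \<beta> (u s x)\<bar> \<le> Br * Bq * Bb"
      unfolding abs_mult using Br[of s] Bq[OF x] Bb[of "u s x"] s nn by (intro mult_mono) auto
    moreover have "\<bar>\<epsilon> (u s x) * \<bar>u s x\<bar> ^ 3 * u s x\<bar> \<le> Be * C\<^sup>2 * y\<^sup>2"
    proof -
      have "\<bar>\<epsilon> (u s x) * \<bar>u s x\<bar> ^ 3 * u s x\<bar> = \<bar>\<epsilon> (u s x)\<bar> * ((u s x)\<^sup>2)\<^sup>2"
        by (simp add: abs_mult power2_eq_square power3_eq_cube)
      also have "\<dots> \<le> Be * (C * y)\<^sup>2" using Be[of "u s x"] u nn by (intro mult_mono power_mono) auto
      finally show ?thesis by (simp add: power_mult_distrib mult.assoc)
    qed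
    moreover have "\<bar>f (memory \<tau> k u s x)\<bar> \<le> Bf" by (rule Bf)
    ultimately have "\<bar>source \<tau> r \<beta> \<epsilon> k f q u s x\<bar> \<le> Br * Bq * Bb + Be * C\<^sup>2 * y\<^sup>2 + Bf"
      unfolding source_def by linarith
    also have "\<dots> \<le> Br * Bq * Bb * y\<^sup>2 + Be * C\<^sup>2 * y\<^sup>2 + Bf * y\<^sup>2"
      using nn y2 mult_left_mono[OF y2, of "Br * Bq * Bb"] mult_left_mono[OF y2, of Bf] by simp
    also have "\<dots> = K * y\<^sup>2" by (simp add: K_def algebra_simps)
    finally have "(source \<tau> r \<beta> \<epsilon> k f q u s x)\<^sup>2 \<le> (K * y\<^sup>2)\<^sup>2"
      using K y2 by (intro abs_le_square_iff[THEN iffD1]) simp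
    then show ?thesis unfolding power_mult_distrib y4 .
  qed
  show ?thesis
  proof (intro exI ballI)
    fix s assume s: "s \<in> {0..T}"
    have L: "source \<tau> r \<beta> \<epsilon> k f q u s \<in> L2_on (-1) 1" using mild T s by (simp add: mild_solution_def)
    have "(norm (to_L2I (source \<tau> r \<beta> \<epsilon> k f q u s)))\<^sup>2 \<le> (LINT x|Imeas. K\<^sup>2 * (1 - \<bar>x\<bar>) powr (-1/2))"
      unfolding norm_to_L2I[OF L] using L integrable_powr_boundary bound[OF s]
      by (intro integral_mono) (auto simp: L2I_iff space_restrict_space)
    also have "\<dots> = (sqrt (LINT x|Imeas. K\<^sup>2 * (1 - \<bar>x\<bar>) powr (-1/2)))\<^sup>2"
      by (rule real_sqrt_pow2[symmetric]) (auto intro!: Bochner_Integration.integral_nonneg)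
    finally show "norm (to_L2I (source \<tau> r \<beta> \<epsilon> k f q u s)) \<le> sqrt (LINT x|Imeas. K\<^sup>2 * (1 - \<bar>x\<bar>) powr (-1/2))"
      by (rule power2_le_imp_le) (auto intro!: Bochner_Integration.integral_nonneg)
  qed
qed

text \<open>A test function sees the source only on a compact rectangle, where it is jointly
  continuous; general \<open>Z\<close> follow by \<open>continuous_on_test_function_dense\<close>.
  This yields the integrability in time that \<open>mild_imp_weak\<close> asks for.\<close>

lemma source_weakly_continuous:
  assumes q: "q \<in> Q_pt" and mild: "mild_solution \<tau> \<rho>0 S r \<beta> \<epsilon> k f q u0 u" and T: "T > 0"
  shows "continuous_on {0..T} (\<lambda>s. inner (to_L2I (source \<tau> r \<beta> \<epsilon> k f q u s)) Z)"
proof -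
  obtain C where C: "\<And>s. s \<in> {0..T} \<Longrightarrow> norm (to_L2I (source \<tau> r \<beta> \<epsilon> k f q u s)) \<le> C"
    using source_norm_bound[OF assms] by metis
  show ?thesis
  proof (rule continuous_on_test_function_dense[OF C])
    fix z assume z: "test_function (-1) 1 z"
    obtain c d where cd: "-1 < c" "c < d" "d < 1" "\<And>x. x \<notin> {c<..<d} \<Longrightarrow> z x = 0" "smooth z"
      using test_functionE[OF z] by auto
    note zL = test_function_L2[OF z]
    have eq: "inner (to_L2I (source \<tau> r \<beta> \<epsilon> k f q u s)) (to_L2I z) = integral (cbox c d) (\<lambda>x. source \<tau> r \<beta> \<epsilon> k f q u s x * z x)" if s: "s \<in> {0..T}" for s
    proof -
      have L: "source \<tau> r \<beta> \<epsilon> k f q u s \<in> L2_on (-1) 1" using mild T s by (simp add: mild_solution_def)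
      have ind: "source \<tau> r \<beta> \<epsilon> k f q u s x * z x = indicator {c..d} x * (source \<tau> r \<beta> \<epsilon> k f q u s x * z x)" for x
        using cd(4)[of x] by (cases "x \<in> {c<..<d}") (auto simp: indicator_def)
      have "inner (to_L2I (source \<tau> r \<beta> \<epsilon> k f q u s)) (to_L2I z) = (LINT x|Imeas. indicator {c..d} x * (source \<tau> r \<beta> \<epsilon> k f q u s x * z x))"
        unfolding inner_to_L2I[OF L zL] by (simp only: ind[symmetric])
      also have "\<dots> = integral {c..d} (\<lambda>x. source \<tau> r \<beta> \<epsilon> k f q u s x * z x)"
        by (rule LINT_indicator_eq_integral) (use L2I_mult[OF L zL] cd in \<open>auto simp only: ind[symmetric]\<close>)
      finally show ?thesis by simp
    qed
    have sc: "continuous_on ({0..T} \<times> {-1<..<1}) (\<lambda>(t, x). source \<tau> r \<beta> \<epsilon> k f q u t x)"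
      by (rule source_continuous[OF tau _ k solution_continuous(2)[OF mild T] r beta eps f q]) (use T in simp)
    have "continuous_on ({0..T} \<times> cbox c d) (\<lambda>(s, x). source \<tau> r \<beta> \<epsilon> k f q u s x * z x)"
    proof -
      have "continuous_on ({0..T} \<times> cbox c d) (\<lambda>p. source \<tau> r \<beta> \<epsilon> k f q u (fst p) (snd p))"
        by (rule continuous_on_subset[OF sc[unfolded case_prod_unfold]]) (use cd in auto)
      moreover have "continuous_on ({0..T} \<times> cbox c d) (\<lambda>p. z (snd p))"
        by (rule continuous_on_compose2[OF smooth_continuous[OF cd(5), of UNIV]]) (auto intro!: continuous_intros)
      ultimately show ?thesis by (auto simp: case_prod_unfold intro!: continuous_on_mult)
    qed
    then have "continuous_on {0..T} (\<lambda>s. integral (cbox c d) (\<lambda>x. source \<tau> r \<beta> \<epsilon> k f q u s x * z x))"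
      by (rule integral_continuous_on_param)
    then show "continuous_on {0..T} (\<lambda>s. inner (to_L2I (source \<tau> r \<beta> \<epsilon> k f q u s)) (to_L2I z))"
      by (rule continuous_on_eq) (simp add: eq)
  qed
qed

text \<open>\<open>mild_imp_weak\<close> gives the identity with the operator on the test function.
  At almost every time \<open>u\<close> lies in the domain, so symmetry moves the operator back onto
  \<open>u\<close>; the resulting identity is bounded in \<open>Z\<close> and extends from test
  functions to all of \<open>L2I\<close>.\<close>

lemma weak_solution:
  assumes q: "q \<in> Q_pt" and mild: "mild_solution \<tau> \<rho>0 S r \<beta> \<epsilon> k f q u0 u" and T: "T > 0"
  defines "G \<equiv> \<lambda>s. to_L2I (source \<tau> r \<beta> \<epsilon> k f q u s)"
  obtains AU N where "negligible N" "\<And>s. s \<in> {0..T} - N \<Longrightarrow> (to_L2I (u s), AU s) \<in> graph_A (rho \<rho>0)"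
    "(\<lambda>s. norm (AU s)) absolutely_integrable_on {0..T}"
    "\<And>Z. (\<lambda>s. inner (AU s) Z) absolutely_integrable_on {0..T}"
    "\<And>Z t. t \<in> {0..T} \<Longrightarrow> inner (to_L2I (u t)) Z = inner (to_L2I (u 0)) Z + integral {0..t} (\<lambda>s. inner (AU s + G s) Z)"
proof -
  obtain AU where AE: "AE t in lebesgue_on {0<..<T}. (to_L2I (u t), AU t) \<in> graph_A (rho \<rho>0)"
    and AUL: "(\<lambda>t. (to_L2I (u t), AU t)) \<in> L2_on 0 T"
    using mild T unfolding mild_solution_def L2_dom_A_def by blast
  have m: "(\<lambda>t. (to_L2I (u t), AU t)) \<in> borel_measurable (lebesgue_on {0<..<T})"
    and i2: "integrable (lebesgue_on {0<..<T}) (\<lambda>t. (norm (to_L2I (u t), AU t))\<^sup>2)"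
    using AUL by (auto simp: L2_on_def)
  have mAU [measurable]: "AU \<in> borel_measurable (lebesgue_on {0<..<T})"
    using measurable_compose[OF m borel_measurable_continuous_onI[of snd]] by (simp add: continuous_on_snd)
  have fm: "finite_measure (lebesgue_on {0<..<T})" by (rule finite_measure_lebesgue_on) simp
  have inorm: "integrable (lebesgue_on {0<..<T}) (\<lambda>t. norm (AU t))"
  proof (rule Bochner_Integration.integrable_bound[of _ "\<lambda>t. 1 + (norm (to_L2I (u t), AU t))\<^sup>2"])
    show "integrable (lebesgue_on {0<..<T}) (\<lambda>t. 1 + (norm (to_L2I (u t), AU t))\<^sup>2)"
      using i2 finite_measure.integrable_const[OF fm, of "1::real"] by simp
    \<comment> \<open>On a bounded time interval this bound turns square integrability into
      integrability of the norm.\<close>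
    have "x \<le> 1 + (y\<^sup>2 + x\<^sup>2)" for x y :: real
    proof -
      have "x \<le> x\<^sup>2 + 1/4" using zero_le_power2[of "x - 1/2"] by (simp add: power2_eq_square algebra_simps)
      moreover have "0 \<le> y\<^sup>2" by simp
      ultimately show ?thesis by linarith
    qed
    then show "AE x in lebesgue_on {0<..<T}. norm (norm (AU x)) \<le> norm (1 + (norm (to_L2I (u x), AU x))\<^sup>2)"
      by (auto simp: norm_Pair)
  qed measurable
  then have norm_ai: "(\<lambda>s. norm (AU s)) absolutely_integrable_on {0..T}" by (rule integrable_interval_HK) auto
  have inner_ai: "(\<lambda>s. inner (AU s) Z) absolutely_integrable_on {c..d}" if "0 \<le> c" "d \<le> T" for Z c d
  proof (rule integrable_interval_HK[OF _ that])
    show "integrable (lebesgue_on {0<..<T}) (\<lambda>s. inner (AU s) Z)"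
    proof (rule Bochner_Integration.integrable_bound[of _ "\<lambda>s. norm (AU s) * norm Z"])
      show "AE s in lebesgue_on {0<..<T}. norm (inner (AU s) Z) \<le> norm (norm (AU s) * norm Z)"
        using Cauchy_Schwarz_ineq2 by auto
    qed (use inorm in auto)
  qed
  obtain N0 where N0: "negligible N0" "\<And>s. s \<in> {0<..<T} \<Longrightarrow> s \<notin> N0 \<Longrightarrow> (to_L2I (u s), AU s) \<in> graph_A (rho \<rho>0)"
  proof -
    have "AE t in lebesgue. t \<in> {0<..<T} \<longrightarrow> (to_L2I (u t), AU t) \<in> graph_A (rho \<rho>0)"
      using AE by (subst (asm) AE_restrict_space_iff) auto
    then show ?thesis using that by (auto elim!: AE_E3 simp: negligible_iff_null_sets)
  qed
  \<comment> \<open>The graph relation is known on the open interval of times only; its end points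
    join the null set.\<close>
  define N where "N = N0 \<union> {0, T}"
  have N: "negligible N" using N0(1) by (simp add: N_def)
  have graph: "(to_L2I (u s), AU s) \<in> graph_A (rho \<rho>0)" if "s \<in> {0..T} - N" for s
    using N0(2)[of s] that by (auto simp: N_def less_le)
  obtain C where C: "\<And>s. s \<in> {0..T} \<Longrightarrow> norm (G s) \<le> C" unfolding G_def using source_norm_bound[OF q mild T] by metis
  have C0: "C \<ge> 0" using order_trans[OF norm_ge_zero C[of 0]] T by simp
  have Gc: "continuous_on {0..T} (\<lambda>s. inner (G s) Z)" for Z unfolding G_def by (rule source_weakly_continuous[OF q mild T])
  have Gi: "(\<lambda>s. inner (G s) Z) integrable_on {0..t}" if "t \<in> {0..T}" for Z t
    by (intro integrable_continuous_interval continuous_on_subset[OF Gc]) (use that in auto)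
  have Ai: "(\<lambda>s. inner (AU s) Z) integrable_on {0..t}" if "t \<in> {0..T}" for Z t
    using inner_ai[of 0 t Z] that by (auto simp: absolutely_integrable_on_def)
  define E where "E t Z = inner (to_L2I (u t)) Z - inner (to_L2I (u 0)) Z - integral {0..t} (\<lambda>s. inner (AU s + G s) Z)" for t Z
  have Etest: "E t (to_L2I z) = 0" if z: "test_function (-1) 1 z" and t: "t \<in> {0..T}" for z t
  proof -
    define B where "B = to_L2I (deriv (\<lambda>x. rho \<rho>0 x * deriv z x))"
    have "inner (to_L2I (u t)) (to_L2I z) = inner (to_L2I (u 0)) (to_L2I z) +
      integral {0..t} (\<lambda>s. inner (to_L2I (u s)) B + inner (G s) (to_L2I z))"
      unfolding B_def
    proof (rule mild_imp_weak[OF rho0 S gen z, where T = T and U = "\<lambda>t. to_L2I (u t)" and G = G and C = C])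
      have "u 0 x = u0 0 x" if "x \<in> {-1<..<1}" for x
        using mild T tau that by (force simp: mild_solution_def)
      moreover have "u 0 \<in> L2_on (-1) 1"
        using solution_continuous(1)[OF mild T] T tau by (auto simp: cont_V_def V_space_def)
      ultimately have "to_L2I (u0 0) = to_L2I (u 0)"
      proof -
        assume eq: "\<And>x. x \<in> {-1<..<1} \<Longrightarrow> u 0 x = u0 0 x" and L: "u 0 \<in> L2_on (-1) 1"
        have "u0 0 \<in> borel_measurable Imeas \<longleftrightarrow> u 0 \<in> borel_measurable Imeas"
          by (rule measurable_cong) (simp add: space_restrict_space eq)
        moreover have "integrable Imeas (\<lambda>x. (u0 0 x)\<^sup>2) \<longleftrightarrow> integrable Imeas (\<lambda>x. (u 0 x)\<^sup>2)"
          by (rule Bochner_Integration.integrable_cong) (simp_all add: space_restrict_space eq)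
        ultimately have "u0 0 \<in> L2_on (-1) 1" using L by (simp add: L2I_iff)
        then show ?thesis using L by (subst to_L2I_eq_iff) (auto simp: space_restrict_space eq intro!: AE_I2)
      qed
      moreover have "integrable (lebesgue_on {0..t}) (\<lambda>s. S (t - s) (G s)) \<and>
          to_L2I (u t) = S t (to_L2I (u0 0)) + (LINT s|lebesgue_on {0..t}. S (t - s) (G s))" if "t \<in> {0..T}" for t
        unfolding G_def using mild[unfolded mild_solution_def, rule_format, OF T] that by blast
      ultimately show "integrable (lebesgue_on {0..t}) (\<lambda>s. S (t - s) (G s)) \<and>
          to_L2I (u t) = S t (to_L2I (u 0)) + (LINT s|lebesgue_on {0..t}. S (t - s) (G s))" if "t \<in> {0..T}" for t
        using that by metis
      show "continuous_on {0..T} (\<lambda>t. to_L2I (u t))"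
        by (rule continuous_on_subset[OF cont_V_L2_continuous[OF solution_continuous(1)[OF mild T]]]) (use tau in auto)
      show "(\<lambda>s. inner (G s) (to_L2I z)) integrable_on {0..T}" using Gi T by simp
    qed (use T C t in auto)
    \<comment> \<open>Here \<open>graph_A_symmetric\<close> is read from right to left at almost
      every time.\<close>
    also have "integral {0..t} (\<lambda>s. inner (to_L2I (u s)) B + inner (G s) (to_L2I z)) = integral {0..t} (\<lambda>s. inner (AU s + G s) (to_L2I z))"
    proof (rule integral_spike[OF N])
      fix s assume "s \<in> {0..t} - N"
      then have "s \<in> {0..T} - N" using t by auto
      from graph_A_symmetric[OF rho0 graph[OF this] z]
      show "inner (AU s + G s) (to_L2I z) = inner (to_L2I (u s)) B + inner (G s) (to_L2I z)"
        by (simp add: B_def inner_add_left)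
    qed
    finally show ?thesis by (simp add: E_def)
  qed
  have Ei: "(\<lambda>s. inner (AU s + G s) Z) integrable_on {0..t}" if "t \<in> {0..T}" for Z t
    unfolding inner_add_left by (intro integrable_add Ai Gi that)
  have Ediff: "E t (Z - Z') = E t Z - E t Z'" if "t \<in> {0..T}" for t Z Z'
    using Henstock_Kurzweil_Integration.integral_diff[OF Ei[OF that, of Z] Ei[OF that, of Z']]
    by (simp add: E_def inner_diff_right)
  have E0: "E t Z = 0" if t: "t \<in> {0..T}" for t Z
  proof -
    have ni: "(\<lambda>s. norm (AU s)) integrable_on {0..t}"
      using set_integrable_subset[OF norm_ai, of "{0..t}"] t by (auto simp: absolutely_integrable_on_def)
    define K where "K = norm (to_L2I (u t)) + norm (to_L2I (u 0)) + integral {0..t} (\<lambda>s. norm (AU s) + C)"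
    have Ebound: "\<bar>E t Z\<bar> \<le> K * norm Z" for Z
    proof -
      have "norm (integral {0..t} (\<lambda>s. inner (AU s + G s) Z)) \<le> integral {0..t} (\<lambda>s. (norm (AU s) + C) * norm Z)"
      proof (rule integral_norm_bound_integral[OF Ei[OF t]])
        show "(\<lambda>s. (norm (AU s) + C) * norm Z) integrable_on {0..t}"
          by (intro integrable_on_mult_left integrable_add ni integrable_const_ivl)
        fix s assume s: "s \<in> {0..t}"
        have "norm (inner (AU s + G s) Z) \<le> norm (AU s + G s) * norm Z" using Cauchy_Schwarz_ineq2[of "AU s + G s" Z] by simp
        also have "\<dots> \<le> (norm (AU s) + C) * norm Z"
          using C[of s] s t norm_triangle_ineq[of "AU s" "G s"] by (intro mult_right_mono) auto
        finally show "norm (inner (AU s + G s) Z) \<le> (norm (AU s) + C) * norm Z" .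
      qed
      also have "\<dots> = integral {0..t} (\<lambda>s. norm (AU s) + C) * norm Z" by (rule Henstock_Kurzweil_Integration.integral_mult_left)
      finally have "\<bar>integral {0..t} (\<lambda>s. inner (AU s + G s) Z)\<bar> \<le> integral {0..t} (\<lambda>s. norm (AU s) + C) * norm Z" by simp
      then show ?thesis
        using Cauchy_Schwarz_ineq2[of "to_L2I (u t)" Z] Cauchy_Schwarz_ineq2[of "to_L2I (u 0)" Z]
        unfolding E_def K_def distrib_right by linarith
    qed
    have K: "K \<ge> 0"
    proof -
      have "integral {0..t} (\<lambda>s. norm (AU s) + C) \<ge> 0"
        by (rule Henstock_Kurzweil_Integration.integral_nonneg) (use C0 in \<open>auto intro!: integrable_add ni\<close>)
      then show ?thesis by (simp add: K_def)
    qed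
    have "\<bar>E t Z\<bar> \<le> e" if "e > 0" for e
    proof -
      obtain z where z: "test_function (-1) 1 z" "dist (to_L2I z) Z < e / (K + 1)"
        using test_function_dense[of "e / (K + 1)" Z] \<open>e > 0\<close> K by auto
      have "\<bar>E t Z\<bar> = \<bar>E t (Z - to_L2I z)\<bar>" using Ediff[OF t] Etest[OF z(1) t] by simp
      also have "\<dots> \<le> K * norm (Z - to_L2I z)" by (rule Ebound)
      also have "\<dots> \<le> (K + 1) * (e / (K + 1))"
        using z(2) K \<open>e > 0\<close> by (intro mult_mono) (auto simp: dist_norm norm_minus_commute)
      also have "\<dots> = e" using K by simp
      finally show ?thesis .
    qed
    then have "\<bar>E t Z\<bar> \<le> 0" using field_le_epsilon[of "\<bar>E t Z\<bar>" 0] by simp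
    then show ?thesis by simp
  qed
  show ?thesis
  proof (rule that[OF N graph norm_ai])
    show "(\<lambda>s. inner (AU s) Z) absolutely_integrable_on {0..T}" for Z by (rule inner_ai) auto
    show "inner (to_L2I (u t)) Z = inner (to_L2I (u 0)) Z + integral {0..t} (\<lambda>s. inner (AU s + G s) Z)" if "t \<in> {0..T}" for Z t
      using E0[OF that, of Z] by (simp add: E_def)
  qed
qed

end

section \<open>Sign of a difference of piecewise analytic functions\<close>

lemma real_analytic_germ_diff:
  fixes F G :: "real \<Rightarrow> real"
  assumes "e1 > 0" "\<And>x. \<bar>x - y\<bar> < e1 \<Longrightarrow> (\<lambda>n. c n * (x - y) ^ n) sums F x"
    and "e2 > 0" "\<And>x. \<bar>x - y\<bar> < e2 \<Longrightarrow> (\<lambda>n. d n * (x - y) ^ n) sums G x"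
  shows "\<exists>e>0. \<exists>a. \<forall>x. \<bar>x - y\<bar> < e \<longrightarrow> (\<lambda>n. a n * (x - y) ^ n) sums (F x - G x)"
proof (intro exI conjI allI impI)
  show "min e1 e2 > 0" using assms by simp
  fix x assume "\<bar>x - y\<bar> < min e1 e2"
  then show "(\<lambda>n. (c n - d n) * (x - y) ^ n) sums (F x - G x)"
    using sums_diff[OF assms(2) assms(4), of x x] by (simp add: left_diff_distrib)
qed

text \<open>The pieces are analytic on closed intervals, so each has a power series also at its end
  points. The right germ comes from the piece whose half-open interval contains \<open>y\<close>,
  the left germ from the piece just below \<open>y\<close>; the latter excludes \<open>y\<close>
  itself, since at a break point the indicators assign \<open>y\<close> to the right piece.\<close>

lemma piecewise_analytic_germ:
  assumes "piecewise_analytic q" and y: "y \<in> {-1<..<1}"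
  shows "\<exists>e>0. \<exists>c F. (\<forall>x. \<bar>x - y\<bar> < e \<longrightarrow> (\<lambda>n. c n * (x - y) ^ n) sums F x) \<and> (\<forall>x\<in>{y..<y+e}. q x = F x)"
    and "\<exists>e>0. \<exists>c F. (\<forall>x. \<bar>x - y\<bar> < e \<longrightarrow> (\<lambda>n. c n * (x - y) ^ n) sums F x) \<and> (\<forall>x\<in>{y-e<..<y}. q x = F x)"
proof -
  obtain n p \<phi> where n: "n \<ge> (1::nat)" and p: "strict_mono_on {1..n} p" "p 1 = -1" "p n = (1::real)"
    and an: "\<And>j. j \<in> {1..n-1} \<Longrightarrow> real_analytic_on (\<phi> j) {p j..p (j+1)}"
    and q: "\<And>x. x \<in> {-1<..<1} \<Longrightarrow> q x = (\<Sum>j=1..n-1. indicator {p j..<p (j+1)} x * \<phi> j x)"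
    using assms(1) unfolding piecewise_analytic_def by blast
  have mono: "p i \<le> p j" if "i \<le> j" "1 \<le> i" "j \<le> n" for i j
    using strict_mono_onD[OF p(1), of i j] that by (cases "i = j") auto
  have piece: "q x = \<phi> j x" if x: "x \<in> {-1<..<1}" and j: "j \<in> {1..n-1}" "x \<in> {p j..<p (j+1)}" for x j
  proof -
    have "(\<Sum>i=1..n-1. indicator {p i..<p (i+1)} x * \<phi> i x) = (\<Sum>i=1..n-1. if i = j then \<phi> j x else 0)"
    proof (rule sum.cong[OF refl])
      fix i assume i: "i \<in> {1..n-1}"
      show "indicator {p i..<p (i+1)} x * \<phi> i x = (if i = j then \<phi> j x else 0)"
      proof (cases "i = j")
        case False
        moreover have "i \<le> n" "j \<le> n" using i j by auto
        ultimately consider "i + 1 \<le> j" "j \<le> n" | "j + 1 \<le> i" "i \<le> n" by linarith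
        then have "x \<notin> {p i..<p (i+1)}"
          using mono[of "i+1" j] mono[of "j+1" i] i j by cases auto
        then show ?thesis using False by simp
      qed (use j in simp)
    qed
    then show ?thesis using q[OF x] j(1) by simp
  qed
  have ex: "\<exists>j\<in>{1..n-1}. x \<in> {p j..<p (j+1)}" if x: "x \<in> {-1<..<1}" for x
  proof -
    define j where "j = Max {j \<in> {1..n}. p j \<le> x}"
    have fin: "finite {j \<in> {1..n}. p j \<le> x}" "{j \<in> {1..n}. p j \<le> x} \<noteq> {}" using n p(2) x by (auto intro!: exI[of _ 1])
    have j: "j \<in> {1..n}" "p j \<le> x" using Max_in[OF fin] by (auto simp: j_def)
    have "j \<noteq> n" using j(2) p(3) x by auto
    then have jn: "j \<in> {1..n-1}" using j by auto
    have "\<not> p (j+1) \<le> x"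
    proof
      assume "p (j+1) \<le> x"
      then have "j + 1 \<le> j" unfolding j_def using jn by (intro Max_ge fin) (auto simp: j_def)
      then show False by simp
    qed
    then show ?thesis using jn j by (intro bexI[of _ j]) auto
  qed
  have germ: "\<exists>e>0. \<exists>c. \<forall>x. \<bar>x - y\<bar> < e \<longrightarrow> (\<lambda>n. c n * (x - y) ^ n) sums \<phi> j x" if "j \<in> {1..n-1}" "y \<in> {p j..p (j+1)}" for j
    using an[OF that(1)] that(2) unfolding real_analytic_on_def by blast
  show "\<exists>e>0. \<exists>c F. (\<forall>x. \<bar>x - y\<bar> < e \<longrightarrow> (\<lambda>n. c n * (x - y) ^ n) sums F x) \<and> (\<forall>x\<in>{y..<y+e}. q x = F x)"
  proof -
    obtain j where j: "j \<in> {1..n-1}" "y \<in> {p j..<p (j+1)}" using ex[OF y] by blast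
    obtain e c where e: "e > 0" "\<And>x. \<bar>x - y\<bar> < e \<Longrightarrow> (\<lambda>n. c n * (x - y) ^ n) sums \<phi> j x"
      using germ[OF j(1)] j(2) by auto
    show ?thesis
    proof (intro exI conjI allI impI ballI)
      show "min e (min (1 - y) (p (j+1) - y)) > 0" using e y j by auto
      fix x
      show "(\<lambda>n. c n * (x - y) ^ n) sums \<phi> j x" if "\<bar>x - y\<bar> < min e (min (1 - y) (p (j+1) - y))" using e(2) that by auto
      show "q x = \<phi> j x" if "x \<in> {y..<y + min e (min (1 - y) (p (j+1) - y))}"
        by (rule piece[OF _ j(1)]) (use that y j in auto)
    qed
  qed
  show "\<exists>e>0. \<exists>c F. (\<forall>x. \<bar>x - y\<bar> < e \<longrightarrow> (\<lambda>n. c n * (x - y) ^ n) sums F x) \<and> (\<forall>x\<in>{y-e<..<y}. q x = F x)"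
  proof -
    obtain i where i: "i \<in> {1..n-1}" "y \<in> {p i..<p (i+1)}" using ex[OF y] by blast
    \<comment> \<open>At a break point \<open>y = p i\<close> the left germ comes from the preceding
      piece, which exists because \<open>p 1 = -1 < y\<close>.\<close>
    define j where "j = (if p i < y then i else i - 1)"
    have "i \<noteq> 1 \<or> p i < y" using p(2) y by auto
    have j: "j \<in> {1..n-1}"
    proof (cases "p i < y")
      case False
      then have "i \<noteq> 1" using \<open>i \<noteq> 1 \<or> p i < y\<close> by blast
      then show ?thesis using i(1) False by (auto simp: j_def)
    qed (use i(1) in \<open>simp add: j_def\<close>)
    have jy: "p j < y" "y \<le> p (j+1)"
    proof -
      show "p j < y"
      proof (cases "p i < y")
        case False
        then have "i \<noteq> 1" using \<open>i \<noteq> 1 \<or> p i < y\<close> by blast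
        then have "i - 1 \<in> {1..n}" "i \<in> {1..n}" using i(1) by auto
        then have "p (i - 1) < p i" using strict_mono_onD[OF p(1), of "i - 1" i] by auto
        then show ?thesis using False i(2) by (simp add: j_def)
      qed (simp add: j_def)
      show "y \<le> p (j+1)" using i \<open>i \<noteq> 1 \<or> p i < y\<close> by (auto simp: j_def)
    qed
    obtain e c where e: "e > 0" "\<And>x. \<bar>x - y\<bar> < e \<Longrightarrow> (\<lambda>n. c n * (x - y) ^ n) sums \<phi> j x"
      using germ[OF j] jy by auto
    show ?thesis
    proof (intro exI conjI allI impI ballI)
      show "min e (min (1 + y) (y - p j)) > 0" using e y jy by auto
      fix x
      show "(\<lambda>n. c n * (x - y) ^ n) sums \<phi> j x" if "\<bar>x - y\<bar> < min e (min (1 + y) (y - p j))" using e(2) that by auto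
      show "q x = \<phi> j x" if "x \<in> {y - min e (min (1 + y) (y - p j))<..<y}"
        by (rule piece[OF _ j]) (use that y jy in auto)
    qed
  qed
qed

text \<open>A power series that is not identically zero has isolated zeros. If
  \<open>F y = 0\<close>, some later coefficient is nonzero; otherwise continuity suffices.\<close>

lemma analytic_germ_nonzero:
  fixes F :: "real \<Rightarrow> real"
  assumes e: "e > 0" "\<And>x. \<bar>x - y\<bar> < e \<Longrightarrow> (\<lambda>n. c n * (x - y) ^ n) sums F x"
    and nz: "\<bar>z - y\<bar> < e" "F z \<noteq> 0"
  shows "\<exists>s>0. \<forall>x. 0 < \<bar>x - y\<bar> \<and> \<bar>x - y\<bar> \<le> s \<longrightarrow> F x \<noteq> 0"
proof -
  define F1 where "F1 x = F x - F y" for x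
  have "(\<lambda>n. c n * 0 ^ n) sums F y" using e(2)[of y] e(1) by simp
  then have Fy: "F y = c 0" using sums_unique2[OF _ powser_sums_zero[of c]] by blast
  show ?thesis
  proof (cases "F y = 0")
    case True
    have "\<exists>m>0. c m \<noteq> 0"
    proof (rule ccontr)
      assume "\<not> (\<exists>m>0. c m \<noteq> 0)"
      then have "c m = 0" for m using Fy True by (metis gr0I)
      then have "(\<lambda>n. 0) sums F z" using e(2)[OF nz(1)] by simp
      then show False using nz(2) sums_unique2[OF _ sums_zero] by blast
    qed
    then obtain m where m: "c m \<noteq> 0" "m > 0" by auto
    obtain s where "s > 0" "\<And>x. x \<in> cball y s - {y} \<Longrightarrow> F x \<noteq> 0"
      by (rule powser_0_nonzero[of e y c F m]) (use e True m in auto)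
    then show ?thesis by (intro exI[of _ s]) (auto simp: dist_real_def abs_minus_commute)
  next
    case False
    have "isCont F y"
    proof -
      have "isCont (\<lambda>x. \<Sum>n. c n * x ^ n) 0"
        by (rule isCont_powser[of _ "e/2"]) (use e(2)[of "y + e/2"] e(1) in \<open>auto simp: sums_iff\<close>)
      then have "isCont (\<lambda>x. \<Sum>n. c n * (x - y) ^ n) y"
        using isCont_o2[of y "\<lambda>x. x - y" "\<lambda>x. \<Sum>n. c n * x ^ n"] by simp
      moreover have "eventually (\<lambda>x. (\<Sum>n. c n * (x - y) ^ n) = F x) (nhds y)"
        unfolding eventually_nhds_metric using e by (intro exI[of _ e]) (auto simp: dist_real_def sums_iff)
      ultimately show ?thesis by (subst isCont_cong[symmetric]) auto
    qed
    then have "eventually (\<lambda>x. F x \<noteq> 0) (at y)"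
      using False by (simp add: isCont_def tendsto_imp_eventually_ne)
    then obtain s where s: "s > 0" "\<And>x. x \<noteq> y \<Longrightarrow> dist x y < s \<Longrightarrow> F x \<noteq> 0" by (auto simp: eventually_at)
    show ?thesis by (intro exI[of _ "s/2"]) (use s in \<open>auto simp: dist_real_def\<close>)
  qed
qed

text \<open>Let \<open>y\<close> be the infimum of the points beyond \<open>x0\<close> where
  \<open>h\<close> differs from 0. The right germ at \<open>y\<close> is not identically zero, so
  its zeros are isolated and by the intermediate value theorem \<open>h\<close> keeps one sign
  immediately to the right of \<open>y\<close>. A merely Lipschitz function could change sign
  infinitely often there.\<close>

lemma first_nonzero_sign:
  fixes h :: "real \<Rightarrow> real"
  assumes cont: "continuous_on {-1<..<1} h" and x0: "x0 \<in> {-1<..<1}" and x1: "x0 < x1" "x1 < 1" "h x1 \<noteq> 0"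
    and germ: "\<And>y. y \<in> {-1<..<1} \<Longrightarrow> \<exists>e>0. \<exists>c F. (\<forall>x. \<bar>x - y\<bar> < e \<longrightarrow> (\<lambda>n. c n * (x - y) ^ n) sums F x) \<and> (\<forall>x\<in>{y..<y+e}. h x = F x)"
  shows "\<exists>b j1 j2 h0 \<sigma>. x0 \<le> j1 \<and> j1 < j2 \<and> j2 < b \<and> b < 1 \<and> h0 > 0 \<and> (\<sigma> = 1 \<or> \<sigma> = -1) \<and>
     (\<forall>x\<in>{x0..b}. \<sigma> * h x \<ge> 0) \<and> (\<forall>x\<in>{j1..j2}. \<sigma> * h x \<ge> h0)"
proof -
  define A where "A = {x. x0 \<le> x \<and> x < 1 \<and> h x \<noteq> 0}"
  have A: "x1 \<in> A" "bdd_below A" using x1 by (auto simp: A_def intro!: bdd_belowI[of _ x0])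
  define y where "y = Inf A"
  have y: "x0 \<le> y" "y \<le> x1" unfolding y_def using A by (auto intro!: cInf_greatest cInf_lower simp: A_def)
  have below: "h x = 0" if "x0 \<le> x" "x < y" for x
    using cInf_lower[OF _ A(2), of x] that y x1 by (force simp: A_def y_def)
  have yI: "y \<in> {-1<..<1}" using y x0 x1 by auto
  obtain e c F where e: "e > 0" "\<And>x. \<bar>x - y\<bar> < e \<Longrightarrow> (\<lambda>n. c n * (x - y) ^ n) sums F x" "\<And>x. x \<in> {y..<y+e} \<Longrightarrow> h x = F x"
    using germ[OF yI] by metis
  \<comment> \<open>Nonzero values of \<open>h\<close> occur arbitrarily close to the infimum, so
    the germ at \<open>y\<close> is not identically zero.\<close>
  obtain z where z: "z \<in> A" "z < y + e" using cInf_lessD[of A "y + e"] A e(1) by (auto simp: y_def)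
  have "y \<le> z" unfolding y_def using z A by (intro cInf_lower) auto
  then have "\<bar>z - y\<bar> < e" "F z \<noteq> 0" using z e(3)[of z] by (auto simp: A_def)
  from analytic_germ_nonzero[OF e(1,2) this]
  obtain s where s: "s > 0" "\<And>x. 0 < \<bar>x - y\<bar> \<Longrightarrow> \<bar>x - y\<bar> \<le> s \<Longrightarrow> F x \<noteq> 0" by auto
  define g where "g = min (s/2) (min (e/2) ((1 - y)/2))"
  have g: "g > 0" "g < s" "g < e" "y + g < 1" using s e yI by (auto simp: g_def min_def field_simps)
  have nz: "h x \<noteq> 0" if "y < x" "x \<le> y + g" for x
    using s(2)[of x] e(3)[of x] that g by auto
  have hc: "continuous_on {u..v} h" if "y \<le> u" "v \<le> y + g" for u v
    by (rule continuous_on_subset[OF cont]) (use that yI g in auto)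
  define \<sigma> where "\<sigma> = sgn (h (y + g))"
  have \<sigma>: "\<sigma> = 1 \<or> \<sigma> = -1" using nz[of "y + g"] g by (auto simp: \<sigma>_def sgn_if)
  have pos: "\<sigma> * h x > 0" if x: "y < x" "x \<le> y + g" for x
  proof (rule ccontr)
    assume "\<not> \<sigma> * h x > 0"
    then have neg: "\<sigma> * h x \<le> 0" by simp
    have "\<sigma> * h (y + g) \<ge> 0" by (simp add: \<sigma>_def sgn_if)
    moreover have "continuous_on {x..y + g} (\<lambda>x. \<sigma> * h x)" using x by (intro continuous_intros hc) auto
    ultimately obtain w where "x \<le> w" "w \<le> y + g" "\<sigma> * h w = 0"
      using IVT'[of "\<lambda>x. \<sigma> * h x" x 0 "y + g"] neg x by auto
    then show False using nz[of w] x \<sigma> by auto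
  qed
  have "\<sigma> * h y \<ge> 0"
  proof (rule tendsto_le[of "at_right y" "\<lambda>x. \<sigma> * h x" _ "\<lambda>_. 0"])
    have "isCont h y" using cont yI by (simp add: continuous_on_eq_continuous_at)
    then have "(h \<longlongrightarrow> h y) (at_right y)" by (simp add: isCont_def filterlim_at_split)
    then show "((\<lambda>x. \<sigma> * h x) \<longlongrightarrow> \<sigma> * h y) (at_right y)" by (intro tendsto_intros)
    show "eventually (\<lambda>x. 0 \<le> \<sigma> * h x) (at_right y)"
      unfolding eventually_at_right_field using pos g by (intro exI[of _ "y + g"]) (auto intro: less_imp_le)
  qed auto
  then have nn: "\<sigma> * h x \<ge> 0" if "x \<in> {x0..y + g}" for x
    using below[of x] pos[of x] that by (cases "x < y"; cases "x = y") (auto intro: less_imp_le)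
  \<comment> \<open>On a closed interval away from \<open>y\<close>, where \<open>h\<close> may
    vanish, compactness gives a positive lower bound.\<close>
  define j1 j2 where "j1 = y + g/3" and "j2 = y + g/2"
  have j: "y < j1" "j1 < j2" "j2 < y + g" using g by (auto simp: j1_def j2_def)
  have "compact {j1..j2}" "{j1..j2} \<noteq> {}" "continuous_on {j1..j2} (\<lambda>x. \<sigma> * h x)"
    using j by (auto intro!: continuous_intros hc)
  from continuous_attains_inf[OF this]
  obtain m where m: "m \<in> {j1..j2}" "\<And>x. x \<in> {j1..j2} \<Longrightarrow> \<sigma> * h m \<le> \<sigma> * h x" by blast
  show ?thesis
  proof (rule exI[of _ "y + g"], rule exI[of _ j1], rule exI[of _ j2], rule exI[of _ "\<sigma> * h m"], rule exI[of _ \<sigma>], intro conjI ballI)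
    show "\<sigma> * h m > 0" using pos[of m] m j by auto
    show "x0 \<le> j1" using j y by linarith
    show "\<sigma> * h x \<ge> 0" if "x \<in> {x0..y + g}" for x by (rule nn[OF that])
    show "\<sigma> * h m \<le> \<sigma> * h x" if "x \<in> {j1..j2}" for x by (rule m(2)[OF that])
  qed (fact j g \<sigma>)+
qed

text \<open>To the right of \<open>x0\<close> this is \<open>first_nonzero_sign\<close>; to the
  left, that lemma is applied to the reflected function \<open>h (- x)\<close>, whose right germs
  are left germs of \<open>q\<close> and \<open>qt\<close>.\<close>

lemma Q_pt_difference_sign:
  assumes q: "q \<in> Q_pt" and qt: "qt \<in> Q_pt" and x0: "x0 \<in> {-1<..<1}" and ne: "\<not> (\<forall>x\<in>{-1<..<1}. q x = qt x)"
  shows "\<exists>b j1 j2 h0 \<sigma>. b \<in> {-1<..<1} \<and> j1 < j2 \<and> {j1..j2} \<subseteq> {min x0 b..max x0 b} \<and> b \<notin> {j1..j2} \<and> h0 > 0 \<and> (\<sigma> = 1 \<or> \<sigma> = -1) \<and>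
     (\<forall>x\<in>{min x0 b..max x0 b}. \<sigma> * (q x - qt x) \<ge> 0) \<and> (\<forall>x\<in>{j1..j2}. \<sigma> * (q x - qt x) \<ge> h0)"
proof -
  define h where "h x = q x - qt x" for x
  have pa: "piecewise_analytic q" "piecewise_analytic qt" using q qt by (auto simp: Q_pt_def)
  have cont: "continuous_on {-1<..<1} h"
    using pa unfolding h_def piecewise_analytic_def by (intro continuous_intros) auto
  have germR: "\<exists>e>0. \<exists>c F. (\<forall>x. \<bar>x - y\<bar> < e \<longrightarrow> (\<lambda>n. c n * (x - y) ^ n) sums F x) \<and> (\<forall>x\<in>{y..<y+e}. h x = F x)" if y: "y \<in> {-1<..<1}" for y
  proof -
    obtain e1 c1 F1 where 1: "e1 > 0" "\<And>x. \<bar>x - y\<bar> < e1 \<Longrightarrow> (\<lambda>n. c1 n * (x - y) ^ n) sums F1 x" "\<And>x. x \<in> {y..<y+e1} \<Longrightarrow> q x = F1 x"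
      using piecewise_analytic_germ(1)[OF pa(1) y] by metis
    obtain e2 c2 F2 where 2: "e2 > 0" "\<And>x. \<bar>x - y\<bar> < e2 \<Longrightarrow> (\<lambda>n. c2 n * (x - y) ^ n) sums F2 x" "\<And>x. x \<in> {y..<y+e2} \<Longrightarrow> qt x = F2 x"
      using piecewise_analytic_germ(1)[OF pa(2) y] by metis
    obtain e a where e: "e > 0" "\<And>x. \<bar>x - y\<bar> < e \<Longrightarrow> (\<lambda>n. a n * (x - y) ^ n) sums (F1 x - F2 x)"
      using real_analytic_germ_diff[OF 1(1,2) 2(1,2)] by blast
    show ?thesis
    proof (intro exI conjI allI impI ballI)
      show "min e (min e1 e2) > 0" using e 1 2 by simp
      fix x
      show "(\<lambda>n. a n * (x - y) ^ n) sums (F1 x - F2 x)" if "\<bar>x - y\<bar> < min e (min e1 e2)" using e(2) that by simp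
      show "h x = F1 x - F2 x" if "x \<in> {y..<y + min e (min e1 e2)}" using 1(3)[of x] 2(3)[of x] that by (auto simp: h_def)
    qed
  qed
  \<comment> \<open>By continuity a point other than \<open>x0\<close> can be chosen, so that it
    lies strictly on one side.\<close>
  obtain z where z: "z \<in> {-1<..<1}" "h z \<noteq> 0" "z \<noteq> x0"
  proof -
    obtain z where z: "z \<in> {-1<..<1}" "h z \<noteq> 0" using ne by (auto simp: h_def)
    show ?thesis
    proof (cases "z = x0")
      case True
      have "isCont h z" using cont z by (simp add: continuous_on_eq_continuous_at)
      then have "eventually (\<lambda>x. h x \<noteq> 0) (at z)" using z by (simp add: isCont_def tendsto_imp_eventually_ne)
      moreover have "eventually (\<lambda>x. x \<in> {-1<..<1}) (at z)" by (rule eventually_at_in_open') (use z in auto)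
      ultimately have "eventually (\<lambda>x. h x \<noteq> 0 \<and> x \<in> {-1<..<1} \<and> x \<noteq> z) (at z)"
        by (auto simp: eventually_conj_iff eventually_at_filter elim: eventually_mono)
      then obtain x where "h x \<noteq> 0 \<and> x \<in> {-1<..<1} \<and> x \<noteq> z" using eventually_happens trivial_limit_at by fastforce
      then show ?thesis using that True by blast
    qed (use that z in blast)
  qed
  have z1: "z < 1" using z(1) by simp
  show ?thesis
  proof (cases "x0 < z")
    case True
    obtain b j1 j2 h0 \<sigma> where "x0 \<le> j1" "j1 < j2" "j2 < b" "b < 1" "h0 > 0" "\<sigma> = 1 \<or> \<sigma> = -1"
      "\<forall>x\<in>{x0..b}. \<sigma> * h x \<ge> 0" "\<forall>x\<in>{j1..j2}. \<sigma> * h x \<ge> h0"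
      using first_nonzero_sign[OF cont x0 True z1 z(2) germR] by blast
    note * = this
    have mm: "min x0 b = x0" "max x0 b = b" using * by auto
    show ?thesis
    proof (intro exI conjI)
      show "b \<in> {-1<..<1}" using * x0 by simp
      show "{j1..j2} \<subseteq> {min x0 b..max x0 b}" "b \<notin> {j1..j2}" unfolding mm using * by auto
      show "\<forall>x\<in>{min x0 b..max x0 b}. \<sigma> * (q x - qt x) \<ge> 0" unfolding mm using *(7) by (simp add: h_def)
      show "\<forall>x\<in>{j1..j2}. \<sigma> * (q x - qt x) \<ge> h0" using *(8) by (simp add: h_def)
    qed (fact *)+
  next
    case False
    define g where "g x = h (- x)" for x
    have gcont: "continuous_on {-1<..<1} g"
      unfolding g_def by (rule continuous_on_compose2[OF cont]) (auto intro!: continuous_intros)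
    have germL: "\<exists>e>0. \<exists>c F. (\<forall>x. \<bar>x - y\<bar> < e \<longrightarrow> (\<lambda>n. c n * (x - y) ^ n) sums F x) \<and> (\<forall>x\<in>{y..<y+e}. g x = F x)" if y: "y \<in> {-1<..<1}" for y
    proof -
      have y': "- y \<in> {-1<..<1}" using y by auto
      obtain e1 c1 F1 where 1: "e1 > 0" "\<And>x. \<bar>x - (- y)\<bar> < e1 \<Longrightarrow> (\<lambda>n. c1 n * (x - (- y)) ^ n) sums F1 x" "\<And>x. x \<in> {-y-e1<..<-y} \<Longrightarrow> q x = F1 x"
        using piecewise_analytic_germ(2)[OF pa(1) y'] by metis
      obtain e2 c2 F2 where 2: "e2 > 0" "\<And>x. \<bar>x - (- y)\<bar> < e2 \<Longrightarrow> (\<lambda>n. c2 n * (x - (- y)) ^ n) sums F2 x" "\<And>x. x \<in> {-y-e2<..<-y} \<Longrightarrow> qt x = F2 x"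
        using piecewise_analytic_germ(2)[OF pa(2) y'] by metis
      obtain e a where e: "e > 0" "\<And>x. \<bar>x - (- y)\<bar> < e \<Longrightarrow> (\<lambda>n. a n * (x - (- y)) ^ n) sums (F1 x - F2 x)"
        using real_analytic_germ_diff[OF 1(1,2) 2(1,2)] by blast
      define m where "m = min e (min e1 e2)"
      have m: "m > 0" using e 1 2 by (simp add: m_def)
      have ser: "(\<lambda>n. (a n * (-1) ^ n) * (x - y) ^ n) sums (F1 (- x) - F2 (- x))" if "\<bar>x - y\<bar> < m" for x
      proof -
        have "- x - (- y) = (-1) * (x - y)" by simp
        then have "a n * (- x - (- y)) ^ n = (a n * (-1) ^ n) * (x - y) ^ n" for n
          by (simp only: power_mult_distrib mult.assoc)
        moreover have "\<bar>- x - (- y)\<bar> < e" using that by (simp add: m_def abs_minus_commute)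
        ultimately show ?thesis using e(2)[of "- x"] by (simp only:)
      qed
      have eqo: "g x = F1 (- x) - F2 (- x)" if "x \<in> {y<..<y+m}" for x
        using 1(3)[of "- x"] 2(3)[of "- x"] that by (auto simp: g_def h_def m_def)
      \<comment> \<open>Left germs say nothing about the value at \<open>y\<close> itself; it is
        recovered because \<open>g\<close> and the power series are both continuous there.\<close>
      have "g y = F1 (- y) - F2 (- y)"
      proof (rule tendsto_unique[of "at_right y" g])
        have "isCont g y" using gcont y by (simp add: continuous_on_eq_continuous_at)
        then show "(g \<longlongrightarrow> g y) (at_right y)" by (simp add: isCont_def filterlim_at_split)
        have "isCont (\<lambda>x. \<Sum>n. (a n * (-1) ^ n) * x ^ n) 0"
          by (rule isCont_powser[of _ "m/2"]) (use ser[of "y + m/2"] m in \<open>auto simp: sums_iff\<close>)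
        then have "isCont (\<lambda>x. \<Sum>n. (a n * (-1) ^ n) * (x - y) ^ n) y"
          using isCont_o2[of y "\<lambda>x. x - y" "\<lambda>x. \<Sum>n. (a n * (-1) ^ n) * x ^ n"] by simp
        then have "((\<lambda>x. \<Sum>n. (a n * (-1) ^ n) * (x - y) ^ n) \<longlongrightarrow> (\<Sum>n. (a n * (-1) ^ n) * (y - y) ^ n)) (at_right y)"
          by (simp add: isCont_def filterlim_at_split)
        moreover have "(\<Sum>n. (a n * (-1) ^ n) * (y - y) ^ n) = F1 (- y) - F2 (- y)" using sums_unique[OF ser[of y]] m by simp
        moreover have "eventually (\<lambda>x. (\<Sum>n. (a n * (-1) ^ n) * (x - y) ^ n) = g x) (at_right y)"
          unfolding eventually_at_right_field
          by (intro exI[of _ "y + m"]) (use ser eqo m in \<open>auto simp: sums_iff\<close>)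
        ultimately show "(g \<longlongrightarrow> F1 (- y) - F2 (- y)) (at_right y)"
          using Lim_transform_eventually by fastforce
      qed simp
      then have eqc: "g x = F1 (- x) - F2 (- x)" if "x \<in> {y..<y+m}" for x
        using eqo[of x] that by (cases "x = y") auto
      show ?thesis
      proof (intro exI conjI allI impI ballI)
        show "m > 0" by (rule m)
        fix x
        show "(\<lambda>n. (a n * (-1) ^ n) * (x - y) ^ n) sums (F1 (- x) - F2 (- x))" if "\<bar>x - y\<bar> < m" by (rule ser[OF that])
        show "g x = F1 (- x) - F2 (- x)" if "x \<in> {y..<y+m}" by (rule eqc[OF that])
      qed
    qed
    have "- x0 \<in> {-1<..<1}" "- x0 < - z" "- z < 1" "g (- z) \<noteq> 0" using x0 z False by (auto simp: g_def)
    from first_nonzero_sign[OF gcont this germL]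
    obtain b j1 j2 h0 \<sigma> where *: "- x0 \<le> j1" "j1 < j2" "j2 < b" "b < 1" "h0 > 0" "\<sigma> = 1 \<or> \<sigma> = -1"
      "\<forall>x\<in>{- x0..b}. \<sigma> * g x \<ge> 0" "\<forall>x\<in>{j1..j2}. \<sigma> * g x \<ge> h0" by blast
    have gh: "q x - qt x = g (- x)" for x by (simp add: g_def h_def)
    have mm: "min x0 (-b) = -b" "max x0 (-b) = x0" using * by auto
    show ?thesis
    proof (intro exI conjI)
      show "-b \<in> {-1<..<1}" using * x0 by simp
      show "-j2 < -j1" using * by simp
      show "{-j2..-j1} \<subseteq> {min x0 (-b)..max x0 (-b)}" "-b \<notin> {-j2..-j1}" unfolding mm using * by auto
      show "\<forall>x\<in>{min x0 (-b)..max x0 (-b)}. \<sigma> * (q x - qt x) \<ge> 0" unfolding mm gh using *(7) by auto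
      show "\<forall>x\<in>{-j2..-j1}. \<sigma> * (q x - qt x) \<ge> h0" unfolding gh using *(8) by auto
    qed (fact *)+
  qed
qed

section \<open>The weight\<close>

text \<open>The Liouville substitution turns \<open>(\<rho> y')' = l\<^sup>2 y\<close>, up to a bounded potential, into an equation with constant
  coefficients, solved by \<open>cosh (l * arc) / quart\<close>. Replacing \<open>cosh\<close> by \<open>cosh - 1\<close> makes the weight and its flux vanish
  at \<open>b\<close>, at the price of the term \<open>l\<^sup>2 / quart\<close>, which is negligible against the exponential growth in \<open>l\<close>.\<close>

definition arc :: "real \<Rightarrow> real \<Rightarrow> real \<Rightarrow> real" where
  "arc \<rho>0 b x = (arcsin b - arcsin x) / sqrt \<rho>0"

definition quart :: "real \<Rightarrow> real" where
  "quart x = sqrt (sqrt (1 - x\<^sup>2))"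

definition weight :: "real \<Rightarrow> real \<Rightarrow> real \<Rightarrow> real \<Rightarrow> real" where
  "weight \<rho>0 b l x = (cosh (l * arc \<rho>0 b x) - 1) / quart x"

text \<open>The first term stems from differentiating \<open>1 / quart\<close>, the second from
  differentiating \<open>cosh\<close>.\<close>

definition weight_flux :: "real \<Rightarrow> real \<Rightarrow> real \<Rightarrow> real \<Rightarrow> real" where
  "weight_flux \<rho>0 b l x = \<rho>0 / 2 * x * (cosh (l * arc \<rho>0 b x) - 1) / quart x
     - sqrt \<rho>0 * l * quart x * sinh (l * arc \<rho>0 b x)"

text \<open>The term produced by the amplitude, \<open>quart * (rho * (1 / quart)')'\<close>:
  nonnegative, and bounded on compact subintervals of the open interval.\<close>

definition weight_potential :: "real \<Rightarrow> real \<Rightarrow> real" where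
  "weight_potential \<rho>0 x = \<rho>0 / 2 * (1 + x\<^sup>2 / (2 * (1 - x\<^sup>2)))"

lemma quart_pos: "x \<in> {-1<..<1} \<Longrightarrow> quart x > 0"
  by (auto simp: quart_def abs_square_less_1)

lemma quart_power4: "x \<in> {-1<..<1} \<Longrightarrow> quart x ^ 4 = 1 - x\<^sup>2"
proof -
  assume x: "x \<in> {-1<..<1}"
  then have "x\<^sup>2 < 1" by (auto simp: abs_square_less_1)
  then have "(quart x)\<^sup>2 = sqrt (1 - x\<^sup>2)" by (simp add: quart_def)
  moreover have "quart x ^ 4 = ((quart x)\<^sup>2)\<^sup>2" by simp
  ultimately show ?thesis using \<open>x\<^sup>2 < 1\<close> by simp
qed

lemma quart_square: "x \<in> {-1<..<1} \<Longrightarrow> sqrt (1 - x\<^sup>2) = (quart x)\<^sup>2"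
  by (auto simp: quart_def abs_square_le_1)

lemma quart_derivative:
  assumes x: "x \<in> {-1<..<1}"
  shows "(quart has_real_derivative - x / (2 * quart x ^ 3)) (at x)"
proof -
  have x2: "1 - x\<^sup>2 > 0" using x by (auto simp: abs_square_less_1)
  have "((\<lambda>x. sqrt (sqrt (1 - x\<^sup>2))) has_real_derivative - x / (2 * quart x * sqrt (1 - x\<^sup>2))) (at x)"
    using x2 by (auto intro!: derivative_eq_intros simp: quart_def field_simps)
  moreover have "2 * quart x * sqrt (1 - x\<^sup>2) = 2 * quart x ^ 3"
    using quart_square[OF x] by (simp add: power2_eq_square power3_eq_cube)
  moreover have "quart = (\<lambda>x. sqrt (sqrt (1 - x\<^sup>2)))" by (simp add: quart_def fun_eq_iff)
  ultimately show ?thesis by simp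
qed

lemma arc_derivative:
  assumes "\<rho>0 > 0" and x: "x \<in> {-1<..<1}"
  shows "(arc \<rho>0 b has_real_derivative - 1 / (sqrt \<rho>0 * (quart x)\<^sup>2)) (at x)"
proof -
  have "(arcsin has_real_derivative inverse (sqrt (1 - x\<^sup>2))) (at x)" using x by (intro DERIV_arcsin) auto
  from DERIV_cdivide[OF DERIV_diff[OF DERIV_const[of "arcsin b"] this], of "sqrt \<rho>0"]
  show ?thesis unfolding arc_def[abs_def]
    by (rule DERIV_cong) (simp add: quart_square[OF x] divide_inverse mult.commute)
qed

lemma weight_derivative:
  assumes "\<rho>0 > 0" and x: "x \<in> {-1<..<1}"
  shows "(weight \<rho>0 b l has_real_derivative weight_flux \<rho>0 b l x / rho \<rho>0 x) (at x)"
proof -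
  define g where "g = quart x"
  define s where "s = sqrt \<rho>0"
  have g: "g > 0" "g ^ 4 = 1 - x\<^sup>2" using quart_pos[OF x] quart_power4[OF x] by (auto simp: g_def)
  have s: "s > 0" "\<rho>0 = s\<^sup>2" using assms by (auto simp: s_def)
  note d = arc_derivative[OF assms(1) x, of b, folded g_def s_def] quart_derivative[OF x, folded g_def]
  have ch: "((\<lambda>x. cosh (l * arc \<rho>0 b x)) has_real_derivative sinh (l * arc \<rho>0 b x) * (l * (- 1 / (s * g\<^sup>2)))) (at x)"
    by (auto intro!: derivative_eq_intros d(1))
  from DERIV_divide[OF DERIV_diff[OF ch DERIV_const[of 1]] d(2)]
  show ?thesis unfolding weight_def[abs_def]
  proof (rule DERIV_cong)
    show "quart x \<noteq> 0" using g by (simp add: g_def)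
    have "rho \<rho>0 x = s\<^sup>2 * g ^ 4" by (simp add: rho_def g s)
    then show "((sinh (l * arc \<rho>0 b x) * (l * (- 1 / (s * g\<^sup>2))) - 0) * quart x - (cosh (l * arc \<rho>0 b x) - 1) * (- x / (2 * g ^ 3))) /
        (quart x * quart x) = weight_flux \<rho>0 b l x / rho \<rho>0 x"
      using g(1) s(1) unfolding weight_flux_def g_def[symmetric] s_def[symmetric] s(2)
      by (simp add: field_simps power2_eq_square power3_eq_cube power4_eq_xxxx)
  qed
qed

text \<open>For \<open>cosh / quart\<close> the right side would be
  \<open>(l^2 + V) * cosh / quart\<close>, with \<open>V\<close> the potential. The subtracted
  \<open>1 / quart\<close> contributes only its share \<open>V / quart\<close>, so
  \<open>l^2 / quart\<close> remains as inhomogeneity.\<close>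

lemma weight_flux_derivative:
  assumes "\<rho>0 > 0" and x: "x \<in> {-1<..<1}"
  shows "(weight_flux \<rho>0 b l has_real_derivative
     (l\<^sup>2 + weight_potential \<rho>0 x) * weight \<rho>0 b l x + l\<^sup>2 / quart x) (at x)"
proof -
  define g where "g = quart x"
  define s where "s = sqrt \<rho>0"
  define C D where "C = cosh (l * arc \<rho>0 b x)" and "D = sinh (l * arc \<rho>0 b x)"
  have g: "g > 0" "g ^ 4 = 1 - x\<^sup>2" using quart_pos[OF x] quart_power4[OF x] by (auto simp: g_def)
  have s: "s > 0" "\<rho>0 = s\<^sup>2" using assms by (auto simp: s_def)
  note d = arc_derivative[OF assms(1) x, of b, folded g_def s_def] quart_derivative[OF x, folded g_def]
  have ch: "((\<lambda>x. cosh (l * arc \<rho>0 b x)) has_real_derivative D * (l * (- 1 / (s * g\<^sup>2)))) (at x)"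
    by (auto intro!: derivative_eq_intros d(1) simp: D_def)
  have sh: "((\<lambda>x. sinh (l * arc \<rho>0 b x)) has_real_derivative C * (l * (- 1 / (s * g\<^sup>2)))) (at x)"
    by (auto intro!: derivative_eq_intros d(1) simp: C_def)
  have lin: "((\<lambda>x. \<rho>0 / 2 * x) has_real_derivative \<rho>0 / 2) (at x)"
    by (auto intro!: derivative_eq_intros)
  from DERIV_diff[OF DERIV_divide[OF DERIV_mult[OF lin DERIV_diff[OF ch DERIV_const[of 1]]] d(2)] DERIV_mult[OF DERIV_cmult[OF d(2), of "s * l"] sh]]
  show ?thesis unfolding weight_flux_def[abs_def] s_def[symmetric]
  proof (rule DERIV_cong)
    show "quart x \<noteq> 0" using g by (simp add: g_def)
    show "((\<rho>0 / 2 * (cosh (l * arc \<rho>0 b x) - 1) + (D * (l * (- 1 / (s * g\<^sup>2))) - 0) * (\<rho>0 / 2 * x)) * quart x -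
        \<rho>0 / 2 * x * (cosh (l * arc \<rho>0 b x) - 1) * (- x / (2 * g ^ 3))) / (quart x * quart x) -
      (s * l * (- x / (2 * g ^ 3)) * sinh (l * arc \<rho>0 b x) + C * (l * (- 1 / (s * g\<^sup>2))) * (s * l * quart x)) =
      (l\<^sup>2 + weight_potential \<rho>0 x) * weight \<rho>0 b l x + l\<^sup>2 / quart x"
      using g(1) s(1)
      unfolding weight_potential_def weight_def g(2)[symmetric] g_def[symmetric] s_def[symmetric] C_def[symmetric] D_def[symmetric]
      unfolding s(2)
      by (simp add: field_simps power2_eq_square power3_eq_cube power4_eq_xxxx)
  qed
qed

section \<open>Integrated differential inequalities and the weak identity on a time slice\<close>

section \<open>Differential inequalities\<close>

text \<open>A substitute for the chain rule: increments are controlled only over short steps and up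
  to \<open>e\<close> times an integrable \<open>w\<close>. Summing over a uniform partition and
  then letting \<open>e\<close> tend to 0 gives the integrated inequality.\<close>

lemma increment_bound_imp_integral_bound:
  fixes \<Phi> D w :: "real \<Rightarrow> real"
  assumes t: "0 \<le> t" "t \<le> T" and D: "D integrable_on {0..T}" and w: "w integrable_on {0..T}"
    and inc: "\<And>e. e > 0 \<Longrightarrow> \<exists>\<eta>>0. \<forall>s t. 0 \<le> s \<and> s \<le> t \<and> t \<le> T \<and> t - s < \<eta> \<longrightarrow>
       \<Phi> t - \<Phi> s \<le> integral {s..t} (\<lambda>r. D r + e * w r)"
  shows "\<Phi> t - \<Phi> 0 \<le> integral {0..t} D"
proof -
  have sub: "D integrable_on {a..b}" "w integrable_on {a..b}" if "0 \<le> a" "b \<le> T" for a b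
    using D w that by (auto intro: integrable_subinterval_real)
  have main: "\<Phi> t - \<Phi> 0 \<le> integral {0..t} D + e * integral {0..t} w" if e: "e > 0" for e
  proof -
    obtain \<eta> where \<eta>: "\<eta> > 0" "\<And>s t. \<lbrakk>0 \<le> s; s \<le> t; t \<le> T; t - s < \<eta>\<rbrakk> \<Longrightarrow>
       \<Phi> t - \<Phi> s \<le> integral {s..t} (\<lambda>r. D r + e * w r)"
      using inc[OF e] by blast
    \<comment> \<open>Division by \<open>t + 1\<close> instead of \<open>t\<close> includes
      \<open>t = 0\<close>.\<close>
    obtain n where n: "1 / real (Suc n) < \<eta> / (t + 1)" using nat_approx_posE[of "\<eta> / (t + 1)"] \<eta>(1) t by auto
    define h where "h = t / real (Suc n)"
    have h: "h \<ge> 0" "h < \<eta>"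
    proof -
      show "h \<ge> 0" using t by (simp add: h_def)
      have "h \<le> (t + 1) * (1 / real (Suc n))" using t by (simp add: h_def divide_right_mono)
      also have "\<dots> < (t + 1) * (\<eta> / (t + 1))" using n t by (intro mult_strict_left_mono) auto
      finally show "h < \<eta>" using t by simp
    qed
    have int: "(\<lambda>r. D r + e * w r) integrable_on {a..b}" if "0 \<le> a" "b \<le> T" for a b
      using sub[OF that] by (intro integrable_add integrable_on_mult_right)
    have "\<Phi> (real k * h) - \<Phi> 0 \<le> integral {0..real k * h} (\<lambda>r. D r + e * w r)" if "k \<le> Suc n" for k
      using that
    proof (induction k)
      case (Suc k)
      have kh: "0 \<le> real k * h" "real k * h \<le> real (Suc k) * h" using h by (auto simp: mult_right_mono)
      have "real (Suc k) * h \<le> real (Suc n) * h" using Suc.prems h by (intro mult_right_mono) auto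
      also have "\<dots> = t" by (simp add: h_def)
      finally have kT: "real (Suc k) * h \<le> T" using t by simp
      have "\<Phi> (real (Suc k) * h) - \<Phi> (real k * h) \<le> integral {real k * h..real (Suc k) * h} (\<lambda>r. D r + e * w r)"
        by (rule \<eta>(2)) (use kh kT h in \<open>auto simp: algebra_simps\<close>)
      moreover have "integral {0..real (Suc k) * h} (\<lambda>r. D r + e * w r) =
          integral {0..real k * h} (\<lambda>r. D r + e * w r) + integral {real k * h..real (Suc k) * h} (\<lambda>r. D r + e * w r)"
        by (rule Henstock_Kurzweil_Integration.integral_combine[symmetric]) (use kh kT int in auto)
      ultimately show ?case using Suc by simp
    qed simp
    from this[of "Suc n"] have "\<Phi> t - \<Phi> 0 \<le> integral {0..t} (\<lambda>r. D r + e * w r)" by (simp add: h_def)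
    also have "\<dots> = integral {0..t} D + e * integral {0..t} w"
      using sub[of 0 t] t by (subst Henstock_Kurzweil_Integration.integral_add) (auto intro: integrable_on_mult_right)
    finally show ?thesis .
  qed
  have "\<Phi> t - \<Phi> 0 \<le> integral {0..t} D + e'" if e': "e' > 0" for e'
  proof -
    define e where "e = e' / (\<bar>integral {0..t} w\<bar> + 1)"
    have e: "e > 0" using e' by (simp add: e_def)
    have "e * integral {0..t} w \<le> e * (\<bar>integral {0..t} w\<bar> + 1)" using e by (intro mult_left_mono) auto
    also have "\<dots> = e'" by (simp add: e_def)
    finally show ?thesis using main[OF e] by linarith
  qed
  then show ?thesis by (rule field_le_epsilon)
qed

text \<open>With \<open>F\<close> for the integral bound,
  \<open>exp (- \<kappa> * t) * (F - Z)\<close> is nonincreasing because \<open>f \<le> F\<close>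
  and \<open>\<kappa> \<ge> 0\<close>. Leaving \<open>Z\<close> free allows any explicit
  supersolution in place of the exact solution.\<close>

lemma gronwall_comparison:
  fixes f g Z z :: "real \<Rightarrow> real"
  assumes f: "continuous_on {0..T} f" and g: "continuous_on {0..T} g" and \<kappa>: "\<kappa> \<ge> 0"
    and le: "\<And>t. t \<in> {0..T} \<Longrightarrow> f t \<le> integral {0..t} (\<lambda>s. \<kappa> * f s + g s)"
    and Z: "\<And>t. (Z has_real_derivative z t) (at t)" "Z 0 \<ge> 0" and super: "\<And>t. t \<in> {0..T} \<Longrightarrow> \<kappa> * Z t + g t \<le> z t"
    and t: "t \<in> {0..T}"
  shows "f t \<le> Z t"
proof -
  define F where "F t = integral {0..t} (\<lambda>s. \<kappa> * f s + g s)" for t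
  have cont: "continuous_on {0..T} (\<lambda>s. \<kappa> * f s + g s)" by (intro continuous_intros f g)
  have F': "(F has_real_derivative \<kappa> * f s + g s) (at s within {0..T})" if "s \<in> {0..T}" for s
    unfolding F_def by (rule integral_has_real_derivative[OF cont that])
  define H where "H s = exp (- \<kappa> * s) * (F s - Z s)" for s
  have H': "(H has_real_derivative exp (- \<kappa> * s) * ((\<kappa> * f s + g s - z s) - \<kappa> * (F s - Z s))) (at s within {0..T})" if "s \<in> {0..T}" for s
    unfolding H_def
    by (rule derivative_eq_intros F'[OF that] has_field_derivative_at_within[OF Z(1)] refl)+ (simp add: algebra_simps)
  have "H t \<le> H 0"
  proof (cases "t = 0")
    case False
    then have t0: "0 < t" using t by auto
    show ?thesis
    proof (rule DERIV_nonpos_imp_decreasing_open[of 0 t H])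
      show "0 \<le> t" using t0 by simp
    next
      fix s assume s: "0 < s" "s < t"
      then have sT: "s \<in> {0..T}" using t by auto
      have "(H has_real_derivative exp (- \<kappa> * s) * ((\<kappa> * f s + g s - z s) - \<kappa> * (F s - Z s))) (at s)"
        using H'[OF sT] s t by (simp add: at_within_Icc_at)
      moreover have "exp (- \<kappa> * s) * ((\<kappa> * f s + g s - z s) - \<kappa> * (F s - Z s)) \<le> 0"
      proof (rule mult_nonneg_nonpos)
        have "\<kappa> * f s \<le> \<kappa> * F s" using le[OF sT] \<kappa> unfolding F_def by (rule mult_left_mono)
        then show "(\<kappa> * f s + g s - z s) - \<kappa> * (F s - Z s) \<le> 0" using super[OF sT] by (simp add: algebra_simps)
      qed simp
      ultimately show "\<exists>y. (H has_real_derivative y) (at s) \<and> y \<le> 0" by blast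
    next
      have "continuous_on {0..T} H" using H' by (rule DERIV_continuous_on)
      then show "continuous_on {0..t} H" by (rule continuous_on_subset) (use t in auto)
    qed
  qed simp
  also have "H 0 \<le> 0" using Z(2) by (simp add: H_def F_def)
  finally have "F t \<le> Z t" by (simp add: H_def mult_le_0_iff)
  then show ?thesis using le[OF t] by (simp add: F_def)
qed

text \<open>\<open>P' = v\<close> is tested with \<open>j1 w * \<psi>\<close>, and the flux
  \<open>R\<close> of the weight with \<open>j w\<close>. The \<open>j2\<close> term is the
  dissipation: of one sign for convex \<open>j\<close>, zero for the identity. At each end either
  the Cauchy data of \<open>w\<close> or those of the weight vanish; \<open>j 0 = 0\<close> serves
  the former case.\<close>

lemma slice_identity:
  fixes w P v \<psi> R L j j1 j2 :: "real \<Rightarrow> real"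
  assumes cd: "-1 < c" "c \<le> d" "d < 1" and "\<rho>0 > 0"
    and w: "\<And>x. x \<in> {c..d} \<Longrightarrow> (w has_real_derivative P x / rho \<rho>0 x) (at x)"
    and P: "continuous_on {c..d} P"
    and parts: "\<And>y y'. \<lbrakk>\<And>x. x \<in> {c..d} \<Longrightarrow> (y has_real_derivative y' x) (at x within {c..d}); continuous_on {c..d} y'\<rbrakk> \<Longrightarrow>
        integral {c..d} (\<lambda>x. v x * y x) = P d * y d - P c * y c - integral {c..d} (\<lambda>x. P x * y' x)"
    and \<psi>: "\<And>x. x \<in> {c..d} \<Longrightarrow> (\<psi> has_real_derivative R x / rho \<rho>0 x) (at x)"
    and R: "\<And>x. x \<in> {c..d} \<Longrightarrow> (R has_real_derivative L x) (at x)" and L: "continuous_on {c..d} L"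
    and j: "\<And>x. (j has_real_derivative j1 x) (at x)" "\<And>x. (j1 has_real_derivative j2 x) (at x)" "continuous_on UNIV j2" "j 0 = 0"
    and bdry: "\<And>e. e \<in> {c, d} \<Longrightarrow> (w e = 0 \<and> P e = 0) \<or> (\<psi> e = 0 \<and> R e = 0)"
  shows "integral {c..d} (\<lambda>x. v x * (j1 (w x) * \<psi> x)) =
     integral {c..d} (\<lambda>x. j (w x) * L x) - integral {c..d} (\<lambda>x. (P x)\<^sup>2 / rho \<rho>0 x * j2 (w x) * \<psi> x)"
proof -
  have pos: "rho \<rho>0 x > 0" if "x \<in> {c..d}" for x using rho_pos[OF assms(4)] that cd by auto
  have wc: "continuous_on {c..d} w" and \<psi>c: "continuous_on {c..d} \<psi>" and Rc: "continuous_on {c..d} R"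
    by (rule DERIV_continuous_on[OF has_field_derivative_at_within], rule w \<psi> R, assumption)+
  have j1c: "continuous_on UNIV j1" using j(2) by (meson DERIV_continuous_on has_field_derivative_at_within)
  have jc: "continuous_on UNIV j" using j(1) by (meson DERIV_continuous_on has_field_derivative_at_within)
  have c: "continuous_on {c..d} (\<lambda>x. j (w x))" "continuous_on {c..d} (\<lambda>x. j1 (w x))" "continuous_on {c..d} (\<lambda>x. j2 (w x))"
    using continuous_on_compose2[OF jc wc] continuous_on_compose2[OF j1c wc] continuous_on_compose2[OF j(3) wc] by auto
  define w' where "w' x = P x / rho \<rho>0 x" for x
  have w'c: "continuous_on {c..d} w'" unfolding w'_def
    by (intro continuous_intros P continuous_rho) (use pos in force)
  define \<psi>' where "\<psi>' x = R x / rho \<rho>0 x" for x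
  have \<psi>'c: "continuous_on {c..d} \<psi>'" unfolding \<psi>'_def
    by (intro continuous_intros Rc continuous_rho) (use pos in force)
  have 1: "integral {c..d} (\<lambda>x. v x * (j1 (w x) * \<psi> x)) = P d * (j1 (w d) * \<psi> d) - P c * (j1 (w c) * \<psi> c)
     - integral {c..d} (\<lambda>x. P x * (j2 (w x) * w' x * \<psi> x + \<psi>' x * j1 (w x)))"
  proof (rule parts)
    fix x assume x: "x \<in> {c..d}"
    have "((\<lambda>x. j1 (w x)) has_real_derivative j2 (w x) * w' x) (at x)"
      unfolding w'_def by (rule DERIV_chain2[OF j(2) w[OF x]])
    from DERIV_mult[OF this \<psi>[OF x, folded \<psi>'_def]]
    show "((\<lambda>x. j1 (w x) * \<psi> x) has_real_derivative j2 (w x) * w' x * \<psi> x + \<psi>' x * j1 (w x)) (at x within {c..d})"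
      by (rule has_field_derivative_at_within)
  qed (intro continuous_intros c w'c \<psi>c \<psi>'c)
  have b1: "P d * (j1 (w d) * \<psi> d) = 0" "P c * (j1 (w c) * \<psi> c) = 0" using bdry[of c] bdry[of d] by auto
  have 2: "((\<lambda>x. L x * j (w x) + j1 (w x) * w' x * R x) has_integral R d * j (w d) - R c * j (w c)) {c..d}"
  proof (rule fundamental_theorem_of_calculus[OF cd(2)])
    fix x assume x: "x \<in> {c..d}"
    have "((\<lambda>x. j (w x)) has_real_derivative j1 (w x) * w' x) (at x)"
      unfolding w'_def by (rule DERIV_chain2[OF j(1) w[OF x]])
    from DERIV_mult[OF R[OF x] this]
    show "((\<lambda>x. R x * j (w x)) has_vector_derivative L x * j (w x) + j1 (w x) * w' x * R x) (at x within {c..d})"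
      using has_field_derivative_at_within has_real_derivative_iff_has_vector_derivative by blast
  qed
  have b2: "R d * j (w d) - R c * j (w c) = 0" using bdry[of c] bdry[of d] j(4) by auto
  have i1: "(\<lambda>x. L x * j (w x)) integrable_on {c..d}" "(\<lambda>x. j1 (w x) * w' x * R x) integrable_on {c..d}"
    "(\<lambda>x. (P x)\<^sup>2 / rho \<rho>0 x * j2 (w x) * \<psi> x) integrable_on {c..d}"
    by (intro integrable_continuous_interval continuous_intros L c w'c Rc P continuous_rho \<psi>c; use pos in force)+
  have "integral {c..d} (\<lambda>x. P x * (j2 (w x) * w' x * \<psi> x + \<psi>' x * j1 (w x)))
     = integral {c..d} (\<lambda>x. (P x)\<^sup>2 / rho \<rho>0 x * j2 (w x) * \<psi> x + j1 (w x) * w' x * R x)"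
    by (rule Henstock_Kurzweil_Integration.integral_cong) (simp add: w'_def \<psi>'_def power2_eq_square algebra_simps)
  also have "\<dots> = integral {c..d} (\<lambda>x. (P x)\<^sup>2 / rho \<rho>0 x * j2 (w x) * \<psi> x) + integral {c..d} (\<lambda>x. j1 (w x) * w' x * R x)"
    by (rule Henstock_Kurzweil_Integration.integral_add[OF i1(3,2)])
  finally have 3: "integral {c..d} (\<lambda>x. P x * (j2 (w x) * w' x * \<psi> x + \<psi>' x * j1 (w x))) =
     integral {c..d} (\<lambda>x. (P x)\<^sup>2 / rho \<rho>0 x * j2 (w x) * \<psi> x) + integral {c..d} (\<lambda>x. j1 (w x) * w' x * R x)" .
  have "integral {c..d} (\<lambda>x. L x * j (w x)) + integral {c..d} (\<lambda>x. j1 (w x) * w' x * R x) = 0"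
    using integral_unique[OF 2] b2 Henstock_Kurzweil_Integration.integral_add[OF i1(1,2)] by simp
  moreover have "integral {c..d} (\<lambda>x. L x * j (w x)) = integral {c..d} (\<lambda>x. j (w x) * L x)" by (simp add: mult.commute)
  ultimately show ?thesis using 1 3 b1 by linarith
qed

lemma integral_le_negligible:
  fixes f g :: "real \<Rightarrow> real"
  assumes "f integrable_on {a..b}" "g integrable_on {a..b}" "negligible N"
    "\<And>x. x \<in> {a..b} - N \<Longrightarrow> f x \<le> g x"
  shows "integral {a..b} f \<le> integral {a..b} g"
proof -
  define f' where "f' x = (if x \<in> N then g x else f x)" for x
  have f': "f' integrable_on {a..b}" "integral {a..b} f' = integral {a..b} f"
    using integrable_spike[OF assms(1,3), of f'] integral_spike[OF assms(3), of "{a..b}" f' f] by (auto simp: f'_def)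
  have "integral {a..b} f' \<le> integral {a..b} g"
    by (rule integral_le[OF f'(1) assms(2)]) (use assms(4) in \<open>auto simp: f'_def\<close>)
  then show ?thesis using f'(2) by simp
qed

text \<open>A convex regularisation of the absolute value. Subtracting \<open>\<eta>\<close> makes
  it vanish at 0, as the condition \<open>j 0 = 0\<close> and the zero initial data demand; the
  price is an error of at most \<open>\<eta>\<close>.\<close>

definition smooth_abs :: "real \<Rightarrow> real \<Rightarrow> real" where
  "smooth_abs \<eta> z = sqrt (z\<^sup>2 + \<eta>\<^sup>2) - \<eta>"

definition smooth_sgn :: "real \<Rightarrow> real \<Rightarrow> real" where
  "smooth_sgn \<eta> z = z / sqrt (z\<^sup>2 + \<eta>\<^sup>2)"

context
  fixes \<eta> :: real
  assumes \<eta>: "\<eta> > 0"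
begin

lemma smooth_abs_pos: "z\<^sup>2 + \<eta>\<^sup>2 > 0"
  using \<eta> by (simp add: add_nonneg_pos)

lemma smooth_abs_derivative: "(smooth_abs \<eta> has_real_derivative smooth_sgn \<eta> z) (at z)"
  unfolding smooth_abs_def[abs_def] smooth_sgn_def using smooth_abs_pos[of z]
  by (auto intro!: derivative_eq_intros simp: field_simps)

lemma smooth_sgn_derivative: "(smooth_sgn \<eta> has_real_derivative \<eta>\<^sup>2 / sqrt (z\<^sup>2 + \<eta>\<^sup>2) ^ 3) (at z)"
proof -
  define s where "s = sqrt (z\<^sup>2 + \<eta>\<^sup>2)"
  have s: "s > 0" "s * s = z\<^sup>2 + \<eta>\<^sup>2" using smooth_abs_pos[of z] by (auto simp: s_def)
  have 1: "((\<lambda>z. sqrt (z\<^sup>2 + \<eta>\<^sup>2)) has_real_derivative z / s) (at z)"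
    unfolding s_def using smooth_abs_pos[of z] by (auto intro!: derivative_eq_intros simp: field_simps)
  have "(smooth_sgn \<eta> has_real_derivative (1 * s - z * (z / s)) / (s * s)) (at z)"
    unfolding smooth_sgn_def[abs_def]
    by (rule DERIV_cong[OF DERIV_divide[OF DERIV_ident 1]]) (use s(1) \<eta> in \<open>auto simp: s_def\<close>)
  moreover have "(1 * s - z * (z / s)) / (s * s) = \<eta>\<^sup>2 / s ^ 3"
  proof -
    have "(1 * s - z * (z / s)) / (s * s) = (s * s - z\<^sup>2) / s ^ 3"
      using s(1) by (simp add: field_simps power2_eq_square power3_eq_cube)
    then show ?thesis using s(2) by simp
  qed
  ultimately show ?thesis by (simp add: s_def)
qed

lemma smooth_sgn_bound: "\<bar>smooth_sgn \<eta> z\<bar> \<le> 1"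
proof -
  have "\<bar>z\<bar> \<le> sqrt (z\<^sup>2 + \<eta>\<^sup>2)" by (rule real_le_rsqrt) simp
  then show ?thesis using smooth_abs_pos[of z] by (simp add: smooth_sgn_def abs_divide)
qed

lemma smooth_abs_bounds: "0 \<le> smooth_abs \<eta> z" "smooth_abs \<eta> z \<le> \<bar>z\<bar>" "\<bar>z\<bar> \<le> smooth_abs \<eta> z + \<eta>"
proof -
  show "0 \<le> smooth_abs \<eta> z" using real_le_rsqrt[of \<eta> "z\<^sup>2 + \<eta>\<^sup>2"] by (simp add: smooth_abs_def)
  have "sqrt (z\<^sup>2 + \<eta>\<^sup>2) \<le> \<bar>z\<bar> + \<eta>"
    by (rule real_le_lsqrt) (use \<eta> in \<open>auto simp: power2_eq_square algebra_simps\<close>)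
  then show "smooth_abs \<eta> z \<le> \<bar>z\<bar>" by (simp add: smooth_abs_def)
  show "\<bar>z\<bar> \<le> smooth_abs \<eta> z + \<eta>" unfolding smooth_abs_def using real_le_rsqrt[of "\<bar>z\<bar>" "z\<^sup>2 + \<eta>\<^sup>2"] by simp
qed

lemma smooth_abs_0: "smooth_abs \<eta> 0 = 0"
  using \<eta> by (simp add: smooth_abs_def)

text \<open>Multiplied by the square root at \<open>a\<close>, this is the Cauchy-Schwarz inequality
  for the vectors \<open>(a, \<eta>)\<close> and \<open>(b, \<eta>)\<close>. It replaces the chain
  rule in time: an increment is bounded by means of the derivative at its later end.\<close>

lemma smooth_abs_convex: "smooth_abs \<eta> a - smooth_abs \<eta> b \<le> smooth_sgn \<eta> a * (a - b)"
proof -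
  define s where "s = sqrt (a\<^sup>2 + \<eta>\<^sup>2)"
  have s: "s > 0" "s * s = a\<^sup>2 + \<eta>\<^sup>2" using smooth_abs_pos[of a] by (auto simp: s_def)
  have "a * b + \<eta>\<^sup>2 \<le> s * sqrt (b\<^sup>2 + \<eta>\<^sup>2)"
  proof -
    have "a * b + \<eta>\<^sup>2 \<le> sqrt ((a\<^sup>2 + \<eta>\<^sup>2) * (b\<^sup>2 + \<eta>\<^sup>2))"
    proof (rule real_le_rsqrt)
      have "(a\<^sup>2 + \<eta>\<^sup>2) * (b\<^sup>2 + \<eta>\<^sup>2) - (a * b + \<eta>\<^sup>2)\<^sup>2 = (\<eta> * (a - b))\<^sup>2"
        by (simp add: power2_eq_square algebra_simps)
      then show "(a * b + \<eta>\<^sup>2)\<^sup>2 \<le> (a\<^sup>2 + \<eta>\<^sup>2) * (b\<^sup>2 + \<eta>\<^sup>2)" using zero_le_power2[of "\<eta> * (a - b)"] by linarith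
    qed
    then show ?thesis by (simp add: s_def real_sqrt_mult)
  qed
  then have "s * s - s * sqrt (b\<^sup>2 + \<eta>\<^sup>2) \<le> a * (a - b)" using s(2) by (simp add: power2_eq_square algebra_simps)
  then have "s * (s - sqrt (b\<^sup>2 + \<eta>\<^sup>2)) \<le> a * (a - b)" by (simp add: algebra_simps)
  then have "s - sqrt (b\<^sup>2 + \<eta>\<^sup>2) \<le> a * (a - b) / s" using s(1) by (simp add: pos_le_divide_eq mult.commute)
  then show ?thesis by (simp add: smooth_abs_def smooth_sgn_def s_def)
qed

lemma smooth_sgn_lipschitz: "\<bar>smooth_sgn \<eta> a - smooth_sgn \<eta> b\<bar> \<le> 1 / \<eta> * \<bar>a - b\<bar>"
proof -
  have "norm (smooth_sgn \<eta> a - smooth_sgn \<eta> b) \<le> 1 / \<eta> * norm (a - b)"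
  proof (rule field_differentiable_bound[of UNIV])
    fix z :: real
    show "(smooth_sgn \<eta> has_real_derivative \<eta>\<^sup>2 / sqrt (z\<^sup>2 + \<eta>\<^sup>2) ^ 3) (at z within UNIV)"
      using smooth_sgn_derivative by simp
    have "\<eta> \<le> sqrt (z\<^sup>2 + \<eta>\<^sup>2)" by (rule real_le_rsqrt) simp
    then have "\<eta> ^ 3 \<le> sqrt (z\<^sup>2 + \<eta>\<^sup>2) ^ 3" using \<eta> by (intro power_mono) auto
    then have "\<eta>\<^sup>2 / sqrt (z\<^sup>2 + \<eta>\<^sup>2) ^ 3 \<le> \<eta>\<^sup>2 / \<eta> ^ 3" using \<eta> smooth_abs_pos[of z] by (intro divide_left_mono) auto
    also have "\<dots> = 1 / \<eta>" using \<eta> by (simp add: power2_eq_square power3_eq_cube)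
    finally show "norm (\<eta>\<^sup>2 / sqrt (z\<^sup>2 + \<eta>\<^sup>2) ^ 3) \<le> 1 / \<eta>" by (simp add: abs_divide)
  qed auto
  then show ?thesis by simp
qed

end

section \<open>The weighted energy method between the observation point and b\<close>

text \<open>\<open>P\<close> is the flux \<open>\<rho> w'\<close>, and \<open>P' = v\<close> weakly on \<open>[c, d]\<close>, boundary values included.\<close>

definition has_flux :: "real \<Rightarrow> real \<Rightarrow> real \<Rightarrow> (real \<Rightarrow> real) \<Rightarrow> (real \<Rightarrow> real) \<Rightarrow> (real \<Rightarrow> real) \<Rightarrow> bool" where
  "has_flux \<rho>0 c d w P v \<longleftrightarrow> continuous_on {c..d} P \<and>
     (\<forall>x\<in>{c..d}. (w has_real_derivative P x / rho \<rho>0 x) (at x)) \<and>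
     (\<forall>y y'. (\<forall>x\<in>{c..d}. (y has_real_derivative y' x) (at x within {c..d})) \<longrightarrow> continuous_on {c..d} y' \<longrightarrow>
        integral {c..d} (\<lambda>x. v x * y x) = P d * y d - P c * y c - integral {c..d} (\<lambda>x. P x * y' x))"

lemma has_fluxD:
  assumes "has_flux \<rho>0 c d w P v"
  shows "continuous_on {c..d} P" "\<And>x. x \<in> {c..d} \<Longrightarrow> (w has_real_derivative P x / rho \<rho>0 x) (at x)"
    "\<And>y y'. \<lbrakk>\<And>x. x \<in> {c..d} \<Longrightarrow> (y has_real_derivative y' x) (at x within {c..d}); continuous_on {c..d} y'\<rbrakk> \<Longrightarrow>
        integral {c..d} (\<lambda>x. v x * y x) = P d * y d - P c * y c - integral {c..d} (\<lambda>x. P x * y' x)"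
proof -
  note H = assms[unfolded has_flux_def]
  show "continuous_on {c..d} P" by (rule H[THEN conjunct1])
  show "(w has_real_derivative P x / rho \<rho>0 x) (at x)" if "x \<in> {c..d}" for x
    by (rule H[THEN conjunct2, THEN conjunct1, rule_format, OF that])
  show "integral {c..d} (\<lambda>x. v x * y x) = P d * y d - P c * y c - integral {c..d} (\<lambda>x. P x * y' x)"
    if "\<And>x. x \<in> {c..d} \<Longrightarrow> (y has_real_derivative y' x) (at x within {c..d})" "continuous_on {c..d} y'" for y y'
    by (rule H[THEN conjunct2, THEN conjunct2, rule_format, OF that])
qed

lemma L2_times_continuous:
  fixes f y :: "real \<Rightarrow> real"
  assumes f: "f \<in> L2_on (-1) 1" and y: "continuous_on {c..d} y" and cd: "-1 < c" "d < 1"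
  shows "(\<lambda>x. f x * y x) integrable_on {c..d}"
    "inner (to_L2I f) (to_L2I (\<lambda>x. indicator {c..d} x * y x)) = integral {c..d} (\<lambda>x. f x * y x)"
proof -
  have yL: "(\<lambda>x. indicator {c..d} x * y x) \<in> L2_on (-1) 1" by (rule L2_indicator_continuous[OF y])
  have i: "integrable Imeas (\<lambda>x. indicator {c..d} x * (f x * y x))"
    using L2I_mult[OF f yL] by (simp add: mult_ac)
  have "(\<lambda>x. indicator {c..d} x * (f x * y x)) integrable_on {c..d}"
    by (rule set_lebesgue_integral_eq_integral[OF integrable_interval_HK[OF i]]) (use cd in auto)
  then show "(\<lambda>x. f x * y x) integrable_on {c..d}" by (rule integrable_eq) simp
  show "inner (to_L2I f) (to_L2I (\<lambda>x. indicator {c..d} x * y x)) = integral {c..d} (\<lambda>x. f x * y x)"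
    unfolding inner_to_L2I[OF f yL] using LINT_indicator_eq_integral[OF i] cd by (simp add: mult_ac)
qed

lemma has_flux_diff:
  assumes "has_flux \<rho>0 c d w1 P1 v1" "has_flux \<rho>0 c d w2 P2 v2"
    and v: "v1 \<in> L2_on (-1) 1" "v2 \<in> L2_on (-1) 1" and cd: "-1 < c" "d < 1"
  shows "has_flux \<rho>0 c d (\<lambda>x. w1 x - w2 x) (\<lambda>x. P1 x - P2 x) (\<lambda>x. v1 x - v2 x)"
  unfolding has_flux_def
proof (intro conjI ballI allI impI)
  note 1 = has_fluxD[OF assms(1)] and 2 = has_fluxD[OF assms(2)]
  show "continuous_on {c..d} (\<lambda>x. P1 x - P2 x)" by (intro continuous_on_diff 1(1) 2(1))
  show "((\<lambda>x. w1 x - w2 x) has_real_derivative (P1 x - P2 x) / rho \<rho>0 x) (at x)" if "x \<in> {c..d}" for x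
    using DERIV_diff[OF 1(2)[OF that] 2(2)[OF that]] by (simp add: diff_divide_distrib)
  fix y y' assume y: "\<forall>x\<in>{c..d}. (y has_real_derivative y' x) (at x within {c..d})" "continuous_on {c..d} y'"
  have yc: "continuous_on {c..d} y" by (rule DERIV_continuous_on[OF y(1)[rule_format]])
  have "integral {c..d} (\<lambda>x. (P1 x - P2 x) * y' x) = integral {c..d} (\<lambda>x. P1 x * y' x) - integral {c..d} (\<lambda>x. P2 x * y' x)"
    unfolding left_diff_distrib
    by (intro Henstock_Kurzweil_Integration.integral_diff integrable_continuous_interval continuous_on_mult 1(1) 2(1) y(2))
  moreover have "integral {c..d} (\<lambda>x. (v1 x - v2 x) * y x) = integral {c..d} (\<lambda>x. v1 x * y x) - integral {c..d} (\<lambda>x. v2 x * y x)"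
    unfolding left_diff_distrib
    by (rule Henstock_Kurzweil_Integration.integral_diff[OF L2_times_continuous(1)[OF v(1) yc cd] L2_times_continuous(1)[OF v(2) yc cd]])
  ultimately show "integral {c..d} (\<lambda>x. (v1 x - v2 x) * y x) = (P1 d - P2 d) * y d - (P1 c - P2 c) * y c - integral {c..d} (\<lambda>x. (P1 x - P2 x) * y' x)"
    using 1(3)[OF y(1)[rule_format] y(2)] 2(3)[OF y(1)[rule_format] y(2)] by (simp add: algebra_simps)
qed

text \<open>The difference of two solutions, reduced to what the energy method uses.
  \<open>W\<close> is its time derivative with values in \<open>L2I\<close> and has the integrable
  majorant \<open>wN\<close>; outside the null set \<open>N\<close> of times it splits into the
  derivative of a flux and the term \<open>g\<close>, which equals \<open>p * h\<close> up to
  \<open>CV * |U|\<close>. The observation point is the end of \<open>{c..d}\<close> other than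
  \<open>b\<close>; letting \<open>b\<close> be either end treats both orientations at once.\<close>

locale energy_comparison =
  fixes \<rho>0 c d b T CV bm bM :: real and U p g :: "real \<Rightarrow> real \<Rightarrow> real" and h :: "real \<Rightarrow> real"
    and W :: "real \<Rightarrow> L2I" and wN :: "real \<Rightarrow> real" and N :: "real set"
  assumes rho0: "\<rho>0 > 0" and cd: "-1 < c" "c \<le> d" "d < 1" and b: "b \<in> {c, d}" and T: "T > 0"
    and Uc: "continuous_on ({0..T} \<times> {c..d}) (\<lambda>(s, x). U s x)"
    and U0: "\<And>x. x \<in> {c..d} \<Longrightarrow> U 0 x = 0"
    and Wint: "\<And>Z. (\<lambda>s. inner (W s) Z) integrable_on {0..T}"
    and Weq: "\<And>s t y. \<lbrakk>0 \<le> s; s \<le> t; t \<le> T; continuous_on {c..d} y\<rbrakk> \<Longrightarrow>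
        integral {c..d} (\<lambda>x. (U t x - U s x) * y x) = integral {s..t} (\<lambda>r. inner (W r) (to_L2I (\<lambda>x. indicator {c..d} x * y x)))"
    and wN: "wN integrable_on {0..T}" "\<And>s. s \<in> {0..T} \<Longrightarrow> norm (W s) \<le> wN s"
    and N: "negligible N"
    and slice: "\<And>s. s \<in> {0..T} - N \<Longrightarrow> \<exists>P v. has_flux \<rho>0 c d (U s) P v \<and>
        (\<forall>e\<in>{c, d}. e \<noteq> b \<longrightarrow> U s e = 0 \<and> P e = 0) \<and>
        (\<forall>y. continuous_on {c..d} y \<longrightarrow>
            inner (W s) (to_L2I (\<lambda>x. indicator {c..d} x * y x)) = integral {c..d} (\<lambda>x. v x * y x) + integral {c..d} (\<lambda>x. g s x * y x))"
    and gc: "\<And>s. s \<in> {0..T} \<Longrightarrow> continuous_on {c..d} (g s)"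
    and gb: "\<And>s x. \<lbrakk>s \<in> {0..T}; x \<in> {c..d}\<rbrakk> \<Longrightarrow> \<bar>g s x - p s x * h x\<bar> \<le> CV * \<bar>U s x\<bar>"
    and p: "\<And>s x. \<lbrakk>s \<in> {0..T}; x \<in> {c..d}\<rbrakk> \<Longrightarrow> bm \<le> p s x \<and> p s x \<le> bM"
    and bm: "bm > 0" and CV: "CV \<ge> 0"
    and h: "\<And>x. x \<in> {c..d} \<Longrightarrow> h x \<ge> 0" "continuous_on {c..d} h"
begin

definition "potential_bound = (SUP x\<in>{c..d}. weight_potential \<rho>0 x)"
definition "amplitude_bound = (SUP x\<in>{c..d}. 1 / quart x)"
definition "solution_bound = (SUP q\<in>{0..T} \<times> {c..d}. \<bar>U (fst q) (snd q)\<bar>)"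
definition "mass l t = integral {c..d} (\<lambda>x. \<bar>U t x\<bar> * weight \<rho>0 b l x)"
definition "moment l t = integral {c..d} (\<lambda>x. U t x * weight \<rho>0 b l x)"
definition "forcing l = integral {c..d} (\<lambda>x. h x * weight \<rho>0 b l x)"
text \<open>Times \<open>l^2\<close>, this bounds the integral of \<open>U * l^2 / quart\<close>,
  the cost of \<open>cosh - 1\<close> in the weight; the factor 2 is the length of the whole
  interval.\<close>

definition "boundary_error = 2 * amplitude_bound * solution_bound"

lemma inI: "x \<in> {c..d} \<Longrightarrow> x \<in> {-1<..<1}" using cd by auto

lemma quart_continuous: "continuous_on {c..d} quart"
  unfolding quart_def by (intro continuous_intros)

lemma weight_continuous: "continuous_on {c..d} (weight \<rho>0 b l)"
  by (rule DERIV_continuous_on[OF has_field_derivative_at_within[OF weight_derivative[OF rho0 inI]]])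

lemma weight_nonneg: "x \<in> {c..d} \<Longrightarrow> weight \<rho>0 b l x \<ge> 0"
  unfolding weight_def using quart_pos[OF inI, of x] cosh_real_ge_1 by (intro divide_nonneg_pos) auto

lemma potential_continuous: "continuous_on {c..d} (weight_potential \<rho>0)"
proof -
  have "1 - x\<^sup>2 \<noteq> 0" if "x \<in> {c..d}" for x
    using quart_power4[OF inI[OF that]] quart_pos[OF inI[OF that]] by (metis less_irrefl power_eq_0_iff)
  then show ?thesis unfolding weight_potential_def by (intro continuous_intros) auto
qed

lemma potential_bounds:
  assumes "x \<in> {c..d}"
  shows "0 \<le> weight_potential \<rho>0 x" "weight_potential \<rho>0 x \<le> potential_bound"
proof -
  have "1 - x\<^sup>2 > 0" using quart_power4[OF inI[OF assms]] quart_pos[OF inI[OF assms]] by (metis zero_less_power)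
  then show "0 \<le> weight_potential \<rho>0 x" using rho0 by (simp add: weight_potential_def)
  show "weight_potential \<rho>0 x \<le> potential_bound" unfolding potential_bound_def
    by (rule cSUP_upper[OF assms]) (intro bounded_imp_bdd_above compact_imp_bounded compact_continuous_image potential_continuous compact_Icc)
qed

lemma amplitude_bounds:
  assumes "x \<in> {c..d}"
  shows "1 \<le> 1 / quart x" "1 / quart x \<le> amplitude_bound"
proof -
  have q: "quart x > 0" by (rule quart_pos[OF inI[OF assms]])
  have "quart x \<le> 1" by (simp add: quart_def)
  then show "1 \<le> 1 / quart x" using q by simp
  have "continuous_on {c..d} (\<lambda>x. 1 / quart x)"
    by (intro continuous_intros quart_continuous) (use quart_pos inI in force)
  then show "1 / quart x \<le> amplitude_bound" unfolding amplitude_bound_def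
    by (intro cSUP_upper[OF assms] bounded_imp_bdd_above compact_imp_bounded compact_continuous_image compact_Icc)
qed

lemma U_bound:
  assumes "s \<in> {0..T}" "x \<in> {c..d}"
  shows "\<bar>U s x\<bar> \<le> solution_bound"
proof -
  have "continuous_on ({0..T} \<times> {c..d}) (\<lambda>q. \<bar>U (fst q) (snd q)\<bar>)"
    using Uc by (intro continuous_intros) (simp add: case_prod_unfold)
  then have "bdd_above ((\<lambda>q. \<bar>U (fst q) (snd q)\<bar>) ` ({0..T} \<times> {c..d}))"
    by (intro bounded_imp_bdd_above compact_imp_bounded compact_continuous_image compact_Times compact_Icc)
  then show ?thesis
    using cSUP_upper[of "(s, x)" "{0..T} \<times> {c..d}" "\<lambda>q. \<bar>U (fst q) (snd q)\<bar>"] assms by (simp add: solution_bound_def)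
qed

lemma U_slice_continuous: "s \<in> {0..T} \<Longrightarrow> continuous_on {c..d} (U s)"
  using continuous_on_compose2[OF Uc, of "{c..d}" "\<lambda>x. (s, x)"]
  by (auto simp: image_subset_iff continuous_on_Pair continuous_on_const continuous_on_id)

lemma constants_nonneg: "potential_bound \<ge> 0" "amplitude_bound \<ge> 1" "solution_bound \<ge> 0" "boundary_error \<ge> 0" "bM > 0"
proof -
  have cI: "c \<in> {c..d}" using cd by auto
  show "potential_bound \<ge> 0" using potential_bounds[OF cI] by linarith
  show a: "amplitude_bound \<ge> 1" using amplitude_bounds[OF cI] by linarith
  show u: "solution_bound \<ge> 0" using U_bound[OF _ cI, of 0] T by auto
  show "boundary_error \<ge> 0" using a u by (simp add: boundary_error_def)
  show "bM > 0" using p[OF _ cI, of 0] T bm by auto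
qed

lemma flux_derivative_bounds:
  fixes l :: real
  assumes "x \<in> {c..d}"
  defines "L \<equiv> (l\<^sup>2 + weight_potential \<rho>0 x) * weight \<rho>0 b l x + l\<^sup>2 / quart x"
  shows "0 \<le> L" "L \<le> (l\<^sup>2 + potential_bound) * weight \<rho>0 b l x + l\<^sup>2 * amplitude_bound"
proof -
  note V = potential_bounds[OF assms(1)] and a = amplitude_bounds[OF assms(1)] and w = weight_nonneg[OF assms(1), of l]
  show "0 \<le> L" unfolding L_def using V w a quart_pos[OF inI[OF assms(1)]] by (intro add_nonneg_nonneg mult_nonneg_nonneg divide_nonneg_pos) auto
  have "(l\<^sup>2 + weight_potential \<rho>0 x) * weight \<rho>0 b l x \<le> (l\<^sup>2 + potential_bound) * weight \<rho>0 b l x"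
    using V w by (intro mult_right_mono) auto
  moreover have "l\<^sup>2 * (1 / quart x) \<le> l\<^sup>2 * amplitude_bound" using a by (intro mult_left_mono) auto
  ultimately show "L \<le> (l\<^sup>2 + potential_bound) * weight \<rho>0 b l x + l\<^sup>2 * amplitude_bound" by (simp add: L_def)
qed

lemma weight_boundary: "weight \<rho>0 b l b = 0" "weight_flux \<rho>0 b l b = 0"
  by (simp_all add: weight_def weight_flux_def arc_def)

lemma flux_derivative_continuous:
  "continuous_on {c..d} (\<lambda>x. (l\<^sup>2 + weight_potential \<rho>0 x) * weight \<rho>0 b l x + l\<^sup>2 / quart x)"
  by (intro continuous_intros potential_continuous weight_continuous quart_continuous) (use quart_pos inI in force)

lemma integral_flux_bound:
  assumes s: "s \<in> {0..T}" and f: "continuous_on {c..d} f" "\<And>x. x \<in> {c..d} \<Longrightarrow> \<bar>f x\<bar> \<le> \<bar>U s x\<bar>"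
  shows "integral {c..d} (\<lambda>x. f x * ((l\<^sup>2 + weight_potential \<rho>0 x) * weight \<rho>0 b l x + l\<^sup>2 / quart x))
     \<le> (l\<^sup>2 + potential_bound) * mass l s + l\<^sup>2 * boundary_error"
proof -
  have "integral {c..d} (\<lambda>x. f x * ((l\<^sup>2 + weight_potential \<rho>0 x) * weight \<rho>0 b l x + l\<^sup>2 / quart x))
     \<le> integral {c..d} (\<lambda>x. (l\<^sup>2 + potential_bound) * (\<bar>U s x\<bar> * weight \<rho>0 b l x) + l\<^sup>2 * amplitude_bound * solution_bound)"
  proof (rule integral_le)
    show "(\<lambda>x. f x * ((l\<^sup>2 + weight_potential \<rho>0 x) * weight \<rho>0 b l x + l\<^sup>2 / quart x)) integrable_on {c..d}"
      by (intro integrable_continuous_interval continuous_on_mult f(1) flux_derivative_continuous)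
    show "(\<lambda>x. (l\<^sup>2 + potential_bound) * (\<bar>U s x\<bar> * weight \<rho>0 b l x) + l\<^sup>2 * amplitude_bound * solution_bound) integrable_on {c..d}"
      by (intro integrable_continuous_interval continuous_intros U_slice_continuous[OF s] weight_continuous)
    fix x assume x: "x \<in> {c..d}"
    note L = flux_derivative_bounds[OF x, of l]
    have "f x * ((l\<^sup>2 + weight_potential \<rho>0 x) * weight \<rho>0 b l x + l\<^sup>2 / quart x)
        \<le> \<bar>U s x\<bar> * ((l\<^sup>2 + potential_bound) * weight \<rho>0 b l x + l\<^sup>2 * amplitude_bound)"
      using L f(2)[OF x] by (intro mult_mono) auto
    also have "\<dots> = (l\<^sup>2 + potential_bound) * (\<bar>U s x\<bar> * weight \<rho>0 b l x) + l\<^sup>2 * amplitude_bound * \<bar>U s x\<bar>"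
      by (simp add: algebra_simps)
    also have "\<dots> \<le> (l\<^sup>2 + potential_bound) * (\<bar>U s x\<bar> * weight \<rho>0 b l x) + l\<^sup>2 * amplitude_bound * solution_bound"
      using U_bound[OF s x] constants_nonneg by (intro add_left_mono mult_left_mono) auto
    finally show "f x * ((l\<^sup>2 + weight_potential \<rho>0 x) * weight \<rho>0 b l x + l\<^sup>2 / quart x)
       \<le> (l\<^sup>2 + potential_bound) * (\<bar>U s x\<bar> * weight \<rho>0 b l x) + l\<^sup>2 * amplitude_bound * solution_bound" .
  qed
  also have "\<dots> = (l\<^sup>2 + potential_bound) * mass l s + integral {c..d} (\<lambda>x. l\<^sup>2 * amplitude_bound * solution_bound)"
    unfolding mass_def
    by (subst Henstock_Kurzweil_Integration.integral_add)
       (auto intro!: integrable_continuous_interval continuous_intros U_slice_continuous[OF s] weight_continuous)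
  also have "integral {c..d} (\<lambda>x. l\<^sup>2 * amplitude_bound * solution_bound) \<le> l\<^sup>2 * boundary_error"
  proof -
    have "(d - c) * (l\<^sup>2 * amplitude_bound * solution_bound) \<le> 2 * (l\<^sup>2 * amplitude_bound * solution_bound)"
      using cd constants_nonneg by (intro mult_right_mono mult_nonneg_nonneg) auto
    then show ?thesis using cd by (simp add: boundary_error_def mult_ac)
  qed
  finally show ?thesis by simp
qed

lemma weight_snd_continuous: "continuous_on ({0..T} \<times> {c..d}) (\<lambda>q. weight \<rho>0 b l (snd q))"
  by (rule continuous_on_compose2[OF weight_continuous continuous_on_snd[OF continuous_on_id]]) auto

lemma mass_continuous: "continuous_on {0..T} (mass l)"
proof -
  have "continuous_on ({0..T} \<times> cbox c d) (\<lambda>(s, x). \<bar>U s x\<bar> * weight \<rho>0 b l x)"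
    unfolding case_prod_unfold using Uc[unfolded case_prod_unfold] weight_snd_continuous
    by (simp add: continuous_on_mult continuous_on_rabs)
  from integral_continuous_on_param[OF this] show ?thesis by (simp add: mass_def[abs_def])
qed

lemma moment_continuous: "continuous_on {0..T} (moment l)"
proof -
  have "continuous_on ({0..T} \<times> cbox c d) (\<lambda>(s, x). U s x * weight \<rho>0 b l x)"
    unfolding case_prod_unfold using Uc[unfolded case_prod_unfold] weight_snd_continuous
    by (simp add: continuous_on_mult continuous_on_rabs)
  from integral_continuous_on_param[OF this] show ?thesis by (simp add: moment_def[abs_def])
qed

text \<open>Kato's inequality in integrated form: the convex function \<open>smooth_abs\<close> is tested against the equation.\<close>

lemma mass_inequality:
  assumes t: "t \<in> {0..T}"
  shows "mass l t \<le> integral {0..t} (\<lambda>s. (l\<^sup>2 + (potential_bound + CV)) * mass l s + (bM * forcing l + l\<^sup>2 * boundary_error))"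
proof -
  let ?\<psi> = "weight \<rho>0 b l"
  define D where "D s = (l\<^sup>2 + (potential_bound + CV)) * mass l s + (bM * forcing l + l\<^sup>2 * boundary_error)" for s
  have Dc: "continuous_on {0..T} D" unfolding D_def by (intro continuous_intros mass_continuous)
  have Di: "D integrable_on {0..T}" by (rule integrable_continuous_interval[OF Dc])
  have "bounded (?\<psi> ` {c..d})" by (intro compact_imp_bounded compact_continuous_image weight_continuous compact_Icc)
  then obtain \<psi>m where "\<forall>z\<in>?\<psi> ` {c..d}. \<bar>z\<bar> \<le> \<psi>m" unfolding bounded_real by blast
  then have \<psi>m: "?\<psi> x \<le> \<psi>m" if "x \<in> {c..d}" for x using that by force
  \<comment> \<open>The inequality is first proved for the regularised absolute value; letting
    \<open>\<eta>\<close> tend to 0 at the end removes the last term.\<close>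
  have main: "mass l t \<le> integral {0..t} D + \<eta> * integral {c..d} ?\<psi>" if \<eta>: "\<eta> > 0" for \<eta>
  proof -
    define j where "j = smooth_abs \<eta>"
    define j1 where "j1 = smooth_sgn \<eta>"
    define j2 where "j2 z = \<eta>\<^sup>2 / sqrt (z\<^sup>2 + \<eta>\<^sup>2) ^ 3" for z
    note jd = smooth_abs_derivative[OF \<eta>, folded j_def j1_def] smooth_sgn_derivative[OF \<eta>, folded j1_def j2_def]
    have jc: "continuous_on A j" "continuous_on A j1" for A
      by (rule DERIV_continuous_on[OF has_field_derivative_at_within[OF jd(1)]], rule DERIV_continuous_on[OF has_field_derivative_at_within[OF jd(2)]])
    have j2c: "continuous_on UNIV j2" unfolding j2_def
      by (intro continuous_intros) (use smooth_abs_pos[OF \<eta>] in \<open>simp add: less_le \<eta>[THEN less_imp_neq, symmetric]\<close>)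
    have j2n: "j2 z \<ge> 0" for z by (simp add: j2_def)
    define y where "y s x = j1 (U s x) * ?\<psi> x" for s x
    have yc: "continuous_on {c..d} (y s)" if "s \<in> {0..T}" for s unfolding y_def
      by (intro continuous_intros weight_continuous continuous_on_compose2[OF jc(2)[of UNIV] U_slice_continuous[OF that]]) auto
    define Z where "Z s = to_L2I (\<lambda>x. indicator {c..d} x * y s x)" for s
    define \<Phi> where "\<Phi> s = integral {c..d} (\<lambda>x. j (U s x) * ?\<psi> x)" for s
    have jUc: "continuous_on {c..d} (\<lambda>x. j (U s x))" if "s \<in> {0..T}" for s
      by (rule continuous_on_compose2[OF jc(1)[of UNIV] U_slice_continuous[OF that]]) auto
    \<comment> \<open>The inequality at a single time. The dissipation has a favourable sign and is
      dropped; the forcing is estimated by \<open>bM\<close>, since \<open>U\<close> may have either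
      sign.\<close>
    have WZ: "inner (W s) (Z s) \<le> D s" if s: "s \<in> {0..T} - N" for s
    proof -
      have sT: "s \<in> {0..T}" using s by auto
      obtain P v where flux: "has_flux \<rho>0 c d (U s) P v" and H: "\<forall>e\<in>{c, d}. e \<noteq> b \<longrightarrow> U s e = 0 \<and> P e = 0"
        "\<forall>y. continuous_on {c..d} y \<longrightarrow>
          inner (W s) (to_L2I (\<lambda>x. indicator {c..d} x * y x)) = integral {c..d} (\<lambda>x. v x * y x) + integral {c..d} (\<lambda>x. g s x * y x)"
        using slice[OF s] by blast
      note Pv = has_fluxD[OF flux] H[rule_format]
      have "integral {c..d} (\<lambda>x. v x * (j1 (U s x) * ?\<psi> x)) =
         integral {c..d} (\<lambda>x. j (U s x) * ((l\<^sup>2 + weight_potential \<rho>0 x) * ?\<psi> x + l\<^sup>2 / quart x))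
         - integral {c..d} (\<lambda>x. (P x)\<^sup>2 / rho \<rho>0 x * j2 (U s x) * ?\<psi> x)"
      proof (rule slice_identity[OF cd rho0 Pv(2) Pv(1) Pv(3) weight_derivative[OF rho0 inI] weight_flux_derivative[OF rho0 inI] flux_derivative_continuous jd j2c])
        show "j 0 = 0" unfolding j_def by (rule smooth_abs_0[OF \<eta>])
        show "U s e = 0 \<and> P e = 0 \<or> ?\<psi> e = 0 \<and> weight_flux \<rho>0 b l e = 0" if "e \<in> {c, d}" for e
          using Pv(4)[OF that] weight_boundary by (cases "e = b") auto
      qed auto
      moreover have "integral {c..d} (\<lambda>x. (P x)\<^sup>2 / rho \<rho>0 x * j2 (U s x) * ?\<psi> x) \<ge> 0"
      proof (rule Henstock_Kurzweil_Integration.integral_nonneg)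
        have j2U: "continuous_on {c..d} (\<lambda>x. j2 (U s x))"
          by (rule continuous_on_compose2[OF j2c U_slice_continuous[OF sT]]) auto
        show "(\<lambda>x. (P x)\<^sup>2 / rho \<rho>0 x * j2 (U s x) * ?\<psi> x) integrable_on {c..d}"
          by (intro integrable_continuous_interval continuous_intros Pv(1) continuous_rho j2U weight_continuous)
             (use rho_pos[OF rho0 inI] in force)
        show "0 \<le> (P x)\<^sup>2 / rho \<rho>0 x * j2 (U s x) * ?\<psi> x" if "x \<in> {c..d}" for x
          using rho_pos[OF rho0 inI[OF that]] j2n weight_nonneg[OF that] by simp
      qed
      moreover have "integral {c..d} (\<lambda>x. j (U s x) * ((l\<^sup>2 + weight_potential \<rho>0 x) * ?\<psi> x + l\<^sup>2 / quart x))
          \<le> (l\<^sup>2 + potential_bound) * mass l s + l\<^sup>2 * boundary_error"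
        by (rule integral_flux_bound[OF sT jUc[OF sT]]) (use smooth_abs_bounds[OF \<eta>] in \<open>simp add: j_def\<close>)
      moreover have "integral {c..d} (\<lambda>x. g s x * (j1 (U s x) * ?\<psi> x)) \<le> CV * mass l s + bM * forcing l"
      proof -
        have "integral {c..d} (\<lambda>x. g s x * (j1 (U s x) * ?\<psi> x)) \<le> integral {c..d} (\<lambda>x. CV * (\<bar>U s x\<bar> * ?\<psi> x) + bM * (h x * ?\<psi> x))"
        proof (rule integral_le)
          show "(\<lambda>x. g s x * (j1 (U s x) * ?\<psi> x)) integrable_on {c..d}"
            using continuous_on_mult[OF gc[OF sT] yc[OF sT]] by (intro integrable_continuous_interval) (simp add: y_def[abs_def])
          show "(\<lambda>x. CV * (\<bar>U s x\<bar> * ?\<psi> x) + bM * (h x * ?\<psi> x)) integrable_on {c..d}"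
            by (intro integrable_continuous_interval continuous_intros U_slice_continuous[OF sT] weight_continuous h(2))
          fix x assume x: "x \<in> {c..d}"
          have "\<bar>p s x * h x\<bar> \<le> bM * h x" using p[OF sT x] bm h(1)[OF x] by (simp add: abs_mult mult_right_mono)
          then have "\<bar>g s x\<bar> \<le> CV * \<bar>U s x\<bar> + bM * h x" using gb[OF sT x] by linarith
          then have "\<bar>g s x * j1 (U s x)\<bar> \<le> (CV * \<bar>U s x\<bar> + bM * h x) * 1"
            unfolding abs_mult using smooth_sgn_bound[OF \<eta>] by (intro mult_mono) (auto simp: j1_def)
          then have "g s x * j1 (U s x) * ?\<psi> x \<le> (CV * \<bar>U s x\<bar> + bM * h x) * ?\<psi> x"
            using weight_nonneg[OF x] by (intro mult_right_mono) auto
          then show "g s x * (j1 (U s x) * ?\<psi> x) \<le> CV * (\<bar>U s x\<bar> * ?\<psi> x) + bM * (h x * ?\<psi> x)"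
            by (simp add: algebra_simps)
        qed
        also have "\<dots> = CV * mass l s + bM * forcing l"
          unfolding mass_def forcing_def
          by (subst Henstock_Kurzweil_Integration.integral_add)
             (auto intro!: integrable_continuous_interval continuous_intros U_slice_continuous[OF sT] weight_continuous h(2))
        finally show ?thesis .
      qed
      moreover have "inner (W s) (Z s) = integral {c..d} (\<lambda>x. v x * (j1 (U s x) * ?\<psi> x)) + integral {c..d} (\<lambda>x. g s x * (j1 (U s x) * ?\<psi> x))"
        using Pv(5)[OF yc[OF sT]] by (simp add: Z_def y_def)
      ultimately show ?thesis unfolding D_def by (simp add: algebra_simps)
    qed
    have "\<Phi> t - \<Phi> 0 \<le> integral {0..t} D"
    proof (rule increment_bound_imp_integral_bound[OF _ _ Di wN(1)])
      fix e :: real assume e: "e > 0"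
      \<comment> \<open>If \<open>U\<close> varies by at most \<open>e'\<close>, then
        \<open>Z\<close> varies by at most \<open>e\<close>: \<open>smooth_sgn\<close> has Lipschitz
        constant \<open>1 / \<eta>\<close>, the weight is at most \<open>|\<psi>m| + 1\<close>, and
        \<open>dist_to_L2I_le\<close> costs a factor 2.\<close>
      define e' where "e' = e * \<eta> / (2 * (\<bar>\<psi>m\<bar> + 1))"
      have e': "e' > 0" using e \<eta> by (simp add: e'_def)
      have "uniformly_continuous_on ({0..T} \<times> {c..d}) (\<lambda>(s, x). U s x)"
        by (intro compact_uniformly_continuous Uc compact_Times compact_Icc)
      then obtain \<delta> where \<delta>: "\<delta> > 0" "\<And>q q'. \<lbrakk>q \<in> {0..T} \<times> {c..d}; q' \<in> {0..T} \<times> {c..d}; dist q' q < \<delta>\<rbrakk> \<Longrightarrow>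
          dist ((\<lambda>(s, x). U s x) q') ((\<lambda>(s, x). U s x) q) < e'"
        using e' unfolding uniformly_continuous_on_def by metis
      have Zd: "norm (Z t - Z r) \<le> e" if tr: "t \<in> {0..T}" "r \<in> {0..T}" "\<bar>t - r\<bar> < \<delta>" for t r
      proof -
        have "dist (Z t) (Z r) \<le> 2 * (e / 2)"
          unfolding Z_def
        proof (rule dist_to_L2I_le)
          show "(\<lambda>x. indicator {c..d} x * y t x) \<in> L2_on (-1) 1" "(\<lambda>x. indicator {c..d} x * y r x) \<in> L2_on (-1) 1"
            by (rule L2_indicator_continuous[OF yc[OF tr(1)]], rule L2_indicator_continuous[OF yc[OF tr(2)]])
          show "\<bar>indicator {c..d} x * y t x - indicator {c..d} x * y r x\<bar> \<le> e / 2" for x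
          proof (cases "x \<in> {c..d}")
            case True
            have Ud: "\<bar>U t x - U r x\<bar> \<le> e'"
              using \<delta>(2)[of "(r, x)" "(t, x)"] tr True by (simp add: dist_Pair_Pair dist_real_def)
            have "\<bar>y t x - y r x\<bar> = \<bar>j1 (U t x) - j1 (U r x)\<bar> * ?\<psi> x"
              using weight_nonneg[OF True] by (simp add: y_def abs_mult flip: left_diff_distrib)
            also have "\<dots> \<le> (1 / \<eta> * e') * (\<bar>\<psi>m\<bar> + 1)"
            proof (rule mult_mono)
              have "\<bar>j1 (U t x) - j1 (U r x)\<bar> \<le> 1 / \<eta> * \<bar>U t x - U r x\<bar>" unfolding j1_def by (rule smooth_sgn_lipschitz[OF \<eta>])
              also have "\<dots> \<le> 1 / \<eta> * e'" using Ud \<eta> by (intro mult_left_mono) auto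
              finally show "\<bar>j1 (U t x) - j1 (U r x)\<bar> \<le> 1 / \<eta> * e'" .
              show "?\<psi> x \<le> \<bar>\<psi>m\<bar> + 1" using \<psi>m[OF True] by linarith
            qed (use \<eta> e' weight_nonneg[OF True] in auto)
            also have "\<dots> = e / 2" using \<eta> by (simp add: e'_def field_simps)
            finally show ?thesis using True by simp
          qed (use e in simp)
        qed (use e in simp)
        then show ?thesis by (simp add: dist_norm)
      qed
      show "\<exists>\<eta>>0. \<forall>s t. 0 \<le> s \<and> s \<le> t \<and> t \<le> T \<and> t - s < \<eta> \<longrightarrow>
         \<Phi> t - \<Phi> s \<le> integral {s..t} (\<lambda>r. D r + e * wN r)"
      proof (intro exI[of _ \<delta>] conjI allI impI)
        fix s t assume st: "0 \<le> s \<and> s \<le> t \<and> t \<le> T \<and> t - s < \<delta>"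
        then have sT: "s \<in> {0..T}" and tT: "t \<in> {0..T}" by auto
        have "\<Phi> t - \<Phi> s = integral {c..d} (\<lambda>x. j (U t x) * ?\<psi> x - j (U s x) * ?\<psi> x)"
          unfolding \<Phi>_def by (rule Henstock_Kurzweil_Integration.integral_diff[symmetric])
            (intro integrable_continuous_interval continuous_intros jUc sT tT weight_continuous)+
        \<comment> \<open>Convexity freezes the test function at the later time \<open>t\<close>;
          inside the time integral it is then exchanged for the one at time \<open>r\<close>, at the
          price of \<open>e * wN r\<close>.\<close>
        also have "\<dots> \<le> integral {c..d} (\<lambda>x. (U t x - U s x) * y t x)"
        proof (rule integral_le)
          show "(\<lambda>x. j (U t x) * ?\<psi> x - j (U s x) * ?\<psi> x) integrable_on {c..d}"
            by (intro integrable_continuous_interval continuous_intros jUc sT tT weight_continuous)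
          show "(\<lambda>x. (U t x - U s x) * y t x) integrable_on {c..d}"
            by (intro integrable_continuous_interval continuous_intros U_slice_continuous sT tT yc)
          fix x assume x: "x \<in> {c..d}"
          have "(j (U t x) - j (U s x)) * ?\<psi> x \<le> (j1 (U t x) * (U t x - U s x)) * ?\<psi> x"
            unfolding j_def j1_def by (intro mult_right_mono smooth_abs_convex[OF \<eta>] weight_nonneg[OF x])
          then show "j (U t x) * ?\<psi> x - j (U s x) * ?\<psi> x \<le> (U t x - U s x) * y t x"
            by (simp add: y_def algebra_simps)
        qed
        also have "\<dots> = integral {s..t} (\<lambda>r. inner (W r) (Z t))"
          unfolding Z_def using st by (intro Weq yc tT) auto
        also have "\<dots> \<le> integral {s..t} (\<lambda>r. D r + e * wN r)"
        proof (rule integral_le_negligible[OF _ _ N])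
          show "(\<lambda>r. inner (W r) (Z t)) integrable_on {s..t}"
            by (rule integrable_subinterval_real[OF Wint]) (use st in auto)
          show "(\<lambda>r. D r + e * wN r) integrable_on {s..t}"
            by (rule integrable_subinterval_real[of _ 0 T]) (use st Di wN(1) in \<open>auto intro!: integrable_add integrable_on_mult_right\<close>)
          fix r assume r: "r \<in> {s..t} - N"
          then have rT: "r \<in> {0..T} - N" using st by auto
          have "inner (W r) (Z t) = inner (W r) (Z r) + inner (W r) (Z t - Z r)" by (simp add: inner_diff_right)
          also have "\<dots> \<le> D r + norm (W r) * norm (Z t - Z r)"
            using WZ[OF rT] norm_cauchy_schwarz[of "W r" "Z t - Z r"] by linarith
          also have "norm (W r) * norm (Z t - Z r) \<le> wN r * e"
            using wN(2)[of r] Zd[OF tT, of r] rT r st order_trans[OF norm_ge_zero wN(2)[of r]] by (intro mult_mono) auto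
          finally show "inner (W r) (Z t) \<le> D r + e * wN r" by (simp add: mult.commute)
        qed
        finally show "\<Phi> t - \<Phi> s \<le> integral {s..t} (\<lambda>r. D r + e * wN r)" .
      qed fact
    qed (use t in auto)
    moreover have "\<Phi> 0 = 0"
    proof -
      have "\<Phi> 0 = integral {c..d} (\<lambda>x. 0)" unfolding \<Phi>_def
        by (rule Henstock_Kurzweil_Integration.integral_cong) (simp add: U0 j_def smooth_abs_0[OF \<eta>])
      then show ?thesis by simp
    qed
    moreover have "mass l t \<le> \<Phi> t + \<eta> * integral {c..d} ?\<psi>"
    proof -
      have "mass l t \<le> integral {c..d} (\<lambda>x. j (U t x) * ?\<psi> x + \<eta> * ?\<psi> x)"
        unfolding mass_def
      proof (rule integral_le)
        show "(\<lambda>x. \<bar>U t x\<bar> * ?\<psi> x) integrable_on {c..d}" "(\<lambda>x. j (U t x) * ?\<psi> x + \<eta> * ?\<psi> x) integrable_on {c..d}"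
          by (intro integrable_continuous_interval continuous_intros U_slice_continuous[OF t] jUc[OF t] weight_continuous)+
        fix x assume x: "x \<in> {c..d}"
        have "\<bar>U t x\<bar> * ?\<psi> x \<le> (j (U t x) + \<eta>) * ?\<psi> x"
          unfolding j_def by (intro mult_right_mono smooth_abs_bounds[OF \<eta>] weight_nonneg[OF x])
        then show "\<bar>U t x\<bar> * ?\<psi> x \<le> j (U t x) * ?\<psi> x + \<eta> * ?\<psi> x" by (simp add: algebra_simps)
      qed
      also have "\<dots> = \<Phi> t + \<eta> * integral {c..d} ?\<psi>"
        unfolding \<Phi>_def by (subst Henstock_Kurzweil_Integration.integral_add)
          (auto intro!: integrable_continuous_interval continuous_intros jUc[OF t] weight_continuous)
      finally show ?thesis .
    qed
    ultimately show ?thesis by linarith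
  qed
  have "mass l t \<le> integral {0..t} D + e" if e: "e > 0" for e
  proof -
    define \<eta> where "\<eta> = e / (\<bar>integral {c..d} ?\<psi>\<bar> + 1)"
    have \<eta>: "\<eta> > 0" using e by (simp add: \<eta>_def)
    have "\<eta> * integral {c..d} ?\<psi> \<le> \<eta> * (\<bar>integral {c..d} ?\<psi>\<bar> + 1)" using \<eta> by (intro mult_left_mono) auto
    also have "\<dots> = e" by (simp add: \<eta>_def)
    finally show ?thesis using main[OF \<eta>] by linarith
  qed
  then have "mass l t \<le> integral {0..t} D" by (rule field_le_epsilon)
  then show ?thesis by (simp add: D_def[abs_def])
qed

text \<open>The computation for the mass is repeated with \<open>j\<close> the identity, for which
  the dissipation vanishes. Now the forcing keeps its sign and enters with the lower bound
  \<open>bm\<close>, while the terms of unknown sign are absorbed into \<open>mass\<close>. The form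
  with \<open>- moment\<close> fits \<open>gronwall_comparison\<close>.\<close>

lemma moment_inequality:
  assumes t: "t \<in> {0..T}"
  shows "- moment l t \<le> integral {0..t} (\<lambda>s. l\<^sup>2 * (- moment l s) +
     ((potential_bound + CV) * mass l s + (l\<^sup>2 * boundary_error - bm * forcing l)))"
proof -
  let ?\<psi> = "weight \<rho>0 b l"
  define D where "D s = l\<^sup>2 * (- moment l s) + ((potential_bound + CV) * mass l s + (l\<^sup>2 * boundary_error - bm * forcing l))" for s
  define Z where "Z = to_L2I (\<lambda>x. indicator {c..d} x * ?\<psi> x)"
  have "moment l t = integral {c..d} (\<lambda>x. (U t x - U 0 x) * ?\<psi> x)"
    unfolding moment_def by (rule Henstock_Kurzweil_Integration.integral_cong) (simp add: U0)
  also have "\<dots> = integral {0..t} (\<lambda>r. inner (W r) Z)"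
    unfolding Z_def using t by (intro Weq weight_continuous) auto
  finally have m: "- moment l t = integral {0..t} (\<lambda>r. - inner (W r) Z)" by simp
  also have "\<dots> \<le> integral {0..t} D"
  proof (rule integral_le_negligible[OF _ _ N])
    show "(\<lambda>r. - inner (W r) Z) integrable_on {0..t}"
      by (intro integrable_neg integrable_subinterval_real[OF Wint]) (use t in auto)
    have "continuous_on {0..T} D" unfolding D_def by (intro continuous_intros mass_continuous moment_continuous)
    then show "D integrable_on {0..t}"
      by (intro integrable_continuous_interval) (rule continuous_on_subset, use t in auto)
    fix s assume "s \<in> {0..t} - N"
    then have s: "s \<in> {0..T} - N" and sT: "s \<in> {0..T}" using t by auto
    obtain P v where flux: "has_flux \<rho>0 c d (U s) P v" and H: "\<forall>e\<in>{c, d}. e \<noteq> b \<longrightarrow> U s e = 0 \<and> P e = 0"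
      "\<forall>y. continuous_on {c..d} y \<longrightarrow>
        inner (W s) (to_L2I (\<lambda>x. indicator {c..d} x * y x)) = integral {c..d} (\<lambda>x. v x * y x) + integral {c..d} (\<lambda>x. g s x * y x)"
      using slice[OF s] by blast
    note Pv = has_fluxD[OF flux] H[rule_format]
    have "integral {c..d} (\<lambda>x. v x * (1 * ?\<psi> x)) =
       integral {c..d} (\<lambda>x. U s x * ((l\<^sup>2 + weight_potential \<rho>0 x) * ?\<psi> x + l\<^sup>2 / quart x))
       - integral {c..d} (\<lambda>x. (P x)\<^sup>2 / rho \<rho>0 x * 0 * ?\<psi> x)"
    proof (rule slice_identity[OF cd rho0 Pv(2) Pv(1) Pv(3) weight_derivative[OF rho0 inI] weight_flux_derivative[OF rho0 inI] flux_derivative_continuous, where j = "\<lambda>z. z" and ?j1.0 = "\<lambda>_. 1" and ?j2.0 = "\<lambda>_. 0"])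
      show "U s e = 0 \<and> P e = 0 \<or> ?\<psi> e = 0 \<and> weight_flux \<rho>0 b l e = 0" if "e \<in> {c, d}" for e
        using Pv(4)[OF that] weight_boundary by (cases "e = b") auto
    qed auto
    then have v: "integral {c..d} (\<lambda>x. v x * ?\<psi> x) = integral {c..d} (\<lambda>x. U s x * ((l\<^sup>2 + weight_potential \<rho>0 x) * ?\<psi> x + l\<^sup>2 / quart x))"
      by simp
    have "integral {c..d} (\<lambda>x. l\<^sup>2 * (U s x * ?\<psi> x) + (- potential_bound * (\<bar>U s x\<bar> * ?\<psi> x) + - (l\<^sup>2 * amplitude_bound * solution_bound)))
       \<le> integral {c..d} (\<lambda>x. U s x * ((l\<^sup>2 + weight_potential \<rho>0 x) * ?\<psi> x + l\<^sup>2 / quart x))"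
    proof (rule integral_le)
      show "(\<lambda>x. l\<^sup>2 * (U s x * ?\<psi> x) + (- potential_bound * (\<bar>U s x\<bar> * ?\<psi> x) + - (l\<^sup>2 * amplitude_bound * solution_bound))) integrable_on {c..d}"
        by (intro integrable_continuous_interval continuous_intros U_slice_continuous[OF sT] weight_continuous)
      show "(\<lambda>x. U s x * ((l\<^sup>2 + weight_potential \<rho>0 x) * ?\<psi> x + l\<^sup>2 / quart x)) integrable_on {c..d}"
        by (intro integrable_continuous_interval continuous_on_mult U_slice_continuous[OF sT] flux_derivative_continuous)
      fix x assume x: "x \<in> {c..d}"
      have "\<bar>U s x * (weight_potential \<rho>0 x * ?\<psi> x)\<bar> \<le> \<bar>U s x\<bar> * (potential_bound * ?\<psi> x)"
        unfolding abs_mult using potential_bounds[OF x] weight_nonneg[OF x] by (intro mult_left_mono) (auto intro: mult_right_mono)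
      moreover have "\<bar>U s x * (l\<^sup>2 * (1 / quart x))\<bar> \<le> solution_bound * (l\<^sup>2 * amplitude_bound)"
        unfolding abs_mult using U_bound[OF sT x] amplitude_bounds[OF x] constants_nonneg
        by (intro mult_mono mult_left_mono) auto
      moreover have "U s x * ((l\<^sup>2 + weight_potential \<rho>0 x) * ?\<psi> x + l\<^sup>2 / quart x) =
         l\<^sup>2 * (U s x * ?\<psi> x) + U s x * (weight_potential \<rho>0 x * ?\<psi> x) + U s x * (l\<^sup>2 * (1 / quart x))"
        by (simp add: algebra_simps)
      moreover have "\<bar>U s x\<bar> * (potential_bound * ?\<psi> x) = potential_bound * (\<bar>U s x\<bar> * ?\<psi> x)"
        "solution_bound * (l\<^sup>2 * amplitude_bound) = l\<^sup>2 * amplitude_bound * solution_bound"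
        by simp_all
      ultimately show "l\<^sup>2 * (U s x * ?\<psi> x) + (- potential_bound * (\<bar>U s x\<bar> * ?\<psi> x) + - (l\<^sup>2 * amplitude_bound * solution_bound))
        \<le> U s x * ((l\<^sup>2 + weight_potential \<rho>0 x) * ?\<psi> x + l\<^sup>2 / quart x)"
        by linarith
    qed
    moreover have "integral {c..d} (\<lambda>x. l\<^sup>2 * (U s x * ?\<psi> x) + (- potential_bound * (\<bar>U s x\<bar> * ?\<psi> x) + - (l\<^sup>2 * amplitude_bound * solution_bound)))
      = l\<^sup>2 * moment l s + (- potential_bound * mass l s + (d - c) * - (l\<^sup>2 * amplitude_bound * solution_bound))"
    proof -
      have i: "(\<lambda>x. U s x * ?\<psi> x) integrable_on {c..d}" "(\<lambda>x. \<bar>U s x\<bar> * ?\<psi> x) integrable_on {c..d}"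
        by (intro integrable_continuous_interval continuous_intros U_slice_continuous[OF sT] weight_continuous)+
      have "((\<lambda>x. l\<^sup>2 * (U s x * ?\<psi> x) + (- potential_bound * (\<bar>U s x\<bar> * ?\<psi> x) + - (l\<^sup>2 * amplitude_bound * solution_bound)))
         has_integral l\<^sup>2 * moment l s + (- potential_bound * mass l s + (d - c) * - (l\<^sup>2 * amplitude_bound * solution_bound))) {c..d}"
        unfolding moment_def mass_def
        by (intro has_integral_add has_integral_mult_right integrable_integral i)
           (use has_integral_const_real[of "- (l\<^sup>2 * amplitude_bound * solution_bound)" c d] cd in simp)
      then show ?thesis by (rule integral_unique)
    qed
    moreover have "(d - c) * (l\<^sup>2 * amplitude_bound * solution_bound) \<le> l\<^sup>2 * boundary_error"
    proof -
      have "(d - c) * (l\<^sup>2 * amplitude_bound * solution_bound) \<le> 2 * (l\<^sup>2 * amplitude_bound * solution_bound)"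
        using cd constants_nonneg by (intro mult_right_mono mult_nonneg_nonneg) auto
      then show ?thesis by (simp add: boundary_error_def mult_ac)
    qed
    moreover have "bm * forcing l - CV * mass l s \<le> integral {c..d} (\<lambda>x. g s x * ?\<psi> x)"
    proof -
      have i: "(\<lambda>x. h x * ?\<psi> x) integrable_on {c..d}" "(\<lambda>x. \<bar>U s x\<bar> * ?\<psi> x) integrable_on {c..d}"
        by (intro integrable_continuous_interval continuous_intros U_slice_continuous[OF sT] weight_continuous h(2))+
      have "((\<lambda>x. bm * (h x * ?\<psi> x) - CV * (\<bar>U s x\<bar> * ?\<psi> x)) has_integral bm * forcing l - CV * mass l s) {c..d}"
        unfolding forcing_def mass_def by (intro has_integral_diff has_integral_mult_right integrable_integral i)
      then have "bm * forcing l - CV * mass l s = integral {c..d} (\<lambda>x. bm * (h x * ?\<psi> x) - CV * (\<bar>U s x\<bar> * ?\<psi> x))"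
        by (simp add: integral_unique)
      also have "\<dots> \<le> integral {c..d} (\<lambda>x. g s x * ?\<psi> x)"
      proof (rule integral_le)
        show "(\<lambda>x. bm * (h x * ?\<psi> x) - CV * (\<bar>U s x\<bar> * ?\<psi> x)) integrable_on {c..d}" "(\<lambda>x. g s x * ?\<psi> x) integrable_on {c..d}"
          by (intro integrable_continuous_interval continuous_intros U_slice_continuous[OF sT] weight_continuous h(2) gc[OF sT])+
        fix x assume x: "x \<in> {c..d}"
        have "bm * h x \<le> p s x * h x" using p[OF sT x] h(1)[OF x] by (intro mult_right_mono) auto
        then have "bm * h x - CV * \<bar>U s x\<bar> \<le> g s x" using gb[OF sT x] by linarith
        then have "(bm * h x - CV * \<bar>U s x\<bar>) * ?\<psi> x \<le> g s x * ?\<psi> x" using weight_nonneg[OF x] by (rule mult_right_mono)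
        then show "bm * (h x * ?\<psi> x) - CV * (\<bar>U s x\<bar> * ?\<psi> x) \<le> g s x * ?\<psi> x" by (simp add: algebra_simps)
      qed
      finally show ?thesis .
    qed
    moreover have "inner (W s) Z = integral {c..d} (\<lambda>x. v x * ?\<psi> x) + integral {c..d} (\<lambda>x. g s x * ?\<psi> x)"
      unfolding Z_def by (rule Pv(5)[OF weight_continuous])
    ultimately show "- inner (W s) Z \<le> D s" unfolding D_def v by (simp add: algebra_simps)
  qed
  finally show ?thesis by (simp add: D_def[abs_def])
qed

end

text \<open>The order of choice matters: \<open>t\<close> is given and \<open>l\<close> comes last.
  The condition \<open>2 \<le> exp (l^2 * t)\<close> later allows \<open>exp (l^2 * t) - 1\<close>
  to be bounded below by half of the exponential.\<close>

lemma growth_rates: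
  fixes A D E K z1 z2 t :: real
  assumes "K > 0" "z1 > 0" "t > 0" "D > 0"
  shows "\<exists>l\<ge>1. l\<^sup>2 * E \<le> K * (exp (l * z1) / 2 - 1) \<and> 2 \<le> exp (l\<^sup>2 * t) \<and> A * exp (l * z2) < D * exp (l\<^sup>2 * t)"
proof -
  \<comment> \<open>Positive majorants of \<open>A\<close> and \<open>z2\<close>, whose signs are
    left open, make the asymptotic comparison unambiguous.\<close>
  define a z where "a = \<bar>A\<bar> + 1" and "z = \<bar>z2\<bar> + 1"
  have az: "a > 0" "z > 0" by (auto simp: a_def z_def)
  have "eventually (\<lambda>l. l \<ge> (1::real)) at_top" by real_asymp
  moreover have "eventually (\<lambda>l. (\<bar>E\<bar> + 1) * l\<^sup>2 \<le> K * (exp (l * z1) / 2 - 1)) at_top" 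
    using assms by real_asymp
  moreover have "eventually (\<lambda>l. 2 \<le> exp (l\<^sup>2 * t)) at_top" using assms by real_asymp
  moreover have "eventually (\<lambda>l. a * exp (l * z) < D * exp (l\<^sup>2 * t)) at_top" using assms az by real_asymp
  ultimately have "eventually (\<lambda>l. l\<ge>1 \<and> l\<^sup>2 * E \<le> K * (exp (l * z1) / 2 - 1) \<and> 2 \<le> exp (l\<^sup>2 * t) \<and> A * exp (l * z2) < D * exp (l\<^sup>2 * t)) at_top"
  proof eventually_elim
    case (elim l)
    have "l\<^sup>2 * E \<le> (\<bar>E\<bar> + 1) * l\<^sup>2" by (simp add: mult.commute mult_right_mono)
    moreover have "A * exp (l * z2) \<le> a * exp (l * z)" using elim
      by (intro mult_mono) (auto intro: mult_left_mono simp: a_def z_def)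
    ultimately show ?case using elim by linarith
  qed
  then show ?thesis by (auto dest: eventually_happens)
qed

section \<open>Growth of the moment and the contradiction\<close>

context energy_comparison
begin

lemma forcing_nonneg: "forcing l \<ge> 0"
  unfolding forcing_def using h weight_nonneg
  by (intro Henstock_Kurzweil_Integration.integral_nonneg integrable_continuous_interval continuous_on_mult weight_continuous) auto

text \<open>The comparison function solves \<open>Z' = \<kappa> Z + B\<close> exactly with
  \<open>Z 0 = 0\<close>, where \<open>B\<close> collects forcing and boundary error.\<close>

lemma mass_bound:
  fixes l :: real
  assumes l: "l \<noteq> 0" and t: "t \<in> {0..T}"
  defines "\<kappa> \<equiv> l\<^sup>2 + (potential_bound + CV)"
  shows "mass l t \<le> (bM * forcing l + l\<^sup>2 * boundary_error) * exp (\<kappa> * t) / \<kappa>"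
proof -
  define B where "B = bM * forcing l + l\<^sup>2 * boundary_error"
  have \<kappa>: "\<kappa> > 0" using l constants_nonneg CV by (simp add: \<kappa>_def add_pos_nonneg)
  have B: "B \<ge> 0" using constants_nonneg forcing_nonneg by (simp add: B_def)
  have "mass l t \<le> B * (exp (\<kappa> * t) - 1) / \<kappa>"
  proof (rule gronwall_comparison[where f = "mass l" and g = "\<lambda>_. B" and \<kappa> = \<kappa> and z = "\<lambda>t. B * exp (\<kappa> * t)" and T = T])
    show "mass l t \<le> integral {0..t} (\<lambda>s. \<kappa> * mass l s + B)" if "t \<in> {0..T}" for t
      using mass_inequality[OF that] by (simp add: \<kappa>_def B_def)
    show "((\<lambda>t. B * (exp (\<kappa> * t) - 1) / \<kappa>) has_real_derivative B * exp (\<kappa> * t)) (at t)" for t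
      using \<kappa> by (auto intro!: derivative_eq_intros)
    show "\<kappa> * (B * (exp (\<kappa> * t) - 1) / \<kappa>) + B \<le> B * exp (\<kappa> * t)" for t
      using \<kappa> by (simp add: field_simps)
  qed (use \<kappa> t mass_continuous in auto)
  also have "\<dots> \<le> B * exp (\<kappa> * t) / \<kappa>" using \<kappa> B by (intro divide_right_mono mult_left_mono) auto
  finally show ?thesis by (simp add: B_def)
qed

text \<open>The mass feeds the moment with a term of rate \<open>\<kappa>\<close>, at least the rate
  \<open>l^2\<close> of the moment itself. The resonant form \<open>t * exp (\<kappa> * t)\<close>
  is a supersolution because \<open>l^2 \<le> \<kappa>\<close>; it avoids division by
  \<open>\<kappa> - l^2\<close>, which may be 0, and carries the factor \<open>t\<close> that later
  makes this loss small.\<close>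

lemma moment_lower_bound:
  fixes l :: real
  assumes l: "l \<noteq> 0" and t: "t \<in> {0..T}"
  defines "\<kappa> \<equiv> l\<^sup>2 + (potential_bound + CV)"
  shows "moment l t \<ge> (bm * forcing l - l\<^sup>2 * boundary_error) * (exp (l\<^sup>2 * t) - 1) / l\<^sup>2
     - (potential_bound + CV) * (bM * forcing l + l\<^sup>2 * boundary_error) * t * exp (\<kappa> * t) / \<kappa>"
proof -
  define C where "C = potential_bound + CV"
  define B where "B = bM * forcing l + l\<^sup>2 * boundary_error"
  define b' where "b' = bm * forcing l - l\<^sup>2 * boundary_error"
  have C: "C \<ge> 0" using constants_nonneg CV by (simp add: C_def)
  have B: "B \<ge> 0" using constants_nonneg forcing_nonneg by (simp add: B_def)
  have l2: "l\<^sup>2 > 0" using l by simp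
  have \<kappa>: "\<kappa> > 0" "l\<^sup>2 \<le> \<kappa>" using l C by (simp_all add: \<kappa>_def C_def add_pos_nonneg)
  have "- moment l t \<le> - (b' * (exp (l\<^sup>2 * t) - 1) / l\<^sup>2) + C * B * t * exp (\<kappa> * t) / \<kappa>"
  proof (rule gronwall_comparison[where f = "\<lambda>t. - moment l t" and g = "\<lambda>s. C * mass l s + - b'" and \<kappa> = "l\<^sup>2"
      and z = "\<lambda>t. - (b' * exp (l\<^sup>2 * t)) + C * B * (exp (\<kappa> * t) + t * (\<kappa> * exp (\<kappa> * t))) / \<kappa>" and T = T])
    show "- moment l t \<le> integral {0..t} (\<lambda>s. l\<^sup>2 * (- moment l s) + (C * mass l s + - b'))" if "t \<in> {0..T}" for t
      using moment_inequality[OF that, of l] by (simp add: C_def b'_def)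
    show "((\<lambda>t. - (b' * (exp (l\<^sup>2 * t) - 1) / l\<^sup>2) + C * B * t * exp (\<kappa> * t) / \<kappa>) has_real_derivative
        - (b' * exp (l\<^sup>2 * t)) + C * B * (exp (\<kappa> * t) + t * (\<kappa> * exp (\<kappa> * t))) / \<kappa>) (at t)" for t
      using \<kappa> l by (auto intro!: derivative_eq_intros simp: field_simps)
    fix t assume t: "t \<in> {0..T}"
    \<comment> \<open>By \<open>mass_bound\<close>, \<open>X\<close> dominates
      \<open>C * mass l t\<close>; differentiating the factor \<open>t\<close> of the supersolution
      supplies exactly one \<open>X\<close>.\<close>
    define X where "X = C * B * (exp (\<kappa> * t) / \<kappa>)"
    have X: "X \<ge> 0" using C B \<kappa> by (simp add: X_def)
    have "C * mass l t \<le> X"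
      using mult_left_mono[OF mass_bound[OF l t] C] unfolding X_def \<kappa>_def B_def by (simp add: mult.assoc)
    moreover have "l\<^sup>2 * (t * X) \<le> \<kappa> * (t * X)" using \<kappa> t X by (intro mult_right_mono) auto
    moreover have "l\<^sup>2 * (- (b' * (exp (l\<^sup>2 * t) - 1) / l\<^sup>2) + C * B * t * exp (\<kappa> * t) / \<kappa>) = - (b' * exp (l\<^sup>2 * t)) + b' + l\<^sup>2 * (t * X)"
      using l by (simp add: X_def field_simps)
    moreover have "- (b' * exp (l\<^sup>2 * t)) + C * B * (exp (\<kappa> * t) + t * (\<kappa> * exp (\<kappa> * t))) / \<kappa> = - (b' * exp (l\<^sup>2 * t)) + X + \<kappa> * (t * X)"
      using \<kappa> by (simp add: X_def field_simps)
    ultimately show "l\<^sup>2 * (- (b' * (exp (l\<^sup>2 * t) - 1) / l\<^sup>2) + C * B * t * exp (\<kappa> * t) / \<kappa>) + (C * mass l t + - b')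
        \<le> - (b' * exp (l\<^sup>2 * t)) + C * B * (exp (\<kappa> * t) + t * (\<kappa> * exp (\<kappa> * t))) / \<kappa>" by linarith
  qed (use t in \<open>auto intro!: continuous_intros mass_continuous moment_continuous\<close>)
  then show ?thesis by (simp add: C_def B_def b'_def)
qed

text \<open>Since \<open>arcsin\<close> is bounded, \<open>|arc|\<close> is at most
  \<open>pi / sqrt \<rho>0\<close>, so the exponent is only linear in \<open>l\<close>. This is the
  side of the comparison on which boundedness of \<open>U\<close> enters.\<close>

lemma moment_upper_bound:
  assumes l: "l \<ge> 0" and t: "t \<in> {0..T}"
  shows "moment l t \<le> 2 * solution_bound * amplitude_bound * exp (l * (pi / sqrt \<rho>0))"
proof -
  define A where "A = solution_bound * (amplitude_bound * exp (l * (pi / sqrt \<rho>0)))"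
  have A: "A \<ge> 0" using constants_nonneg by (simp add: A_def)
  have "moment l t \<le> integral {c..d} (\<lambda>x. A)"
    unfolding moment_def
  proof (rule integral_le)
    show "(\<lambda>x. U t x * weight \<rho>0 b l x) integrable_on {c..d}"
      by (intro integrable_continuous_interval continuous_intros U_slice_continuous[OF t] weight_continuous)
    fix x assume x: "x \<in> {c..d}"
    have bI: "b \<in> {-1<..<1}" using b cd by auto
    define y where "y = l * arc \<rho>0 b x"
    have "\<bar>arcsin b - arcsin x\<bar> \<le> pi"
      using arcsin_bounded[of b] arcsin_bounded[of x] bI inI[OF x] by auto
    then have "\<bar>arc \<rho>0 b x\<bar> \<le> pi / sqrt \<rho>0"
      unfolding arc_def abs_divide using rho0 by (simp add: divide_right_mono)
    then have y: "\<bar>y\<bar> \<le> l * (pi / sqrt \<rho>0)" unfolding y_def abs_mult using l by (simp only: abs_of_nonneg mult_left_mono)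
    have "exp y \<le> exp \<bar>y\<bar>" "exp (- y) \<le> exp \<bar>y\<bar>" by auto
    then have "exp y + exp (- y) \<le> 2 * exp \<bar>y\<bar>" by linarith
    then have "cosh y \<le> exp \<bar>y\<bar>" unfolding cosh_field_def by simp
    also have "\<dots> \<le> exp (l * (pi / sqrt \<rho>0))" using y by simp
    finally have "cosh y - 1 \<le> exp (l * (pi / sqrt \<rho>0))" by simp
    then have "(1 / quart x) * (cosh y - 1) \<le> amplitude_bound * exp (l * (pi / sqrt \<rho>0))"
      using amplitude_bounds[OF x] cosh_real_ge_1[of y] by (intro mult_mono) auto
    then have w: "weight \<rho>0 b l x \<le> amplitude_bound * exp (l * (pi / sqrt \<rho>0))"
      by (simp add: weight_def y_def)
    have "U t x * weight \<rho>0 b l x \<le> \<bar>U t x\<bar> * weight \<rho>0 b l x"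
      by (intro mult_right_mono weight_nonneg x) auto
    also have "\<dots> \<le> A" unfolding A_def
      using U_bound[OF t x] w weight_nonneg[OF x] constants_nonneg by (intro mult_mono) auto
    finally show "U t x * weight \<rho>0 b l x \<le> A" .
  qed auto
  also have "\<dots> = (d - c) * A" using cd by simp
  also have "\<dots> \<le> 2 * A" using cd A by (intro mult_right_mono) auto
  finally show ?thesis by (simp add: A_def mult_ac)
qed

text \<open>As \<open>b\<close> lies outside the closed interval \<open>{j1..j2}\<close>,
  \<open>|arc|\<close> has a positive minimum \<open>\<zeta>\<close> there, and \<open>cosh\<close>
  is at least half of the exponential.\<close>

lemma forcing_lower_bound:
  assumes J: "c \<le> j1" "j1 < j2" "j2 \<le> d" "b \<notin> {j1..j2}"
    and h0: "h0 > 0" "\<And>x. x \<in> {j1..j2} \<Longrightarrow> h0 \<le> h x"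
  obtains K \<zeta> where "K > 0" "\<zeta> > 0" "\<And>l. l \<ge> 0 \<Longrightarrow> K * (exp (l * \<zeta>) / 2 - 1) \<le> forcing l"
proof -
  have sub: "{j1..j2} \<subseteq> {c..d}" using J by auto
  have bI: "b \<in> {-1<..<1}" using b cd by auto
  have "continuous_on {j1..j2} (arc \<rho>0 b)"
    by (rule DERIV_continuous_on[OF has_field_derivative_at_within[OF arc_derivative[OF rho0 inI]]]) (use sub in auto)
  then have "continuous_on {j1..j2} (\<lambda>x. \<bar>arc \<rho>0 b x\<bar>)" by (intro continuous_intros)
  from continuous_attains_inf[OF compact_Icc _ this] obtain x0 where
    x0: "x0 \<in> {j1..j2}" "\<And>x. x \<in> {j1..j2} \<Longrightarrow> \<bar>arc \<rho>0 b x0\<bar> \<le> \<bar>arc \<rho>0 b x\<bar>" using J by auto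
  define \<zeta> where "\<zeta> = \<bar>arc \<rho>0 b x0\<bar>"
  have \<zeta>: "\<zeta> > 0"
  proof -
    have "b \<noteq> x0" using J(4) x0(1) by auto
    then have "arcsin b \<noteq> arcsin x0" using bI inI[of x0] x0(1) sub by (subst arcsin_eq_iff) auto
    then show ?thesis using rho0 by (simp add: \<zeta>_def arc_def)
  qed
  show ?thesis
  proof (rule that[of "(j2 - j1) * h0" \<zeta>])
    fix l :: real assume l: "l \<ge> 0"
    define E where "E = h0 * (exp (l * \<zeta>) / 2 - 1)"
    have hw: "continuous_on {c..d} (\<lambda>x. h x * weight \<rho>0 b l x)"
      by (intro continuous_on_mult weight_continuous h(2))
    have "(j2 - j1) * E = integral {j1..j2} (\<lambda>x. E)" using J by simp
    also have "\<dots> \<le> integral {j1..j2} (\<lambda>x. h x * weight \<rho>0 b l x)"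
    proof (rule integral_le)
      show "(\<lambda>x. h x * weight \<rho>0 b l x) integrable_on {j1..j2}"
        by (intro integrable_continuous_interval continuous_on_subset[OF hw sub])
      fix x assume x: "x \<in> {j1..j2}"
      define y where "y = \<bar>l * arc \<rho>0 b x\<bar>"
      have xc: "x \<in> {c..d}" using x sub by auto
      have "l * \<zeta> \<le> y" unfolding y_def abs_mult using x0(2)[OF x] l by (simp add: \<zeta>_def mult_left_mono)
      then have "exp (l * \<zeta>) / 2 - 1 \<le> exp y / 2 - 1" by simp
      also have "\<dots> \<le> cosh y - 1" by (simp add: cosh_field_def)
      also have "cosh y = cosh (l * arc \<rho>0 b x)" by (simp add: y_def)
      also have "cosh (l * arc \<rho>0 b x) - 1 \<le> (cosh (l * arc \<rho>0 b x) - 1) * (1 / quart x)"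
        using mult_left_mono[OF amplitude_bounds(1)[OF xc], of "cosh (l * arc \<rho>0 b x) - 1"] cosh_real_ge_1 by simp
      finally have "exp (l * \<zeta>) / 2 - 1 \<le> weight \<rho>0 b l x" by (simp add: weight_def)
      then have "E \<le> h0 * weight \<rho>0 b l x" unfolding E_def using h0(1) by (intro mult_left_mono) auto
      also have "\<dots> \<le> h x * weight \<rho>0 b l x" by (intro mult_right_mono h0(2) weight_nonneg x xc)
      finally show "E \<le> h x * weight \<rho>0 b l x" .
    qed auto
    also have "\<dots> \<le> forcing l" unfolding forcing_def
      by (rule integral_subset_le[OF sub]) (use hw sub h weight_nonneg in \<open>auto intro!: integrable_continuous_interval intro: continuous_on_subset\<close>)
    finally show "(j2 - j1) * h0 * (exp (l * \<zeta>) / 2 - 1) \<le> forcing l" by (simp add: E_def mult.assoc)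
  qed (use J h0 \<zeta> in auto)
qed

text \<open>The time is fixed first, so small that the loss caused by the mass is a fraction of the
  gain from \<open>bm\<close>; \<open>l\<close> is chosen afterwards. The forcing is a common factor
  of gain and loss, so it only has to exceed fixed multiples of \<open>l^2\<close>.\<close>

lemma no_positive_forcing:
  assumes J: "c \<le> j1" "j1 < j2" "j2 \<le> d" "b \<notin> {j1..j2}"
    and h0: "h0 > 0" "\<And>x. x \<in> {j1..j2} \<Longrightarrow> h0 \<le> h x"
  shows False
proof -
  define C where "C = potential_bound + CV"
  have C: "C \<ge> 0" using constants_nonneg CV by (simp add: C_def)
  have bM: "bM > 0" "bm \<le> bM" using constants_nonneg order_trans[of bm "p 0 c" bM] p[of 0 c] T cd by auto
  obtain K \<zeta> where K: "K > 0" "\<zeta> > 0" "\<And>l. l \<ge> 0 \<Longrightarrow> K * (exp (l * \<zeta>) / 2 - 1) \<le> forcing l"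
    using forcing_lower_bound[OF assms] by metis
  \<comment> \<open>The last argument makes \<open>C * (2 * bM) * t * exp (C * t)\<close> at most
    \<open>bm / 8\<close>, half of the gain \<open>bm / 4\<close> found below;
    \<open>t \<le> 1\<close> bounds \<open>exp (C * t)\<close> by \<open>exp C\<close>, and
    \<open>C + 1\<close> avoids division by 0.\<close>
  define t where "t = min (min T 1) (bm / (16 * bM * (C + 1) * exp C))"
  have t: "t > 0" "t \<in> {0..T}" "t \<le> 1" using T bm bM C by (auto simp: t_def)
  have small: "C * (2 * bM) * t * exp (C * t) \<le> bm / 8"
  proof -
    have "C * (2 * bM) * t * exp (C * t) \<le> (C + 1) * (2 * bM) * t * exp C"
      using C bM t by (intro mult_mono) (auto intro: mult_left_le)
    also have "\<dots> \<le> (C + 1) * (2 * bM) * (bm / (16 * bM * (C + 1) * exp C)) * exp C"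
      using C bM by (intro mult_right_mono mult_left_mono) (auto simp: t_def)
    also have "\<dots> = bm / 8 * ((C + 1) * bM * exp C / ((C + 1) * bM * exp C))" by simp
    also have "(C + 1) * bM * exp C \<noteq> 0" using C bM by simp
    then have "bm / 8 * ((C + 1) * bM * exp C / ((C + 1) * bM * exp C)) = bm / 8" by (simp only: divide_self mult_1_right not_False_eq_True)
    finally show ?thesis .
  qed
  \<comment> \<open>The second condition makes the forcing dominate both \<open>l^2\<close> and
    \<open>l^2 * (2 * boundary_error / bm)\<close>, so half of \<open>bm * forcing l\<close> absorbs
    the boundary error.\<close>
  obtain l where l: "l \<ge> 1" "l\<^sup>2 * (2 * boundary_error / bm + 1) \<le> K * (exp (l * \<zeta>) / 2 - 1)" "2 \<le> exp (l\<^sup>2 * t)"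
     "2 * solution_bound * amplitude_bound * exp (l * (pi / sqrt \<rho>0)) < bm / 8 * exp (l\<^sup>2 * t)"
    using growth_rates[of K \<zeta> t "bm / 8" "2 * boundary_error / bm + 1" "2 * solution_bound * amplitude_bound" "pi / sqrt \<rho>0"]
      K t bm by auto
  define H where "H = forcing l"
  define X where "X = exp (l\<^sup>2 * t)"
  define \<kappa> where "\<kappa> = l\<^sup>2 + C"
  have l2: "l\<^sup>2 > 0" using l by simp
  have \<kappa>: "l\<^sup>2 \<le> \<kappa>" "\<kappa> > 0" using add_pos_nonneg[OF l2 C] C by (auto simp: \<kappa>_def)
  have H: "l\<^sup>2 * (2 * boundary_error / bm + 1) \<le> H" using l K(3)[of l] by (simp add: H_def)
  have E0: "l\<^sup>2 * (2 * boundary_error / bm) \<ge> 0" using constants_nonneg bm by simp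
  have "l\<^sup>2 * (2 * boundary_error / bm) + l\<^sup>2 \<le> H" using H by (simp only: distrib_left mult_1_right)
  with E0 l2 have Hl: "l\<^sup>2 \<le> H \<and> l\<^sup>2 * (2 * boundary_error / bm) \<le> H" by linarith
  note Hl = Hl[THEN conjunct1] Hl[THEN conjunct2]
  have Hp: "H > 0" using Hl(1) l2 by linarith
  have E1: "l\<^sup>2 * boundary_error \<le> bm * H / 2" using Hl(2) bm by (simp add: field_simps)
  have "bm * H \<le> bM * H" using bM Hp by (intro mult_right_mono) auto
  moreover have "bm * H > 0" using bm Hp by simp
  ultimately have E2: "l\<^sup>2 * boundary_error \<le> bM * H" using E1 by linarith
  \<comment> \<open>The gain \<open>bm / 4\<close> contains two halves: one is given up to the
    boundary error, the other in passing from \<open>X - 1\<close> to \<open>X / 2\<close>.\<close>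
  have "H / l\<^sup>2 * (bm / 8) * X \<le> (H / l\<^sup>2) * (bm / 4 - C * (2 * bM) * t * exp (C * t)) * X"
    using small Hp by (intro mult_right_mono mult_left_mono) (auto simp: X_def)
  also have "\<dots> = (bm * H / 2) * (X / 2) / l\<^sup>2 - C * (2 * bM * H) * t * exp (\<kappa> * t) / l\<^sup>2"
  proof -
    \<comment> \<open>The mass outgrows the moment only by the factor \<open>exp (C * t)\<close>,
      which is independent of \<open>l\<close>.\<close>
    have "exp (\<kappa> * t) = X * exp (C * t)" by (simp add: X_def \<kappa>_def distrib_right exp_add)
    then show ?thesis by (simp add: diff_divide_distrib algebra_simps)
  qed
  also have "\<dots> \<le> (bm * H - l\<^sup>2 * boundary_error) * (X - 1) / l\<^sup>2 - C * (bM * H + l\<^sup>2 * boundary_error) * t * exp (\<kappa> * t) / \<kappa>"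
  proof (rule diff_mono)
    show "(bm * H / 2) * (X / 2) / l\<^sup>2 \<le> (bm * H - l\<^sup>2 * boundary_error) * (X - 1) / l\<^sup>2"
      by (intro divide_right_mono mult_mono) (use E1 l(3)[folded X_def] \<open>bm * H > 0\<close> l2 in linarith)+
    have "C * (bM * H + l\<^sup>2 * boundary_error) * t * exp (\<kappa> * t) \<le> C * (2 * bM * H) * t * exp (\<kappa> * t)"
      using E2 C t(1) by (intro mult_right_mono mult_left_mono) (linarith | simp)+
    moreover have "0 \<le> C * (2 * bM * H) * t * exp (\<kappa> * t)" using C bM(1) Hp t(1) by simp
    ultimately show "C * (bM * H + l\<^sup>2 * boundary_error) * t * exp (\<kappa> * t) / \<kappa> \<le> C * (2 * bM * H) * t * exp (\<kappa> * t) / l\<^sup>2"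
      using \<kappa> l2 by (intro frac_le) auto
  qed
  also have "\<dots> \<le> moment l t"
    using moment_lower_bound[of l t] l t by (simp add: C_def H_def X_def \<kappa>_def)
  also have "\<dots> \<le> 2 * solution_bound * amplitude_bound * exp (l * (pi / sqrt \<rho>0))"
    using moment_upper_bound[of l t] l t by simp
  also have "\<dots> < bm / 8 * X" using l by (simp add: X_def)
  \<comment> \<open>The forcing is at least \<open>l^2\<close>, so \<open>H / l^2\<close> is at
    least 1, contrary to this estimate.\<close>
  finally have "H / l\<^sup>2 * (bm / 8 * X) < 1 * (bm / 8 * X)" by (simp add: mult.assoc)
  moreover have "1 * (bm / 8 * X) \<le> H / l\<^sup>2 * (bm / 8 * X)"
    using Hl(1) l2 bm by (intro mult_right_mono) (auto simp: X_def)
  ultimately show False by linarith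
qed

end

section \<open>Comparison of two solutions\<close>

lemma C2_bounded_imp_C1_bounded: "C2_bounded_on D g \<Longrightarrow> C1_bounded_on D g"
  unfolding C2_bounded_on_def using C1_bounded_on_continuous by (auto simp: C1_bounded_on_def)

lemma C1_bounded_lipschitz:
  assumes "C1_bounded_on UNIV g"
  shows "\<exists>L\<ge>0. \<forall>a b. \<bar>g a - g b\<bar> \<le> L * \<bar>a - b\<bar>"
proof -
  obtain g' where g': "\<And>x. (g has_real_derivative g' x) (at x)" "bounded (range g')"
    using assms by (auto simp: C1_bounded_on_def)
  obtain L where L: "\<And>x. \<bar>g' x\<bar> \<le> L" using g'(2) by (auto simp: bounded_real)
  have "\<bar>g a - g b\<bar> \<le> L * \<bar>a - b\<bar>" for a b
    using field_differentiable_bound[of UNIV g g' L a b] g'(1) L by auto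
  moreover have "L \<ge> 0" using L[of 0] by simp
  ultimately show ?thesis by blast
qed

text \<open>The absorption grows like a fourth power, so a Lipschitz constant exists only on bounded
  sets; \<open>R\<close> will be a common bound of both solutions on a compact rectangle.\<close>

lemma absorption_lipschitz:
  assumes \<epsilon>: "C1_bounded_on UNIV \<epsilon>" and R: "R \<ge> 0"
  shows "\<exists>L\<ge>0. \<forall>a b. \<bar>a\<bar> \<le> R \<longrightarrow> \<bar>b\<bar> \<le> R \<longrightarrow> \<bar>\<epsilon> a * \<bar>a\<bar> ^ 3 * a - \<epsilon> b * \<bar>b\<bar> ^ 3 * b\<bar> \<le> L * \<bar>a - b\<bar>"
proof -
  obtain L where L: "L \<ge> 0" "\<And>a b. \<bar>\<epsilon> a - \<epsilon> b\<bar> \<le> L * \<bar>a - b\<bar>" using C1_bounded_lipschitz[OF \<epsilon>] by blast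
  obtain B where B: "\<And>z. \<bar>\<epsilon> z\<bar> \<le> B" using \<epsilon> by (auto simp: C1_bounded_on_def bounded_real)
  have B0: "B \<ge> 0" using B[of 0] by simp
  have "\<bar>\<epsilon> a * \<bar>a\<bar> ^ 3 * a - \<epsilon> b * \<bar>b\<bar> ^ 3 * b\<bar> \<le> (B * (4 * R ^ 3) + L * R ^ 4) * \<bar>a - b\<bar>" if a: "\<bar>a\<bar> \<le> R" and b: "\<bar>b\<bar> \<le> R" for a b
  proof -
    have cub: "\<bar>\<bar>a\<bar> ^ 3 - \<bar>b\<bar> ^ 3\<bar> \<le> \<bar>a - b\<bar> * (3 * R\<^sup>2)"
    proof -
      have "\<bar>a\<bar> ^ 3 - \<bar>b\<bar> ^ 3 = (\<bar>a\<bar> - \<bar>b\<bar>) * (\<bar>a\<bar>\<^sup>2 + \<bar>a\<bar> * \<bar>b\<bar> + \<bar>b\<bar>\<^sup>2)"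
        by (simp add: power2_eq_square power3_eq_cube algebra_simps)
      moreover have "\<bar>\<bar>a\<bar>\<^sup>2 + \<bar>a\<bar> * \<bar>b\<bar> + \<bar>b\<bar>\<^sup>2\<bar> \<le> 3 * R\<^sup>2"
      proof -
        have "\<bar>a\<bar>\<^sup>2 \<le> R\<^sup>2" by (rule power_mono[OF a]) simp
        moreover have "\<bar>b\<bar>\<^sup>2 \<le> R\<^sup>2" by (rule power_mono[OF b]) simp
        moreover have "\<bar>a\<bar> * \<bar>b\<bar> \<le> R\<^sup>2" unfolding power2_eq_square using a b R by (intro mult_mono) auto
        moreover have "0 \<le> \<bar>a\<bar>\<^sup>2 + \<bar>a\<bar> * \<bar>b\<bar> + \<bar>b\<bar>\<^sup>2" by (intro add_nonneg_nonneg) auto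
        ultimately show ?thesis by linarith
      qed
      moreover have "\<bar>\<bar>a\<bar> - \<bar>b\<bar>\<bar> \<le> \<bar>a - b\<bar>" by (rule abs_triangle_ineq3)
      ultimately show ?thesis by (simp only: abs_mult mult_mono abs_ge_zero)
    qed
    have "\<bar>\<bar>a\<bar> ^ 3 * a - \<bar>b\<bar> ^ 3 * b\<bar> = \<bar>\<bar>a\<bar> ^ 3 * (a - b) + (\<bar>a\<bar> ^ 3 - \<bar>b\<bar> ^ 3) * b\<bar>" by (simp add: algebra_simps)
    also have "\<dots> \<le> \<bar>\<bar>a\<bar> ^ 3 * (a - b)\<bar> + \<bar>(\<bar>a\<bar> ^ 3 - \<bar>b\<bar> ^ 3) * b\<bar>" by (rule abs_triangle_ineq)
    also have "\<dots> \<le> R ^ 3 * \<bar>a - b\<bar> + \<bar>a - b\<bar> * (3 * R\<^sup>2) * R"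
    proof (rule add_mono)
      have "\<bar>a\<bar> ^ 3 \<le> R ^ 3" by (rule power_mono[OF a]) simp
      then show "\<bar>\<bar>a\<bar> ^ 3 * (a - b)\<bar> \<le> R ^ 3 * \<bar>a - b\<bar>" by (simp add: abs_mult mult_right_mono)
      show "\<bar>(\<bar>a\<bar> ^ 3 - \<bar>b\<bar> ^ 3) * b\<bar> \<le> \<bar>a - b\<bar> * (3 * R\<^sup>2) * R"
        unfolding abs_mult by (rule mult_mono[OF cub b]) simp_all
    qed
    also have "\<dots> = 4 * R ^ 3 * \<bar>a - b\<bar>" by (simp add: power2_eq_square power3_eq_cube algebra_simps)
    finally have A: "\<bar>\<bar>a\<bar> ^ 3 * a - \<bar>b\<bar> ^ 3 * b\<bar> \<le> 4 * R ^ 3 * \<bar>a - b\<bar>" .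
    have bb: "\<bar>\<bar>b\<bar> ^ 3 * b\<bar> \<le> R ^ 4"
    proof -
      have "\<bar>\<bar>b\<bar> ^ 3 * b\<bar> = \<bar>b\<bar> ^ 4" by (simp add: abs_mult power4_eq_xxxx power3_eq_cube)
      also have "\<dots> \<le> R ^ 4" by (intro power_mono b) simp
      finally show ?thesis .
    qed
    have "\<epsilon> a * \<bar>a\<bar> ^ 3 * a - \<epsilon> b * \<bar>b\<bar> ^ 3 * b = \<epsilon> a * (\<bar>a\<bar> ^ 3 * a - \<bar>b\<bar> ^ 3 * b) + (\<epsilon> a - \<epsilon> b) * (\<bar>b\<bar> ^ 3 * b)"
      by (simp add: algebra_simps)
    then have "\<bar>\<epsilon> a * \<bar>a\<bar> ^ 3 * a - \<epsilon> b * \<bar>b\<bar> ^ 3 * b\<bar> \<le> \<bar>\<epsilon> a\<bar> * \<bar>\<bar>a\<bar> ^ 3 * a - \<bar>b\<bar> ^ 3 * b\<bar> + \<bar>\<epsilon> a - \<epsilon> b\<bar> * \<bar>\<bar>b\<bar> ^ 3 * b\<bar>"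
      by (metis abs_mult abs_triangle_ineq)
    also have "\<dots> \<le> B * (4 * R ^ 3 * \<bar>a - b\<bar>) + L * \<bar>a - b\<bar> * R ^ 4"
    proof (rule add_mono)
      show "\<bar>\<epsilon> a\<bar> * \<bar>\<bar>a\<bar> ^ 3 * a - \<bar>b\<bar> ^ 3 * b\<bar> \<le> B * (4 * R ^ 3 * \<bar>a - b\<bar>)"
        by (rule mult_mono[OF B A B0]) simp
      show "\<bar>\<epsilon> a - \<epsilon> b\<bar> * \<bar>\<bar>b\<bar> ^ 3 * b\<bar> \<le> L * \<bar>a - b\<bar> * R ^ 4"
        by (rule mult_mono[OF L(2) bb]) (use L(1) in simp_all)
    qed
    also have "\<dots> = (B * (4 * R ^ 3) + L * R ^ 4) * \<bar>a - b\<bar>" by (simp add: algebra_simps)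
    finally show ?thesis .
  qed
  moreover have "B * (4 * R ^ 3) + L * R ^ 4 \<ge> 0" using B0 L R by simp
  ultimately show ?thesis by blast
qed

text \<open>For delays up to \<open>\<delta>\<close> the kernel vanishes; for longer ones
  \<open>s + \<sigma>\<close> is negative and the common history is read.\<close>

lemma memory_eq_before_delay:
  assumes "\<delta> \<le> \<tau>" and s: "s \<in> {0..\<delta>}"
    and k: "\<And>s. s \<in> {-\<delta>..0} \<Longrightarrow> k s x = 0" and eq: "\<And>s. s \<in> {-\<tau>..0} \<Longrightarrow> u s x = ut s x"
  shows "memory \<tau> k u s x = memory \<tau> k ut s x"
  unfolding memory_def
proof (rule Henstock_Kurzweil_Integration.integral_cong)
  fix \<sigma> assume \<sigma>: "\<sigma> \<in> {-\<tau>..0}"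
  show "k \<sigma> x * u (s + \<sigma>) x = k \<sigma> x * ut (s + \<sigma>) x"
  proof (cases "\<sigma> \<in> {-\<delta>..0}")
    case False
    then show ?thesis using eq[of "s + \<sigma>"] s \<sigma> by auto
  qed (simp add: k)
qed

context problem_data
begin

text \<open>The weak solution in the shape that \<open>energy_comparison\<close> expects:
  \<open>W\<close> is \<open>AU + G\<close>, functions on \<open>{c..d}\<close> are extended by 0
  through the indicator, and almost every time slice carries its flux.\<close>

lemma localized_solution:
  assumes q: "q \<in> Q_pt" and mild: "mild_solution \<tau> \<rho>0 S r \<beta> \<epsilon> k f q u0 u" and T: "T > 0"
    and cd: "-1 < c" "c \<le> d" "d < 1"
  defines "g \<equiv> source \<tau> r \<beta> \<epsilon> k f q u"
  obtains W wN N where "negligible N" "wN integrable_on {0..T}" "\<forall>s\<in>{0..T}. norm (W s) \<le> wN s"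
    "\<forall>Z. (\<lambda>s. inner (W s) Z) integrable_on {0..T}"
    "\<forall>s t (y :: real \<Rightarrow> real). 0 \<le> s \<longrightarrow> s \<le> t \<longrightarrow> t \<le> T \<longrightarrow> continuous_on {c..d} y \<longrightarrow>
        integral {c..d} (\<lambda>x. (u t x - u s x) * y x) = integral {s..t} (\<lambda>r. inner (W r) (to_L2I (\<lambda>x. indicator {c..d} x * y x)))"
    "\<forall>s\<in>{0..T} - N. \<exists>P v. v \<in> L2_on (-1) 1 \<and> has_flux \<rho>0 c d (u s) P v \<and>
        (\<forall>y :: real \<Rightarrow> real. continuous_on {c..d} y \<longrightarrow>
            inner (W s) (to_L2I (\<lambda>x. indicator {c..d} x * y x)) = integral {c..d} (\<lambda>x. v x * y x) + integral {c..d} (\<lambda>x. g s x * y x))"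
proof (rule weak_solution[OF q mild T])
  fix AU N
  define G where "G s = to_L2I (g s)" for s
  assume W: "negligible N" "\<And>s. s \<in> {0..T} - N \<Longrightarrow> (to_L2I (u s), AU s) \<in> graph_A (rho \<rho>0)"
    "(\<lambda>s. norm (AU s)) absolutely_integrable_on {0..T}"
    "\<And>Z. (\<lambda>s. inner (AU s) Z) absolutely_integrable_on {0..T}"
    "\<And>Z t. t \<in> {0..T} \<Longrightarrow> inner (to_L2I (u t)) Z = inner (to_L2I (u 0)) Z
        + integral {0..t} (\<lambda>s. inner (AU s + to_L2I (source \<tau> r \<beta> \<epsilon> k f q u s)) Z)"
  note increment = W(5)[folded g_def, folded G_def]
  obtain C where C: "\<And>s. s \<in> {0..T} \<Longrightarrow> norm (G s) \<le> C"
    using source_norm_bound[OF q mild T] unfolding G_def g_def by metis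
  have uV: "u s \<in> V_space (rho \<rho>0)" if "s \<in> {0..T}" for s
    using solution_continuous(1)[OF mild T] that tau by (auto simp: cont_V_def)
  then have uL: "u s \<in> L2_on (-1) 1" if "s \<in> {0..T}" for s using that by (auto simp: V_space_def)
  have gL: "g s \<in> L2_on (-1) 1" if "s \<in> {0..T}" for s using mild T that by (simp add: g_def mild_solution_def)
  have Wi: "(\<lambda>s. inner (AU s + G s) Z) integrable_on {0..T}" for Z
    unfolding inner_add_left
  proof (rule integrable_add)
    show "(\<lambda>s. inner (AU s) Z) integrable_on {0..T}" by (rule set_lebesgue_integral_eq_integral[OF W(4)])
    show "(\<lambda>s. inner (G s) Z) integrable_on {0..T}"
      unfolding G_def g_def by (intro integrable_continuous_interval source_weakly_continuous[OF q mild T])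
  qed
  show ?thesis
  proof (rule that[where W = "\<lambda>s. AU s + G s" and wN = "\<lambda>s. norm (AU s) + C" and N = N])
    show "negligible N" by (rule W(1))
    show "(\<lambda>s. norm (AU s) + C) integrable_on {0..T}"
      by (intro integrable_add set_lebesgue_integral_eq_integral[OF W(3)] integrable_const_ivl)
    show "\<forall>s\<in>{0..T}. norm (AU s + G s) \<le> norm (AU s) + C"
      by (intro ballI norm_triangle_le add_left_mono C)
    show "\<forall>Z. (\<lambda>s. inner (AU s + G s) Z) integrable_on {0..T}" using Wi by blast
    show "\<forall>s t (y :: real \<Rightarrow> real). 0 \<le> s \<longrightarrow> s \<le> t \<longrightarrow> t \<le> T \<longrightarrow> continuous_on {c..d} y \<longrightarrow>
        integral {c..d} (\<lambda>x. (u t x - u s x) * y x) = integral {s..t} (\<lambda>r. inner (AU r + G r) (to_L2I (\<lambda>x. indicator {c..d} x * y x)))"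
    proof (intro allI impI)
      fix s t :: real and y :: "real \<Rightarrow> real" assume st: "0 \<le> s" "s \<le> t" "t \<le> T" and y: "continuous_on {c..d} y"
      define Z where "Z = to_L2I (\<lambda>x. indicator {c..d} x * y x)"
      have sT: "s \<in> {0..T}" "t \<in> {0..T}" using st by auto
      note L = L2_times_continuous[OF uL y cd(1,3)]
      have "integral {c..d} (\<lambda>x. (u t x - u s x) * y x) = integral {c..d} (\<lambda>x. u t x * y x) - integral {c..d} (\<lambda>x. u s x * y x)"
        unfolding left_diff_distrib by (rule Henstock_Kurzweil_Integration.integral_diff[OF L(1)[OF sT(2)] L(1)[OF sT(1)]])
      also have "\<dots> = inner (to_L2I (u t)) Z - inner (to_L2I (u s)) Z"
        unfolding Z_def L(2)[OF sT(1)] L(2)[OF sT(2)] ..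
      also have "\<dots> = integral {0..t} (\<lambda>s. inner (AU s + G s) Z) - integral {0..s} (\<lambda>s. inner (AU s + G s) Z)"
        using increment[OF sT(1), of Z] increment[OF sT(2), of Z] by simp
      also have "\<dots> = integral {s..t} (\<lambda>s. inner (AU s + G s) Z)"
        using Henstock_Kurzweil_Integration.integral_combine[OF st(1,2) integrable_subinterval_real[OF Wi[of Z]]] st by auto
      finally show "integral {c..d} (\<lambda>x. (u t x - u s x) * y x) = integral {s..t} (\<lambda>s. inner (AU s + G s) (to_L2I (\<lambda>x. indicator {c..d} x * y x)))"
        by (simp add: Z_def)
    qed
    show "\<forall>s\<in>{0..T} - N. \<exists>P v. v \<in> L2_on (-1) 1 \<and> has_flux \<rho>0 c d (u s) P v \<and>
        (\<forall>y :: real \<Rightarrow> real. continuous_on {c..d} y \<longrightarrow>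
            inner (AU s + G s) (to_L2I (\<lambda>x. indicator {c..d} x * y x)) = integral {c..d} (\<lambda>x. v x * y x) + integral {c..d} (\<lambda>x. g s x * y x))"
    proof
      fix s assume s: "s \<in> {0..T} - N"
      then have sT: "s \<in> {0..T}" by simp
      obtain v P where vP: "v \<in> L2_on (-1) 1" "AU s = to_L2I v" "continuous_on {-1..1} P"
        "\<And>x. x \<in> {-1<..<1} \<Longrightarrow> (u s has_real_derivative P x / rho \<rho>0 x) (at x)"
        "\<And>c d y y'. \<lbrakk>-1 < c; c \<le> d; d < 1; \<And>x. x \<in> {c..d} \<Longrightarrow> (y has_real_derivative y' x) (at x within {c..d});
            continuous_on {c..d} y'\<rbrakk> \<Longrightarrow>
            integral {c..d} (\<lambda>x. v x * y x) = P d * y d - P c * y c - integral {c..d} (\<lambda>x. P x * y' x)"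
        using graph_A_slice[OF rho0 uV[OF sT] W(2)[OF s]] by blast
      show "\<exists>P v. v \<in> L2_on (-1) 1 \<and> has_flux \<rho>0 c d (u s) P v \<and>
        (\<forall>y :: real \<Rightarrow> real. continuous_on {c..d} y \<longrightarrow>
            inner (AU s + G s) (to_L2I (\<lambda>x. indicator {c..d} x * y x)) = integral {c..d} (\<lambda>x. v x * y x) + integral {c..d} (\<lambda>x. g s x * y x))"
        unfolding has_flux_def
      proof (intro exI conjI ballI allI impI)
        show "continuous_on {c..d} P" by (rule continuous_on_subset[OF vP(3)]) (use cd in auto)
        show "v \<in> L2_on (-1) 1" by (rule vP(1))
        show "(u s has_real_derivative P x / rho \<rho>0 x) (at x)" if "x \<in> {c..d}" for x
          by (rule vP(4)) (use that cd in auto)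
        show "integral {c..d} (\<lambda>x. v x * y x) = P d * y d - P c * y c - integral {c..d} (\<lambda>x. P x * y' x)"
          if "\<forall>x\<in>{c..d}. (y has_real_derivative y' x) (at x within {c..d})" "continuous_on {c..d} y'" for y y'
          by (rule vP(5)[OF cd that(1)[rule_format] that(2)])
        show "inner (AU s + G s) (to_L2I (\<lambda>x. indicator {c..d} x * y x)) = integral {c..d} (\<lambda>x. v x * y x) + integral {c..d} (\<lambda>x. g s x * y x)"
          if "continuous_on {c..d} y" for y
          using L2_times_continuous(2)[OF vP(1) that cd(1,3)] L2_times_continuous(2)[OF gL[OF sT] that cd(1,3)]
          by (simp add: inner_add_left vP(2) G_def)
      qed
    qed
  qed
qed

end

context problem_data
begin

lemma no_signed_difference:
  assumes q: "q \<in> Q_pt" and qt: "qt \<in> Q_pt"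
    and u: "mild_solution \<tau> \<rho>0 S r \<beta> \<epsilon> k f q u0 u" and ut: "mild_solution \<tau> \<rho>0 S r \<beta> \<epsilon> k f qt u0 ut"
    and \<delta>: "0 < \<delta>" "\<delta> < \<tau>" and kz: "\<And>s x. s \<in> {-\<delta>..0} \<Longrightarrow> x \<in> {-1..1} \<Longrightarrow> k s x = 0"
    and rpos: "\<And>t. t \<ge> 0 \<Longrightarrow> r t > 0" and bpos: "\<And>z. \<beta> z > 0"
    and x0: "x0 \<in> {-1<..<1}" and T: "T > 0"
    and eq: "\<And>t. t \<in> {0<..<T} \<Longrightarrow> u t x0 = ut t x0"
      "\<And>t. t \<in> {0<..<T} \<Longrightarrow> deriv (u t) x0 = deriv (ut t) x0"
    and b: "b \<in> {-1<..<1}" and J: "j1 < j2" "{j1..j2} \<subseteq> {min x0 b..max x0 b}" "b \<notin> {j1..j2}"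
    and h0: "h0 > 0" "\<And>x. x \<in> {j1..j2} \<Longrightarrow> q x - qt x \<ge> h0"
    and h: "\<And>x. x \<in> {min x0 b..max x0 b} \<Longrightarrow> q x - qt x \<ge> 0"
  shows False
proof -
  define c d where "c = min x0 b" and "d = max x0 b"
  have cd: "-1 < c" "c \<le> d" "d < 1" using x0 b by (auto simp: c_def d_def)
  have cd1: "x \<in> {-1<..<1}" if "x \<in> {c..d}" for x using that cd by auto
  have ends: "{c, d} = {x0, b}" by (auto simp: c_def d_def min_def max_def)
  have x0c: "x0 \<in> {c..d}" by (auto simp: c_def d_def)
  \<comment> \<open>Before \<open>T\<close> the Cauchy data at \<open>x0\<close> agree, and up to
    \<open>\<delta>\<close> the memory terms agree.\<close>
  define T0 where "T0 = min T \<delta> / 2"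
  have T0: "T0 > 0" "T0 < T" "T0 < \<delta>" using T \<delta> by (auto simp: T0_def)
  define U where "U s x = u s x - ut s x" for s x
  define gu where "gu = source \<tau> r \<beta> \<epsilon> k f q u"
  define gv where "gv = source \<tau> r \<beta> \<epsilon> k f qt ut"
  define g where "g s x = gu s x - gv s x" for s x
  define p where "p s x = r s * \<beta> (u s x)" for s x
  let ?D = "{0..T0} \<times> {c..d}"
  have uc: "continuous_on ?D (\<lambda>z. u (fst z) (snd z))" "continuous_on ?D (\<lambda>z. ut (fst z) (snd z))"
    by (rule continuous_on_subset[OF solution_continuous(2)[OF u T0(1), unfolded case_prod_unfold]], use tau cd in force,
      rule continuous_on_subset[OF solution_continuous(2)[OF ut T0(1), unfolded case_prod_unfold]], use tau cd in force)
  have init: "u s x = ut s x" if "s \<in> {-\<tau>..0}" "x \<in> {-1<..<1}" for s x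
    using u ut T0(1) that unfolding mild_solution_def by metis
  have D: "compact ?D" by (intro compact_Times compact_Icc)
  have Dne: "(0, c) \<in> ?D" using T0 cd by auto
  obtain R1 where R1: "\<And>s x. s \<in> {0..T0} \<Longrightarrow> x \<in> {c..d} \<Longrightarrow> \<bar>u s x\<bar> \<le> R1"
    using compact_imp_bounded[OF compact_continuous_image[OF uc(1) D]] by (force simp: bounded_real)
  obtain R2 where R2: "\<And>s x. s \<in> {0..T0} \<Longrightarrow> x \<in> {c..d} \<Longrightarrow> \<bar>ut s x\<bar> \<le> R2"
    using compact_imp_bounded[OF compact_continuous_image[OF uc(2) D]] by (force simp: bounded_real)
  define R where "R = max \<bar>R1\<bar> \<bar>R2\<bar>"
  have R: "R \<ge> 0" by (simp add: R_def)
  have RU: "\<bar>u s x\<bar> \<le> R" "\<bar>ut s x\<bar> \<le> R" if "s \<in> {0..T0}" "x \<in> {c..d}" for s x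
    using R1[OF that] R2[OF that] by (auto simp: R_def)
  obtain L\<epsilon> where L\<epsilon>: "L\<epsilon> \<ge> 0" "\<And>a b. \<lbrakk>\<bar>a\<bar> \<le> R; \<bar>b\<bar> \<le> R\<rbrakk> \<Longrightarrow> \<bar>\<epsilon> a * \<bar>a\<bar> ^ 3 * a - \<epsilon> b * \<bar>b\<bar> ^ 3 * b\<bar> \<le> L\<epsilon> * \<bar>a - b\<bar>"
    using absorption_lipschitz[OF eps R] by blast
  obtain L\<beta> where L\<beta>: "L\<beta> \<ge> 0" "\<And>a b. \<bar>\<beta> a - \<beta> b\<bar> \<le> L\<beta> * \<bar>a - b\<bar>"
    using C1_bounded_lipschitz[OF C2_bounded_imp_C1_bounded[OF beta]] by blast
  obtain Br where Br: "\<And>t. t \<in> {0..} \<Longrightarrow> \<bar>r t\<bar> \<le> Br" using r by (auto simp: C1_bounded_on_def bounded_real)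
  obtain Bq where Bq: "\<And>x. x \<in> {-1<..<1} \<Longrightarrow> \<bar>qt x\<bar> \<le> Bq" using Q_pt_bounded[OF qt] by metis
  have B0: "Br \<ge> 0" "Bq \<ge> 0" using Br[of 0] Bq[of 0] by auto
  \<comment> \<open>The reaction term is split as \<open>r * \<beta>(u) * (q - qt) + r * qt *
    (\<beta>(u) - \<beta>(ut))\<close>: the first summand is the signed forcing
    \<open>p * h\<close>, the second is Lipschitz in \<open>U\<close> and joins the
    absorption.\<close>
  define CV where "CV = Br * Bq * L\<beta> + L\<epsilon>"
  have CV: "CV \<ge> 0" using B0 L\<beta> L\<epsilon> by (simp add: CV_def)
  have pc: "continuous_on ?D (\<lambda>z. p (fst z) (snd z))"
    unfolding p_def
  proof (rule continuous_on_mult)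
    show "continuous_on ?D (\<lambda>z. r (fst z))"
      by (rule continuous_on_compose2[OF C1_bounded_on_continuous[OF r] continuous_on_fst[OF continuous_on_id]]) auto
    show "continuous_on ?D (\<lambda>z. \<beta> (u (fst z) (snd z)))"
      by (rule continuous_on_compose2[OF C2_bounded_on_continuous[OF beta] uc(1)]) auto
  qed
  \<comment> \<open>Compactness turns positivity of \<open>r\<close> and \<open>\<beta>\<close> into
    a uniform positive lower bound for \<open>p\<close>.\<close>
  obtain z1 where z1: "z1 \<in> ?D" "\<And>z. z \<in> ?D \<Longrightarrow> p (fst z1) (snd z1) \<le> p (fst z) (snd z)"
    using continuous_attains_inf[OF D _ pc] Dne by blast
  obtain z2 where z2: "z2 \<in> ?D" "\<And>z. z \<in> ?D \<Longrightarrow> p (fst z) (snd z) \<le> p (fst z2) (snd z2)"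
    using continuous_attains_sup[OF D _ pc] Dne by blast
  define bm bM where "bm = p (fst z1) (snd z1)" and "bM = p (fst z2) (snd z2)"
  have bm: "bm > 0" unfolding bm_def p_def using rpos[of "fst z1"] bpos z1(1) by auto
  have hc: "continuous_on {c..d} (\<lambda>x. q x - qt x)"
    by (intro continuous_intros continuous_on_subset[OF Q_pt_continuous[OF q]] continuous_on_subset[OF Q_pt_continuous[OF qt]]) (use cd in auto)
  have gsc: "continuous_on {c..d} (gu s)" "continuous_on {c..d} (gv s)" if s: "s \<in> {0..T0}" for s
  proof -
    note sc = source_continuous[OF tau less_imp_le[OF T0(1)] k _ r beta eps f]
    have pr: "continuous_on {c..d} (\<lambda>x. (s, x))" by (intro continuous_intros)
    show "continuous_on {c..d} (gu s)" unfolding gu_def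
      using continuous_on_compose2[OF sc[OF solution_continuous(2)[OF u T0(1)] q] pr] s cd by (auto simp: image_subset_iff)
    show "continuous_on {c..d} (gv s)" unfolding gv_def
      using continuous_on_compose2[OF sc[OF solution_continuous(2)[OF ut T0(1)] qt] pr] s cd by (auto simp: image_subset_iff)
  qed
  have gb: "\<bar>g s x - p s x * (q x - qt x)\<bar> \<le> CV * \<bar>U s x\<bar>" if s: "s \<in> {0..T0}" and x: "x \<in> {c..d}" for s x
  proof -
    have "memory \<tau> k u s x = memory \<tau> k ut s x"
      by (rule memory_eq_before_delay[of \<delta>]) (use \<delta> s T0 kz init cd1[OF x] in auto)
    then have "g s x - p s x * (q x - qt x) = r s * qt x * (\<beta> (u s x) - \<beta> (ut s x))
       - (\<epsilon> (u s x) * \<bar>u s x\<bar> ^ 3 * u s x - \<epsilon> (ut s x) * \<bar>ut s x\<bar> ^ 3 * ut s x)"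
      by (simp add: g_def gu_def gv_def source_def p_def algebra_simps)
    also have "\<bar>\<dots>\<bar> \<le> \<bar>r s * qt x * (\<beta> (u s x) - \<beta> (ut s x))\<bar> + \<bar>\<epsilon> (u s x) * \<bar>u s x\<bar> ^ 3 * u s x - \<epsilon> (ut s x) * \<bar>ut s x\<bar> ^ 3 * ut s x\<bar>"
      by (rule abs_triangle_ineq4)
    also have "\<dots> \<le> Br * Bq * (L\<beta> * \<bar>U s x\<bar>) + L\<epsilon> * \<bar>U s x\<bar>"
    proof (rule add_mono)
      show "\<bar>r s * qt x * (\<beta> (u s x) - \<beta> (ut s x))\<bar> \<le> Br * Bq * (L\<beta> * \<bar>U s x\<bar>)"
        unfolding abs_mult U_def using Br[of s] Bq[OF cd1[OF x]] L\<beta>(2) B0 s by (intro mult_mono) auto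
      show "\<bar>\<epsilon> (u s x) * \<bar>u s x\<bar> ^ 3 * u s x - \<epsilon> (ut s x) * \<bar>ut s x\<bar> ^ 3 * ut s x\<bar> \<le> L\<epsilon> * \<bar>U s x\<bar>"
        unfolding U_def by (rule L\<epsilon>(2)[OF RU[OF s x]])
    qed
    finally show ?thesis by (simp add: CV_def algebra_simps)
  qed
  show False
  proof (rule localized_solution[OF q u T0(1) cd])
    fix W1 wN1 N1
    assume 1: "negligible N1" "wN1 integrable_on {0..T0}" "\<forall>s\<in>{0..T0}. norm (W1 s) \<le> wN1 s"
      "\<forall>Z. (\<lambda>s. inner (W1 s) Z) integrable_on {0..T0}"
      "\<forall>s t (y :: real \<Rightarrow> real). 0 \<le> s \<longrightarrow> s \<le> t \<longrightarrow> t \<le> T0 \<longrightarrow> continuous_on {c..d} y \<longrightarrow>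
          integral {c..d} (\<lambda>x. (u t x - u s x) * y x) = integral {s..t} (\<lambda>r. inner (W1 r) (to_L2I (\<lambda>x. indicator {c..d} x * y x)))"
      "\<forall>s\<in>{0..T0} - N1. \<exists>P v. v \<in> L2_on (-1) 1 \<and> has_flux \<rho>0 c d (u s) P v \<and>
          (\<forall>y :: real \<Rightarrow> real. continuous_on {c..d} y \<longrightarrow>
              inner (W1 s) (to_L2I (\<lambda>x. indicator {c..d} x * y x)) = integral {c..d} (\<lambda>x. v x * y x)
                + integral {c..d} (\<lambda>x. source \<tau> r \<beta> \<epsilon> k f q u s x * y x))"
    show False
    proof (rule localized_solution[OF qt ut T0(1) cd])
      fix W2 wN2 N2
      assume 2: "negligible N2" "wN2 integrable_on {0..T0}" "\<forall>s\<in>{0..T0}. norm (W2 s) \<le> wN2 s"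
        "\<forall>Z. (\<lambda>s. inner (W2 s) Z) integrable_on {0..T0}"
        "\<forall>s t (y :: real \<Rightarrow> real). 0 \<le> s \<longrightarrow> s \<le> t \<longrightarrow> t \<le> T0 \<longrightarrow> continuous_on {c..d} y \<longrightarrow>
            integral {c..d} (\<lambda>x. (ut t x - ut s x) * y x) = integral {s..t} (\<lambda>r. inner (W2 r) (to_L2I (\<lambda>x. indicator {c..d} x * y x)))"
        "\<forall>s\<in>{0..T0} - N2. \<exists>P v. v \<in> L2_on (-1) 1 \<and> has_flux \<rho>0 c d (ut s) P v \<and>
            (\<forall>y :: real \<Rightarrow> real. continuous_on {c..d} y \<longrightarrow>
                inner (W2 s) (to_L2I (\<lambda>x. indicator {c..d} x * y x)) = integral {c..d} (\<lambda>x. v x * y x)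
                  + integral {c..d} (\<lambda>x. source \<tau> r \<beta> \<epsilon> k f qt ut s x * y x))"
      \<comment> \<open>Time 0 joins the null set because the data at \<open>x0\<close> are given on
        an open interval of times.\<close>
      interpret energy_comparison \<rho>0 c d b T0 CV bm bM U p g "\<lambda>x. q x - qt x"
        "\<lambda>s. W1 s - W2 s" "\<lambda>s. wN1 s + wN2 s" "N1 \<union> N2 \<union> {0}"
      proof
        show "\<rho>0 > 0" "-1 < c" "c \<le> d" "d < 1" "T0 > 0" "bm > 0" "CV \<ge> 0" by (simp_all add: rho0 cd T0 bm CV)
        show "b \<in> {c, d}" unfolding ends by simp
        show "continuous_on ?D (\<lambda>(s, x). U s x)"
          unfolding case_prod_unfold U_def by (intro continuous_on_diff uc)
        show "U 0 x = 0" if "x \<in> {c..d}" for x using init[of 0 x] tau cd1[OF that] by (simp add: U_def)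
        show "(\<lambda>s. inner (W1 s - W2 s) Z) integrable_on {0..T0}" for Z
          unfolding inner_diff_left using 1(4) 2(4) by (intro integrable_diff) auto
        show "integral {c..d} (\<lambda>x. (U t x - U s x) * y x) = integral {s..t} (\<lambda>r. inner (W1 r - W2 r) (to_L2I (\<lambda>x. indicator {c..d} x * y x)))"
          if st: "0 \<le> s" "s \<le> t" "t \<le> T0" and y: "continuous_on {c..d} y" for s t y
        proof -
          have sl: "continuous_on {c..d} (u s)" "continuous_on {c..d} (ut s)" if "s \<in> {0..T0}" for s
          proof -
            have pr: "continuous_on {c..d} (\<lambda>x. (s, x))" by (intro continuous_intros)
            show "continuous_on {c..d} (u s)" "continuous_on {c..d} (ut s)"
              using continuous_on_compose2[OF uc(1) pr] continuous_on_compose2[OF uc(2) pr] that by (auto simp: image_subset_iff)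
          qed
          have s: "s \<in> {0..T0}" and t: "t \<in> {0..T0}" using st by auto
          have i: "(\<lambda>r. inner (W1 r) Z) integrable_on {s..t}" "(\<lambda>r. inner (W2 r) Z) integrable_on {s..t}" for Z
            by (rule integrable_subinterval_real[OF 1(4)[rule_format]], use st in simp,
                rule integrable_subinterval_real[OF 2(4)[rule_format]], use st in simp)
          have "integral {c..d} (\<lambda>x. (U t x - U s x) * y x) = integral {c..d} (\<lambda>x. (u t x - u s x) * y x - (ut t x - ut s x) * y x)"
            by (simp add: U_def algebra_simps)
          also have "\<dots> = integral {c..d} (\<lambda>x. (u t x - u s x) * y x) - integral {c..d} (\<lambda>x. (ut t x - ut s x) * y x)"
            by (intro Henstock_Kurzweil_Integration.integral_diff integrable_continuous_interval continuous_intros sl[OF s] sl[OF t] y)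
          also have "\<dots> = integral {s..t} (\<lambda>r. inner (W1 r) (to_L2I (\<lambda>x. indicator {c..d} x * y x)))
              - integral {s..t} (\<lambda>r. inner (W2 r) (to_L2I (\<lambda>x. indicator {c..d} x * y x)))"
            using 1(5)[rule_format, OF st y] 2(5)[rule_format, OF st y] by simp
          also have "\<dots> = integral {s..t} (\<lambda>r. inner (W1 r - W2 r) (to_L2I (\<lambda>x. indicator {c..d} x * y x)))"
            unfolding inner_diff_left by (rule Henstock_Kurzweil_Integration.integral_diff[symmetric, OF i])
          finally show ?thesis .
        qed
        show "(\<lambda>s. wN1 s + wN2 s) integrable_on {0..T0}" by (rule integrable_add[OF 1(2) 2(2)])
        show "norm (W1 s - W2 s) \<le> wN1 s + wN2 s" if "s \<in> {0..T0}" for s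
          using norm_triangle_ineq4[of "W1 s" "W2 s"] 1(3)[rule_format, OF that] 2(3)[rule_format, OF that] by linarith
        show "negligible (N1 \<union> N2 \<union> {0})" using 1(1) 2(1) by simp
        show "continuous_on {c..d} (g s)" if "s \<in> {0..T0}" for s
          unfolding g_def by (intro continuous_on_diff gsc that)
        show "\<bar>g s x - p s x * (q x - qt x)\<bar> \<le> CV * \<bar>U s x\<bar>" if "s \<in> {0..T0}" "x \<in> {c..d}" for s x
          by (rule gb[OF that])
        show "bm \<le> p s x \<and> p s x \<le> bM" if "s \<in> {0..T0}" "x \<in> {c..d}" for s x
          using z1(2)[of "(s, x)"] z2(2)[of "(s, x)"] that by (auto simp: bm_def bM_def)
        show "q x - qt x \<ge> 0" if "x \<in> {c..d}" for x using h[of x] that by (simp add: c_def d_def)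
        show "continuous_on {c..d} (\<lambda>x. q x - qt x)" by (rule hc)
        fix s assume s: "s \<in> {0..T0} - (N1 \<union> N2 \<union> {0})"
        then have sT: "s \<in> {0..T0}" and s1: "s \<in> {0..T0} - N1" and s2: "s \<in> {0..T0} - N2" and sT': "s \<in> {0<..<T}"
          using T0 by auto
        from 1(6)[rule_format, OF s1] 2(6)[rule_format, OF s2]
        show "\<exists>P v. has_flux \<rho>0 c d (U s) P v \<and>
          (\<forall>e\<in>{c, d}. e \<noteq> b \<longrightarrow> U s e = 0 \<and> P e = 0) \<and>
          (\<forall>y. continuous_on {c..d} y \<longrightarrow>
              inner (W1 s - W2 s) (to_L2I (\<lambda>x. indicator {c..d} x * y x)) = integral {c..d} (\<lambda>x. v x * y x) + integral {c..d} (\<lambda>x. g s x * y x))"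
        proof (elim exE conjE)
          fix P1 v1 P2 v2
          assume A: "v1 \<in> L2_on (-1) 1" "has_flux \<rho>0 c d (u s) P1 v1"
            "\<forall>y :: real \<Rightarrow> real. continuous_on {c..d} y \<longrightarrow>
              inner (W1 s) (to_L2I (\<lambda>x. indicator {c..d} x * y x)) = integral {c..d} (\<lambda>x. v1 x * y x)
                + integral {c..d} (\<lambda>x. source \<tau> r \<beta> \<epsilon> k f q u s x * y x)"
            and B: "v2 \<in> L2_on (-1) 1" "has_flux \<rho>0 c d (ut s) P2 v2"
            "\<forall>y :: real \<Rightarrow> real. continuous_on {c..d} y \<longrightarrow>
              inner (W2 s) (to_L2I (\<lambda>x. indicator {c..d} x * y x)) = integral {c..d} (\<lambda>x. v2 x * y x)
                + integral {c..d} (\<lambda>x. source \<tau> r \<beta> \<epsilon> k f qt ut s x * y x)"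
          show ?thesis
          proof (rule exI[of _ "\<lambda>x. P1 x - P2 x"], rule exI[of _ "\<lambda>x. v1 x - v2 x"], intro conjI ballI allI impI)
            show "has_flux \<rho>0 c d (U s) (\<lambda>x. P1 x - P2 x) (\<lambda>x. v1 x - v2 x)"
              unfolding U_def[abs_def] by (rule has_flux_diff[OF A(2) B(2) A(1) B(1) cd(1,3)])
            \<comment> \<open>Equal derivatives at \<open>x0\<close> become equal fluxes, as
              \<open>rho\<close> is positive at this interior point.\<close>
            have "deriv (u s) x0 = P1 x0 / rho \<rho>0 x0" "deriv (ut s) x0 = P2 x0 / rho \<rho>0 x0"
              using has_fluxD(2)[OF A(2) x0c] has_fluxD(2)[OF B(2) x0c] by (auto intro: DERIV_imp_deriv)
            then have P0: "P1 x0 = P2 x0" using eq(2)[OF sT'] rho_pos[OF rho0 x0] by simp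
            show "U s e = 0" "P1 e - P2 e = 0" if "e \<in> {c, d}" "e \<noteq> b" for e
              using that P0 eq(1)[OF sT'] unfolding ends by (auto simp: U_def)
            show "inner (W1 s - W2 s) (to_L2I (\<lambda>x. indicator {c..d} x * y x)) =
                integral {c..d} (\<lambda>x. (v1 x - v2 x) * y x) + integral {c..d} (\<lambda>x. g s x * y x)"
              if y: "continuous_on {c..d} y" for y
            proof -
              have "integral {c..d} (\<lambda>x. g s x * y x) = integral {c..d} (\<lambda>x. gu s x * y x) - integral {c..d} (\<lambda>x. gv s x * y x)"
                unfolding g_def left_diff_distrib
                by (intro Henstock_Kurzweil_Integration.integral_diff integrable_continuous_interval continuous_on_mult gsc[OF sT] y)
              moreover have "integral {c..d} (\<lambda>x. (v1 x - v2 x) * y x) = integral {c..d} (\<lambda>x. v1 x * y x) - integral {c..d} (\<lambda>x. v2 x * y x)"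
                unfolding left_diff_distrib
                by (rule Henstock_Kurzweil_Integration.integral_diff[OF L2_times_continuous(1)[OF A(1) y cd(1,3)] L2_times_continuous(1)[OF B(1) y cd(1,3)]])
              ultimately show ?thesis
                using A(3)[rule_format, OF y] B(3)[rule_format, OF y]
                by (simp add: inner_diff_left gu_def gv_def)
            qed
          qed
        qed
      qed
      show False
        by (rule no_positive_forcing[of j1 j2 h0]) (use J h0 in \<open>auto simp: c_def d_def\<close>)
    qed
  qed
qed

end

theorem theorem3p3:
  fixes \<tau> \<rho>0 \<epsilon>1 \<delta> x0 T :: real
    and r \<beta> \<epsilon> f q qt :: "real \<Rightarrow> real"
    and k u0 u ut :: "real \<Rightarrow> real \<Rightarrow> real"
    and expA :: "real \<Rightarrow> L2I \<Rightarrow> L2I"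
  assumes "\<tau> > 0" and "\<rho>0 > 0"
    and "C1_bounded_on {0..} r"
    and "C2_bounded_on UNIV \<beta>"
    and "C1_bounded_on UNIV \<epsilon>" and "\<epsilon>1 > 0" and "\<And>z. \<epsilon> z \<ge> \<epsilon>1"
    and "C1_rect {-\<tau>..0} {-1..1} k"
    and "C1_bounded_on UNIV f"
    and "\<exists>L. L-lipschitz_on UNIV f" and "\<exists>L. L-lipschitz_on UNIV (deriv f)"
    \<comment> \<open>\<open>expA t\<close> is \<open>e\<^sup>t\<^sup>A\<close>\<close>
    and "C0_semigroup expA" and "infinitesimal_generator expA = graph_A (rho \<rho>0)"
    and "q \<in> Q_pt" and "qt \<in> Q_pt"
    and "C12_rect {-\<tau>..0} {-1..1} u0"
    and "mild_solution \<tau> \<rho>0 expA r \<beta> \<epsilon> k f q u0 u"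
    and "mild_solution \<tau> \<rho>0 expA r \<beta> \<epsilon> k f qt u0 ut"
    and "0 < \<delta>" and "\<delta> < \<tau>"
    and "\<And>s x. s \<in> {-\<delta>..0} \<Longrightarrow> x \<in> {-1..1} \<Longrightarrow> k s x = 0"
    and "\<And>t. t \<ge> 0 \<Longrightarrow> r t > 0" and "\<And>z. \<beta> z > 0"
    and "x0 \<in> {-1<..<1}" and "T > 0"
    and "\<And>t. t \<in> {0<..<T} \<Longrightarrow> u t x0 = ut t x0"
    and "\<And>t. t \<in> {0<..<T} \<Longrightarrow> deriv (u t) x0 = deriv (ut t) x0"
  shows "\<forall>x\<in>{-1<..<1}. q x = qt x"
proof (rule ccontr)
  assume ne: "\<not> (\<forall>x\<in>{-1<..<1}. q x = qt x)"
  interpret problem_data \<tau> \<rho>0 r \<beta> \<epsilon> f k expA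
    by (unfold_locales) (use assms in auto)
  from Q_pt_difference_sign[OF \<open>q \<in> Q_pt\<close> \<open>qt \<in> Q_pt\<close> \<open>x0 \<in> {-1<..<1}\<close> ne]
  obtain b j1 j2 h0 \<sigma> where b: "b \<in> {-1<..<1}" and J: "j1 < j2" "{j1..j2} \<subseteq> {min x0 b..max x0 b}" "b \<notin> {j1..j2}"
    and h0: "h0 > 0" and \<sigma>: "\<sigma> = 1 \<or> \<sigma> = -1"
    and h: "\<forall>x\<in>{min x0 b..max x0 b}. \<sigma> * (q x - qt x) \<ge> 0" "\<forall>x\<in>{j1..j2}. \<sigma> * (q x - qt x) \<ge> h0"
    by blast
  note hyps = assms(19-25)
  from \<sigma> show False
  proof
    assume "\<sigma> = 1"
    then show False
      by (intro no_signed_difference[OF assms(14,15,17,18) hyps assms(26,27) b J h0]) (use h in auto)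
  next
    \<comment> \<open>The hypotheses are symmetric in the two problems, so the negative sign is
      handled by exchanging them.\<close>
    assume "\<sigma> = -1"
    then show False
      by (intro no_signed_difference[OF assms(15,14,18,17) hyps assms(26)[symmetric] assms(27)[symmetric] b J h0]) (use h in auto)
  qed
qed

end
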